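(* Let $Q$ be a real-valued convex continuous function on $\mathbf{R}^+=[0,\infty)$ such that $Q$ is $C^1$ on $(0,\infty)$ and $Q'(x)\ge\rho$ for all $x>0$ with a constant $\rho>0$. Then, for every Borel probability measure $\mu\in\mathcal{M}(\mathbf{R}^+)$, $$\widetilde{\Sigma}_Q^+(\mu)\le\frac{1}{\rho}\,\Phi_Q^+(\mu).$$
   Context: $\mathcal{M}(\mathbf{R}^+)$ is the set of Borel probability measures on $\mathbf{R}^+=[0,\infty)$. Free entropy: $\Sigma(\mu):=\iint\log|x-y|\,d\mu(x)\,d\mu(y)$. Relative free entropy on $\mathbf{R}^+$: for a real-valued continuous $Q$ on $\mathbf{R}^+$ with $\lim_{x\to+\infty}x\exp(-\varepsilon Q(x))=0$ for every $\varepsilon>0$ (automatic under the hypotheses of the claim), $$\widetilde{\Sigma}_Q^+(\mu):=-\Sigma(\mu)+\int_{\mathbf{R}^+}Q(x)\,d\mu(x)+B^+(Q),$$ $$B^+(Q):=\lim_{n\to\infty}\frac1{n^2}\log\int\cdots\int_{(\mathbf{R}^+)^n}\exp\Bigl(-n\sum_{i=1}^nQ(x_i)\Bigr)\prod_{i<j}(x_i-x_j)^2\prod_{i=1}^ndx_i,$$ the limit existing and being finite; $\widetilde{\Sigma}_Q^+$ is nonnegative with a unique zero (its minimizer), so that $B^+(Q)=-\min_{\mu\in\mathcal{M}(\mathbf{R}^+)}\bigl(-\Sigma(\mu)+\int Q\,d\mu\bigr)$. (The expression $-\Sigma(\mu)+\int Q\,d\mu$ is understood as $\iint\{-\log|x-y|+\frac12(Q(x)+Q(y))\}\,d\mu(x)\,d\mu(y)\in(-\infty,+\infty]$.)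 Hilbert transform: for a density $p$ on $\mathbf{R}^+$ (extended by $0$ to $\mathbf{R}$), $(Hp)(x):=\lim_{\varepsilon\searrow0}\int_{|x-t|>\varepsilon}\frac{p(t)}{x-t}\,dt$; for $p\in L^3(\mathbf{R}^+,x\,dx)$ this exists for a.e. $x\in\mathbf{R}^+$. Relative free Fisher information on $\mathbf{R}^+$: $$\Phi_Q^+(\mu):=4\int_{\mathbf{R}^+}x\Bigl((Hp)(x)-\tfrac12Q'(x)\Bigr)^2d\mu(x)$$ if $\mu$ has a density $p=d\mu/dx$ with $p\in L^3(\mathbf{R}^+,x\,dx)$; otherwise $\Phi_Q^+(\mu):=+\infty$. *)

theory Defs
  imports "HOL-Probability.Probability"
begin

definition borel_pos :: "real measure" where
  "borel_pos = restrict_space borel {0..}"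

definition leb_pos :: "real measure" where
  "leb_pos = restrict_space lborel {0..}"

definition prob_measures_pos :: "real measure set" where
  "prob_measures_pos = {\<mu>. prob_space \<mu> \<and> sets \<mu> = sets borel_pos}"

(* The library's ln satisfies ln 0 = 0, whereas the diagonal has to carry the value -\<infinity>. *)
definition elog :: "real \<Rightarrow> ereal" where
  "elog r = (if r = 0 then -\<infinity> else ereal (ln r))"

(* Integral of an extended real function, as integral of the positive part minus integral of
   the negative part; e2ennreal cuts negative values off at 0.  It is meaningful when one of
   the two is finite, in particular for a kernel bounded below on a probability space. *)
definition eintegral :: "'a measure \<Rightarrow> ('a \<Rightarrow> ereal) \<Rightarrow> ereal" where
  "eintegral M f =
     enn2ereal (\<integral>\<^sup>+ z. e2ennreal (f z) \<partial>M) - enn2ereal (\<integral>\<^sup>+ z. e2ennreal (- f z) \<partial>M)"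

(* The functional -\<Sigma>(\<mu>) + \<integral>Q d\<mu>, written as one double integral so that no
   \<infinity> - \<infinity> can occur. *)
definition weighted_energy :: "(real \<Rightarrow> real) \<Rightarrow> real measure \<Rightarrow> ereal" where
  "weighted_energy Q \<mu> =
     eintegral (\<mu> \<Otimes>\<^sub>M \<mu>) (\<lambda>(x, y). - elog \<bar>x - y\<bar> + ereal ((Q x + Q y) / 2))"

definition partition_pos :: "(real \<Rightarrow> real) \<Rightarrow> nat \<Rightarrow> real" where
  "partition_pos Q n =
     (LINT x | PiM {..<n} (\<lambda>_. leb_pos).
        exp (- real n * (\<Sum>i<n. Q (x i))) * (\<Prod>j<n. \<Prod>i<j. (x i - x j)\<^sup>2))"

definition B_pos :: "(real \<Rightarrow> real) \<Rightarrow> real" where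
  "B_pos Q = lim (\<lambda>n. ln (partition_pos Q n) / (real n)\<^sup>2)"

definition rel_free_entropy_pos :: "(real \<Rightarrow> real) \<Rightarrow> real measure \<Rightarrow> ereal" where
  "rel_free_entropy_pos Q \<mu> = weighted_energy Q \<mu> + ereal (B_pos Q)"

definition hilbert_transform :: "(real \<Rightarrow> real) \<Rightarrow> real \<Rightarrow> real" where
  "hilbert_transform p x =
     Lim (at_right 0) (\<lambda>\<epsilon>. LINT t:{t. \<epsilon> < \<bar>x - t\<bar>}|lborel. p t / (x - t))"

definition has_density_pos :: "real measure \<Rightarrow> bool" where
  "has_density_pos \<mu> \<longleftrightarrow> (\<exists>f \<in> borel_measurable leb_pos. density leb_pos f = \<mu>)"

(* The Radon-Nikodym derivative d\<mu>/dx, extended by 0 to the negative half-line. *)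
definition density_pos :: "real measure \<Rightarrow> real \<Rightarrow> real" where
  "density_pos \<mu> x = indicator {0..} x * enn2real (RN_deriv leb_pos \<mu> x)"

definition rel_free_fisher_pos :: "(real \<Rightarrow> real) \<Rightarrow> real measure \<Rightarrow> ereal" where
  "rel_free_fisher_pos Q \<mu> =
     (if has_density_pos \<mu> \<and> integrable leb_pos (\<lambda>x. x * \<bar>density_pos \<mu> x\<bar> ^ 3)
      then 4 * enn2ereal (\<integral>\<^sup>+ x. ennreal
             (x * (hilbert_transform (density_pos \<mu>) x - deriv Q x / 2)\<^sup>2) \<partial>\<mu>)
      else \<infinity>)"

end

theory Submission
  imports Defs
begin

text \<open>
  By a monotonicity argument of Fekete type the limit defining \<open>B_pos Q\<close> exists, and it is the limit
  of the suprema, over configurations of \<open>n\<close> points of the half-line, of the discrete energies.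
  It therefore suffices to compare \<open>\<mu>\<close> with such configurations.  The configuration is reached
  from \<open>\<mu>\<close> by transporting its \<open>n\<close> quantile blocks monotonically onto the \<open>n\<close> points; in
  square-root coordinates this map takes \<open>s = sqrt x\<close> to \<open>\<tau> x\<close>, and \<open>t = sqrt y\<close> to \<open>\<tau> y\<close>.  Applying \<open>ln r \<le> r - 1\<close> to the
  difference quotients \<open>(\<tau> x - \<tau> y) / (s - t)\<close> and \<open>(\<tau> x + \<tau> y) / (s + t)\<close> bounds the change of the
  logarithmic energy by a double integral, which integration against the Hilbert transform turns
  into \<open>4 \<integral> (\<tau> x - sqrt x) H x d\<mu>\<close> with \<open>H x = sqrt x * Hp x\<close>.  Convexity and \<open>Q' \<ge> \<rho>\<close> bound the
  change of the potential from below by \<open>2 sqrt x Q' x d + \<rho> d\<^sup>2\<close> with \<open>d = \<tau> x - sqrt x\<close>, and what is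
  left is \<open>4 d G - \<rho> d\<^sup>2 \<le> 4 G\<^sup>2 / \<rho>\<close> for \<open>G x = sqrt x * (Hp x - Q' x / 2)\<close>.

  The substitution \<open>x = s\<^sup>2\<close> also makes the Hilbert transform accessible: the even density
  \<open>q s = \<bar>s\<bar> * p (s\<^sup>2)\<close> lies in \<open>L\<^sup>1 \<inter> L\<^sup>2\<close>.  Its Cauchy transforms at height \<open>b\<close> have inner products
  depending only on the sum of the heights, which makes them an \<open>L\<^sup>2\<close> Cauchy family as \<open>b\<close> tends to 0;
  the convergence is upgraded to convergence almost everywhere at Lebesgue points.
\<close>

section \<open>The partition function\<close>

text \<open>Only an upper bound on \<open>B_pos Q\<close> is required, so no minimizer of the energy
  has to be constructed: \<open>mu\<close> is compared with each finite configuration separately,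
  and its image under transport is that configuration. Two obstacles shape the rest. Applying ln r
  <= r - 1 to two quotients leaves a constant -2; it is paid for by the virial bound
  \<open>integral_sqrt_H_le\<close>, since 4 * 1/2 = 2, which comes from testing the same pairing
  with the square root itself. And no moments of \<open>mu\<close> are assumed: x, x * Q' x and Q x
  are shown integrable from finite Fisher information, by testing with truncated square roots and
  absorbing half of the unknown term. Test functions are bounded and monotone throughout. Block maps
  have this form, and monotonicity makes the symmetrized kernel nonnegative, so that Fatou and
  domination replace principal values. The square root is the right coordinate because it turns the
  weight x in the L^3 condition and in the Fisher information into weight 1, and because x = s^2
  converts the bare slope bound \<open>\<rho>\<close> into a quadratic gain.\<close>

locale confining_potential =
  fixes Q :: "real \<Rightarrow> real" and \<rho> :: real
  assumes convex: "convex_on {0..} Q"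
    and continuous: "continuous_on {0..} Q"
    and growth: "\<And>x y. 0 \<le> x \<Longrightarrow> x \<le> y \<Longrightarrow> \<rho> * (y - x) \<le> Q y - Q x"
    and rho_pos: "\<rho> > 0"

text \<open>Ordered pairs are summed, so each unordered pair counts twice, as in the squared
  Vandermonde product. Using a set instead of a tuple builds in distinctness of the points and
  independence of their labelling.\<close>

definition log_energy_sum :: "real set \<Rightarrow> real" where
  "log_energy_sum P = (\<Sum>a\<in>P. \<Sum>b\<in>P-{a}. ln \<bar>a - b\<bar>)"

lemma sum_offdiag_symmetric:
  fixes f :: "nat \<Rightarrow> nat \<Rightarrow> real"
  assumes "\<And>i j. f i j = f j i"
  shows "(\<Sum>i<n. \<Sum>j\<in>{..<n}-{i}. f i j) = (\<Sum>j<n. \<Sum>i<j. 2 * f i j)"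
proof (induction n)
  case (Suc n)
  have "(\<Sum>j\<in>{..<Suc n}-{i}. f i j) = (\<Sum>j\<in>{..<n}-{i}. f i j) + f i n" if "i < n" for i
  proof -
    have "{..<Suc n}-{i} = insert n ({..<n}-{i})" using that by auto
    then show ?thesis by simp
  qed
  moreover have "{..<Suc n}-{n} = {..<n}" by auto
  ultimately have "(\<Sum>i<Suc n. \<Sum>j\<in>{..<Suc n}-{i}. f i j)
     = (\<Sum>i<n. (\<Sum>j\<in>{..<n}-{i}. f i j) + f i n) + (\<Sum>j<n. f n j)"
    by simp
  also have "\<dots> = (\<Sum>j<Suc n. \<Sum>i<j. 2 * f i j)"
    using Suc assms[of n] by (simp add: sum.distrib sum_distrib_left[symmetric])
  finally show ?case .
qed simp

lemma log_energy_sum_image: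
  fixes n :: nat
  assumes "inj_on x {..<n}"
  shows "log_energy_sum (x ` {..<n}) = (\<Sum>i<n. \<Sum>j\<in>{..<n}-{i}. ln \<bar>x i - x j\<bar>)"
proof -
  have "(\<Sum>b\<in>x ` {..<n}-{x i}. ln \<bar>x i - b\<bar>) = (\<Sum>j\<in>{..<n}-{i}. ln \<bar>x i - x j\<bar>)" if "i < n" for i
  proof -
    have "x ` {..<n} - {x i} = x ` ({..<n} - {i})"
      using assms that by (auto simp: inj_on_def)
    moreover have "inj_on x ({..<n} - {i})" using assms by (rule inj_on_subset) auto
    ultimately show ?thesis by (simp add: sum.reindex)
  qed
  then show ?thesis
    unfolding log_energy_sum_def using assms by (simp add: sum.reindex)
qed

lemma vandermonde_square_eq_exp:
  fixes x :: "nat \<Rightarrow> real"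
  assumes "inj_on x {..<n}"
  shows "(\<Prod>j<n. \<Prod>i<j. (x i - x j)\<^sup>2) = exp (log_energy_sum (x ` {..<n}))"
proof -
  have "(x i - x j)\<^sup>2 = exp (2 * ln \<bar>x i - x j\<bar>)" if "j < n" "i < j" for i j
  proof -
    have "x i \<noteq> x j" using assms that by (auto simp: inj_on_def)
    then have "exp (ln \<bar>x i - x j\<bar>) = \<bar>x i - x j\<bar>" by simp
    then show ?thesis
      by (simp add: exp_double)
  qed
  then have "(\<Prod>j<n. \<Prod>i<j. (x i - x j)\<^sup>2) = (\<Prod>j<n. \<Prod>i<j. exp (2 * ln \<bar>x i - x j\<bar>))"
    by (intro prod.cong refl) auto
  also have "\<dots> = exp (\<Sum>j<n. \<Sum>i<j. 2 * ln \<bar>x i - x j\<bar>)"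
    by (simp add: exp_sum)
  also have "(\<Sum>j<n. \<Sum>i<j. 2 * ln \<bar>x i - x j\<bar>) = (\<Sum>i<n. \<Sum>j\<in>{..<n}-{i}. ln \<bar>x i - x j\<bar>)"
    by (rule sum_offdiag_symmetric[symmetric]) (simp add: abs_minus_commute)
  finally show ?thesis by (simp add: log_energy_sum_image[OF assms])
qed

text \<open>Each of the n (n - 1) ordered pairs contributes \<open>ln c\<close>. It is applied with
  c = 1 - 1/n, where the total cost is only of order n.\<close>

lemma log_energy_sum_scale:
  assumes "c > 0" "finite P"
  shows "log_energy_sum ((\<lambda>a. c * a) ` P) = log_energy_sum P + real (card P) * (real (card P) - 1) * ln c"
proof -
  have inj: "inj_on (\<lambda>a. c * a) A" for A using assms by (auto simp: inj_on_def)
  have "(\<Sum>b\<in>(\<lambda>a. c * a) ` P - {c * a}. ln \<bar>c * a - b\<bar>)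
      = (\<Sum>b\<in>P-{a}. ln \<bar>a - b\<bar>) + (real (card P) - 1) * ln c" if a: "a \<in> P" for a
  proof -
    have "(\<lambda>a. c * a) ` P - {c * a} = (\<lambda>a. c * a) ` (P - {a})" using assms by auto
    then have "(\<Sum>b\<in>(\<lambda>a. c * a) ` P - {c * a}. ln \<bar>c * a - b\<bar>) = (\<Sum>b\<in>P-{a}. ln \<bar>c * a - c * b\<bar>)"
      by (simp add: sum.reindex[OF inj])
    also have "\<dots> = (\<Sum>b\<in>P-{a}. ln \<bar>a - b\<bar> + ln c)"
    proof (rule sum.cong)
      fix b assume "b \<in> P - {a}"
      then have "\<bar>c * a - c * b\<bar> = c * \<bar>a - b\<bar>" "\<bar>a - b\<bar> > 0"
        using assms by (auto simp: abs_mult right_diff_distrib[symmetric])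
      then show "ln \<bar>c * a - c * b\<bar> = ln \<bar>a - b\<bar> + ln c" using assms by (simp add: ln_mult)
    qed simp
    also have "\<dots> = (\<Sum>b\<in>P-{a}. ln \<bar>a - b\<bar>) + (real (card P) - 1) * ln c"
    proof -
      have "card P > 0" using a assms(2) by (auto simp: card_gt_0_iff)
      then have "real (card (P - {a})) = real (card P) - 1"
        using a assms(2) by (simp add: of_nat_diff)
      then show ?thesis by (simp only: sum.distrib sum_constant)
    qed
    finally show ?thesis .
  qed
  then show ?thesis unfolding log_energy_sum_def
    by (simp add: sum.reindex[OF inj] sum.distrib)
qed

text \<open>On either side of i the distances are distinct multiples k / n, so each side costs at
  most the logarithm of n^n / n!, and n^n / n! is a single term of the series of exp n.\<close>

lemma sum_ln_equispaced:
  assumes "i < n"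
  shows "(\<Sum>j\<in>{..<n}-{i}. ln \<bar>real i / real n - real j / real n\<bar>) \<ge> - 2 * real n"
proof -
  have n: "n > 0" using assms by simp
  define g where "g k = ln (real n / real k)" for k :: nat
  have g0: "g k \<ge> 0" if "k \<in> {1..n}" for k using that by (auto simp: g_def)
  have sg: "(\<Sum>k=1..n. g k) \<le> real n"
  proof -
    have "exp (\<Sum>k=1..n. g k) = (\<Prod>k=1..n. real n / real k)"
      using n by (subst exp_sum) (auto simp: g_def intro!: prod.cong)
    also have "\<dots> = real n ^ n / fact n"
      by (simp add: prod_dividef fact_prod)
    also have "\<dots> \<le> exp (real n)"
    proof -
      have "(\<lambda>k. real n ^ k / fact k) sums exp (real n)"
        using exp_converges[of "real n"] by (simp add: field_simps)
      then show ?thesis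
        using sum_le_suminf[of "\<lambda>k. real n ^ k / fact k" "{n}"] by (simp add: sums_iff)
    qed
    finally show ?thesis by simp
  qed
  have e: "ln \<bar>real i / real n - real j / real n\<bar> = - g (if j < i then i - j else j - i)" if "j \<noteq> i" for j
  proof -
    have "\<bar>real i / real n - real j / real n\<bar> = real (if j < i then i - j else j - i) / real n"
      using n by (auto simp: field_simps of_nat_diff)
    then show ?thesis using n that by (auto simp: g_def ln_div)
  qed
  have "(\<Sum>j\<in>{..<n}-{i}. g (if j < i then i - j else j - i)) 
     = (\<Sum>j\<in>{..<i}. g (i - j)) + (\<Sum>j\<in>{i<..<n}. g (j - i))"
  proof -
    have split: "{..<n}-{i} = {..<i} \<union> {i<..<n}" using assms by auto
    have "(\<Sum>j\<in>{..<n}-{i}. g (if j < i then i - j else j - i))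
        = (\<Sum>j\<in>{..<i}. g (if j < i then i - j else j - i)) + (\<Sum>j\<in>{i<..<n}. g (if j < i then i - j else j - i))"
      unfolding split by (rule sum.union_disjoint) auto
    also have "(\<Sum>j\<in>{..<i}. g (if j < i then i - j else j - i)) = (\<Sum>j\<in>{..<i}. g (i - j))"
      by (rule sum.cong) auto
    also have "(\<Sum>j\<in>{i<..<n}. g (if j < i then i - j else j - i)) = (\<Sum>j\<in>{i<..<n}. g (j - i))"
      by (rule sum.cong) auto
    finally show ?thesis .
  qed
  also have "(\<Sum>j\<in>{..<i}. g (i - j)) \<le> (\<Sum>k=1..n. g k)"
  proof -
    have "(\<Sum>j\<in>{..<i}. g (i - j)) = (\<Sum>k\<in>(\<lambda>j. i - j) ` {..<i}. g k)"
      by (subst sum.reindex) (auto simp: inj_on_def)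
    also have "\<dots> \<le> (\<Sum>k=1..n. g k)" using g0 assms by (intro sum_mono2) auto
    finally show ?thesis .
  qed
  also have "(\<Sum>j\<in>{i<..<n}. g (j - i)) \<le> (\<Sum>k=1..n. g k)"
  proof -
    have "(\<Sum>j\<in>{i<..<n}. g (j - i)) = (\<Sum>k\<in>(\<lambda>j. j - i) ` {i<..<n}. g k)"
      by (subst sum.reindex) (auto simp: inj_on_def)
    also have "\<dots> \<le> (\<Sum>k=1..n. g k)" using g0 assms by (intro sum_mono2) auto
    finally show ?thesis .
  qed
  finally have "(\<Sum>j\<in>{..<n}-{i}. g (if j < i then i - j else j - i)) \<le> 2 * real n" using sg by simp
  moreover have "(\<Sum>j\<in>{..<n}-{i}. ln \<bar>real i / real n - real j / real n\<bar>)
     = - (\<Sum>j\<in>{..<n}-{i}. g (if j < i then i - j else j - i))"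
    unfolding sum_negf[symmetric] by (rule sum.cong) (auto simp: e)
  ultimately show ?thesis by simp
qed

section \<open>Weighted Fekete maxima of configurations on the half-line\<close>

context confining_potential
begin

text \<open>The normalization makes the potential nonnegative with value 0 at the origin; the
  subtracted constant reappears in \<open>B_pos_eq\<close>.\<close>

definition Q0 :: "real \<Rightarrow> real" where "Q0 x = Q x - Q 0"

text \<open>The factor \<open>card P - 1\<close>, in place of the \<open>card P\<close> of the Gibbs
  weight, makes the energy a sum over ordered pairs of one kernel
  (\<open>point_energy_kernel\<close>). The averaging argument of Fekete needs this form.\<close>

definition point_energy :: "real set \<Rightarrow> real" where
  "point_energy P = log_energy_sum P - (real (card P) - 1) * (\<Sum>a\<in>P. Q0 a)"

definition configs :: "nat \<Rightarrow> real set set" where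
  "configs n = {P. finite P \<and> card P = n \<and> P \<subseteq> {0..}}"

text \<open>This is n (n - 1) times the logarithm of the n-th weighted Fekete diameter of the
  half-line.\<close>

definition max_energy :: "nat \<Rightarrow> real" where
  "max_energy n = Sup (point_energy ` configs n)"

lemma Q0_ge: "0 \<le> x \<Longrightarrow> \<rho> * x \<le> Q0 x"
  using growth[of 0 x] by (simp add: Q0_def)

lemma Q0_nonneg: "0 \<le> x \<Longrightarrow> 0 \<le> Q0 x"
  using Q0_ge[of x] rho_pos by (meson mult_nonneg_nonneg less_imp_le order_trans)

lemma Q0_mono: "0 \<le> x \<Longrightarrow> x \<le> y \<Longrightarrow> Q0 x \<le> Q0 y"
  using growth[of x y] rho_pos mult_nonneg_nonneg[of \<rho> "y - x"] by (simp add: Q0_def del: mult_nonneg_nonneg)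

lemma Q0_convex_comb:
  assumes "0 \<le> x" "0 \<le> y" "0 \<le> t" "t \<le> 1"
  shows "Q0 ((1 - t) * x + t * y) \<le> (1 - t) * Q0 x + t * Q0 y"
  using convex_onD[OF convex, of t x y] assms by (simp add: Q0_def algebra_simps)

text \<open>Every point lies in 2 (n - 1) ordered pairs, each carrying half of its
  potential.\<close>

lemma point_energy_kernel:
  assumes "finite P"
  shows "point_energy P = (\<Sum>a\<in>P. \<Sum>b\<in>P-{a}. ln \<bar>a - b\<bar> - (Q0 a + Q0 b) / 2)"
proof -
  have s: "(\<Sum>b\<in>P-{a}. Q0 b) = (\<Sum>b\<in>P. Q0 b) - Q0 a" if "a \<in> P" for a
    using that assms by (simp add: sum_diff1)
  have c: "real (card (P - {a})) = real (card P) - 1" if "a \<in> P" for a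
    using that assms by (metis One_nat_def Suc_leI card_Diff_singleton card_gt_0_iff empty_iff of_nat_1 of_nat_diff)
  have "(\<Sum>a\<in>P. \<Sum>b\<in>P-{a}. (Q0 a + Q0 b) / 2) = (\<Sum>a\<in>P. ((real (card P) - 1) * Q0 a + ((\<Sum>b\<in>P. Q0 b) - Q0 a)) / 2)"
    by (intro sum.cong refl)
      (simp add: sum_divide_distrib[symmetric] sum.distrib s c del: card_Diff_singleton card_Diff_insert)
  also have "\<dots> = ((real (card P) - 1) * (\<Sum>a\<in>P. Q0 a) + (real (card P) * (\<Sum>b\<in>P. Q0 b) - (\<Sum>a\<in>P. Q0 a))) / 2"
    by (simp add: sum_divide_distrib[symmetric] sum.distrib sum_subtractf sum_distrib_left)
  also have "\<dots> = (real (card P) - 1) * (\<Sum>a\<in>P. Q0 a)"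
    by (simp add: field_simps)
  finally show ?thesis
    by (simp add: point_energy_def log_energy_sum_def sum_subtractf)
qed

text \<open>The estimate ln r <= r - 1 at r = \<open>(\<rho> / 2) * \<bar>a - b\<bar>\<close>: the
  linear growth of the potential absorbs r, which leaves a constant.\<close>

lemma kernel_le:
  assumes "0 \<le> a" "0 \<le> b" "a \<noteq> b"
  shows "ln \<bar>a - b\<bar> - (Q0 a + Q0 b) / 2 \<le> - 1 - ln (\<rho> / 2)"
proof -
  have p: "(\<rho> / 2) * \<bar>a - b\<bar> > 0" using assms rho_pos by simp
  have "ln ((\<rho> / 2) * \<bar>a - b\<bar>) \<le> (\<rho> / 2) * \<bar>a - b\<bar> - 1"
    using ln_le_minus_one[OF p] .
  moreover have "ln ((\<rho> / 2) * \<bar>a - b\<bar>) = ln (\<rho> / 2) + ln \<bar>a - b\<bar>"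
    using assms rho_pos by (subst ln_mult) auto
  moreover have "(\<rho> / 2) * \<bar>a - b\<bar> \<le> (\<rho> / 2) * (a + b)"
    using assms rho_pos by (intro mult_left_mono) auto
  moreover have "(\<rho> / 2) * (a + b) \<le> (Q0 a + Q0 b) / 2"
    using Q0_ge[of a] Q0_ge[of b] assms by (simp add: field_simps)
  ultimately show ?thesis by linarith
qed

lemma point_energy_bdd:
  assumes "P \<in> configs n"
  shows "point_energy P \<le> real n * (real n - 1) * (- 1 - ln (\<rho> / 2))"
proof -
  have P: "finite P" "card P = n" "P \<subseteq> {0..}" using assms by (auto simp: configs_def)
  have c: "real (card (P - {a})) = real n - 1" if "a \<in> P" for a
    using that P by (metis One_nat_def Suc_leI card_Diff_singleton card_gt_0_iff empty_iff of_nat_1 of_nat_diff)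
  have "point_energy P \<le> (\<Sum>a\<in>P. \<Sum>b\<in>P-{a}. (- 1 - ln (\<rho> / 2)))"
    unfolding point_energy_kernel[OF P(1)] using P by (intro sum_mono kernel_le) auto
  also have "\<dots> = (\<Sum>a\<in>P. (real n - 1) * (- 1 - ln (\<rho> / 2)))"
    by (intro sum.cong refl) (simp only: sum_constant c)
  also have "\<dots> = real n * (real n - 1) * (- 1 - ln (\<rho> / 2))"
    using P by simp
  finally show ?thesis .
qed

lemma bdd_above_point_energy: "bdd_above (point_energy ` configs n)"
  by (rule bdd_aboveI2[OF point_energy_bdd])

lemma point_energy_le_max: "P \<in> configs n \<Longrightarrow> point_energy P \<le> max_energy n"
  unfolding max_energy_def by (intro cSup_upper bdd_above_point_energy) auto

lemma configs_equispaced: "(\<lambda>i. real i / real n) ` {..<n} \<in> configs n"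
proof -
  have "inj_on (\<lambda>i. real i / real n) {..<n}" by (auto simp: inj_on_def)
  then show ?thesis by (auto simp: configs_def card_image)
qed

lemma configs_nonempty: "configs n \<noteq> {}"
  using configs_equispaced by blast

lemma max_energy_le:
  "(\<And>P. P \<in> configs n \<Longrightarrow> point_energy P \<le> c) \<Longrightarrow> max_energy n \<le> c"
  unfolding max_energy_def using configs_nonempty by (intro cSup_least) auto

text \<open>Tested on the points i / n, where the potential is at most \<open>Q0 1\<close> and
  \<open>sum_ln_equispaced\<close> controls the logarithms.\<close>

lemma max_energy_ge: "max_energy n \<ge> - real n * (2 * real n + (real n - 1) * Q0 1)"
proof -
  define x where "x i = real i / real n" for i :: nat
  have inj: "inj_on x {..<n}" by (auto simp: inj_on_def x_def)
  have Q: "Q0 (x i) \<le> Q0 1" if "i < n" for i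
    using that by (intro Q0_mono) (auto simp: x_def)
  have "log_energy_sum (x ` {..<n}) \<ge> (\<Sum>i<n. - 2 * real n)"
    unfolding log_energy_sum_image[OF inj] unfolding x_def
    by (intro sum_mono sum_ln_equispaced) auto
  then have 1: "log_energy_sum (x ` {..<n}) \<ge> - 2 * real n * real n" by simp
  have "(\<Sum>a\<in>x ` {..<n}. Q0 a) \<le> (\<Sum>i<n. Q0 1)"
    using inj Q by (simp add: sum.reindex) (rule sum_mono[of "{..<n}" "\<lambda>i. Q0 (x i)" "\<lambda>_. Q0 1", simplified])
  then have 2: "(\<Sum>a\<in>x ` {..<n}. Q0 a) \<le> real n * Q0 1" by simp
  have "point_energy (x ` {..<n}) \<ge> - real n * (2 * real n + (real n - 1) * Q0 1)"
  proof (cases "n = 0")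
    case False
    then have "(real n - 1) * (\<Sum>a\<in>x ` {..<n}. Q0 a) \<le> (real n - 1) * (real n * Q0 1)"
      by (intro mult_left_mono 2) auto
    with 1 show ?thesis
      using card_image[OF inj] by (simp add: point_energy_def algebra_simps)
  qed (simp add: point_energy_def log_energy_sum_def)
  also have "point_energy (x ` {..<n}) \<le> max_energy n"
    using configs_equispaced[of n] unfolding x_def by (rule point_energy_le_max)
  finally show ?thesis .
qed

text \<open>Fekete: average over the configurations that omit one point.\<close>

lemma max_energy_Suc_le:
  assumes "n \<ge> 2"
  shows "(real n - 1) * max_energy (Suc n) \<le> (real n + 1) * max_energy n"
proof -
  let ?K = "\<lambda>a b. ln \<bar>a - b\<bar> - (Q0 a + Q0 b) / 2"
  have main: "(real n - 1) * point_energy P \<le> (real n + 1) * max_energy n" if "P \<in> configs (Suc n)" for P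
  proof -
    have P: "finite P" "card P = Suc n" "P \<subseteq> {0..}" using that by (auto simp: configs_def)
    have rem: "point_energy (P - {p}) = point_energy P - 2 * (\<Sum>b\<in>P-{p}. ?K p b)" if p: "p \<in> P" for p
    proof -
      have "(\<Sum>b\<in>P-{a}. ?K a b) = (\<Sum>b\<in>P-{p}-{a}. ?K a b) + ?K p a" if "a \<in> P - {p}" for a
      proof -
        have "P - {a} - {p} = P - {p} - {a}" by auto
        then have "(\<Sum>b\<in>P-{a}. ?K a b) = ?K a p + (\<Sum>b\<in>P-{p}-{a}. ?K a b)"
          using P p that by (subst sum.remove[of "P - {a}" p]) auto
        then show ?thesis by (simp add: abs_minus_commute add.commute)
      qed
      then have "(\<Sum>a\<in>P-{p}. \<Sum>b\<in>P-{a}. ?K a b) = (\<Sum>a\<in>P-{p}. (\<Sum>b\<in>P-{p}-{a}. ?K a b) + ?K p a)"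
        by (intro sum.cong refl) blast
      also have "\<dots> = point_energy (P - {p}) + (\<Sum>b\<in>P-{p}. ?K p b)"
        using P by (subst point_energy_kernel) (auto simp: sum.distrib)
      finally show ?thesis
        using P p by (simp add: point_energy_kernel[OF P(1)] sum.remove[of P p "\<lambda>a. \<Sum>b\<in>P-{a}. ?K a b"])
    qed
    \<comment> \<open>An ordered pair survives the omission of exactly n - 1 of the n + 1
      points.\<close>
    have "(\<Sum>p\<in>P. point_energy (P - {p})) = real (Suc n) * point_energy P - 2 * point_energy P"
      using P by (simp add: rem sum_subtractf sum_distrib_left[symmetric] point_energy_kernel[OF P(1)])
    moreover have "(\<Sum>p\<in>P. point_energy (P - {p})) \<le> (\<Sum>p\<in>P. max_energy n)"
      using P by (intro sum_mono point_energy_le_max) (auto simp: configs_def)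
    ultimately show ?thesis using P by (simp add: algebra_simps)
  qed
  have n1: "real n - 1 > 0" using assms by simp
  have "max_energy (Suc n) \<le> (real n + 1) * max_energy n / (real n - 1)"
    using main n1 by (intro max_energy_le) (simp add: field_simps)
  then show ?thesis using n1 by (simp add: field_simps)
qed

text \<open>By \<open>max_energy_Suc_le\<close> the quotient by n (n - 1) decreases, and
  \<open>max_energy_ge\<close> bounds it from below. Passing to the denominator n^2 multiplies it by
  (n - 1) / n, which tends to 1.\<close>

lemma max_energy_converges: "convergent (\<lambda>n. max_energy n / (real n)\<^sup>2)"
proof -
  \<comment> \<open>The offset 2 keeps the denominator positive and stays in the range of
    \<open>max_energy_Suc_le\<close>.\<close>
  define m where "m n = max_energy (n + 2) / (real (n + 2) * (real (n + 2) - 1))" for n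
  have "m (Suc n) \<le> m n" for n
  proof -
    have a: "(real (n+2) - 1) * max_energy (Suc (n+2)) \<le> (real (n+2) + 1) * max_energy (n+2)"
      by (rule max_energy_Suc_le) simp
    define N where "N = real (n+2)"
    have N: "N \<ge> 2" by (simp add: N_def)
    define A where "A = max_energy (Suc (n+2))"
    define B where "B = max_energy (n+2)"
    have a': "(N - 1) * A \<le> (N + 1) * B" using a by (simp add: N_def A_def B_def)
    have "Suc n + 2 = Suc (n + 2)" "real (Suc (n + 2)) = N + 1" by (simp_all add: N_def)
    then have "m (Suc n) = A / ((N + 1) * N)" "m n = B / (N * (N - 1))"
      unfolding m_def A_def B_def by (simp_all only: N_def add_diff_cancel_right')
    moreover have "A / ((N + 1) * N) \<le> B / (N * (N - 1))"
    proof -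
      have "A * (N * (N - 1)) \<le> B * ((N + 1) * N)" using mult_left_mono[OF a', of N] N by (simp add: algebra_simps)
      then show ?thesis using N by (simp add: divide_simps mult_ac)
    qed
    ultimately show ?thesis by simp
  qed
  then have dec: "decseq m" by (rule decseq_SucI)
  \<comment> \<open>The 4 bounds 2 N / (N - 1) for N >= 2.\<close>
  have "m n \<ge> - (4 + Q0 1)" for n
  proof -
    define N where "N = real (n+2)"
    have N: "N \<ge> 2" by (simp add: N_def)
    have "- N * (2 * N + (N - 1) * Q0 1) \<le> max_energy (n + 2)"
      using max_energy_ge[of "n+2"] by (simp add: N_def)
    moreover have "- (4 + Q0 1) * (N * (N - 1)) \<le> - N * (2 * N + (N - 1) * Q0 1)"
    proof -
      have "0 \<le> N * (2 * N - 4)" using N by (intro mult_nonneg_nonneg) auto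
      then show ?thesis by (simp add: algebra_simps)
    qed
    ultimately have "- (4 + Q0 1) * (N * (N - 1)) \<le> max_energy (n + 2)" by linarith
    moreover have "m n = max_energy (n + 2) / (N * (N - 1))" by (simp only: m_def N_def)
    moreover have "N * (N - 1) > 0" using N by simp
    ultimately show ?thesis by (simp only: pos_le_divide_eq)
  qed
  then have "\<forall>n. - (4 + Q0 1) \<le> m n" by blast
  with dec obtain L where L: "m \<longlonglongrightarrow> L" by (rule decseq_convergent)
  have "(\<lambda>n. m n * ((real (n + 2) - 1) / real (n + 2))) \<longlonglongrightarrow> L * 1"
    by (intro tendsto_mult L) real_asymp
  moreover have "m n * ((real (n + 2) - 1) / real (n + 2)) = max_energy (n + 2) / (real (n + 2))\<^sup>2" for n
  proof -
    define N where "N = real (n+2)"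
    have N: "N \<ge> 2" by (simp add: N_def)
    show ?thesis unfolding m_def N_def[symmetric] using N by (simp add: power2_eq_square)
  qed
  ultimately have "(\<lambda>n. max_energy (n + 2) / (real (n + 2))\<^sup>2) \<longlonglongrightarrow> L" by simp
  then show ?thesis
    unfolding convergent_def using LIMSEQ_offset[of "\<lambda>n. max_energy n / (real n)\<^sup>2" 2 L] by blast
qed

end

section \<open>Comparison of the partition function with the discrete maxima\<close>

lemma space_leb_pos [simp]: "space leb_pos = {0..}"
  by (simp add: leb_pos_def space_restrict_space)

lemma sets_leb_pos: "sets leb_pos = sets (restrict_space borel {0..})"
  by (simp add: leb_pos_def sets_restrict_space)

lemma nn_integral_leb_pos:
  "(\<integral>\<^sup>+x. f x \<partial>leb_pos) = (\<integral>\<^sup>+x. f x * indicator {0..} x \<partial>lborel)"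
  unfolding leb_pos_def by (rule nn_integral_restrict_space) simp

lemma emeasure_leb_pos_Icc:
  "0 \<le> a \<Longrightarrow> a \<le> b \<Longrightarrow> emeasure leb_pos {a..b} = ennreal (b - a)"
  unfolding leb_pos_def by (subst emeasure_restrict_space) auto

lemma sigma_finite_leb_pos: "sigma_finite_measure leb_pos"
  unfolding leb_pos_def
  by (rule sigma_finite_measure_restrict_space) (auto intro: lborel.sigma_finite_measure_axioms)

lemma product_sigma_finite_leb_pos: "product_sigma_finite (\<lambda>_. leb_pos)"
  by (simp add: product_sigma_finite_def sigma_finite_leb_pos)

lemma nn_integral_leb_pos_exp:
  assumes "c > 0"
  shows "(\<integral>\<^sup>+x. ennreal (exp (- c * x)) \<partial>leb_pos) = ennreal (1 / c)"
proof -
  have "(\<integral>\<^sup>+x. ennreal (exp (- c * x)) * indicator {0..} x \<partial>lborel) = ennreal (0 - (- exp (- c * 0) / c))"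
  proof (rule nn_integral_FTC_atLeast)
    show "((\<lambda>x. - exp (- c * x) / c) has_real_derivative exp (- c * x)) (at x)" for x
      using assms by (auto intro!: derivative_eq_intros)
    show "((\<lambda>x. - exp (- c * x) / c) \<longlongrightarrow> 0) at_top"
      using assms by real_asymp
  qed auto
  then show ?thesis by (simp add: nn_integral_leb_pos)
qed

text \<open>ln r <= r - 1 for the reciprocal r of 1 - 1/n gives -ln (1 - 1/n) <= 1 / (n - 1). So
  contracting n points by 1 - 1/n costs at most n, negligible against n^2.\<close>

lemma ln_one_minus_inverse_ge:
  assumes "n \<ge> (2::nat)"
  shows "- real n \<le> real n * (real n - 1) * ln (1 - 1 / real n)"
proof -
  have "ln (1 / (1 - 1 / real n)) \<le> 1 / (1 - 1 / real n) - 1"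
    using assms by (intro ln_le_minus_one) auto
  then have "- ln (1 - 1 / real n) \<le> 1 / (1 - 1 / real n) - 1" using assms by (simp add: ln_div)
  also have "\<dots> = 1 / (real n - 1)" using assms by (simp add: field_simps)
  finally have "(real n * (real n - 1)) * (- ln (1 - 1 / real n)) \<le> (real n * (real n - 1)) * (1 / (real n - 1))"
    using assms by (intro mult_left_mono) auto
  then show ?thesis using assms by simp
qed

context confining_potential
begin

definition weight :: "nat \<Rightarrow> (nat \<Rightarrow> real) \<Rightarrow> real" where
  "weight n x = exp (- real n * (\<Sum>i<n. Q (x i))) * (\<Prod>j<n. \<Prod>i<j. (x i - x j)\<^sup>2)"

lemma measurable_Q_leb_pos [measurable]: "Q \<in> borel_measurable leb_pos"
proof -
  have "Q \<in> borel_measurable (restrict_space borel {0..})"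
    by (rule borel_measurable_continuous_on_restrict[OF continuous])
  then show ?thesis by (simp add: measurable_cong_sets[OF sets_leb_pos refl])
qed

lemma measurable_id_leb_pos [measurable]: "(\<lambda>x. x) \<in> borel_measurable leb_pos"
  unfolding leb_pos_def by (rule measurable_restrict_space1) simp

lemma measurable_weight [measurable]: "weight n \<in> borel_measurable (PiM {..<n} (\<lambda>_. leb_pos))"
proof -
  have Q: "(\<lambda>x. Q (x i)) \<in> borel_measurable (PiM {..<n} (\<lambda>_. leb_pos))" if "i < n" for i
    by (rule measurable_compose[OF _ measurable_Q_leb_pos]) (use that in \<open>auto intro: measurable_component_singleton\<close>)
  have i: "(\<lambda>x. x i) \<in> borel_measurable (PiM {..<n} (\<lambda>_. leb_pos))" if "i < n" for i
    by (rule measurable_compose[OF _ measurable_id_leb_pos]) (use that in \<open>auto intro: measurable_component_singleton\<close>)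
  show ?thesis
    unfolding weight_def
    by (intro borel_measurable_times borel_measurable_exp borel_measurable_sum borel_measurable_prod
        borel_measurable_const borel_measurable_power borel_measurable_diff borel_measurable_uminus
        measurable_compose[OF _ borel_measurable_exp] Q i) auto
qed

lemma weight_nonneg: "weight n x \<ge> 0"
  by (auto simp: weight_def intro!: mult_nonneg_nonneg prod_nonneg)

lemma weight_inj:
  assumes "inj_on x {..<n}"
  shows "weight n x = exp (log_energy_sum (x ` {..<n}) - real n * (\<Sum>i<n. Q0 (x i)) - (real n)\<^sup>2 * Q 0)"
proof -
  have "(\<Sum>i<n. Q (x i)) = (\<Sum>i<n. Q0 (x i)) + real n * Q 0"
    by (simp add: Q0_def sum_subtractf)
  then show ?thesis
    unfolding weight_def vandermonde_square_eq_exp[OF assms]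
    by (simp add: exp_add[symmetric] algebra_simps power2_eq_square)
qed

text \<open>The Gibbs weight carries n copies of the potential and \<open>point_energy\<close> only
  n - 1. The spare copy is at least \<open>\<rho>\<close> times the sum of the coordinates and
  supplies an integrable product. Where two coordinates coincide the weight vanishes.\<close>

lemma weight_le:
  assumes "\<And>i. i < n \<Longrightarrow> 0 \<le> x i"
  shows "weight n x \<le> exp (max_energy n - (real n)\<^sup>2 * Q 0) * (\<Prod>i<n. exp (- \<rho> * x i))"
proof (cases "inj_on x {..<n}")
  case True
  have "x ` {..<n} \<in> configs n" using True assms by (auto simp: configs_def card_image)
  then have "point_energy (x ` {..<n}) \<le> max_energy n" by (rule point_energy_le_max)
  then have "log_energy_sum (x ` {..<n}) - (real n - 1) * (\<Sum>i<n. Q0 (x i)) \<le> max_energy n"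
    using True by (simp add: point_energy_def card_image sum.reindex)
  moreover have "(\<Sum>i<n. \<rho> * x i) \<le> (\<Sum>i<n. Q0 (x i))"
    using assms by (intro sum_mono Q0_ge) auto
  ultimately have "log_energy_sum (x ` {..<n}) - real n * (\<Sum>i<n. Q0 (x i)) - (real n)\<^sup>2 * Q 0
     \<le> max_energy n - (real n)\<^sup>2 * Q 0 + (\<Sum>i<n. - \<rho> * x i)"
    by (simp add: algebra_simps sum_negf)
  then show ?thesis
    unfolding weight_inj[OF True] by (simp add: exp_sum[symmetric] exp_add[symmetric])
next
  case False
  then obtain i j where "i < n" "j < n" "i < j" "x i = x j"
    unfolding inj_on_def by (metis lessThan_iff linorder_neqE_nat)
  then have "(\<Prod>i<j. (x i - x j)\<^sup>2) = 0" by (intro prod_zero) auto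
  then have "(\<Prod>j<n. \<Prod>i<j. (x i - x j)\<^sup>2) = 0"
    using \<open>j < n\<close> by (intro prod_zero) auto
  then have "weight n x = 0" by (simp only: weight_def mult_zero_right)
  then show ?thesis by (simp add: prod_nonneg)
qed

lemma nn_integral_weight_le:
  "(\<integral>\<^sup>+x. ennreal (weight n x) \<partial>PiM {..<n} (\<lambda>_. leb_pos))
     \<le> ennreal (exp (max_energy n - (real n)\<^sup>2 * Q 0) * (1 / \<rho>) ^ n)"
proof -
  interpret product_sigma_finite "\<lambda>_::nat. leb_pos" by (rule product_sigma_finite_leb_pos)
  let ?P = "PiM {..<n} (\<lambda>_. leb_pos)"
  have mexp: "(\<lambda>t. ennreal (exp (- \<rho> * t))) \<in> borel_measurable leb_pos" by measurable
  have "(\<integral>\<^sup>+x. ennreal (weight n x) \<partial>?P)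
     \<le> (\<integral>\<^sup>+x. ennreal (exp (max_energy n - (real n)\<^sup>2 * Q 0)) * (\<Prod>i<n. ennreal (exp (- \<rho> * x i))) \<partial>?P)"
  proof (rule nn_integral_mono)
    fix x assume "x \<in> space ?P"
    then have "0 \<le> x i" if "i < n" for i using that by (auto simp: space_PiM PiE_iff)
    from weight_le[OF this]
    show "ennreal (weight n x) \<le> ennreal (exp (max_energy n - (real n)\<^sup>2 * Q 0)) * (\<Prod>i<n. ennreal (exp (- \<rho> * x i)))"
      by (simp add: prod_ennreal ennreal_mult'[symmetric] prod_nonneg)
  qed
  also have "\<dots> = ennreal (exp (max_energy n - (real n)\<^sup>2 * Q 0)) * (\<integral>\<^sup>+x. (\<Prod>i<n. ennreal (exp (- \<rho> * x i))) \<partial>?P)"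
  proof (rule nn_integral_cmult)
    have "(\<lambda>x. ennreal (exp (- \<rho> * x i))) \<in> borel_measurable ?P" if "i < n" for i
      by (rule measurable_compose[OF _ mexp]) (use that in \<open>auto intro: measurable_component_singleton\<close>)
    then show "(\<lambda>x. \<Prod>i<n. ennreal (exp (- \<rho> * x i))) \<in> borel_measurable ?P"
      by (intro borel_measurable_prod_ennreal) auto
  qed
  also have "(\<integral>\<^sup>+x. (\<Prod>i<n. ennreal (exp (- \<rho> * x i))) \<partial>?P) = (\<Prod>i<n. \<integral>\<^sup>+t. ennreal (exp (- \<rho> * t)) \<partial>leb_pos)"
    by (rule product_nn_integral_prod) (use mexp in auto)
  also have "\<dots> = ennreal ((1 / \<rho>) ^ n)"
    using rho_pos by (simp add: nn_integral_leb_pos_exp[OF rho_pos, simplified] ennreal_power)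
  finally show ?thesis using rho_pos by (simp add: ennreal_mult'[symmetric])
qed

text \<open>The Bochner integral in \<open>partition_pos\<close> would return 0 for a non-integrable
  function, so integrability is first secured by \<open>nn_integral_weight_le\<close>.\<close>

lemma partition_pos_eq: "ennreal (partition_pos Q n) = (\<integral>\<^sup>+x. ennreal (weight n x) \<partial>PiM {..<n} (\<lambda>_. leb_pos))"
proof -
  have "(\<integral>\<^sup>+x. ennreal (weight n x) \<partial>PiM {..<n} (\<lambda>_. leb_pos)) < \<infinity>"
    using nn_integral_weight_le[of n] by (rule le_less_trans) simp
  then have "integrable (PiM {..<n} (\<lambda>_. leb_pos)) (weight n)"
    using weight_nonneg by (intro integrableI_nonneg) auto
  then have "(\<integral>\<^sup>+x. ennreal (weight n x) \<partial>PiM {..<n} (\<lambda>_. leb_pos)) = ennreal (LINT x|PiM {..<n} (\<lambda>_. leb_pos). weight n x)"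
    by (rule nn_integral_eq_integral) (simp add: weight_nonneg)
  then show ?thesis by (simp add: partition_pos_def weight_def)
qed

lemma partition_pos_nonneg: "partition_pos Q n \<ge> 0"
  unfolding partition_pos_def weight_def[symmetric] by (simp add: weight_nonneg)

text \<open>Spreading the points of \<open>P\<close> apart by multiples of \<open>1/n\<^sup>2\<close> never decreases the mutual
  distances of points of the box, and the shift costs little potential energy by convexity.\<close>

lemma partition_pos_ge:
  assumes P: "P \<in> configs n" and n: "n \<ge> 2"
  shows "exp (point_energy P - real n - real n * Q0 1 - (real n)\<^sup>2 * Q 0) * (1 / (real n)\<^sup>2) ^ n \<le> partition_pos Q n"
proof -
  interpret product_sigma_finite "\<lambda>_::nat. leb_pos" by (rule product_sigma_finite_leb_pos)
  let ?P = "PiM {..<n} (\<lambda>_. leb_pos)"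
  have fin: "finite P" "card P = n" "P \<subseteq> {0..}" using P by (auto simp: configs_def)
  define xs where "xs = sorted_list_of_set P"
  define x where "x i = xs ! i" for i
  have len: "length xs = n" and ss: "sorted_wrt (<) xs" and sx: "set xs = P"
    using fin by (auto simp: xs_def)
  have mono: "x i < x j" if "i < j" "j < n" for i j
    using ss that len by (auto simp: x_def sorted_wrt_iff_nth_less)
  have inj: "inj_on x {..<n}"
    using mono by (intro linorder_inj_onI') fastforce
  have im: "x ` {..<n} = P"
    using sx len by (auto simp: x_def set_conv_nth)
  have pos: "0 \<le> x i" if "i < n" for i using im fin that by auto
  define t where "t = 1 / real n"
  have t: "0 < t" "t \<le> 1 / 2" using n by (auto simp: t_def field_simps)
  define \<eta> where "\<eta> = t * t"
  have eta: "\<eta> > 0" using t by (simp add: \<eta>_def)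
  \<comment> \<open>The i-th interval starts \<open>i * \<eta>\<close> beyond the contracted point
    and has length \<open>\<eta>\<close>, so gaps never fall below those of the contracted points.
    The largest total shift is n * \<open>\<eta>\<close> = t, hence y i <= (1 - t) * x i + t * 1, a
    convex combination with the point 1.\<close>
  define c where "c i = (1 - t) * x i + real i * \<eta>" for i
  define box where "box = (\<Pi>\<^sub>E i\<in>{..<n}. {c i..c i + \<eta>})"
  have cpos: "0 \<le> c i" if "i < n" for i
    using pos[OF that] t eta by (auto simp: c_def)
  have box_meas: "box \<in> sets ?P"
    unfolding box_def
    by (rule sets_PiM_I_finite) (use cpos in \<open>auto simp: sets_leb_pos sets_restrict_space_iff intro: order_trans\<close>)
  have em: "emeasure ?P box = ennreal ((1 / (real n)\<^sup>2) ^ n)"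
  proof -
    have "emeasure ?P box = (\<Prod>i<n. emeasure leb_pos {c i..c i + \<eta>})"
      unfolding box_def
      by (rule emeasure_PiM) (use cpos in \<open>auto simp: sets_leb_pos sets_restrict_space_iff intro: order_trans\<close>)
    also have "\<dots> = (\<Prod>i<n. ennreal \<eta>)"
      using cpos eta by (intro prod.cong refl) (simp add: emeasure_leb_pos_Icc)
    also have "\<dots> = ennreal (\<eta> ^ n)" using eta by (simp add: ennreal_power)
    finally show ?thesis by (simp add: \<eta>_def t_def power2_eq_square)
  qed
  have lower: "exp (point_energy P - real n - real n * Q0 1 - (real n)\<^sup>2 * Q 0) \<le> weight n y" if y: "y \<in> box" for y
  proof -
    have yc: "c i \<le> y i" "y i \<le> c i + \<eta>" if "i < n" for i
      using y that by (auto simp: box_def PiE_iff)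
    have gap: "(1 - t) * (x j - x i) \<le> y j - y i" if "i < j" "j < n" for i j
    proof -
      have "real i + 1 \<le> real j" using that by simp
      then have "(real i + 1) * \<eta> \<le> real j * \<eta>" using eta by (intro mult_right_mono) auto
      then show ?thesis using yc(2)[of i] yc(1)[of j] that by (simp add: c_def algebra_simps)
    qed
    have ymono: "y i < y j" if "i < j" "j < n" for i j
    proof -
      have "0 < (1 - t) * (x j - x i)" using mono[OF that] t by simp
      then show ?thesis using gap[OF that] by linarith
    qed
    have yinj: "inj_on y {..<n}"
      using ymono by (intro linorder_inj_onI') fastforce
    have absgap: "(1 - t) * \<bar>x i - x j\<bar> \<le> \<bar>y i - y j\<bar>" if "i < n" "j < n" "i \<noteq> j" for i j
      using gap[of i j] gap[of j i] mono[of i j] mono[of j i] ymono[of i j] ymono[of j i] that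
      by (cases i j rule: linorder_cases) (auto simp: abs_if)
    have "log_energy_sum ((\<lambda>a. (1 - t) * a) ` P) \<le> log_energy_sum (y ` {..<n})"
    proof -
      have "inj_on ((\<lambda>a. (1 - t) * a) \<circ> x) {..<n}"
        using inj t by (intro comp_inj_on) (auto simp: inj_on_def)
      then have i2: "inj_on (\<lambda>i. (1 - t) * x i) {..<n}" by (simp add: o_def)
      have "(\<lambda>a. (1 - t) * a) ` P = (\<lambda>i. (1 - t) * x i) ` {..<n}" by (simp add: im[symmetric] image_image)
      then have "log_energy_sum ((\<lambda>a. (1 - t) * a) ` P) = (\<Sum>i<n. \<Sum>j\<in>{..<n}-{i}. ln \<bar>(1 - t) * x i - (1 - t) * x j\<bar>)"
        using log_energy_sum_image[OF i2] by simp
      also have "\<dots> \<le> (\<Sum>i<n. \<Sum>j\<in>{..<n}-{i}. ln \<bar>y i - y j\<bar>)"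
      proof (intro sum_mono)
        fix i j assume ij: "i \<in> {..<n}" "j \<in> {..<n} - {i}"
        have "\<bar>(1 - t) * x i - (1 - t) * x j\<bar> = (1 - t) * \<bar>x i - x j\<bar>"
          using t by (simp add: abs_mult right_diff_distrib[symmetric])
        moreover have "x i \<noteq> x j" using inj ij by (auto simp: inj_on_def)
        then have "0 < (1 - t) * \<bar>x i - x j\<bar>" using t by simp
        ultimately show "ln \<bar>(1 - t) * x i - (1 - t) * x j\<bar> \<le> ln \<bar>y i - y j\<bar>"
          using absgap[of i j] ij by (simp add: ln_mono)
      qed
      also have "\<dots> = log_energy_sum (y ` {..<n})" by (simp add: log_energy_sum_image[OF yinj])
      finally show ?thesis .
    qed
    then have 1: "log_energy_sum P + real n * (real n - 1) * ln (1 - t) \<le> log_energy_sum (y ` {..<n})"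
      using log_energy_sum_scale[of "1 - t" P] t fin by simp
    have 2: "- real n \<le> real n * (real n - 1) * ln (1 - t)"
      unfolding t_def by (rule ln_one_minus_inverse_ge[OF n])
    \<comment> \<open>Contraction by 1 - 1/n combined with convexity turns the n copies of the
      potential in the Gibbs weight into the n - 1 copies of \<open>point_energy\<close>.\<close>
    have "real n * Q0 (y i) \<le> (real n - 1) * Q0 (x i) + Q0 1" if i: "i < n" for i
    proof -
      have "real i + 1 \<le> real n" using i by simp
      then have "(real i + 1) * \<eta> \<le> real n * \<eta>" using eta by (intro mult_right_mono) auto
      also have "\<dots> = t * 1" using n by (simp add: \<eta>_def t_def)
      finally have "y i \<le> (1 - t) * x i + t * 1"
        using yc(2)[OF i] by (simp add: c_def algebra_simps)
      moreover have "0 \<le> y i" using yc(1)[OF i] cpos[OF i] by simp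
      ultimately have "Q0 (y i) \<le> Q0 ((1 - t) * x i + t * 1)" by (intro Q0_mono)
      also have "\<dots> \<le> (1 - t) * Q0 (x i) + t * Q0 1" using t pos[OF i] by (intro Q0_convex_comb) auto
      finally have "real n * Q0 (y i) \<le> real n * ((1 - t) * Q0 (x i) + t * Q0 1)" by (intro mult_left_mono) auto
      also have "\<dots> = (real n - 1) * Q0 (x i) + Q0 1" using n by (simp add: t_def field_simps)
      finally show ?thesis .
    qed
    then have "(\<Sum>i<n. real n * Q0 (y i)) \<le> (\<Sum>i<n. (real n - 1) * Q0 (x i) + Q0 1)"
      by (intro sum_mono) auto
    then have 3: "real n * (\<Sum>i<n. Q0 (y i)) \<le> (real n - 1) * (\<Sum>a\<in>P. Q0 a) + real n * Q0 1"
      unfolding im[symmetric] using inj by (simp add: sum.reindex sum.distrib sum_distrib_left)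
    have "point_energy P = log_energy_sum P - (real n - 1) * (\<Sum>a\<in>P. Q0 a)"
      using fin by (simp add: point_energy_def)
    with 1 2 3 show ?thesis
      unfolding weight_inj[OF yinj] by simp
  qed
  have "ennreal (exp (point_energy P - real n - real n * Q0 1 - (real n)\<^sup>2 * Q 0) * (1 / (real n)\<^sup>2) ^ n)
      = (\<integral>\<^sup>+y. ennreal (exp (point_energy P - real n - real n * Q0 1 - (real n)\<^sup>2 * Q 0)) * indicator box y \<partial>?P)"
    using box_meas by (simp add: nn_integral_cmult_indicator em ennreal_mult'[symmetric])
  also have "\<dots> \<le> (\<integral>\<^sup>+y. ennreal (weight n y) \<partial>?P)"
    using lower by (intro nn_integral_mono) (auto simp: ennreal_leI split: split_indicator)
  also have "\<dots> = ennreal (partition_pos Q n)" by (rule partition_pos_eq[symmetric])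
  finally show ?thesis by (simp add: partition_pos_nonneg)
qed


text \<open>Upper and lower bounds on the partition function pinch its normalized logarithm. The box
  volume n^(-2n) costs 2 ln n / n, all other errors are O(1/n). Since \<open>lim\<close> is only
  meaningful for convergent sequences, this also validates the definition of
  \<open>B_pos\<close>.\<close>

lemma B_pos_eq: "B_pos Q = lim (\<lambda>n. max_energy n / (real n)\<^sup>2) - Q 0"
proof -
  obtain L where L: "(\<lambda>n. max_energy n / (real n)\<^sup>2) \<longlonglongrightarrow> L"
    using max_energy_converges by (auto simp: convergent_def)
  have upper: "ln (partition_pos Q n) / (real n)\<^sup>2 \<le> max_energy n / (real n)\<^sup>2 - Q 0 - ln \<rho> / real n"
    and lower: "max_energy n / (real n)\<^sup>2 - Q 0 - (1 + Q0 1) / real n - 2 * ln (real n) / real n \<le> ln (partition_pos Q n) / (real n)\<^sup>2"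
    if n: "n \<ge> 2" for n
  proof -
    have pos: "partition_pos Q n > 0"
    proof -
      obtain P where "P \<in> configs n" using configs_nonempty by blast
      from partition_pos_ge[OF this n] show ?thesis
        using n by (intro less_le_trans[OF _ \<open>_ \<le> partition_pos Q n\<close>]) auto
    qed
    have "ennreal (partition_pos Q n) \<le> ennreal (exp (max_energy n - (real n)\<^sup>2 * Q 0) * (1 / \<rho>) ^ n)"
      unfolding partition_pos_eq by (rule nn_integral_weight_le)
    then have "partition_pos Q n \<le> exp (max_energy n - (real n)\<^sup>2 * Q 0) * (1 / \<rho>) ^ n"
      using rho_pos by (subst (asm) ennreal_le_iff) auto
    then have "ln (partition_pos Q n) \<le> ln (exp (max_energy n - (real n)\<^sup>2 * Q 0) * (1 / \<rho>) ^ n)"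
      using pos by (intro ln_mono)  
    also have "\<dots> = max_energy n - (real n)\<^sup>2 * Q 0 - real n * ln \<rho>"
      using rho_pos by (subst ln_mult) (auto simp: ln_realpow ln_div)
    finally have "ln (partition_pos Q n) / (real n)\<^sup>2 \<le> (max_energy n - (real n)\<^sup>2 * Q 0 - real n * ln \<rho>) / (real n)\<^sup>2"
      by (rule divide_right_mono) simp
    also have "\<dots> = max_energy n / (real n)\<^sup>2 - Q 0 - ln \<rho> / real n"
      using n by (simp add: diff_divide_distrib power2_eq_square)
    finally show "ln (partition_pos Q n) / (real n)\<^sup>2 \<le> max_energy n / (real n)\<^sup>2 - Q 0 - ln \<rho> / real n" .
    have "max_energy n \<le> ln (partition_pos Q n) + real n + real n * Q0 1 + (real n)\<^sup>2 * Q 0 + 2 * real n * ln (real n)"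
    proof (rule max_energy_le)
      fix P assume "P \<in> configs n"
      from partition_pos_ge[OF this n]
      have "ln (exp (point_energy P - real n - real n * Q0 1 - (real n)\<^sup>2 * Q 0) * (1 / (real n)\<^sup>2) ^ n) \<le> ln (partition_pos Q n)"
        using n by (intro ln_mono) auto
      moreover have "ln (exp (point_energy P - real n - real n * Q0 1 - (real n)\<^sup>2 * Q 0) * (1 / (real n)\<^sup>2) ^ n)
         = point_energy P - real n - real n * Q0 1 - (real n)\<^sup>2 * Q 0 - 2 * real n * ln (real n)"
        using n by (subst ln_mult) (auto simp: ln_realpow ln_div)
      ultimately show "point_energy P \<le> ln (partition_pos Q n) + real n + real n * Q0 1 + (real n)\<^sup>2 * Q 0 + 2 * real n * ln (real n)"
        by linarith
    qed
    then have "(max_energy n - real n - real n * Q0 1 - (real n)\<^sup>2 * Q 0 - 2 * real n * ln (real n)) / (real n)\<^sup>2 \<le> ln (partition_pos Q n) / (real n)\<^sup>2"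
      by (intro divide_right_mono) auto
    moreover have "(max_energy n - real n - real n * Q0 1 - (real n)\<^sup>2 * Q 0 - 2 * real n * ln (real n)) / (real n)\<^sup>2
      = max_energy n / (real n)\<^sup>2 - Q 0 - (1 + Q0 1) / real n - 2 * ln (real n) / real n"
      using n by (simp add: diff_divide_distrib add_divide_distrib power2_eq_square)
    ultimately show "max_energy n / (real n)\<^sup>2 - Q 0 - (1 + Q0 1) / real n - 2 * ln (real n) / real n \<le> ln (partition_pos Q n) / (real n)\<^sup>2"
      by simp
  qed
  have 1: "(\<lambda>n. max_energy n / (real n)\<^sup>2 - Q 0 - ln \<rho> / real n) \<longlonglongrightarrow> L - Q 0 - 0"
    by (intro tendsto_diff L tendsto_const) real_asymp
  have 2: "(\<lambda>n. max_energy n / (real n)\<^sup>2 - Q 0 - (1 + Q0 1) / real n - 2 * ln (real n) / real n) \<longlonglongrightarrow> L - Q 0 - 0 - 0"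
    by (intro tendsto_diff L tendsto_const lim_const_over_n) real_asymp
  have "(\<lambda>n. ln (partition_pos Q n) / (real n)\<^sup>2) \<longlonglongrightarrow> L - Q 0"
    by (rule tendsto_sandwich[OF eventually_mono[OF eventually_ge_at_top[of "2::nat"] lower]
          eventually_mono[OF eventually_ge_at_top[of "2::nat"] upper] 2[simplified] 1[simplified]])
  then show ?thesis unfolding B_pos_def using L by (simp add: limI)
qed

text \<open>The hypothesis concerns the natural functional of an empirical measure, with full weight
  n on the potential, whereas \<open>max_energy\<close> carries n - 1. Applying the hypothesis to
  the configuration contracted by 1 - 1/n closes the gap: convexity gains the factor (n - 1) / n and
  the logarithms lose at most n.\<close>

lemma B_pos_leI:
  assumes bound: "\<And>n P. n \<ge> 2 \<Longrightarrow> P \<in> configs n \<Longrightarrow> log_energy_sum P / (real n)\<^sup>2 - (\<Sum>a\<in>P. Q a) / real n \<le> X + e n"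
    and e: "e \<longlonglongrightarrow> 0"
  shows "B_pos Q \<le> X"
proof -
  obtain L where L: "(\<lambda>n. max_energy n / (real n)\<^sup>2) \<longlonglongrightarrow> L"
    using max_energy_converges by (auto simp: convergent_def)
  have "max_energy n / (real n)\<^sup>2 \<le> X + e n + Q 0 + 1 / real n" if n: "n \<ge> 2" for n
  proof -
    have "max_energy n \<le> (real n)\<^sup>2 * (X + e n + Q 0 + 1 / real n)"
    proof (rule max_energy_le)
      fix P assume P: "P \<in> configs n"
      then have fin: "finite P" "card P = n" "P \<subseteq> {0..}" by (auto simp: configs_def)
      define t where "t = 1 / real n"
      have t: "0 < t" "t \<le> 1 / 2" using n by (auto simp: t_def field_simps)
      have inj: "inj_on (\<lambda>a. (1 - t) * a) P" using t by (auto simp: inj_on_def)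
      let ?P = "(\<lambda>a. (1 - t) * a) ` P"
      have "?P \<in> configs n"
        using fin t inj by (auto simp: configs_def card_image)
      from bound[OF n this]
      have "(real n)\<^sup>2 * (log_energy_sum ?P / (real n)\<^sup>2 - (\<Sum>a\<in>?P. Q a) / real n) \<le> (real n)\<^sup>2 * (X + e n)"
        by (intro mult_left_mono) auto
      moreover have "(real n)\<^sup>2 * (log_energy_sum ?P / (real n)\<^sup>2 - (\<Sum>a\<in>?P. Q a) / real n)
         = log_energy_sum ?P - real n * (\<Sum>a\<in>?P. Q a)"
        using n by (simp add: right_diff_distrib power2_eq_square)
      ultimately have b: "log_energy_sum ?P - real n * (\<Sum>a\<in>?P. Q a) \<le> (real n)\<^sup>2 * (X + e n)" by simp
      have l: "log_energy_sum P - real n \<le> log_energy_sum ?P"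
        using log_energy_sum_scale[of "1 - t" P] t fin ln_one_minus_inverse_ge[OF n] by (simp add: t_def)
      have "real n * Q ((1 - t) * a) \<le> (real n - 1) * Q0 a + real n * Q 0" if a: "a \<in> P" for a
      proof -
        have "0 \<le> a" using fin a by auto
        then have "Q0 ((1 - t) * a + t * 0) \<le> (1 - t) * Q0 a + t * Q0 0"
          using t by (intro Q0_convex_comb) auto
        then have "real n * Q0 ((1 - t) * a) \<le> real n * ((1 - t) * Q0 a)"
          by (intro mult_left_mono) (auto simp: Q0_def)
        also have "\<dots> = (real n - 1) * Q0 a" using n by (simp add: t_def field_simps)
        finally show ?thesis by (simp add: Q0_def algebra_simps)
      qed
      then have "(\<Sum>a\<in>P. real n * Q ((1 - t) * a)) \<le> (\<Sum>a\<in>P. (real n - 1) * Q0 a + real n * Q 0)"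
        by (intro sum_mono)
      then have q: "real n * (\<Sum>a\<in>?P. Q a) \<le> (real n - 1) * (\<Sum>a\<in>P. Q0 a) + (real n)\<^sup>2 * Q 0"
        using inj fin by (simp add: sum.reindex sum.distrib sum_distrib_left power2_eq_square)
      have "(real n)\<^sup>2 * (X + e n + Q 0 + 1 / real n) = (real n)\<^sup>2 * (X + e n) + (real n)\<^sup>2 * Q 0 + real n"
        using n by (simp add: distrib_left power2_eq_square)
      with b l q show "point_energy P \<le> (real n)\<^sup>2 * (X + e n + Q 0 + 1 / real n)"
        using fin by (simp add: point_energy_def)
    qed
    then show ?thesis using n by (simp add: pos_divide_le_eq mult.commute)
  qed
  from eventually_mono[OF eventually_ge_at_top[of "2::nat"] this]
  have ev: "eventually (\<lambda>n. max_energy n / (real n)\<^sup>2 \<le> X + e n + Q 0 + 1 / real n) sequentially"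
    by simp
  have "(\<lambda>n. X + e n + Q 0 + 1 / real n) \<longlonglongrightarrow> X + 0 + Q 0 + 0"
    by (intro tendsto_add tendsto_const e) real_asymp
  from tendsto_le[OF _ this L ev] have "L \<le> X + Q 0" by simp
  then show ?thesis using L by (simp add: B_pos_eq limI)
qed

end

section \<open>Poisson averages at Lebesgue points\<close>

text \<open>The Poisson kernel of the upper half-plane without the factor 1 / pi, so its total mass
  is pi.\<close>

definition poisson_ker :: "real \<Rightarrow> real \<Rightarrow> real" where
  "poisson_ker y u = y / (u\<^sup>2 + y\<^sup>2)"

lemma poisson_ker_nonneg: "0 \<le> y \<Longrightarrow> 0 \<le> poisson_ker y u"
  by (simp add: poisson_ker_def)

lemma poisson_ker_minus [simp]: "poisson_ker y (- u) = poisson_ker y u"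
  by (simp add: poisson_ker_def)

lemma measurable_poisson_ker [measurable]: "poisson_ker y \<in> borel_measurable borel"
  unfolding poisson_ker_def by measurable

lemma nn_integral_poisson_ker_half:
  assumes "y > 0"
  shows "(\<integral>\<^sup>+u. ennreal (poisson_ker y u) * indicator {0..} u \<partial>lborel) = ennreal (pi / 2)"
proof -
  have "(\<integral>\<^sup>+u. ennreal (poisson_ker y u) * indicator {0..} u \<partial>lborel) = ennreal (pi / 2 - arctan (0 / y))"
  proof (rule nn_integral_FTC_atLeast)
    show "((\<lambda>u. arctan (u / y)) has_real_derivative poisson_ker y u) (at u)" for u
    proof -
      have "((\<lambda>u. arctan (u / y)) has_real_derivative (inverse (1 + (u / y)\<^sup>2) * (1 / y))) (at u)"
        using assms by (auto intro!: derivative_eq_intros)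
      moreover have "inverse (1 + (u / y)\<^sup>2) * (1 / y) = poisson_ker y u"
        using assms by (simp add: poisson_ker_def field_simps power2_eq_square)
      ultimately show ?thesis by simp
    qed
    show "((\<lambda>u. arctan (u / y)) \<longlongrightarrow> pi / 2) at_top"
      using assms by real_asymp
  qed (use assms in \<open>auto simp: poisson_ker_nonneg\<close>)
  then show ?thesis by simp
qed

lemma nn_integral_poisson_ker:
  assumes "y > 0"
  shows "(\<integral>\<^sup>+u. ennreal (poisson_ker y u) \<partial>lborel) = ennreal pi"
proof -
  have "(\<integral>\<^sup>+u. ennreal (poisson_ker y u) * indicator {..<0} u \<partial>lborel) = (\<integral>\<^sup>+u. ennreal (poisson_ker y u) * indicator {0<..} u \<partial>lborel)"
    by (subst nn_integral_real_affine[where c="-1" and t=0]) (auto intro!: nn_integral_cong split: split_indicator)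
  also have "\<dots> = (\<integral>\<^sup>+u. ennreal (poisson_ker y u) * indicator {0..} u \<partial>lborel)"
    by (rule nn_integral_cong_AE) (use AE_lborel_singleton[of 0] in \<open>auto elim!: eventually_mono split: split_indicator\<close>)
  finally have 1: "(\<integral>\<^sup>+u. ennreal (poisson_ker y u) * indicator {..<0} u \<partial>lborel) = ennreal (pi / 2)"
    using nn_integral_poisson_ker_half[OF assms] by simp
  have "(\<integral>\<^sup>+u. ennreal (poisson_ker y u) \<partial>lborel)
      = (\<integral>\<^sup>+u. ennreal (poisson_ker y u) * indicator {..<0} u + ennreal (poisson_ker y u) * indicator {0..} u \<partial>lborel)"
    by (intro nn_integral_cong) (auto split: split_indicator)
  also have "\<dots> = ennreal (pi / 2) + ennreal (pi / 2)"
    by (subst nn_integral_add) (auto simp: 1 nn_integral_poisson_ker_half[OF assms])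
  also have "\<dots> = ennreal pi"
    by (subst ennreal_plus[symmetric]) auto
  finally show ?thesis .
qed

lemma nn_integral_poisson_ker_shift:
  assumes "y > 0"
  shows "(\<integral>\<^sup>+u. ennreal (poisson_ker y (x - u)) \<partial>lborel) = ennreal pi"
  by (subst nn_integral_real_affine[where c="-1" and t=x]) (auto simp: nn_integral_poisson_ker[OF assms])

text \<open>A symmetric decreasing kernel is a superposition of indicators of centred intervals,
  with minus its derivative as density. This reduces Poisson averages to masses of balls.\<close>

lemma poisson_ker_layer_cake:
  assumes "y > 0"
  shows "ennreal (poisson_ker y d) = (\<integral>\<^sup>+r. ennreal (2 * r * y / (r\<^sup>2 + y\<^sup>2)\<^sup>2) * indicator {\<bar>d\<bar>..} r \<partial>lborel)"
proof -
  have "(\<integral>\<^sup>+r. ennreal (2 * r * y / (r\<^sup>2 + y\<^sup>2)\<^sup>2) * indicator {\<bar>d\<bar>..} r \<partial>lborel) = ennreal (0 - (- poisson_ker y \<bar>d\<bar>))"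
  proof (rule nn_integral_FTC_atLeast)
    show "((\<lambda>r. - poisson_ker y r) has_real_derivative 2 * r * y / (r\<^sup>2 + y\<^sup>2)\<^sup>2) (at r)" for r
    proof -
      have "r\<^sup>2 + y\<^sup>2 \<noteq> 0" using assms by (simp add: sum_power2_eq_zero_iff)
      then show ?thesis
        unfolding poisson_ker_def by (auto intro!: derivative_eq_intros simp: power2_eq_square)
    qed
    show "((\<lambda>r. - poisson_ker y r) \<longlongrightarrow> 0) at_top"
      unfolding poisson_ker_def using assms by real_asymp
  qed (use assms in auto)
  then show ?thesis by (simp add: poisson_ker_def)
qed

lemma tendsto_ennreal_zeroI:
  fixes f :: "'a \<Rightarrow> ennreal"
  assumes "\<And>e. e > 0 \<Longrightarrow> eventually (\<lambda>y. f y \<le> ennreal e) F"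
  shows "(f \<longlongrightarrow> 0) F"
proof (rule order_tendstoI)
  fix a :: ennreal assume "0 < a"
  then obtain b :: ennreal where b: "0 < b" "b < a" using dense by blast
  then obtain e where e: "e > 0" "b = ennreal e"
    by (cases b) (auto simp: ennreal_eq_0_iff zero_less_iff_neq_zero)
  show "eventually (\<lambda>y. f y < a) F"
    using assms[OF e(1)] by (rule eventually_mono) (use b e in \<open>auto intro: le_less_trans\<close>)
qed simp

text \<open>Outer regularity encloses the \<open>M\<close>-null set E in an open U of small
  \<open>M\<close>-mass. Around each bad point there are arbitrarily small balls inside U of mass
  above c * r, and the Vitali theorem selects disjoint ones covering almost all bad points. Their
  total length is at most 2 / c times the mass of U.\<close>

lemma AE_vanishing_density:
  fixes M :: "real measure"
  assumes "finite_measure M" and sets[measurable_cong]: "sets M = sets borel"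
    and E: "E \<in> sets borel" and null: "emeasure M E = 0"
  shows "AE x in lborel. x \<in> E \<longrightarrow> (\<forall>c>0. \<exists>r0>0. \<forall>r. 0 < r \<longrightarrow> r < r0 \<longrightarrow> emeasure M (cball x r) \<le> ennreal (c * r))"
proof -
  interpret finite_measure M by fact
  define S where "S c = {x\<in>E. \<forall>r0>0. \<exists>r. 0 < r \<and> r < r0 \<and> emeasure M (cball x r) > ennreal (c * r)}" for c :: real
  have neg: "negligible (S c)" if c: "c > 0" for c
  proof (subst negligible_outer, intro allI impI)
    fix e :: real assume e: "e > 0"
    have "emeasure M E = (INF U\<in>{U. E \<subseteq> U \<and> open U}. emeasure M U)"
      by (rule outer_regular[OF sets _ E]) (simp add: emeasure_eq_measure)
    \<comment> \<open>A ball of length 2 r has mass above c r, so lengths are at most 2 / c times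
      masses; the bound c * e / 4 makes the total length at most e / 2.\<close>
    then have "(INF U\<in>{U. E \<subseteq> U \<and> open U}. emeasure M U) < ennreal (c * e / 4)"
      using null e c by simp
    then obtain U where U: "E \<subseteq> U" "open U" "emeasure M U < ennreal (c * e / 4)"
      by (auto simp: INF_less_iff)
    define K where "K = {(x, r). x \<in> S c \<and> 0 < r \<and> cball x r \<subseteq> U \<and> emeasure M (cball x r) > ennreal (c * r)}"
    have cover: "\<exists>i. i \<in> K \<and> x \<in> cball (fst i) (snd i) \<and> snd i < d" if x: "x \<in> S c" and d: "0 < d" for x d
    proof -
      have "x \<in> U" using x U by (auto simp: S_def)
      then obtain d' where d': "d' > 0" "cball x d' \<subseteq> U" using U open_contains_cball by blast
      have "0 < min d d'" using d d' by simp
      then obtain r where r: "0 < r" "r < min d d'" "emeasure M (cball x r) > ennreal (c * r)"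
        using x unfolding S_def by blast
      then have "cball x r \<subseteq> U" using d' by (meson cball_subset_cball_iff less_imp_le min.strict_boundedE subset_trans subset_cball)
      with r x have "(x, r) \<in> K" by (simp add: K_def)
      then show ?thesis using r by (intro exI[of _ "(x, r)"]) auto
    qed
    obtain C where C: "countable C" "C \<subseteq> K"
      "pairwise (\<lambda>i j. disjnt (cball (fst i) (snd i)) (cball (fst j) (snd j))) C"
      "negligible (S c - (\<Union>i\<in>C. cball (fst i) (snd i)))"
      by (rule Vitali_covering_theorem_cballs[of K snd "S c" fst]) (use cover in \<open>auto simp: K_def\<close>)
    define V where "V = (\<Union>i\<in>C. cball (fst i) (snd i))"
    have Vb: "V \<in> sets borel" unfolding V_def using C(1) by (intro sets.countable_UN'') auto
    have disj: "disjoint_family_on (\<lambda>i. cball (fst i) (snd i)) C"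
      using C(3) by (auto simp: disjoint_family_on_def pairwise_def disjnt_def)
    have "emeasure lborel V = (\<integral>\<^sup>+i. emeasure lborel (cball (fst i) (snd i)) \<partial>count_space C)"
      unfolding V_def by (rule emeasure_UN_countable) (use C disj in auto)
    also have "\<dots> \<le> (\<integral>\<^sup>+i. ennreal (2 / c) * emeasure M (cball (fst i) (snd i)) \<partial>count_space C)"
    proof (rule nn_integral_mono)
      fix i assume "i \<in> space (count_space C)"
      then have i: "0 < snd i" "emeasure M (cball (fst i) (snd i)) > ennreal (c * snd i)"
        using C(2) by (auto simp: K_def)
      have "emeasure lborel (cball (fst i) (snd i)) = ennreal (2 * snd i)"
        using i by (simp add: cball_eq_atLeastAtMost)
      also have "\<dots> = ennreal (2 / c) * ennreal (c * snd i)"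
        using c i by (simp add: ennreal_mult'[symmetric])
      also have "\<dots> \<le> ennreal (2 / c) * emeasure M (cball (fst i) (snd i))"
        using i by (intro mult_left_mono) auto
      finally show "emeasure lborel (cball (fst i) (snd i)) \<le> ennreal (2 / c) * emeasure M (cball (fst i) (snd i))" .
    qed
    also have "\<dots> = ennreal (2 / c) * (\<integral>\<^sup>+i. emeasure M (cball (fst i) (snd i)) \<partial>count_space C)"
      by (rule nn_integral_cmult) auto
    also have "(\<integral>\<^sup>+i. emeasure M (cball (fst i) (snd i)) \<partial>count_space C) = emeasure M V"
      unfolding V_def by (rule emeasure_UN_countable[symmetric]) (use C disj in \<open>auto simp: sets\<close>)
    also have "ennreal (2 / c) * emeasure M V \<le> ennreal (2 / c) * ennreal (c * e / 4)"
    proof (intro mult_left_mono order_trans[OF emeasure_mono less_imp_le[OF U(3)]])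
      show "V \<subseteq> U" unfolding V_def
      proof (rule UN_least)
        fix i assume "i \<in> C"
        with C(2) have "i \<in> K" by blast
        then show "cball (fst i) (snd i) \<subseteq> U" by (simp add: K_def case_prod_beta)
      qed
    qed (use U in \<open>simp_all add: sets\<close>)
    also have "ennreal (2 / c) * ennreal (c * e / 4) = ennreal (e / 2)"
      using c e by (simp add: ennreal_mult'[symmetric])
    finally have VE: "emeasure lborel V \<le> ennreal (e / 2)" .
    have fm: "V \<in> fmeasurable lborel"
      using Vb VE by (intro fmeasurableI) (auto intro: le_less_trans)
    then have Vl: "V \<in> lmeasurable" and mV: "measure lebesgue V = measure lborel V"
      by (auto simp: fmeasurable_def)
    have "measure lborel V \<le> e / 2"
    proof -
      have "emeasure lborel V = ennreal (measure lborel V)"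
        by (rule emeasure_eq_ennreal_measure) (use VE in \<open>auto simp: top_unique\<close>)
      then show ?thesis using VE e by simp
    qed
    then have m2: "measure lebesgue V < e" using mV e by simp
    obtain T where T: "S c - V \<subseteq> T" "T \<in> lmeasurable" "measure lebesgue T < e - measure lebesgue V"
      using C(4) m2 unfolding V_def[symmetric] by (subst (asm) negligible_outer) (metis diff_gt_0_iff_gt)
    show "\<exists>T. S c \<subseteq> T \<and> T \<in> lmeasurable \<and> measure lebesgue T < e"
    proof (intro exI conjI)
      show "S c \<subseteq> T \<union> V" using T by auto
      show "T \<union> V \<in> lmeasurable" using T Vl by blast
      have "measure lebesgue (T \<union> V) \<le> measure lebesgue T + measure lebesgue V"
        using T Vl by (intro measure_Un_le) auto
      then show "measure lebesgue (T \<union> V) < e" using T by simp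
    qed
  qed
  have "negligible (\<Union>k::nat. S (1 / real (Suc k)))"
    by (rule negligible_countable_Union) (auto intro: neg)
  then have "(\<Union>k::nat. S (1 / real (Suc k))) \<in> null_sets lebesgue"
    by (simp add: negligible_iff_null_sets)
  then have "AE x in lebesgue. x \<notin> (\<Union>k::nat. S (1 / real (Suc k)))"
    by (rule AE_not_in)
  then have "AE x in lborel. x \<notin> (\<Union>k::nat. S (1 / real (Suc k)))"
    by (simp add: AE_completion_iff)
  then show ?thesis
  proof (rule eventually_mono, intro impI allI)
    fix x c :: real assume x: "x \<notin> (\<Union>k::nat. S (1 / real (Suc k)))" "x \<in> E" and c: "c > 0"
    obtain k where k: "1 / real (Suc k) < c" using reals_Archimedean[OF c] by (auto simp: inverse_eq_divide)
    have "x \<notin> S (1 / real (Suc k))" using x by auto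
    then have "\<exists>r0>0. \<forall>r. 0 < r \<longrightarrow> r < r0 \<longrightarrow> emeasure M (cball x r) \<le> ennreal (1 / real (Suc k) * r)"
      using x(2) unfolding S_def by (simp only: mem_Collect_eq not_less[symmetric]) blast
    then obtain r0 where r0: "r0 > 0" "\<And>r. 0 < r \<Longrightarrow> r < r0 \<Longrightarrow> emeasure M (cball x r) \<le> ennreal (1 / real (Suc k) * r)"
      by blast
    show "\<exists>r0>0. \<forall>r. 0 < r \<longrightarrow> r < r0 \<longrightarrow> emeasure M (cball x r) \<le> ennreal (c * r)"
    proof (intro exI conjI allI impI)
      fix r :: real assume r: "0 < r" "r < r0"
      have "1 / real (Suc k) * r \<le> c * r" using k r by (intro mult_right_mono) auto
      with r0(2)[OF r] show "emeasure M (cball x r) \<le> ennreal (c * r)"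
        by (meson ennreal_leI order_trans)
    qed (rule r0(1))
  qed
qed

text \<open>In the layer-cake formula radii below \<open>r0\<close> see at most mass c * r and
  contribute at most c * pi, uniformly in y. Radii beyond \<open>r0\<close> contribute at most the
  total mass times \<open>poisson_ker y r0\<close>, which tends to 0.\<close>

lemma poisson_tendsto_0_of_density:
  fixes M :: "real measure"
  assumes "finite_measure M" and sets[measurable_cong]: "sets M = sets borel"
    and dens: "\<forall>c>0. \<exists>r0>0. \<forall>r. 0 < r \<longrightarrow> r < r0 \<longrightarrow> emeasure M (cball x r) \<le> ennreal (c * r)"
  shows "((\<lambda>y. \<integral>\<^sup>+u. ennreal (poisson_ker y (x - u)) \<partial>M) \<longlongrightarrow> 0) (at_right 0)"
proof (rule tendsto_ennreal_zeroI)
  fix e :: real assume e: "e > 0"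
  interpret finite_measure M by fact
  interpret pair_sigma_finite M lborel ..
  \<comment> \<open>Small radii contribute 2 c times the half-line mass pi / 2 of the kernel, that
    is e / 2.\<close>
  define c where "c = e / (2 * pi)"
  have c: "c > 0" using e by (simp add: c_def)
  then obtain r0 where r0: "r0 > 0" "\<And>r. 0 < r \<Longrightarrow> r < r0 \<Longrightarrow> emeasure M (cball x r) \<le> ennreal (c * r)"
    using dens by blast
  define m where "m = measure M (space M)"
  have bound: "(\<integral>\<^sup>+u. ennreal (poisson_ker y (x - u)) \<partial>M) \<le> ennreal (e / 2 + m * y / r0\<^sup>2)" if y: "y > 0" for y
  proof -
    define \<kappa> where "\<kappa> r = 2 * r * y / (r\<^sup>2 + y\<^sup>2)\<^sup>2" for r
    have k_meas[measurable]: "\<kappa> \<in> borel_measurable borel" unfolding \<kappa>_def by measurable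
    have k_nn: "0 \<le> \<kappa> r" if "0 \<le> r" for r using that y by (simp add: \<kappa>_def)
    have "(\<integral>\<^sup>+u. ennreal (poisson_ker y (x - u)) \<partial>M)
        = (\<integral>\<^sup>+u. \<integral>\<^sup>+r. ennreal (\<kappa> r) * indicator {\<bar>x - u\<bar>..} r \<partial>lborel \<partial>M)"
      unfolding \<kappa>_def by (intro nn_integral_cong poisson_ker_layer_cake y)
    also have "\<dots> = (\<integral>\<^sup>+r. \<integral>\<^sup>+u. ennreal (\<kappa> r) * indicator {\<bar>x - u\<bar>..} r \<partial>M \<partial>lborel)"
    proof (rule Fubini'[symmetric])
      have "(\<lambda>(u, r). ennreal (\<kappa> r) * indicator {p. \<bar>x - fst p\<bar> \<le> snd p} (u, r)) \<in> borel_measurable (M \<Otimes>\<^sub>M lborel)"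
        by measurable
      then show "(\<lambda>(u, r). ennreal (\<kappa> r) * indicator {\<bar>x - u\<bar>..} r) \<in> borel_measurable (M \<Otimes>\<^sub>M lborel)"
        by (rule measurable_cong[THEN iffD1, rotated]) (auto split: split_indicator)
    qed
    also have "\<dots> = (\<integral>\<^sup>+r. ennreal (\<kappa> r) * emeasure M (cball x r) * indicator {0..} r \<partial>lborel)"
    proof (rule nn_integral_cong)
      fix r :: real
      have "(\<integral>\<^sup>+u. ennreal (\<kappa> r) * indicator {\<bar>x - u\<bar>..} r \<partial>M) = (\<integral>\<^sup>+u. ennreal (\<kappa> r) * indicator (cball x r) u \<partial>M)"
        by (intro nn_integral_cong) (auto simp: dist_real_def split: split_indicator)
      also have "\<dots> = ennreal (\<kappa> r) * emeasure M (cball x r)"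
        by (rule nn_integral_cmult_indicator) (simp add: sets)
      also have "\<dots> = ennreal (\<kappa> r) * emeasure M (cball x r) * indicator {0..} r"
        by (auto split: split_indicator simp: not_le cball_empty)
      finally show "(\<integral>\<^sup>+u. ennreal (\<kappa> r) * indicator {\<bar>x - u\<bar>..} r \<partial>M) = ennreal (\<kappa> r) * emeasure M (cball x r) * indicator {0..} r" .
    qed
    also have "\<dots> \<le> (\<integral>\<^sup>+r. ennreal (2 * c) * (ennreal (poisson_ker y r) * indicator {0..} r) + ennreal m * (ennreal (\<kappa> r) * indicator {\<bar>r0\<bar>..} r) \<partial>lborel)"
    proof (rule nn_integral_mono)
      fix r :: real
      consider "r < 0" | "r = 0" | "0 < r" "r < r0" | "r0 \<le> r" by linarith
      then show "ennreal (\<kappa> r) * emeasure M (cball x r) * indicator {0..} r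
        \<le> ennreal (2 * c) * (ennreal (poisson_ker y r) * indicator {0..} r) + ennreal m * (ennreal (\<kappa> r) * indicator {\<bar>r0\<bar>..} r)"
      proof cases
        case 3
        have "\<kappa> r * r \<le> 2 * poisson_ker y r"
        proof -
          have p: "r\<^sup>2 + y\<^sup>2 > 0" using y by (simp add: add_nonneg_pos)
          have "\<kappa> r * r = 2 * y * r\<^sup>2 / (r\<^sup>2 + y\<^sup>2)\<^sup>2" by (simp add: \<kappa>_def power2_eq_square)
          also have "\<dots> \<le> 2 * y * (r\<^sup>2 + y\<^sup>2) / (r\<^sup>2 + y\<^sup>2)\<^sup>2"
            using y by (intro divide_right_mono mult_left_mono) auto
          also have "\<dots> = 2 * poisson_ker y r" using p by (simp add: poisson_ker_def power2_eq_square)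
          finally show ?thesis .
        qed
        then have "\<kappa> r * (c * r) \<le> 2 * c * poisson_ker y r" using c by (simp add: mult.left_commute mult.assoc)
        then have "ennreal (\<kappa> r) * ennreal (c * r) \<le> ennreal (2 * c) * ennreal (poisson_ker y r)"
          using c k_nn[of r] 3 y by (simp add: ennreal_mult'[symmetric] poisson_ker_nonneg ennreal_leI)
        moreover have "ennreal (\<kappa> r) * emeasure M (cball x r) \<le> ennreal (\<kappa> r) * ennreal (c * r)"
          using r0(2)[OF 3] by (intro mult_left_mono) auto
        ultimately show ?thesis using 3 by (auto intro: order_trans)
      next
        case 4
        have "emeasure M (cball x r) \<le> ennreal m"
          unfolding m_def emeasure_eq_measure[symmetric] by (rule emeasure_space)
        then have "ennreal (\<kappa> r) * emeasure M (cball x r) \<le> ennreal m * ennreal (\<kappa> r)"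
          by (subst mult.commute) (intro mult_right_mono, auto)
        then show ?thesis using 4 r0(1) by (auto intro: order_trans add_increasing)
      qed (auto simp: \<kappa>_def)
    qed
    also have "\<dots> = ennreal (2 * c) * ennreal (pi / 2) + ennreal m * ennreal (poisson_ker y r0)"
      using poisson_ker_layer_cake[OF y, of r0]
      by (subst nn_integral_add) (auto simp: nn_integral_cmult nn_integral_poisson_ker_half[OF y] \<kappa>_def)
    also have "\<dots> = ennreal (e / 2 + m * poisson_ker y r0)"
    proof -
      have "0 \<le> m * poisson_ker y r0" using y by (simp add: m_def poisson_ker_nonneg)
      then show ?thesis
        using c y e by (simp add: ennreal_mult'[symmetric] ennreal_plus[symmetric] c_def m_def del: ennreal_plus)
    qed
    also have "\<dots> \<le> ennreal (e / 2 + m * y / r0\<^sup>2)"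
    proof (intro ennreal_leI add_left_mono)
      have "poisson_ker y r0 \<le> y / r0\<^sup>2" using y r0(1) by (auto simp: poisson_ker_def intro!: divide_left_mono mult_pos_pos add_pos_nonneg)
      then have "m * poisson_ker y r0 \<le> m * (y / r0\<^sup>2)" by (intro mult_left_mono) (auto simp: m_def)
      then show "m * poisson_ker y r0 \<le> m * y / r0\<^sup>2" by simp
    qed
    finally show ?thesis .
  qed
  have "((\<lambda>y. e / 2 + m * y / r0\<^sup>2) \<longlongrightarrow> e / 2 + m * 0 / r0\<^sup>2) (at_right 0)"
    using r0(1) by (intro tendsto_intros) auto
  then have "eventually (\<lambda>y. e / 2 + m * y / r0\<^sup>2 < e) (at_right 0)"
    by (rule order_tendstoD(2)) (use e in simp)
  then show "eventually (\<lambda>y. (\<integral>\<^sup>+u. ennreal (poisson_ker y (x - u)) \<partial>M) \<le> ennreal e) (at_right 0)"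
    using eventually_at_right_less[of 0]
  proof eventually_elim
    case (elim y)
    then show ?case using bound[of y] by (meson ennreal_leI less_imp_le order_trans)
  qed
qed


text \<open>For \<open>\<bar>u\<bar>\<close> >= N >= \<open>\<bar>x\<bar>\<close> + 1 one has
  \<open>\<bar>u\<bar>\<close> <= N * \<open>\<bar>x - u\<bar>\<close>, so the kernel is comparable
  with y / (1 + u^2) and the tail vanishes linearly in y.\<close>

lemma nn_integral_poisson_tail:
  fixes g :: "real \<Rightarrow> real"
  assumes [measurable]: "g \<in> borel_measurable borel" and y: "y > 0" and N: "\<bar>x\<bar> + 1 \<le> N"
  shows "(\<integral>\<^sup>+u. ennreal (poisson_ker y (x - u) * \<bar>g u\<bar>) * indicator {u. N \<le> \<bar>u\<bar>} u \<partial>lborel)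
    \<le> ennreal (y * (1 + N\<^sup>2)) * (\<integral>\<^sup>+u. ennreal (\<bar>g u\<bar> / (1 + u\<^sup>2)) \<partial>lborel)"
proof -
  have "ennreal (poisson_ker y (x - u) * \<bar>g u\<bar>) * indicator {u. N \<le> \<bar>u\<bar>} u
     \<le> ennreal (y * (1 + N\<^sup>2)) * ennreal (\<bar>g u\<bar> / (1 + u\<^sup>2))" for u
  proof (cases "N \<le> \<bar>u\<bar>")
    case True
    have d: "1 \<le> \<bar>x - u\<bar>" using True N by linarith
    have "\<bar>u\<bar> \<le> \<bar>x - u\<bar> + (N - 1)" using N by linarith
    also have "\<dots> \<le> \<bar>x - u\<bar> + (N - 1) * \<bar>x - u\<bar>"
      using d N mult_left_mono[OF d, of "N - 1"] by simp
    finally have "\<bar>u\<bar> \<le> N * \<bar>x - u\<bar>" by (simp add: algebra_simps)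
    then have "\<bar>u\<bar>\<^sup>2 \<le> (N * \<bar>x - u\<bar>)\<^sup>2" by (rule power_mono) simp
    then have "u\<^sup>2 \<le> N\<^sup>2 * (x - u)\<^sup>2" by (simp add: power_mult_distrib)
    moreover have "1 \<le> (x - u)\<^sup>2" using d power_mono[OF d, of 2] by simp
    ultimately have le: "1 + u\<^sup>2 \<le> (1 + N\<^sup>2) * (x - u)\<^sup>2" by (simp add: algebra_simps)
    have "poisson_ker y (x - u) \<le> y / (x - u)\<^sup>2"
      using y \<open>1 \<le> (x - u)\<^sup>2\<close> by (auto simp: poisson_ker_def intro!: divide_left_mono mult_pos_pos add_pos_nonneg)
    also have "\<dots> \<le> y * (1 + N\<^sup>2) / (1 + u\<^sup>2)"
    proof -
      have "(1 + u\<^sup>2) * y \<le> (1 + N\<^sup>2) * (x - u)\<^sup>2 * y" using le y by (intro mult_right_mono) auto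
      moreover have "0 < (x - u)\<^sup>2" "0 < 1 + u\<^sup>2" using \<open>1 \<le> (x - u)\<^sup>2\<close> by (auto intro: add_pos_nonneg)
      ultimately show ?thesis by (simp add: divide_le_eq pos_le_divide_eq mult_ac)
    qed
    finally have "poisson_ker y (x - u) * \<bar>g u\<bar> \<le> y * (1 + N\<^sup>2) / (1 + u\<^sup>2) * \<bar>g u\<bar>"
      by (intro mult_right_mono) auto
    then show ?thesis using True y by (simp add: ennreal_mult'[symmetric] ennreal_leI)
  qed simp
  then have "(\<integral>\<^sup>+u. ennreal (poisson_ker y (x - u) * \<bar>g u\<bar>) * indicator {u. N \<le> \<bar>u\<bar>} u \<partial>lborel)
     \<le> (\<integral>\<^sup>+u. ennreal (y * (1 + N\<^sup>2)) * ennreal (\<bar>g u\<bar> / (1 + u\<^sup>2)) \<partial>lborel)"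
    by (intro nn_integral_mono)
  then show ?thesis by (simp add: nn_integral_cmult)
qed

text \<open>Since \<open>ennreal\<close> clips negative values, the measure with density w gives no
  mass to the set where w <= 0, and \<open>AE_vanishing_density\<close> applies there.\<close>

lemma poisson_tendsto_0_of_vanishing:
  fixes w :: "real \<Rightarrow> real"
  assumes [measurable]: "w \<in> borel_measurable borel" and fin: "(\<integral>\<^sup>+u. ennreal (w u) \<partial>lborel) < \<infinity>"
  shows "AE x in lborel. w x \<le> 0 \<longrightarrow>
    ((\<lambda>y. \<integral>\<^sup>+u. ennreal (poisson_ker y (x - u)) * ennreal (w u) \<partial>lborel) \<longlongrightarrow> 0) (at_right 0)"
proof -
  define M where "M = density lborel (\<lambda>u. ennreal (w u))"
  have sets: "sets M = sets borel" by (simp add: M_def)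
  have fm: "finite_measure M"
    by (rule finite_measureI) (use fin in \<open>simp add: M_def emeasure_density less_top\<close>)
  define E where "E = {x. w x \<le> 0}"
  have E: "E \<in> sets borel" unfolding E_def by measurable
  have null: "emeasure M E = 0"
    unfolding M_def E_def
    by (subst emeasure_density) (auto simp: nn_integral_0_iff_AE ennreal_neg split: split_indicator)
  from AE_vanishing_density[OF fm sets E null] show ?thesis
  proof (rule eventually_mono, intro impI)
    fix x assume "x \<in> E \<longrightarrow> (\<forall>c>0. \<exists>r0>0. \<forall>r. 0 < r \<longrightarrow> r < r0 \<longrightarrow> emeasure M (cball x r) \<le> ennreal (c * r))"
      and "w x \<le> 0"
    then have "\<forall>c>0. \<exists>r0>0. \<forall>r. 0 < r \<longrightarrow> r < r0 \<longrightarrow> emeasure M (cball x r) \<le> ennreal (c * r)"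
      by (simp add: E_def)
    from poisson_tendsto_0_of_density[OF fm sets this]
    have "((\<lambda>y. \<integral>\<^sup>+u. ennreal (poisson_ker y (x - u)) \<partial>M) \<longlongrightarrow> 0) (at_right 0)" .
    moreover have "(\<integral>\<^sup>+u. ennreal (poisson_ker y (x - u)) \<partial>M)
       = (\<integral>\<^sup>+u. ennreal (poisson_ker y (x - u)) * ennreal (w u) \<partial>lborel)" for y
      unfolding M_def by (subst nn_integral_density) (auto simp: mult.commute)
    ultimately show "((\<lambda>y. \<integral>\<^sup>+u. ennreal (poisson_ker y (x - u)) * ennreal (w u) \<partial>lborel) \<longlongrightarrow> 0) (at_right 0)"
      by simp
  qed
qed

text \<open>For each rational q the positive and negative parts of h - q vanish where h <= q or h >=
  q respectively, and their Poisson averages vanish in the limit at almost all such points.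
  Discarding countably many null sets handles all rationals at once; at x one picks rationals just
  above and just below h x. Cutting off at N makes the parts integrable, the rest is a Poisson
  tail.\<close>

theorem AE_poisson_lebesgue_point:
  fixes h :: "real \<Rightarrow> real"
  assumes [measurable]: "h \<in> borel_measurable borel"
    and fin: "(\<integral>\<^sup>+u. ennreal (\<bar>h u\<bar> / (1 + u\<^sup>2)) \<partial>lborel) < \<infinity>"
  shows "AE x in lborel. ((\<lambda>y. \<integral>\<^sup>+u. ennreal (poisson_ker y (x - u) * \<bar>h u - h x\<bar>) \<partial>lborel) \<longlongrightarrow> 0) (at_right 0)"
proof -
  define w where "w s N q u = indicator {- real N<..<real N} u * max 0 (s * (h u - q))" for s :: real and N :: nat and q u :: real
  have w_meas[measurable]: "w s N q \<in> borel_measurable borel" for s N q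
    unfolding w_def by measurable
  have finN: "(\<integral>\<^sup>+u. ennreal (w s N q u) \<partial>lborel) < \<infinity>" if s: "\<bar>s\<bar> = 1" for s N q
  proof -
    have "(\<integral>\<^sup>+u. ennreal (w s N q u) \<partial>lborel)
       \<le> (\<integral>\<^sup>+u. ennreal (1 + (real N)\<^sup>2) * ennreal (\<bar>h u\<bar> / (1 + u\<^sup>2)) + ennreal \<bar>q\<bar> * indicator {- real N<..<real N} u \<partial>lborel)"
    proof (rule nn_integral_mono)
      fix u :: real
      show "ennreal (w s N q u) \<le> ennreal (1 + (real N)\<^sup>2) * ennreal (\<bar>h u\<bar> / (1 + u\<^sup>2)) + ennreal \<bar>q\<bar> * indicator {- real N<..<real N} u"
      proof (cases "u \<in> {- real N<..<real N}")
        case True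
        then have "\<bar>u\<bar>\<^sup>2 \<le> (real N)\<^sup>2" by (intro power_mono) auto
        then have "1 * \<bar>h u\<bar> \<le> (1 + (real N)\<^sup>2) / (1 + u\<^sup>2) * \<bar>h u\<bar>"
          by (intro mult_right_mono) (auto simp: pos_le_divide_eq add_pos_nonneg)
        then have a: "\<bar>h u\<bar> \<le> (1 + (real N)\<^sup>2) * (\<bar>h u\<bar> / (1 + u\<^sup>2))" by simp
        have "\<bar>s * (h u - q)\<bar> \<le> \<bar>h u\<bar> + \<bar>q\<bar>" using s by (simp add: abs_mult)
        then have "w s N q u \<le> (1 + (real N)\<^sup>2) * (\<bar>h u\<bar> / (1 + u\<^sup>2)) + \<bar>q\<bar>"
          using a True by (auto simp: w_def)
        then have "ennreal (w s N q u) \<le> ennreal ((1 + (real N)\<^sup>2) * (\<bar>h u\<bar> / (1 + u\<^sup>2)) + \<bar>q\<bar>)" by (rule ennreal_leI)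
        also have "\<dots> = ennreal (1 + (real N)\<^sup>2) * ennreal (\<bar>h u\<bar> / (1 + u\<^sup>2)) + ennreal \<bar>q\<bar>"
          by (subst ennreal_plus) (auto simp: ennreal_mult'[symmetric] simp del: ennreal_plus intro!: divide_nonneg_nonneg)
        finally show ?thesis using True by simp
      qed (simp add: w_def)
    qed
    also have "\<dots> = ennreal (1 + (real N)\<^sup>2) * (\<integral>\<^sup>+u. ennreal (\<bar>h u\<bar> / (1 + u\<^sup>2)) \<partial>lborel) + ennreal \<bar>q\<bar> * ennreal (2 * real N)"
      by (subst nn_integral_add) (auto simp: nn_integral_cmult nn_integral_cmult_indicator)
    also have "\<dots> < \<infinity>" using fin by (simp add: ennreal_mult_less_top less_top[symmetric] ennreal_mult_eq_top_iff)
    finally show ?thesis .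
  qed
  have single: "AE x in lborel. w s N q x \<le> 0 \<longrightarrow>
    ((\<lambda>y. \<integral>\<^sup>+u. ennreal (poisson_ker y (x - u)) * ennreal (w s N q u) \<partial>lborel) \<longlongrightarrow> 0) (at_right 0)"
    if "\<bar>s\<bar> = 1" for s N q
    by (rule poisson_tendsto_0_of_vanishing[OF w_meas finN[OF that]])
  have "AE x in lborel. \<forall>q\<in>\<rat>. \<forall>N. \<forall>s\<in>{1, -1}. w s N q x \<le> 0 \<longrightarrow>
    ((\<lambda>y. \<integral>\<^sup>+u. ennreal (poisson_ker y (x - u)) * ennreal (w s N q u) \<partial>lborel) \<longlongrightarrow> 0) (at_right 0)"
  proof (rule AE_ball_countable'[OF _ countable_rat])
    fix q :: real
    show "AE x in lborel. \<forall>N. \<forall>s\<in>{1, -1}. w s N q x \<le> 0 \<longrightarrow>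
    ((\<lambda>y. \<integral>\<^sup>+u. ennreal (poisson_ker y (x - u)) * ennreal (w s N q u) \<partial>lborel) \<longlongrightarrow> 0) (at_right 0)"
      unfolding AE_all_countable
    proof
      fix N
      show "AE x in lborel. \<forall>s\<in>{1, -1}. w s N q x \<le> 0 \<longrightarrow>
    ((\<lambda>y. \<integral>\<^sup>+u. ennreal (poisson_ker y (x - u)) * ennreal (w s N q u) \<partial>lborel) \<longlongrightarrow> 0) (at_right 0)"
      proof (rule AE_ball_countable')
        fix s :: real assume "s \<in> {1, -1}"
        then have "\<bar>s\<bar> = 1" by auto
        then show "AE x in lborel. w s N q x \<le> 0 \<longrightarrow>
    ((\<lambda>y. \<integral>\<^sup>+u. ennreal (poisson_ker y (x - u)) * ennreal (w s N q u) \<partial>lborel) \<longlongrightarrow> 0) (at_right 0)"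
          by (rule single)
      qed simp
    qed
  qed
  then show ?thesis
  proof (rule eventually_mono)
    fix x :: real
    assume good: "\<forall>q\<in>\<rat>. \<forall>N. \<forall>s\<in>{1, -1}. w s N q x \<le> 0 \<longrightarrow>
      ((\<lambda>y. \<integral>\<^sup>+u. ennreal (poisson_ker y (x - u)) * ennreal (w s N q u) \<partial>lborel) \<longlongrightarrow> 0) (at_right 0)"
    obtain N :: nat where N: "\<bar>x\<bar> + 1 \<le> real N" using real_arch_simple by blast
    define C where "C = (\<integral>\<^sup>+u. ennreal (\<bar>h u - h x\<bar> / (1 + u\<^sup>2)) \<partial>lborel)"
    have Cfin: "C < \<infinity>"
    proof -
      have "C \<le> (\<integral>\<^sup>+u. ennreal (\<bar>h u\<bar> / (1 + u\<^sup>2)) + ennreal \<bar>h x\<bar> * ennreal (poisson_ker 1 u) \<partial>lborel)"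
        unfolding C_def
      proof (rule nn_integral_mono)
        fix u
        have "\<bar>h u - h x\<bar> / (1 + u\<^sup>2) \<le> (\<bar>h u\<bar> + \<bar>h x\<bar>) / (1 + u\<^sup>2)"
          by (intro divide_right_mono) auto
        also have "\<dots> = \<bar>h u\<bar> / (1 + u\<^sup>2) + \<bar>h x\<bar> * poisson_ker 1 u"
          by (simp add: poisson_ker_def add_divide_distrib add.commute)
        finally show "ennreal (\<bar>h u - h x\<bar> / (1 + u\<^sup>2)) \<le> ennreal (\<bar>h u\<bar> / (1 + u\<^sup>2)) + ennreal \<bar>h x\<bar> * ennreal (poisson_ker 1 u)"
          by (simp add: ennreal_mult'[symmetric] ennreal_plus[symmetric] poisson_ker_nonneg ennreal_leI del: ennreal_plus)
      qed
      also have "\<dots> = (\<integral>\<^sup>+u. ennreal (\<bar>h u\<bar> / (1 + u\<^sup>2)) \<partial>lborel) + ennreal \<bar>h x\<bar> * ennreal pi"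
        by (subst nn_integral_add) (auto simp: nn_integral_cmult nn_integral_poisson_ker)
      also have "\<dots> < \<infinity>" using fin by (simp add: ennreal_mult_less_top)
      finally show ?thesis .
    qed
    then obtain c where c: "C = ennreal c" "0 \<le> c" by (cases C) auto
    show "((\<lambda>y. \<integral>\<^sup>+u. ennreal (poisson_ker y (x - u) * \<bar>h u - h x\<bar>) \<partial>lborel) \<longlongrightarrow> 0) (at_right 0)"
    proof (rule tendsto_ennreal_zeroI)
      fix e :: real assume e: "e > 0"
      \<comment> \<open>The oscillation allowance 2 d has Poisson mass 2 d * pi = e / 4, one of four
        contributions of size e / 4.\<close>
      define d where "d = e / (8 * pi)"
      have d: "d > 0" using e by (simp add: d_def)
      obtain q1 where q1: "q1 \<in> \<rat>" "h x < q1" "q1 < h x + d" using Rats_dense_in_real[of "h x" "h x + d"] d by auto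
      obtain q2 where q2: "q2 \<in> \<rat>" "h x - d < q2" "q2 < h x" using Rats_dense_in_real[of "h x - d" "h x"] d by auto
      let ?P = "\<lambda>s q y. \<integral>\<^sup>+u. ennreal (poisson_ker y (x - u)) * ennreal (w s N q u) \<partial>lborel"
      have "((?P 1 q1) \<longlongrightarrow> 0) (at_right 0)" using good q1 by (auto simp: w_def)
      then have e1: "eventually (\<lambda>y. ?P 1 q1 y < ennreal (e / 4)) (at_right 0)"
        by (rule order_tendstoD(2)) (use e in simp)
      have "((?P (-1) q2) \<longlongrightarrow> 0) (at_right 0)" using good q2 by (auto simp: w_def)
      then have e2: "eventually (\<lambda>y. ?P (-1) q2 y < ennreal (e / 4)) (at_right 0)"
        by (rule order_tendstoD(2)) (use e in simp)
      have "((\<lambda>y. y * (1 + (real N)\<^sup>2) * c) \<longlongrightarrow> 0 * (1 + (real N)\<^sup>2) * c) (at_right 0)"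
        by (intro tendsto_intros)
      then have e3: "eventually (\<lambda>y. y * (1 + (real N)\<^sup>2) * c < e / 4) (at_right 0)"
        by (rule order_tendstoD(2)) (use e in simp)
      from e1 e2 e3 eventually_at_right_less[of 0]
      show "eventually (\<lambda>y. (\<integral>\<^sup>+u. ennreal (poisson_ker y (x - u) * \<bar>h u - h x\<bar>) \<partial>lborel) \<le> ennreal e) (at_right 0)"
      proof eventually_elim
        case (elim y)
        let ?R = "\<lambda>u. poisson_ker y (x - u)"
        have R: "0 \<le> ?R u" for u using elim by (simp add: poisson_ker_nonneg)
        have "(\<integral>\<^sup>+u. ennreal (?R u * \<bar>h u - h x\<bar>) \<partial>lborel)
          \<le> (\<integral>\<^sup>+u. (ennreal (?R u) * ennreal (w 1 N q1 u) + ennreal (?R u) * ennreal (w (-1) N q2 u))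
              + (ennreal (2 * d) * ennreal (?R u) + ennreal (?R u * \<bar>h u - h x\<bar>) * indicator {u. real N \<le> \<bar>u\<bar>} u) \<partial>lborel)"
        proof (rule nn_integral_mono)
          fix u
          show "ennreal (?R u * \<bar>h u - h x\<bar>) \<le> (ennreal (?R u) * ennreal (w 1 N q1 u) + ennreal (?R u) * ennreal (w (-1) N q2 u))
              + (ennreal (2 * d) * ennreal (?R u) + ennreal (?R u * \<bar>h u - h x\<bar>) * indicator {u. real N \<le> \<bar>u\<bar>} u)"
          proof (cases "real N \<le> \<bar>u\<bar>")
            case True
            then show ?thesis by (auto intro!: add_increasing)
          next
            case False
            \<comment> \<open>Above h x the excess over q1 is measured by the first part, below h x
              the deficit under q2 by the second; both rationals lie within d of h x.\<close>
            then have "\<bar>h u - h x\<bar> \<le> w 1 N q1 u + w (-1) N q2 u + 2 * d"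
            proof -
              have "u \<in> {- real N<..<real N}" using False by auto
              then show ?thesis using q1 q2 by (simp add: w_def)
            qed
            then have "?R u * \<bar>h u - h x\<bar> \<le> ?R u * (w 1 N q1 u + w (-1) N q2 u + 2 * d)"
              using R by (intro mult_left_mono)
            then have "ennreal (?R u * \<bar>h u - h x\<bar>) \<le> ennreal ((?R u * w 1 N q1 u + ?R u * w (-1) N q2 u) + 2 * d * ?R u)"
              by (intro ennreal_leI) (simp add: algebra_simps)
            also have "\<dots> = (ennreal (?R u) * ennreal (w 1 N q1 u) + ennreal (?R u) * ennreal (w (-1) N q2 u)) + ennreal (2 * d) * ennreal (?R u)"
            proof -
              have "0 \<le> ?R u * w 1 N q1 u" "0 \<le> ?R u * w (-1) N q2 u" "0 \<le> 2 * d * ?R u"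
                using R[of u] d by (auto simp: w_def)
              then show ?thesis using R[of u] d by (simp add: ennreal_mult' w_def)
            qed
            finally show ?thesis using False by simp
          qed
        qed
        also have "\<dots> = (?P 1 q1 y + ?P (-1) q2 y) + (ennreal (2 * d) * ennreal pi
            + (\<integral>\<^sup>+u. ennreal (?R u * \<bar>h u - h x\<bar>) * indicator {u. real N \<le> \<bar>u\<bar>} u \<partial>lborel))"
          using elim by (simp add: nn_integral_add nn_integral_cmult nn_integral_poisson_ker_shift)
        also have "\<dots> \<le> (ennreal (e / 4) + ennreal (e / 4)) + (ennreal (2 * d) * ennreal pi + ennreal (y * (1 + (real N)\<^sup>2)) * C)"
          using elim nn_integral_poisson_tail[of "\<lambda>u. h u - h x" y x "real N"] N
          unfolding C_def by (intro add_mono) auto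
        also have "\<dots> = ennreal (e / 4 + e / 4 + (2 * d * pi + y * (1 + (real N)\<^sup>2) * c))"
          using e d elim c by (simp add: ennreal_mult'[symmetric] ennreal_plus[symmetric] del: ennreal_plus)
        also have "\<dots> \<le> ennreal e"
          using elim by (intro ennreal_leI) (simp add: d_def)
        finally show ?case .
      qed
    qed
  qed
qed

section \<open>Cauchy transforms of integrable and square integrable functions\<close>

definition cauchy_ker :: "complex \<Rightarrow> real \<Rightarrow> complex" where
  "cauchy_ker z u = 1 / (complex_of_real u - z)"

text \<open>The integral of f(t) / (s + i b - t), that is the Cauchy transform at height b over s.
  Writing it with a pole at t - i b makes it a superposition of simple poles in s, so products in s
  reduce to integrals of two kernels.\<close>

definition cauchy_transform :: "(real \<Rightarrow> real) \<Rightarrow> real \<Rightarrow> real \<Rightarrow> complex" where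
  "cauchy_transform f b s = (LINT t|lborel. complex_of_real (f t) * cauchy_ker (Complex t (- b)) s)"

lemma measurable_cauchy_ker [measurable]: "cauchy_ker z \<in> borel_measurable borel"
  unfolding cauchy_ker_def by measurable

lemma measurable_cauchy_ker_pair [measurable]:
  "(\<lambda>(t, s). cauchy_ker (Complex t c) s) \<in> borel_measurable (borel \<Otimes>\<^sub>M borel)"
  unfolding cauchy_ker_def Complex_eq by measurable

lemma norm_cauchy_ker_square:
  assumes "Im z \<noteq> 0"
  shows "(norm (cauchy_ker z u))\<^sup>2 = poisson_ker \<bar>Im z\<bar> (Re z - u) / \<bar>Im z\<bar>"
proof -
  have "(norm (complex_of_real u - z))\<^sup>2 = (u - Re z)\<^sup>2 + (Im z)\<^sup>2"
    by (simp add: cmod_power2)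
  then show ?thesis
    using assms by (simp add: cauchy_ker_def norm_divide power_divide poisson_ker_def power2_commute)
qed

lemma nn_integral_norm_cauchy_ker_square:
  assumes "Im z \<noteq> 0"
  shows "(\<integral>\<^sup>+u. ennreal ((norm (cauchy_ker z u))\<^sup>2) \<partial>lborel) = ennreal (pi / \<bar>Im z\<bar>)"
proof -
  have "(\<integral>\<^sup>+u. ennreal ((norm (cauchy_ker z u))\<^sup>2) \<partial>lborel)
      = (\<integral>\<^sup>+u. ennreal (poisson_ker \<bar>Im z\<bar> (Re z - u)) * ennreal (1 / \<bar>Im z\<bar>) \<partial>lborel)"
    by (intro nn_integral_cong) (simp add: norm_cauchy_ker_square[OF assms] ennreal_mult'[symmetric] poisson_ker_nonneg)
  also have "\<dots> = ennreal pi * ennreal (1 / \<bar>Im z\<bar>)"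
    using assms by (simp add: nn_integral_multc nn_integral_poisson_ker_shift)
  also have "\<dots> = ennreal (pi / \<bar>Im z\<bar>)" by (simp add: ennreal_mult'[symmetric])
  finally show ?thesis .
qed

lemma norm_cauchy_ker_le:
  assumes "Im z \<noteq> 0"
  shows "norm (cauchy_ker z u) \<le> 1 / \<bar>Im z\<bar>"
proof -
  have "\<bar>Im z\<bar> \<le> norm (complex_of_real u - z)"
    using abs_Im_le_cmod[of "complex_of_real u - z"] by simp
  then show ?thesis using assms by (auto simp: cauchy_ker_def norm_divide intro!: divide_left_mono mult_pos_pos)
qed

lemma nn_integral_norm_mult_le:
  fixes f g :: "'a \<Rightarrow> 'b :: {real_normed_algebra, second_countable_topology}"
  assumes [measurable]: "f \<in> borel_measurable M" "g \<in> borel_measurable M"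
  shows "(\<integral>\<^sup>+x. ennreal (norm (f x * g x)) \<partial>M)
     \<le> (\<integral>\<^sup>+x. ennreal ((norm (f x))\<^sup>2) \<partial>M) + (\<integral>\<^sup>+x. ennreal ((norm (g x))\<^sup>2) \<partial>M)"
proof -
  have "norm (f x * g x) \<le> (norm (f x))\<^sup>2 + (norm (g x))\<^sup>2" for x
  proof -
    have "0 \<le> (norm (f x) - norm (g x))\<^sup>2" by simp
    then have "2 * (norm (f x) * norm (g x)) \<le> (norm (f x))\<^sup>2 + (norm (g x))\<^sup>2"
      by (simp add: power2_diff)
    moreover have "norm (f x * g x) \<le> norm (f x) * norm (g x)" by (rule norm_mult_ineq)
    moreover have "0 \<le> norm (f x) * norm (g x)" by simp
    ultimately show ?thesis by linarith
  qed
  then have "(\<integral>\<^sup>+x. ennreal (norm (f x * g x)) \<partial>M) \<le> (\<integral>\<^sup>+x. ennreal ((norm (f x))\<^sup>2) + ennreal ((norm (g x))\<^sup>2) \<partial>M)"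
    by (intro nn_integral_mono) (simp add: ennreal_plus[symmetric] ennreal_leI del: ennreal_plus)
  then show ?thesis by (simp add: nn_integral_add)
qed

lemma integrable_cauchy_ker_mult:
  assumes "Im z \<noteq> 0" "Im w \<noteq> 0"
  shows "integrable lborel (\<lambda>u. cauchy_ker z u * cauchy_ker w u)"
proof (rule integrableI_bounded)
  have "(\<integral>\<^sup>+u. ennreal (norm (cauchy_ker z u * cauchy_ker w u)) \<partial>lborel) \<le> ennreal (pi / \<bar>Im z\<bar>) + ennreal (pi / \<bar>Im w\<bar>)"
    using nn_integral_norm_mult_le[of "cauchy_ker z" lborel "cauchy_ker w"] assms
    by (simp add: nn_integral_norm_cauchy_ker_square)
  also have "\<dots> < \<infinity>" by simp
  finally show "(\<integral>\<^sup>+u. ennreal (norm (cauchy_ker z u * cauchy_ker w u)) \<partial>lborel) < \<infinity>" .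
qed measurable

lemma arctan_scaled_at_top: "b \<noteq> 0 \<Longrightarrow> ((\<lambda>u. arctan ((u - c) / b)) \<longlongrightarrow> sgn b * (pi / 2)) at_top"
  by (cases "b > 0") (simp_all add: not_less order_le_less, real_asymp, real_asymp)

lemma arctan_scaled_at_bot: "b \<noteq> 0 \<Longrightarrow> ((\<lambda>u. arctan ((u - c) / b)) \<longlongrightarrow> - sgn b * (pi / 2)) at_bot"
  by (cases "b > 0") (simp_all add: not_less order_le_less, real_asymp, real_asymp)

text \<open>Partial fractions with the explicit primitive \<open>A z\<close>, a branch of log (u -
  z) up to a constant. At both ends the real logarithms cancel and the arctangents leave the signs
  of the imaginary parts; for poles in the same half-plane the value is 0.\<close>

lemma integral_cauchy_ker_mult:
  assumes "Im z \<noteq> 0" "Im w \<noteq> 0" "z \<noteq> w"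
  shows "(LINT u|lborel. cauchy_ker z u * cauchy_ker w u) = \<i> * of_real (pi * (sgn (Im z) - sgn (Im w))) / (z - w)"
proof -
  define A where "A z u = complex_of_real (ln ((u - Re z)\<^sup>2 + (Im z)\<^sup>2) / 2) + \<i> * complex_of_real (arctan ((u - Re z) / Im z))" for z u
  have der: "(A z has_vector_derivative cauchy_ker z u) (at u)" if "Im z \<noteq> 0" for z u
  proof -
    have p: "(u - Re z)\<^sup>2 + (Im z)\<^sup>2 > 0" using that by (simp add: add_nonneg_pos)
    have "((\<lambda>u. ln ((u - Re z)\<^sup>2 + (Im z)\<^sup>2) / 2) has_real_derivative (u - Re z) / ((u - Re z)\<^sup>2 + (Im z)\<^sup>2)) (at u)"
    proof -
      have half: "2 * a / P / 2 = a / P" for a P :: real by simp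
      have "((\<lambda>u. ln ((u - Re z)\<^sup>2 + (Im z)\<^sup>2)) has_real_derivative 2 * (u - Re z) / ((u - Re z)\<^sup>2 + (Im z)\<^sup>2)) (at u)"
        using p by (auto intro!: derivative_eq_intros)
      from DERIV_cdivide[OF this, of 2] show ?thesis
        by (rule DERIV_cong) (rule half)
    qed
    moreover have "((\<lambda>u. arctan ((u - Re z) / Im z)) has_real_derivative Im z / ((u - Re z)\<^sup>2 + (Im z)\<^sup>2)) (at u)"
    proof -
      have "((\<lambda>u. arctan ((u - Re z) / Im z)) has_real_derivative inverse (1 + ((u - Re z) / Im z)\<^sup>2) * (1 / Im z)) (at u)"
        using that by (auto intro!: derivative_eq_intros)
      moreover have "inverse (1 + ((u - Re z) / Im z)\<^sup>2) * (1 / Im z) = Im z / ((u - Re z)\<^sup>2 + (Im z)\<^sup>2)"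
      proof -
        have "1 + ((u - Re z) / Im z)\<^sup>2 = ((u - Re z)\<^sup>2 + (Im z)\<^sup>2) / (Im z)\<^sup>2"
          using that by (simp add: power_divide field_simps)
        then show ?thesis using that by (simp add: power2_eq_square)
      qed
      ultimately show ?thesis by simp
    qed
    ultimately have "(A z has_vector_derivative (complex_of_real ((u - Re z) / ((u - Re z)\<^sup>2 + (Im z)\<^sup>2))
        + \<i> * complex_of_real (Im z / ((u - Re z)\<^sup>2 + (Im z)\<^sup>2)))) (at u)"
      unfolding A_def by (auto simp: has_vector_derivative_complex_iff)
    moreover have "complex_of_real ((u - Re z) / ((u - Re z)\<^sup>2 + (Im z)\<^sup>2))
        + \<i> * complex_of_real (Im z / ((u - Re z)\<^sup>2 + (Im z)\<^sup>2)) = cauchy_ker z u"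
    proof -
      have "x * P / P\<^sup>2 = x / P" if "P > 0" for x P :: real using that by (simp add: power2_eq_square)
      from this[OF p] show ?thesis by (simp add: cauchy_ker_def complex_eq_iff Re_divide Im_divide)
    qed
    ultimately show ?thesis by simp
  qed
  define B where "B = \<i> * complex_of_real (pi / 2 * (sgn (Im z) - sgn (Im w))) / (z - w)"
  have top: "((\<lambda>u. (A z u - A w u) / (z - w)) \<longlongrightarrow> B) at_top"
  proof -
    have "((\<lambda>u. ln ((u - Re z)\<^sup>2 + (Im z)\<^sup>2) / 2 - ln ((u - Re w)\<^sup>2 + (Im w)\<^sup>2) / 2) \<longlongrightarrow> 0) at_top"
      by real_asymp
    then have "((\<lambda>u. complex_of_real (ln ((u - Re z)\<^sup>2 + (Im z)\<^sup>2) / 2 - ln ((u - Re w)\<^sup>2 + (Im w)\<^sup>2) / 2)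
        + \<i> * complex_of_real (arctan ((u - Re z) / Im z) - arctan ((u - Re w) / Im w))) \<longlongrightarrow>
        complex_of_real 0 + \<i> * complex_of_real (sgn (Im z) * (pi / 2) - sgn (Im w) * (pi / 2))) at_top"
      using assms by (intro tendsto_add tendsto_mult tendsto_const tendsto_of_real tendsto_diff arctan_scaled_at_top)
    then have "((\<lambda>u. A z u - A w u) \<longlongrightarrow> \<i> * complex_of_real (pi / 2 * (sgn (Im z) - sgn (Im w)))) at_top"
      unfolding A_def by (simp add: algebra_simps)
    then show ?thesis unfolding B_def using assms by (intro tendsto_divide tendsto_const) auto
  qed
  have bot: "((\<lambda>u. (A z u - A w u) / (z - w)) \<longlongrightarrow> - B) at_bot"
  proof -
    have "((\<lambda>u. ln ((u - Re z)\<^sup>2 + (Im z)\<^sup>2) / 2 - ln ((u - Re w)\<^sup>2 + (Im w)\<^sup>2) / 2) \<longlongrightarrow> 0) at_bot"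
      by real_asymp
    then have "((\<lambda>u. complex_of_real (ln ((u - Re z)\<^sup>2 + (Im z)\<^sup>2) / 2 - ln ((u - Re w)\<^sup>2 + (Im w)\<^sup>2) / 2)
        + \<i> * complex_of_real (arctan ((u - Re z) / Im z) - arctan ((u - Re w) / Im w))) \<longlongrightarrow>
        complex_of_real 0 + \<i> * complex_of_real (- sgn (Im z) * (pi / 2) - - sgn (Im w) * (pi / 2))) at_bot"
      using assms by (intro tendsto_add tendsto_mult tendsto_const tendsto_of_real tendsto_diff arctan_scaled_at_bot)
    then have "((\<lambda>u. A z u - A w u) \<longlongrightarrow> - (\<i> * complex_of_real (pi / 2 * (sgn (Im z) - sgn (Im w))))) at_bot"
      unfolding A_def by (simp add: algebra_simps)
    then have "((\<lambda>u. (A z u - A w u) / (z - w)) \<longlongrightarrow> - (\<i> * complex_of_real (pi / 2 * (sgn (Im z) - sgn (Im w)))) / (z - w)) at_bot"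
      using assms by (intro tendsto_divide tendsto_const) auto
    then show ?thesis unfolding B_def by simp
  qed
  have "(LBINT u=-\<infinity>..\<infinity>. cauchy_ker z u * cauchy_ker w u) = B - (- B)"
  proof (rule interval_integral_FTC_integrable)
    show "((\<lambda>u. (A z u - A w u) / (z - w)) has_vector_derivative cauchy_ker z u * cauchy_ker w u) (at u)" for u
    proof -
      have nz: "complex_of_real u - z \<noteq> 0" "complex_of_real u - w \<noteq> 0"
        using assms by (auto simp: complex_eq_iff)
      have "((\<lambda>u. (A z u - A w u) / (z - w)) has_vector_derivative (cauchy_ker z u - cauchy_ker w u) / (z - w)) (at u)"
        using assms by (intro has_vector_derivative_divide has_vector_derivative_diff der)
      moreover have "(cauchy_ker z u - cauchy_ker w u) / (z - w) = cauchy_ker z u * cauchy_ker w u"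
        using nz assms(3) by (simp add: cauchy_ker_def divide_simps)
      ultimately show ?thesis by simp
    qed
    show "isCont (\<lambda>u. cauchy_ker z u * cauchy_ker w u) u" for u
      unfolding cauchy_ker_def using assms by (intro continuous_intros) (auto simp: complex_eq_iff)
    show "set_integrable lborel (einterval (-\<infinity>) \<infinity>) (\<lambda>u. cauchy_ker z u * cauchy_ker w u)"
      using integrable_cauchy_ker_mult[OF assms(1,2)] by (simp add: set_integrable_def)
  qed (use top bot in \<open>simp_all add: ereal_tendsto_simps\<close>)
  then have "(LINT u|lborel. cauchy_ker z u * cauchy_ker w u) = B + B"
    by (simp add: interval_lebesgue_integral_def set_lebesgue_integral_def)
  also have "\<dots> = \<i> * of_real (pi * (sgn (Im z) - sgn (Im w))) / (z - w)"
  proof -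
    have "\<i> * complex_of_real (pi / 2 * x) + \<i> * complex_of_real (pi / 2 * x) = \<i> * of_real (pi * x)" for x
      by (simp add: complex_eq_iff)
    then show ?thesis unfolding B_def by (simp only: add_divide_distrib[symmetric])
  qed
  finally show ?thesis .
qed

lemma integrable_mult_cauchy_ker:
  assumes f: "integrable lborel f" and b: "b \<noteq> 0"
  shows "integrable lborel (\<lambda>t. complex_of_real (f t) * cauchy_ker (Complex t (- b)) s)"
proof (rule Bochner_Integration.integrable_bound[of _ "\<lambda>t. \<bar>f t\<bar> * (1 / \<bar>b\<bar>)"])
  have [measurable]: "f \<in> borel_measurable borel" using f by auto
  show "(\<lambda>t. complex_of_real (f t) * cauchy_ker (Complex t (- b)) s) \<in> borel_measurable lborel"
    unfolding cauchy_ker_def Complex_eq by measurable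
  have "norm (cauchy_ker (Complex t (- b)) s) \<le> 1 / \<bar>b\<bar>" for t
    using norm_cauchy_ker_le[of "Complex t (- b)" s] b by simp
  then show "AE t in lborel. norm (complex_of_real (f t) * cauchy_ker (Complex t (- b)) s) \<le> norm (\<bar>f t\<bar> * (1 / \<bar>b\<bar>))"
    by (auto simp: norm_mult intro!: mult_left_mono simp del: times_divide_eq_right)
qed (use f in auto)

text \<open>Cauchy-Schwarz with respect to the measure \<open>\<bar>f t\<bar>\<close> dt moves the
  square onto the kernel, whose square integral in s is pi / \<open>\<bar>b\<bar>\<close> for every
  t.\<close>

lemma cauchy_transform_square:
  assumes f: "integrable lborel f" and b: "b \<noteq> 0"
  shows "(\<integral>\<^sup>+s. ennreal ((norm (cauchy_transform f b s))\<^sup>2) \<partial>lborel) \<le> ennreal ((LINT t|lborel. \<bar>f t\<bar>)\<^sup>2 * pi / \<bar>b\<bar>)"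
proof -
  have f_meas[measurable]: "f \<in> borel_measurable borel" using f by auto
  define F where "F = (LINT t|lborel. \<bar>f t\<bar>)"
  have F: "0 \<le> F" by (simp add: F_def)
  have nnF: "(\<integral>\<^sup>+t. ennreal \<bar>f t\<bar> \<partial>lborel) = ennreal F"
    unfolding F_def using f by (simp add: nn_integral_eq_integral)
  define M where "M = density lborel (\<lambda>t. ennreal \<bar>f t\<bar>)"
  have le: "ennreal ((norm (cauchy_transform f b s))\<^sup>2)
      \<le> ennreal F * (\<integral>\<^sup>+t. ennreal \<bar>f t\<bar> * ennreal ((norm (cauchy_ker (Complex t (- b)) s))\<^sup>2) \<partial>lborel)" for s
  proof -
    have m[measurable]: "(\<lambda>t. cauchy_ker (Complex t (- b)) s) \<in> borel_measurable borel"
      unfolding cauchy_ker_def Complex_eq by measurable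
    have "ennreal (norm (cauchy_transform f b s)) \<le> (\<integral>\<^sup>+t. ennreal (norm (complex_of_real (f t) * cauchy_ker (Complex t (- b)) s)) \<partial>lborel)"
      unfolding cauchy_transform_def by (rule integral_norm_bound_ennreal) (rule integrable_mult_cauchy_ker[OF f b])
    also have "\<dots> = (\<integral>\<^sup>+t. ennreal (norm (cauchy_ker (Complex t (- b)) s)) * 1 \<partial>M)"
      unfolding M_def by (subst nn_integral_density) (auto simp: norm_mult ennreal_mult' intro!: nn_integral_cong)
    finally have "(ennreal (norm (cauchy_transform f b s)))\<^sup>2 \<le> (\<integral>\<^sup>+t. ennreal (norm (cauchy_ker (Complex t (- b)) s)) * 1 \<partial>M)\<^sup>2"
      by (rule power_mono) simp
    also have "\<dots> \<le> (\<integral>\<^sup>+t. (ennreal (norm (cauchy_ker (Complex t (- b)) s)))\<^sup>2 \<partial>M) * (\<integral>\<^sup>+t. 1\<^sup>2 \<partial>M)"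
      by (rule Cauchy_Schwarz_nn_integral) (auto simp: M_def)
    also have "(\<integral>\<^sup>+t. 1\<^sup>2 \<partial>M) = ennreal F"
      unfolding M_def by (simp add: emeasure_density nnF)
    also have "(\<integral>\<^sup>+t. (ennreal (norm (cauchy_ker (Complex t (- b)) s)))\<^sup>2 \<partial>M)
        = (\<integral>\<^sup>+t. ennreal \<bar>f t\<bar> * ennreal ((norm (cauchy_ker (Complex t (- b)) s))\<^sup>2) \<partial>lborel)"
      unfolding M_def by (subst nn_integral_density) (auto simp: ennreal_power)
    finally show ?thesis by (simp add: ennreal_power mult.commute)
  qed
  have "(\<integral>\<^sup>+s. ennreal ((norm (cauchy_transform f b s))\<^sup>2) \<partial>lborel)
      \<le> (\<integral>\<^sup>+s. ennreal F * (\<integral>\<^sup>+t. ennreal \<bar>f t\<bar> * ennreal ((norm (cauchy_ker (Complex t (- b)) s))\<^sup>2) \<partial>lborel) \<partial>lborel)"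
    by (intro nn_integral_mono le)
  also have "\<dots> = ennreal F * (\<integral>\<^sup>+s. \<integral>\<^sup>+t. ennreal \<bar>f t\<bar> * ennreal ((norm (cauchy_ker (Complex t (- b)) s))\<^sup>2) \<partial>lborel \<partial>lborel)"
    by (rule nn_integral_cmult) measurable
  also have "(\<integral>\<^sup>+s. \<integral>\<^sup>+t. ennreal \<bar>f t\<bar> * ennreal ((norm (cauchy_ker (Complex t (- b)) s))\<^sup>2) \<partial>lborel \<partial>lborel)
      = (\<integral>\<^sup>+t. \<integral>\<^sup>+s. ennreal \<bar>f t\<bar> * ennreal ((norm (cauchy_ker (Complex t (- b)) s))\<^sup>2) \<partial>lborel \<partial>lborel)"
    by (rule lborel_pair.Fubini') measurable
  also have "\<dots> = (\<integral>\<^sup>+t. ennreal \<bar>f t\<bar> * ennreal (pi / \<bar>b\<bar>) \<partial>lborel)"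
    using b by (intro nn_integral_cong) (simp add: nn_integral_cmult nn_integral_norm_cauchy_ker_square)
  also have "\<dots> = ennreal F * ennreal (pi / \<bar>b\<bar>)"
    by (simp add: nn_integral_multc nnF)
  finally show ?thesis
    using F unfolding F_def[symmetric] by (simp add: ennreal_mult'[symmetric] power2_eq_square mult.assoc)
qed

lemma measurable_cauchy_transform [measurable]:
  assumes [measurable]: "f \<in> borel_measurable borel"
  shows "cauchy_transform f b \<in> borel_measurable borel"
proof -
  have "(\<lambda>s. LINT t|lborel. complex_of_real (f t) * cauchy_ker (Complex t (- b)) s) \<in> borel_measurable lborel"
    unfolding cauchy_ker_def Complex_eq by measurable
  then show ?thesis by (simp add: cauchy_transform_def[abs_def])
qed

lemma integrable_pair_ker_mult:
  fixes f :: "real \<Rightarrow> real" and g :: "real \<Rightarrow> complex"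
  assumes f: "integrable lborel f" and b: "b \<noteq> 0" and [measurable]: "g \<in> borel_measurable borel"
    and g: "(\<integral>\<^sup>+s. ennreal ((norm (g s))\<^sup>2) \<partial>lborel) < \<infinity>"
  shows "integrable (lborel \<Otimes>\<^sub>M lborel) (\<lambda>(t, s). complex_of_real (f t) * (cauchy_ker (Complex t (- b)) s * g s))"
proof (rule integrableI_bounded)
  have f_meas[measurable]: "f \<in> borel_measurable borel" using f by auto
  show "(\<lambda>(t, s). complex_of_real (f t) * (cauchy_ker (Complex t (- b)) s * g s)) \<in> borel_measurable (lborel \<Otimes>\<^sub>M lborel)"
    by measurable
  have "(\<integral>\<^sup>+p. ennreal (norm (case p of (t, s) \<Rightarrow> complex_of_real (f t) * (cauchy_ker (Complex t (- b)) s * g s))) \<partial>(lborel \<Otimes>\<^sub>M lborel))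
     = (\<integral>\<^sup>+t. \<integral>\<^sup>+s. ennreal (norm (complex_of_real (f t) * (cauchy_ker (Complex t (- b)) s * g s))) \<partial>lborel \<partial>lborel)"
    by (subst lborel.nn_integral_fst[symmetric]) auto
  also have "\<dots> \<le> (\<integral>\<^sup>+t. ennreal \<bar>f t\<bar> * (ennreal (pi / \<bar>b\<bar>) + (\<integral>\<^sup>+s. ennreal ((norm (g s))\<^sup>2) \<partial>lborel)) \<partial>lborel)"
  proof (rule nn_integral_mono)
    fix t
    have "(\<integral>\<^sup>+s. ennreal (norm (complex_of_real (f t) * (cauchy_ker (Complex t (- b)) s * g s))) \<partial>lborel)
      = ennreal \<bar>f t\<bar> * (\<integral>\<^sup>+s. ennreal (norm (cauchy_ker (Complex t (- b)) s * g s)) \<partial>lborel)"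
      by (subst nn_integral_cmult[symmetric]) (auto simp: norm_mult ennreal_mult' intro!: nn_integral_cong)
    also have "\<dots> \<le> ennreal \<bar>f t\<bar> * (ennreal (pi / \<bar>b\<bar>) + (\<integral>\<^sup>+s. ennreal ((norm (g s))\<^sup>2) \<partial>lborel))"
      using nn_integral_norm_mult_le[of "cauchy_ker (Complex t (- b))" lborel g] b
      by (intro mult_left_mono) (auto simp: nn_integral_norm_cauchy_ker_square)
    finally show "(\<integral>\<^sup>+s. ennreal (norm (complex_of_real (f t) * (cauchy_ker (Complex t (- b)) s * g s))) \<partial>lborel)
      \<le> ennreal \<bar>f t\<bar> * (ennreal (pi / \<bar>b\<bar>) + (\<integral>\<^sup>+s. ennreal ((norm (g s))\<^sup>2) \<partial>lborel))" .
  qed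
  also have "\<dots> = (\<integral>\<^sup>+t. ennreal \<bar>f t\<bar> \<partial>lborel) * (ennreal (pi / \<bar>b\<bar>) + (\<integral>\<^sup>+s. ennreal ((norm (g s))\<^sup>2) \<partial>lborel))"
    by (rule nn_integral_multc) measurable
  also have "\<dots> < \<infinity>"
    using f g by (simp add: nn_integral_eq_integral ennreal_mult_less_top)
  finally show "(\<integral>\<^sup>+p. ennreal (norm (case p of (t, s) \<Rightarrow> complex_of_real (f t) * (cauchy_ker (Complex t (- b)) s * g s))) \<partial>(lborel \<Otimes>\<^sub>M lborel)) < \<infinity>" .
qed

lemma integral_cauchy_transform_mult:
  fixes f :: "real \<Rightarrow> real" and g :: "real \<Rightarrow> complex"
  assumes f: "integrable lborel f" and b: "b \<noteq> 0" and g_meas: "g \<in> borel_measurable borel"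
    and g: "(\<integral>\<^sup>+s. ennreal ((norm (g s))\<^sup>2) \<partial>lborel) < \<infinity>"
  shows "(LINT s|lborel. cauchy_transform f b s * g s)
    = (LINT t|lborel. complex_of_real (f t) * (LINT s|lborel. cauchy_ker (Complex t (- b)) s * g s))"
proof -
  have "(LINT s|lborel. cauchy_transform f b s * g s)
      = (LINT s|lborel. LINT t|lborel. complex_of_real (f t) * (cauchy_ker (Complex t (- b)) s * g s))"
    unfolding cauchy_transform_def by (simp add: mult.assoc flip: integral_mult_left_zero)
  also have "\<dots> = (LINT t|lborel. LINT s|lborel. complex_of_real (f t) * (cauchy_ker (Complex t (- b)) s * g s))"
    by (rule lborel_pair.Fubini_integral) (rule integrable_pair_ker_mult[OF f b g_meas g])
  finally show ?thesis by simp
qed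

text \<open>Under the integral over t this is \<open>integral_cauchy_ker_mult\<close>. Integration
  against a pole at height Im z lifts the transform from b to b + Im z when the signs agree; for
  opposite signs both poles lie in one half-plane and both sides vanish.\<close>

lemma integral_cauchy_ker_mult_transform:
  fixes f :: "real \<Rightarrow> real"
  assumes f: "integrable lborel f" and b: "b \<noteq> 0" and z: "Im z \<noteq> 0"
  shows "(LINT s|lborel. cauchy_ker z s * cauchy_transform f b s)
     = \<i> * of_real (pi * (sgn (Im z) + sgn b)) * cauchy_transform f (b + Im z) (Re z)"
proof -
  have "(LINT s|lborel. cauchy_ker z s * cauchy_transform f b s)
    = (LINT t|lborel. complex_of_real (f t) * (LINT s|lborel. cauchy_ker (Complex t (- b)) s * cauchy_ker z s))"
    using integral_cauchy_transform_mult[OF f b measurable_cauchy_ker, of z] z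
    by (simp add: nn_integral_norm_cauchy_ker_square mult.commute)
  also have "\<dots> = (LINT t|lborel. \<i> * of_real (pi * (sgn (Im z) + sgn b)) * (complex_of_real (f t) * cauchy_ker (Complex t (- (b + Im z))) (Re z)))"
  proof (rule integral_cong_AE)
    show "AE t in lborel. complex_of_real (f t) * (LINT s|lborel. cauchy_ker (Complex t (- b)) s * cauchy_ker z s)
      = \<i> * of_real (pi * (sgn (Im z) + sgn b)) * (complex_of_real (f t) * cauchy_ker (Complex t (- (b + Im z))) (Re z))"
      \<comment> \<open>For b = - Im z the two poles coincide exactly at t = Re z.\<close>
      using AE_lborel_singleton[of "Re z"]
    proof (rule eventually_mono)
      fix t assume t: "t \<noteq> Re z"
      have "(LINT s|lborel. cauchy_ker (Complex t (- b)) s * cauchy_ker z s) = \<i> * of_real (pi * (- sgn b - sgn (Im z))) / (Complex t (- b) - z)"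
        using integral_cauchy_ker_mult[of "Complex t (- b)" z] b z t by (auto simp: complex_eq_iff sgn_minus)
      also have "\<dots> = \<i> * of_real (pi * (sgn (Im z) + sgn b)) / - (Complex t (- b) - z)"
      proof -
        have "\<i> * complex_of_real (pi * (- sgn b - sgn (Im z))) = - (\<i> * of_real (pi * (sgn (Im z) + sgn b)))"
          by (simp add: algebra_simps)
        then show ?thesis by (simp only: minus_divide_left[symmetric] minus_divide_right[symmetric])
      qed
      also have "- (Complex t (- b) - z) = complex_of_real (Re z) - Complex t (- (b + Im z))"
        by (simp add: complex_eq_iff)
      finally show "complex_of_real (f t) * (LINT s|lborel. cauchy_ker (Complex t (- b)) s * cauchy_ker z s)
      = \<i> * of_real (pi * (sgn (Im z) + sgn b)) * (complex_of_real (f t) * cauchy_ker (Complex t (- (b + Im z))) (Re z))"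
        by (simp add: cauchy_ker_def)
    qed
    have f_meas[measurable]: "f \<in> borel_measurable borel" using f by auto
    show "(\<lambda>t. complex_of_real (f t) * (LINT s|lborel. cauchy_ker (Complex t (- b)) s * cauchy_ker z s)) \<in> borel_measurable lborel"
      by measurable
    show "(\<lambda>t. \<i> * of_real (pi * (sgn (Im z) + sgn b)) * (complex_of_real (f t) * cauchy_ker (Complex t (- (b + Im z))) (Re z))) \<in> borel_measurable lborel"
      unfolding cauchy_ker_def Complex_eq by measurable
  qed
  finally show ?thesis by (simp add: cauchy_transform_def)
qed

lemma cnj_cauchy_transform: "cnj (cauchy_transform f b s) = cauchy_transform f (- b) s"
proof -
  have "cnj (cauchy_ker (Complex t c) s) = cauchy_ker (Complex t (- c)) s" for t c
    by (simp add: cauchy_ker_def complex_eq_iff Re_divide Im_divide)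
  then show ?thesis unfolding cauchy_transform_def by (subst integral_bounded_linear'[OF bounded_linear_cnj bounded_linear_cnj, symmetric]) simp_all
qed

text \<open>Conjugation turns height b into -b. Expanding the first factor as an integral of kernels
  and applying the lifting formula leaves a single transform at height -(a + b), so the inner
  product depends on a + b alone.\<close>

lemma cauchy_transform_inner:
  assumes f: "integrable lborel f" and "a > 0" "b > 0"
  shows "(LINT s|lborel. cauchy_transform f a s * cnj (cauchy_transform f b s))
    = - 2 * \<i> * pi * (LINT t|lborel. complex_of_real (f t) * cauchy_transform f (- (a + b)) t)"
proof -
  have f_meas[measurable]: "f \<in> borel_measurable borel" using f by auto
  have "(LINT s|lborel. cauchy_transform f a s * cauchy_transform f (- b) s)
    = (LINT t|lborel. complex_of_real (f t) * (LINT s|lborel. cauchy_ker (Complex t (- a)) s * cauchy_transform f (- b) s))"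
  proof (rule integral_cauchy_transform_mult[OF f])
    show "(\<integral>\<^sup>+s. ennreal ((norm (cauchy_transform f (- b) s))\<^sup>2) \<partial>lborel) < \<infinity>"
      using cauchy_transform_square[OF f, of "- b"] assms by (auto intro: le_less_trans)
  qed (use assms in auto)
  also have "\<dots> = (LINT t|lborel. (- 2 * \<i> * pi) * (complex_of_real (f t) * cauchy_transform f (- (a + b)) t))"
    using assms by (intro Bochner_Integration.integral_cong)
      (simp_all add: integral_cauchy_ker_mult_transform[OF f] sgn_minus add.commute)
  finally show ?thesis by (simp add: cnj_cauchy_transform)
qed

section \<open>Boundary values in L^2\<close>

text \<open>Midpoint convexity makes the increments along an arithmetic progression nondecreasing,
  so one positive increment would force linear growth and contradict the upper bound.\<close>

lemma antimono_of_midconvex_bounded: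
  fixes k :: "real \<Rightarrow> real"
  assumes mid: "\<And>x y. 0 < x \<Longrightarrow> 0 < y \<Longrightarrow> 2 * k ((x + y) / 2) \<le> k x + k y"
    and bdd: "\<And>x. 0 < x \<Longrightarrow> k x \<le> B" and "0 < x" "x \<le> y"
  shows "k y \<le> k x"
proof (rule ccontr)
  assume "\<not> k y \<le> k x"
  then have kk: "k x < k y" by simp
  define d where "d = y - x"
  have d: "d \<ge> 0" using assms by (simp add: d_def)
  define a where "a n = k (x + real n * d)" for n
  have pos: "0 < x + real n * d" for n using d assms(3) by (simp add: add_pos_nonneg)
  have inc: "a 1 - a 0 \<le> a (Suc n) - a n" for n
  proof (induction n)
    case (Suc n)
    have "(x + real n * d + (x + real (Suc (Suc n)) * d)) / 2 = x + real (Suc n) * d"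
      by (simp add: field_simps)
    with mid[OF pos[of n] pos[of "Suc (Suc n)"]] have "2 * a (Suc n) \<le> a n + a (Suc (Suc n))"
      unfolding a_def by (simp only:)
    then show ?case using Suc by linarith
  qed simp
  have lin: "a 0 + real n * (a 1 - a 0) \<le> a n" for n
  proof (induction n)
    case (Suc n)
    have "a 0 + real (Suc n) * (a 1 - a 0) = (a 0 + real n * (a 1 - a 0)) + (a 1 - a 0)" by (simp add: algebra_simps)
    also have "\<dots> \<le> a n + (a (Suc n) - a n)" using Suc inc[of n] by (rule add_mono)
    finally show ?case by simp
  qed simp
  have "a 1 - a 0 > 0" using kk by (simp add: a_def d_def)
  then obtain n where "B - a 0 < real n * (a 1 - a 0)" using reals_Archimedean3 by blast
  with lin[of n] bdd[OF pos[of n]] show False by (simp add: a_def)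
qed

text \<open>With D the m-th increment, D <= 2^(-m) + 2^m * D^2, and the rate 4^(-m) makes the sum of
  the integrals of 2^m * D^2 finite; hence the sequence converges almost everywhere. Fatou transfers
  the rate to the limit.\<close>

lemma L2_Cauchy_limit:
  fixes u :: "nat \<Rightarrow> 'a \<Rightarrow> real"
  assumes [measurable]: "\<And>n. u n \<in> borel_measurable M"
    and cau: "\<And>m n. m \<le> n \<Longrightarrow> (\<integral>\<^sup>+x. ennreal ((u m x - u n x)\<^sup>2) \<partial>M) \<le> ennreal (c * (1 / 4) ^ m)"
    and c: "0 \<le> c"
  obtains g where "g \<in> borel_measurable M" "\<And>m. (\<integral>\<^sup>+x. ennreal ((u m x - g x)\<^sup>2) \<partial>M) \<le> ennreal (c * (1 / 4) ^ m)"
proof -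
  have "(\<integral>\<^sup>+x. (\<Sum>m. ennreal (2 ^ m * (u m x - u (Suc m) x)\<^sup>2)) \<partial>M)
      = (\<Sum>m. \<integral>\<^sup>+x. ennreal (2 ^ m * (u m x - u (Suc m) x)\<^sup>2) \<partial>M)"
    by (rule nn_integral_suminf) measurable
  also have "\<dots> \<le> (\<Sum>m. ennreal (c * (1 / 2) ^ m))"
  proof (rule suminf_le)
    fix m
    have "(\<integral>\<^sup>+x. ennreal (2 ^ m * (u m x - u (Suc m) x)\<^sup>2) \<partial>M) = ennreal (2 ^ m) * (\<integral>\<^sup>+x. ennreal ((u m x - u (Suc m) x)\<^sup>2) \<partial>M)"
      by (subst nn_integral_cmult[symmetric]) (auto simp: ennreal_mult')
    also have "\<dots> \<le> ennreal (2 ^ m) * ennreal (c * (1 / 4) ^ m)"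
      by (intro mult_left_mono cau) auto
    also have "\<dots> = ennreal (c * (1 / 2) ^ m)"
    proof -
      have "(2::real) ^ m * (1 / 4) ^ m = (1 / 2) ^ m" by (simp flip: power_mult_distrib)
      then show ?thesis by (simp add: ennreal_mult'[symmetric] mult.left_commute)
    qed
    finally show "(\<integral>\<^sup>+x. ennreal (2 ^ m * (u m x - u (Suc m) x)\<^sup>2) \<partial>M) \<le> ennreal (c * (1 / 2) ^ m)" .
  qed auto
  also have "\<dots> = ennreal (\<Sum>m. c * (1 / 2) ^ m)"
    using c by (intro suminf_ennreal2) (auto intro!: summable_mult summable_geometric)
  also have "\<dots> < \<infinity>" by simp
  finally have fin: "(\<integral>\<^sup>+x. (\<Sum>m. ennreal (2 ^ m * (u m x - u (Suc m) x)\<^sup>2)) \<partial>M) \<noteq> \<infinity>" by simp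
  have AE1: "AE x in M. (\<Sum>m. ennreal (2 ^ m * (u m x - u (Suc m) x)\<^sup>2)) \<noteq> \<infinity>"
    by (rule nn_integral_PInf_AE[OF _ fin]) measurable
  have AEc: "AE x in M. convergent (\<lambda>n. u n x)"
    using AE1
  proof (rule eventually_mono)
    fix x assume "(\<Sum>m. ennreal (2 ^ m * (u m x - u (Suc m) x)\<^sup>2)) \<noteq> \<infinity>"
    then have s: "summable (\<lambda>m. 2 ^ m * (u m x - u (Suc m) x)\<^sup>2)"
      by (intro summable_suminf_not_top) auto
    have "summable (\<lambda>m. (1 / 2) ^ m + 2 ^ m * (u m x - u (Suc m) x)\<^sup>2)"
      by (intro summable_add s summable_geometric) simp
    then have "summable (\<lambda>m. u (Suc m) x - u m x)"
    proof (rule summable_comparison_test', simp)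
      fix m :: nat
      define D where "D = \<bar>u (Suc m) x - u m x\<bar>"
      define p where "p = (2::real) ^ m"
      have p: "p > 0" by (simp add: p_def)
      have "0 \<le> (1 - p * D)\<^sup>2 / p" using p by simp
      also have "\<dots> = 1 / p - 2 * D + p * D\<^sup>2" using p by (simp add: field_simps power2_eq_square)
      finally have "2 * D \<le> 1 / p + p * D\<^sup>2" by simp
      moreover have "0 \<le> D" by (simp add: D_def)
      moreover have "D\<^sup>2 = (u m x - u (Suc m) x)\<^sup>2" by (simp add: D_def power2_commute)
      ultimately have "D \<le> 1 / p + p * (u m x - u (Suc m) x)\<^sup>2" by simp
      then show "\<bar>u (Suc m) x - u m x\<bar> \<le> (1 / 2) ^ m + 2 ^ m * (u m x - u (Suc m) x)\<^sup>2"
        by (simp add: D_def p_def power_divide)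
    qed
    then have "convergent (\<lambda>n. \<Sum>m<n. u (Suc m) x - u m x)" by (simp add: summable_iff_convergent)
    then have "convergent (\<lambda>n. u n x - u 0 x)" by (simp only: sum_lessThan_telescope[of "\<lambda>n. u n x"])
    then have "convergent (\<lambda>n. (u n x - u 0 x) + u 0 x)" by (intro convergent_add convergent_const)
    then show "convergent (\<lambda>n. u n x)" by simp
  qed
  define g where "g x = lim (\<lambda>n. u n x)" for x
  have g_meas[measurable]: "g \<in> borel_measurable M" unfolding g_def[abs_def] by measurable
  have "(\<integral>\<^sup>+x. ennreal ((u m x - g x)\<^sup>2) \<partial>M) \<le> ennreal (c * (1 / 4) ^ m)" for m
  proof -
    have "(\<integral>\<^sup>+x. ennreal ((u m x - g x)\<^sup>2) \<partial>M) = (\<integral>\<^sup>+x. liminf (\<lambda>n. ennreal ((u m x - u n x)\<^sup>2)) \<partial>M)"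
    proof (rule nn_integral_cong_AE, use AEc in \<open>rule eventually_mono\<close>)
      fix x assume "convergent (\<lambda>n. u n x)"
      then have "(\<lambda>n. u n x) \<longlonglongrightarrow> g x" by (simp add: g_def convergent_LIMSEQ_iff)
      then have "(\<lambda>n. ennreal ((u m x - u n x)\<^sup>2)) \<longlonglongrightarrow> ennreal ((u m x - g x)\<^sup>2)"
        by (intro tendsto_ennrealI tendsto_power tendsto_diff tendsto_const)
      then show "ennreal ((u m x - g x)\<^sup>2) = liminf (\<lambda>n. ennreal ((u m x - u n x)\<^sup>2))"
        by (rule lim_imp_Liminf[OF sequentially_bot, symmetric])
    qed
    also have "\<dots> \<le> liminf (\<lambda>n. \<integral>\<^sup>+x. ennreal ((u m x - u n x)\<^sup>2) \<partial>M)"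
      by (rule nn_integral_liminf) measurable
    also have "\<dots> \<le> ennreal (c * (1 / 4) ^ m)"
      by (rule Liminf_le) (auto intro!: eventually_sequentiallyI[of m] cau)
    finally show ?thesis .
  qed
  with g_meas show thesis by (rule that)
qed

locale L1_L2_function =
  fixes f :: "real \<Rightarrow> real"
  assumes L1: "integrable lborel f" and L2: "integrable lborel (\<lambda>t. (f t)\<^sup>2)"
begin

lemma f_measurable [measurable]: "f \<in> borel_measurable borel"
  using L1 by auto

definition F :: "real \<Rightarrow> real \<Rightarrow> complex" where "F = cauchy_transform f"

text \<open>By \<open>Im_F\<close> this is the double integral of f(s) f(t) against the Poisson
  kernel of height y at s - t. Up to the factor 2 pi it is the real part of the inner product of two
  transforms whose heights add up to y.\<close>

definition K :: "real \<Rightarrow> real" where "K y = - (LINT t|lborel. f t * Im (F y t))"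

lemma F_measurable [measurable]: "F b \<in> borel_measurable borel"
  unfolding F_def by measurable

lemma norm_F_le: "b \<noteq> 0 \<Longrightarrow> norm (F b s) \<le> (LINT t|lborel. \<bar>f t\<bar>) / \<bar>b\<bar>"
proof -
  assume b: "b \<noteq> 0"
  have "norm (F b s) \<le> (LINT t|lborel. norm (complex_of_real (f t) * cauchy_ker (Complex t (- b)) s))"
    unfolding F_def cauchy_transform_def by (rule integral_norm_bound)
  also have "\<dots> \<le> (LINT t|lborel. \<bar>f t\<bar> * (1 / \<bar>b\<bar>))"
  proof (rule integral_mono)
    show "integrable lborel (\<lambda>t. norm (complex_of_real (f t) * cauchy_ker (Complex t (- b)) s))"
      by (rule integrable_norm[OF integrable_mult_cauchy_ker[OF L1 b]])
    show "integrable lborel (\<lambda>t. \<bar>f t\<bar> * (1 / \<bar>b\<bar>))" using L1 by auto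
    fix t
    show "norm (complex_of_real (f t) * cauchy_ker (Complex t (- b)) s) \<le> \<bar>f t\<bar> * (1 / \<bar>b\<bar>)"
      unfolding norm_mult norm_of_real
      by (intro mult_left_mono) (use norm_cauchy_ker_le[of "Complex t (- b)" s] b in auto)
  qed
  finally show ?thesis by simp
qed

lemma F_square_finite: "b \<noteq> 0 \<Longrightarrow> (\<integral>\<^sup>+s. ennreal ((norm (F b s))\<^sup>2) \<partial>lborel) < \<infinity>"
  using cauchy_transform_square[OF L1, of b] unfolding F_def by (auto intro: le_less_trans)

lemma cnj_F: "cnj (F b s) = F (- b) s"
  by (simp add: F_def cnj_cauchy_transform)

lemma F_inner_integrable: "a \<noteq> 0 \<Longrightarrow> b \<noteq> 0 \<Longrightarrow> integrable lborel (\<lambda>s. F a s * cnj (F b s))"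
proof (rule integrableI_bounded)
  assume "a \<noteq> 0" "b \<noteq> 0"
  then show "(\<integral>\<^sup>+s. ennreal (norm (F a s * cnj (F b s))) \<partial>lborel) < \<infinity>"
    using le_less_trans[OF nn_integral_norm_mult_le[of "F a" lborel "F (- b)"]] F_square_finite[of a] F_square_finite[of "- b"]
    by (auto simp: cnj_F)
qed (simp add: cnj_F)

lemma integrable_f_mult_F: "b \<noteq> 0 \<Longrightarrow> integrable lborel (\<lambda>t. complex_of_real (f t) * F b t)"
proof (rule Bochner_Integration.integrable_bound[of _ "\<lambda>t. \<bar>f t\<bar> * ((LINT t|lborel. \<bar>f t\<bar>) / \<bar>b\<bar>)"])
  assume b: "b \<noteq> 0"
  show "AE t in lborel. norm (complex_of_real (f t) * F b t) \<le> norm (\<bar>f t\<bar> * ((LINT t|lborel. \<bar>f t\<bar>) / \<bar>b\<bar>))"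
  proof (rule AE_I2)
    fix t
    have "\<bar>f t\<bar> * norm (F b t) \<le> \<bar>f t\<bar> * ((LINT t|lborel. \<bar>f t\<bar>) / \<bar>b\<bar>)"
      by (intro mult_left_mono norm_F_le b) auto
    then show "norm (complex_of_real (f t) * F b t) \<le> norm (\<bar>f t\<bar> * ((LINT t|lborel. \<bar>f t\<bar>) / \<bar>b\<bar>))"
      unfolding norm_mult norm_of_real by simp
  qed
qed (use L1 in auto)

lemma Re_F_inner:
  assumes "a > 0" "b > 0"
  shows "(LINT s|lborel. Re (F a s * cnj (F b s))) = 2 * pi * K (a + b)"
proof -
  have "Re (LINT s|lborel. F a s * cnj (F b s)) = Re (- 2 * \<i> * pi * (LINT t|lborel. complex_of_real (f t) * F (- (a + b)) t))"
    using cauchy_transform_inner[OF L1 assms] by (simp add: F_def)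
  also have "\<dots> = 2 * pi * Im (LINT t|lborel. complex_of_real (f t) * F (- (a + b)) t)" by simp
  also have "Im (LINT t|lborel. complex_of_real (f t) * F (- (a + b)) t) = (LINT t|lborel. Im (complex_of_real (f t) * F (- (a + b)) t))"
    using integrable_f_mult_F[of "- (a + b)"] assms by (intro integral_Im[symmetric]) auto
  also have "\<dots> = K (a + b)"
    unfolding K_def by (subst integral_minus[symmetric]) (simp add: cnj_F[symmetric] del: minus_add_distrib)
  finally show ?thesis using integral_Re[OF F_inner_integrable[of a b]] assms by simp
qed

text \<open>Expansion of the square by \<open>Re_F_inner\<close>. The second claim, with the heights
  halved, is midpoint convexity of \<open>K\<close>.\<close>

lemma F_dist:
  assumes "a > 0" "b > 0"
  shows "(\<integral>\<^sup>+s. ennreal ((norm (F a s - F b s))\<^sup>2) \<partial>lborel) = ennreal (2 * pi * (K (2 * a) + K (2 * b) - 2 * K (a + b)))"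
    and "0 \<le> K (2 * a) + K (2 * b) - 2 * K (a + b)"
proof -
  define G where "G x y s = Re (F x s * cnj (F y s))" for x y s
  have int: "integrable lborel (G x y)" if "x > 0" "y > 0" for x y
    unfolding G_def by (rule integrable_Re[OF F_inner_integrable]) (use that in auto)
  have val: "(LINT s|lborel. G x y s) = 2 * pi * K (x + y)" if "x > 0" "y > 0" for x y
    unfolding G_def by (rule Re_F_inner[OF that])
  have e: "(norm (F a s - F b s))\<^sup>2 = G a a s - G a b s - G b a s + G b b s" for s
    unfolding cmod_power2 G_def by (simp add: power2_eq_square algebra_simps)
  have i: "integrable lborel (\<lambda>s. (norm (F a s - F b s))\<^sup>2)"
    unfolding e by (intro Bochner_Integration.integrable_add Bochner_Integration.integrable_diff int assms)
  have v: "(LINT s|lborel. (norm (F a s - F b s))\<^sup>2) = 2 * pi * (K (2 * a) + K (2 * b) - 2 * K (a + b))"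
    unfolding e using assms
    by (simp add: int val) (simp add: algebra_simps mult_2[symmetric])
  show "(\<integral>\<^sup>+s. ennreal ((norm (F a s - F b s))\<^sup>2) \<partial>lborel) = ennreal (2 * pi * (K (2 * a) + K (2 * b) - 2 * K (a + b)))"
    using nn_integral_eq_integral[OF i] v by simp
  have "0 \<le> (LINT s|lborel. (norm (F a s - F b s))\<^sup>2)" by simp
  then show "0 \<le> K (2 * a) + K (2 * b) - 2 * K (a + b)" unfolding v using pi_gt_zero by (auto simp: zero_le_mult_iff)
qed

lemma Im_cauchy_ker: "Im (cauchy_ker (Complex t (- y)) s) = - poisson_ker y (s - t)"
  by (simp add: cauchy_ker_def Im_divide poisson_ker_def)

lemma Re_cauchy_ker: "Re (cauchy_ker (Complex t (- y)) s) = (s - t) / ((s - t)\<^sup>2 + y\<^sup>2)"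
  by (simp add: cauchy_ker_def Re_divide)

lemma Im_F: "y > 0 \<Longrightarrow> Im (F y s) = - (LINT t|lborel. f t * poisson_ker y (s - t))"
proof -
  assume "y > 0"
  then have "Im (F y s) = (LINT t|lborel. Im (complex_of_real (f t) * cauchy_ker (Complex t (- y)) s))"
    unfolding F_def cauchy_transform_def by (intro integral_Im[symmetric] integrable_mult_cauchy_ker L1) simp
  then show ?thesis by (simp add: Im_cauchy_ker)
qed

lemma Re_F: "y > 0 \<Longrightarrow> Re (F y s) = (LINT t|lborel. f t * ((s - t) / ((s - t)\<^sup>2 + y\<^sup>2)))"
proof -
  assume "y > 0"
  then have "Re (F y s) = (LINT t|lborel. Re (complex_of_real (f t) * cauchy_ker (Complex t (- y)) s))"
    unfolding F_def cauchy_transform_def by (intro integral_Re[symmetric] integrable_mult_cauchy_ker L1) simp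
  then show ?thesis by (simp add: Re_cauchy_ker)
qed

text \<open>Square integrability of f enters here: the product
  \<open>\<bar>f s\<bar> * \<bar>f t\<bar>\<close> is at most the sum of the squares, and
  integrating the kernel in the free variable gives pi for each, independently of y.\<close>

lemma K_bounded:
  assumes y: "y > 0"
  shows "K y \<le> 2 * pi * (LINT t|lborel. (f t)\<^sup>2)"
proof -
  define I where "I = (LINT t|lborel. (f t)\<^sup>2)"
  have I: "0 \<le> I" by (simp add: I_def)
  have nnI: "(\<integral>\<^sup>+t. ennreal ((f t)\<^sup>2) \<partial>lborel) = ennreal I"
    unfolding I_def using L2 by (simp add: nn_integral_eq_integral)
  have "ennreal (K y) \<le> ennreal \<bar>LINT t|lborel. f t * Im (F y t)\<bar>"
    unfolding K_def by (intro ennreal_leI) simp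
  also have "\<dots> \<le> (\<integral>\<^sup>+t. ennreal \<bar>f t * Im (F y t)\<bar> \<partial>lborel)"
  proof -
    have "integrable lborel (\<lambda>t. Im (complex_of_real (f t) * F y t))"
      using integrable_f_mult_F[of y] y by (intro integrable_Im) auto
    then show ?thesis using integral_norm_bound_ennreal[of lborel "\<lambda>t. f t * Im (F y t)"] by simp
  qed
  also have "\<dots> \<le> (\<integral>\<^sup>+s. \<integral>\<^sup>+t. ennreal (\<bar>f s\<bar> * \<bar>f t\<bar> * poisson_ker y (s - t)) \<partial>lborel \<partial>lborel)"
  proof (rule nn_integral_mono)
    fix s
    have int: "integrable lborel (\<lambda>t. f t * poisson_ker y (s - t))"
    proof -
      have "integrable lborel (\<lambda>t. Im (complex_of_real (f t) * cauchy_ker (Complex t (- y)) s))"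
        using integrable_mult_cauchy_ker[OF L1, of y s] y by (intro integrable_Im) auto
      then show ?thesis by (simp add: Im_cauchy_ker)
    qed
    have "ennreal \<bar>f s * Im (F y s)\<bar> = ennreal \<bar>f s\<bar> * ennreal \<bar>LINT t|lborel. f t * poisson_ker y (s - t)\<bar>"
      by (simp add: Im_F[OF y] abs_mult ennreal_mult')
    also have "\<dots> \<le> ennreal \<bar>f s\<bar> * (\<integral>\<^sup>+t. ennreal \<bar>f t * poisson_ker y (s - t)\<bar> \<partial>lborel)"
      using integral_norm_bound_ennreal[OF int] by (intro mult_left_mono) auto
    also have "\<dots> = (\<integral>\<^sup>+t. ennreal (\<bar>f s\<bar> * \<bar>f t\<bar> * poisson_ker y (s - t)) \<partial>lborel)"
      using y by (subst nn_integral_cmult[symmetric]) (auto simp: abs_mult poisson_ker_nonneg ennreal_mult'[symmetric] mult.assoc)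
    finally show "ennreal \<bar>f s * Im (F y s)\<bar> \<le> (\<integral>\<^sup>+t. ennreal (\<bar>f s\<bar> * \<bar>f t\<bar> * poisson_ker y (s - t)) \<partial>lborel)" .
  qed
  also have "\<dots> \<le> (\<integral>\<^sup>+s. \<integral>\<^sup>+t. ennreal ((f s)\<^sup>2) * ennreal (poisson_ker y (s - t)) + ennreal ((f t)\<^sup>2) * ennreal (poisson_ker y (s - t)) \<partial>lborel \<partial>lborel)"
  proof (intro nn_integral_mono)
    fix s t
    have "0 \<le> (\<bar>f s\<bar> - \<bar>f t\<bar>)\<^sup>2" by simp
    then have "2 * (\<bar>f s\<bar> * \<bar>f t\<bar>) \<le> (f s)\<^sup>2 + (f t)\<^sup>2" by (simp add: power2_diff)
    moreover have "0 \<le> \<bar>f s\<bar> * \<bar>f t\<bar>" by simp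
    ultimately have "\<bar>f s\<bar> * \<bar>f t\<bar> \<le> (f s)\<^sup>2 + (f t)\<^sup>2" by linarith
    then have "\<bar>f s\<bar> * \<bar>f t\<bar> * poisson_ker y (s - t) \<le> ((f s)\<^sup>2 + (f t)\<^sup>2) * poisson_ker y (s - t)"
      using y by (intro mult_right_mono) (auto simp: poisson_ker_nonneg)
    then show "ennreal (\<bar>f s\<bar> * \<bar>f t\<bar> * poisson_ker y (s - t))
      \<le> ennreal ((f s)\<^sup>2) * ennreal (poisson_ker y (s - t)) + ennreal ((f t)\<^sup>2) * ennreal (poisson_ker y (s - t))"
      using y by (simp add: ennreal_mult'[symmetric] ennreal_plus[symmetric] poisson_ker_nonneg distrib_right ennreal_leI del: ennreal_plus)
  qed
  also have "\<dots> = (\<integral>\<^sup>+s. \<integral>\<^sup>+t. ennreal ((f s)\<^sup>2) * ennreal (poisson_ker y (s - t)) \<partial>lborel \<partial>lborel)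
      + (\<integral>\<^sup>+s. \<integral>\<^sup>+t. ennreal ((f t)\<^sup>2) * ennreal (poisson_ker y (s - t)) \<partial>lborel \<partial>lborel)"
    by (simp add: nn_integral_add)
  also have "(\<integral>\<^sup>+s. \<integral>\<^sup>+t. ennreal ((f t)\<^sup>2) * ennreal (poisson_ker y (s - t)) \<partial>lborel \<partial>lborel)
      = (\<integral>\<^sup>+t. \<integral>\<^sup>+s. ennreal ((f t)\<^sup>2) * ennreal (poisson_ker y (t - s)) \<partial>lborel \<partial>lborel)"
  proof -
    have "poisson_ker y (s - t) = poisson_ker y (t - s)" for s t
      using poisson_ker_minus[of y "s - t"] by simp
    then show ?thesis by (subst lborel_pair.Fubini') auto
  qed
  also have "(\<integral>\<^sup>+s. \<integral>\<^sup>+t. ennreal ((f s)\<^sup>2) * ennreal (poisson_ker y (s - t)) \<partial>lborel \<partial>lborel) = ennreal I * ennreal pi"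
    by (simp add: nn_integral_cmult nn_integral_multc nn_integral_poisson_ker_shift[OF y] nnI)
  also have "ennreal I * ennreal pi + ennreal I * ennreal pi = ennreal (2 * pi * I)"
    using I by (simp add: ennreal_mult'[symmetric] ennreal_plus[symmetric] mult.commute del: ennreal_plus)
  finally show ?thesis using I unfolding I_def[symmetric] by (simp add: ennreal_le_iff)
qed

lemma K_antimono: "0 < x \<Longrightarrow> x \<le> y \<Longrightarrow> K y \<le> K x"
proof (rule antimono_of_midconvex_bounded[of K])
  show "2 * K ((x + y) / 2) \<le> K x + K y" if "0 < x" "0 < y" for x y
    using F_dist(2)[of "x / 2" "y / 2"] that by (simp add: add_divide_distrib)
qed (rule K_bounded)

end

lemma L2_tendsto_integral_mult:
  fixes h g :: "'a \<Rightarrow> real" and u :: "nat \<Rightarrow> 'a \<Rightarrow> real"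
  assumes [measurable]: "h \<in> borel_measurable M" "g \<in> borel_measurable M" "\<And>m. u m \<in> borel_measurable M"
    and h: "(\<integral>\<^sup>+x. ennreal ((h x)\<^sup>2) \<partial>M) < \<infinity>"
    and lim: "(\<lambda>m. \<integral>\<^sup>+x. ennreal ((u m x - g x)\<^sup>2) \<partial>M) \<longlonglongrightarrow> 0"
    and iu: "\<And>m. integrable M (\<lambda>x. h x * u m x)" and ig: "integrable M (\<lambda>x. h x * g x)"
  shows "(\<lambda>m. LINT x|M. h x * u m x) \<longlonglongrightarrow> (LINT x|M. h x * g x)"
proof -
  define H where "H = (\<integral>\<^sup>+x. ennreal ((h x)\<^sup>2) \<partial>M)"
  define D where "D m = (LINT x|M. h x * u m x) - (LINT x|M. h x * g x)" for m
  have le: "ennreal ((D m)\<^sup>2) \<le> H * (\<integral>\<^sup>+x. ennreal ((u m x - g x)\<^sup>2) \<partial>M)" for m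
  proof -
    have i: "integrable M (\<lambda>x. h x * (u m x - g x))" using iu ig by (simp add: right_diff_distrib)
    have "D m = (LINT x|M. h x * (u m x - g x))" unfolding D_def using iu ig by (simp add: right_diff_distrib)
    then have "ennreal \<bar>D m\<bar> \<le> (\<integral>\<^sup>+x. ennreal \<bar>h x * (u m x - g x)\<bar> \<partial>M)"
      using integral_norm_bound_ennreal[OF i] by simp
    also have "\<dots> = (\<integral>\<^sup>+x. ennreal \<bar>h x\<bar> * ennreal \<bar>u m x - g x\<bar> \<partial>M)" by (simp add: abs_mult ennreal_mult')
    finally have "(ennreal \<bar>D m\<bar>)\<^sup>2 \<le> (\<integral>\<^sup>+x. ennreal \<bar>h x\<bar> * ennreal \<bar>u m x - g x\<bar> \<partial>M)\<^sup>2" by (rule power_mono) simp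
    also have "\<dots> \<le> (\<integral>\<^sup>+x. (ennreal \<bar>h x\<bar>)\<^sup>2 \<partial>M) * (\<integral>\<^sup>+x. (ennreal \<bar>u m x - g x\<bar>)\<^sup>2 \<partial>M)"
      by (rule Cauchy_Schwarz_nn_integral) measurable
    finally show ?thesis by (simp add: ennreal_power H_def)
  qed
  have Hlim: "(\<lambda>m. H * (\<integral>\<^sup>+x. ennreal ((u m x - g x)\<^sup>2) \<partial>M)) \<longlonglongrightarrow> H * 0"
    by (intro ennreal_tendsto_cmult lim) (use h in \<open>simp add: H_def\<close>)
  have "(\<lambda>m. ennreal ((D m)\<^sup>2)) \<longlonglongrightarrow> 0"
    by (rule tendsto_sandwich[OF _ _ tendsto_const Hlim[simplified]]) (auto intro!: always_eventually le)
  then have "(\<lambda>m. (D m)\<^sup>2) \<longlonglongrightarrow> 0" by (simp add: tendsto_ennreal_iff[of _ _ 0, simplified])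
  then have "(\<lambda>m. \<bar>D m\<bar>) \<longlonglongrightarrow> 0" using tendsto_real_sqrt[of "\<lambda>m. (D m)\<^sup>2" 0] by simp
  then have "D \<longlonglongrightarrow> 0" by (simp add: tendsto_rabs_zero_iff)
  then show ?thesis unfolding D_def by (rule LIM_zero_cancel)
qed

lemma integrable_mult_L2:
  fixes h g :: "'a \<Rightarrow> real"
  assumes [measurable]: "h \<in> borel_measurable M" "g \<in> borel_measurable M"
    and "(\<integral>\<^sup>+x. ennreal ((h x)\<^sup>2) \<partial>M) < \<infinity>" "(\<integral>\<^sup>+x. ennreal ((g x)\<^sup>2) \<partial>M) < \<infinity>"
  shows "integrable M (\<lambda>x. h x * g x)"
proof (rule integrableI_bounded)
  show "(\<integral>\<^sup>+x. ennreal (norm (h x * g x)) \<partial>M) < \<infinity>"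
    by (rule le_less_trans[OF nn_integral_norm_mult_le]) (use assms in simp_all)
qed measurable

lemma nn_integral_poisson_ker_square:
  assumes "a > 0"
  shows "(\<integral>\<^sup>+u. ennreal ((poisson_ker a (s - u))\<^sup>2) \<partial>lborel) < \<infinity>"
proof -
  have "(\<integral>\<^sup>+u. ennreal ((poisson_ker a (s - u))\<^sup>2) \<partial>lborel) \<le> (\<integral>\<^sup>+u. ennreal (1 / a) * ennreal (poisson_ker a (s - u)) \<partial>lborel)"
  proof (rule nn_integral_mono)
    fix u
    have "poisson_ker a (s - u) \<le> a / a\<^sup>2"
      using assms by (auto simp: poisson_ker_def intro!: divide_left_mono mult_pos_pos add_nonneg_pos)
    also have "a / a\<^sup>2 = 1 / a" by (simp add: power2_eq_square)
    finally have "poisson_ker a (s - u) * poisson_ker a (s - u) \<le> 1 / a * poisson_ker a (s - u)"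
      using assms by (intro mult_right_mono) (auto simp: poisson_ker_nonneg)
    then show "ennreal ((poisson_ker a (s - u))\<^sup>2) \<le> ennreal (1 / a) * ennreal (poisson_ker a (s - u))"
      using assms by (simp add: ennreal_mult'[symmetric] power2_eq_square ennreal_leI)
  qed
  also have "\<dots> = ennreal (1 / a) * ennreal pi"
    using assms by (simp add: nn_integral_cmult nn_integral_poisson_ker_shift)
  also have "\<dots> < \<infinity>" by (simp add: ennreal_mult_less_top)
  finally show ?thesis .
qed

lemma integrable_poisson_ker:
  assumes "a > 0"
  shows "integrable lborel (\<lambda>u. poisson_ker a (s - u))" "(LINT u|lborel. poisson_ker a (s - u)) = pi"
proof -
  show "integrable lborel (\<lambda>u. poisson_ker a (s - u))"
    using assms by (intro integrableI_nonneg) (auto simp: poisson_ker_nonneg nn_integral_poisson_ker_shift)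
  show "(LINT u|lborel. poisson_ker a (s - u)) = pi"
    using assms by (subst integral_eq_nn_integral) (auto simp: poisson_ker_nonneg nn_integral_poisson_ker_shift)
qed

context L1_L2_function
begin

text \<open>As y decreases to 0, \<open>K\<close> increases to its finite supremum L. By
  \<open>F_dist\<close>, two heights for which \<open>K\<close> of the doubled height is within
  (1/4)^m of L are at squared distance at most 4 pi (1/4)^m, the rate required by
  \<open>L2_Cauchy_limit\<close>.\<close>

lemma conj_poisson_L2_limit:
  obtains g :: "real \<Rightarrow> real" and Y :: "nat \<Rightarrow> real"
  where "g \<in> borel_measurable borel" "\<And>m. Y m > 0" "Y \<longlonglongrightarrow> 0"
    "(\<lambda>m. \<integral>\<^sup>+s. ennreal ((Re (F (Y m) s) - g s)\<^sup>2) \<partial>lborel) \<longlonglongrightarrow> 0"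
    "(\<integral>\<^sup>+s. ennreal ((g s)\<^sup>2) \<partial>lborel) < \<infinity>"
proof -
  define L where "L = Sup (K ` {0<..})"
  have bdd: "bdd_above (K ` {0<..})"
    by (rule bdd_aboveI2[where M="2 * pi * (LINT t|lborel. (f t)\<^sup>2)"]) (simp add: K_bounded)
  have KL: "K y \<le> L" if "y > 0" for y
    unfolding L_def by (rule cSup_upper) (use bdd that in auto)
  have "\<exists>y. 0 < y \<and> y \<le> 1 / real (Suc m) \<and> L - (1 / 4) ^ m \<le> K (2 * y)" for m
  proof -
    have "\<exists>x\<in>K ` {0<..}. L - (1 / 4) ^ m < x"
      unfolding L_def by (rule less_cSupD) (auto intro: greaterThan_non_empty)
    then obtain y0 where y0: "0 < y0" "L - (1 / 4) ^ m < K y0" by auto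
    \<comment> \<open>Halving serves the argument 2 * y of \<open>K\<close>; the second bound forces
      Y to tend to 0.\<close>
    define y where "y = min (y0 / 2) (1 / real (Suc m))"
    have "0 < y" "2 * y \<le> y0" "y \<le> 1 / real (Suc m)" using y0 by (auto simp: y_def)
    moreover have "K y0 \<le> K (2 * y)" using \<open>0 < y\<close> \<open>2 * y \<le> y0\<close> by (intro K_antimono) auto
    ultimately show ?thesis using y0 by (intro exI[of _ y]) auto
  qed
  then obtain Y where Y: "\<And>m. 0 < Y m" "\<And>m. Y m \<le> 1 / real (Suc m)" "\<And>m. L - (1 / 4) ^ m \<le> K (2 * Y m)"
    by metis
  have Y0: "Y \<longlonglongrightarrow> 0"
    by (rule tendsto_sandwich[OF _ _ tendsto_const LIMSEQ_inverse_real_of_nat])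
      (use Y in \<open>auto intro!: always_eventually less_imp_le simp: inverse_eq_divide\<close>)
  have cau: "(\<integral>\<^sup>+s. ennreal ((Re (F (Y m) s) - Re (F (Y n) s))\<^sup>2) \<partial>lborel) \<le> ennreal ((4 * pi) * (1 / 4) ^ m)"
    if mn: "m \<le> n" for m n
  proof -
    have "(\<integral>\<^sup>+s. ennreal ((Re (F (Y m) s) - Re (F (Y n) s))\<^sup>2) \<partial>lborel) \<le> (\<integral>\<^sup>+s. ennreal ((norm (F (Y m) s - F (Y n) s))\<^sup>2) \<partial>lborel)"
      by (intro nn_integral_mono ennreal_leI) (simp add: cmod_power2)
    also have "\<dots> = ennreal (2 * pi * (K (2 * Y m) + K (2 * Y n) - 2 * K (Y m + Y n)))"
      by (rule F_dist(1)[OF Y(1) Y(1)])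
    also have "\<dots> \<le> ennreal (2 * pi * (2 * (1 / 4) ^ m))"
    proof (intro ennreal_leI mult_left_mono)
      have "((1::real) / 4) ^ n \<le> (1 / 4) ^ m" using mn by (intro power_decreasing) auto
      then have "L - (1 / 4) ^ m \<le> K (2 * Y n)" using Y(3)[of n] by linarith
      then have "L - (1 / 4) ^ m \<le> K (2 * max (Y m) (Y n))"
        using Y(3)[of m] by (simp add: max_def)
      also have "\<dots> \<le> K (Y m + Y n)" using Y(1)[of m] Y(1)[of n] by (intro K_antimono) auto
      finally show "K (2 * Y m) + K (2 * Y n) - 2 * K (Y m + Y n) \<le> 2 * (1 / 4) ^ m"
        using KL[of "2 * Y m"] KL[of "2 * Y n"] Y(1)[of m] Y(1)[of n] by simp
    qed simp
    finally show ?thesis by (simp add: mult.assoc)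
  qed
  obtain g where g[measurable]: "g \<in> borel_measurable lborel"
    and gl: "\<And>m. (\<integral>\<^sup>+s. ennreal ((Re (F (Y m) s) - g s)\<^sup>2) \<partial>lborel) \<le> ennreal ((4 * pi) * (1 / 4) ^ m)"
  proof (rule L2_Cauchy_limit[of "\<lambda>m s. Re (F (Y m) s)" lborel "4 * pi"])
    show "(\<lambda>s. Re (F (Y n) s)) \<in> borel_measurable lborel" for n by measurable
  qed (use cau in simp_all)
  have "(\<lambda>m. ennreal ((4 * pi) * (1 / 4) ^ m)) \<longlonglongrightarrow> ennreal ((4 * pi) * 0)"
    by (intro tendsto_ennrealI tendsto_mult tendsto_const LIMSEQ_realpow_zero) auto
  then have up: "(\<lambda>m. ennreal ((4 * pi) * (1 / 4) ^ m)) \<longlonglongrightarrow> 0"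
    unfolding mult_zero_right ennreal_0 .
  have lim: "(\<lambda>m. \<integral>\<^sup>+s. ennreal ((Re (F (Y m) s) - g s)\<^sup>2) \<partial>lborel) \<longlonglongrightarrow> 0"
  proof (rule tendsto_sandwich[OF _ _ tendsto_const up])
    show "eventually (\<lambda>m. 0 \<le> (\<integral>\<^sup>+s. ennreal ((Re (F (Y m) s) - g s)\<^sup>2) \<partial>lborel)) sequentially"
      by (rule always_eventually) simp
    show "eventually (\<lambda>m. (\<integral>\<^sup>+s. ennreal ((Re (F (Y m) s) - g s)\<^sup>2) \<partial>lborel) \<le> ennreal ((4 * pi) * (1 / 4) ^ m)) sequentially"
      by (rule always_eventually) (use gl in blast)
  qed
  have "(\<integral>\<^sup>+s. ennreal ((g s)\<^sup>2) \<partial>lborel)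
      \<le> (\<integral>\<^sup>+s. 2 * ennreal ((Re (F (Y 0) s) - g s)\<^sup>2) + 2 * ennreal ((norm (F (Y 0) s))\<^sup>2) \<partial>lborel)"
  proof (rule nn_integral_mono)
    fix s
    have "0 \<le> ((Re (F (Y 0) s) - g s) + Re (F (Y 0) s))\<^sup>2" by simp
    then have "(g s)\<^sup>2 \<le> 2 * (Re (F (Y 0) s) - g s)\<^sup>2 + 2 * (Re (F (Y 0) s))\<^sup>2"
      by (simp add: power2_eq_square algebra_simps)
    also have "(Re (F (Y 0) s))\<^sup>2 \<le> (norm (F (Y 0) s))\<^sup>2" by (simp add: cmod_power2)
    finally have "ennreal ((g s)\<^sup>2) \<le> ennreal (2 * (Re (F (Y 0) s) - g s)\<^sup>2 + 2 * (norm (F (Y 0) s))\<^sup>2)" by (intro ennreal_leI) simp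
    then show "ennreal ((g s)\<^sup>2) \<le> 2 * ennreal ((Re (F (Y 0) s) - g s)\<^sup>2) + 2 * ennreal ((norm (F (Y 0) s))\<^sup>2)"
      by (simp add: ennreal_mult')
  qed
  also have "\<dots> = 2 * (\<integral>\<^sup>+s. ennreal ((Re (F (Y 0) s) - g s)\<^sup>2) \<partial>lborel) + 2 * (\<integral>\<^sup>+s. ennreal ((norm (F (Y 0) s))\<^sup>2) \<partial>lborel)"
    by (simp add: nn_integral_add nn_integral_cmult)
  also have "\<dots> < \<infinity>"
    using le_less_trans[OF gl[of 0]] F_square_finite[of "Y 0"] Y(1)[of 0] by (simp add: ennreal_mult_less_top)
  finally have "(\<integral>\<^sup>+s. ennreal ((g s)\<^sup>2) \<partial>lborel) < \<infinity>" .
  with that[of g Y] Y(1) Y0 lim g show thesis by simp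
qed

text \<open>The Poisson kernel is the difference of the Cauchy kernels with poles s + i a and s - i
  a, divided by 2 i. The first lifts the transform to height a + b, the second integrates to
  0.\<close>

lemma poisson_conj_poisson:
  assumes "a > 0" "b > 0"
  shows "(LINT u|lborel. poisson_ker a (s - u) * Re (F b u)) = pi * Re (F (a + b) s)"
proof -
  have int: "integrable lborel (\<lambda>u. cauchy_ker z u * F b u)" if "Im z \<noteq> 0" for z
  proof (rule integrableI_bounded)
    show "(\<integral>\<^sup>+u. ennreal (norm (cauchy_ker z u * F b u)) \<partial>lborel) < \<infinity>"
      by (rule le_less_trans[OF nn_integral_norm_mult_le])
        (use that F_square_finite[of b] assms in \<open>simp_all add: nn_integral_norm_cauchy_ker_square\<close>)
  qed measurable
  have ker: "cauchy_ker (Complex s a) u - cauchy_ker (Complex s (- a)) u = 2 * \<i> * complex_of_real (poisson_ker a (s - u))" for u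
  proof -
    have nz: "complex_of_real u - Complex s a \<noteq> 0" "complex_of_real u - Complex s (- a) \<noteq> 0"
      using assms by (auto simp: complex_eq_iff)
    have "complex_of_real u - Complex s (- a) - (complex_of_real u - Complex s a) = 2 * \<i> * a"
      by (simp add: complex_eq_iff)
    moreover have "(complex_of_real u - Complex s a) * (complex_of_real u - Complex s (- a)) = complex_of_real ((s - u)\<^sup>2 + a\<^sup>2)"
      by (simp add: complex_eq_iff power2_eq_square algebra_simps)
    ultimately have "cauchy_ker (Complex s a) u - cauchy_ker (Complex s (- a)) u = (2 * \<i> * a) / complex_of_real ((s - u)\<^sup>2 + a\<^sup>2)"
      by (simp only: cauchy_ker_def diff_frac_eq[OF nz] mult_1)
    then show ?thesis by (simp add: poisson_ker_def)
  qed
  have "(LINT u|lborel. 2 * \<i> * (complex_of_real (poisson_ker a (s - u)) * F b u))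
     = (LINT u|lborel. cauchy_ker (Complex s a) u * F b u - cauchy_ker (Complex s (- a)) u * F b u)"
    by (simp add: left_diff_distrib[symmetric] ker mult.assoc)
  also have "\<dots> = (LINT u|lborel. cauchy_ker (Complex s a) u * F b u) - (LINT u|lborel. cauchy_ker (Complex s (- a)) u * F b u)"
    using int[of "Complex s a"] int[of "Complex s (- a)"] assms by simp
  also have "\<dots> = 2 * \<i> * (pi * F (a + b) s)"
    unfolding F_def using assms integral_cauchy_ker_mult_transform[OF L1, of b "Complex s a"]
      integral_cauchy_ker_mult_transform[OF L1, of b "Complex s (- a)"]
    by (simp add: add.commute)
  finally have "2 * \<i> * (LINT u|lborel. complex_of_real (poisson_ker a (s - u)) * F b u) = 2 * \<i> * (pi * F (a + b) s)"
    by simp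
  then have eq: "(LINT u|lborel. complex_of_real (poisson_ker a (s - u)) * F b u) = pi * F (a + b) s" by simp
  have i: "integrable lborel (\<lambda>u. complex_of_real (poisson_ker a (s - u)) * F b u)"
  proof -
    have "integrable lborel (\<lambda>u. (1 / (2 * \<i>)) * (cauchy_ker (Complex s a) u * F b u - cauchy_ker (Complex s (- a)) u * F b u))"
      using int[of "Complex s a"] int[of "Complex s (- a)"] assms by (intro integrable_mult_right Bochner_Integration.integrable_diff) auto
    then show ?thesis by (simp add: left_diff_distrib[symmetric] ker)
  qed
  have "(LINT u|lborel. Re (complex_of_real (poisson_ker a (s - u)) * F b u)) = Re (pi * F (a + b) s)"
    using integral_Re[OF i] eq by simp
  then show ?thesis by simp
qed

text \<open>The difference of the two kernels is, up to a unimodular factor, y times their product,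
  and each is at most 1 / a in modulus.\<close>

lemma F_continuous_right:
  assumes "a > 0"
  shows "((\<lambda>y. Re (F (a + y) s)) \<longlongrightarrow> Re (F a s)) (at_right 0)"
proof -
  define N where "N = (LINT t|lborel. \<bar>f t\<bar>)"
  have le: "norm (Re (F (a + y) s) - Re (F a s)) \<le> N / a\<^sup>2 * y" if y: "y > 0" for y
  proof -
    have ints: "integrable lborel (\<lambda>t. complex_of_real (f t) * cauchy_ker (Complex t (- b)) s)" if "b > 0" for b
      by (rule integrable_mult_cauchy_ker[OF L1]) (use that in auto)
    have "F (a + y) s - F a s = (LINT t|lborel. complex_of_real (f t) * cauchy_ker (Complex t (- (a + y))) s - complex_of_real (f t) * cauchy_ker (Complex t (- a)) s)"
      unfolding F_def cauchy_transform_def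
      by (rule Bochner_Integration.integral_diff[symmetric]; rule ints) (use assms y in auto)
    then have "norm (F (a + y) s - F a s) \<le> (LINT t|lborel. norm (complex_of_real (f t) * cauchy_ker (Complex t (- (a + y))) s - complex_of_real (f t) * cauchy_ker (Complex t (- a)) s))"
      by (simp only: integral_norm_bound)
    also have "\<dots> \<le> (LINT t|lborel. \<bar>f t\<bar> * (y / a\<^sup>2))"
    proof (rule integral_mono)
      show "integrable lborel (\<lambda>t. norm (complex_of_real (f t) * cauchy_ker (Complex t (- (a + y))) s - complex_of_real (f t) * cauchy_ker (Complex t (- a)) s))"
        using ints[of "a + y"] ints[of a] assms y by (intro integrable_norm Bochner_Integration.integrable_diff) auto
      show "integrable lborel (\<lambda>t. \<bar>f t\<bar> * (y / a\<^sup>2))" using L1 by (intro integrable_mult_left) auto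
      fix t
      let ?z = "complex_of_real s - Complex t (- (a + y))" and ?w = "complex_of_real s - Complex t (- a)"
      have nz: "?z \<noteq> 0" "?w \<noteq> 0" using assms y by (auto simp: complex_eq_iff)
      have nl: "a \<le> norm ?z" "a \<le> norm ?w"
        using abs_Im_le_cmod[of ?z] abs_Im_le_cmod[of ?w] assms y by auto
      have "cauchy_ker (Complex t (- (a + y))) s - cauchy_ker (Complex t (- a)) s = (?w - ?z) / (?z * ?w)"
        using nz by (simp add: cauchy_ker_def diff_frac_eq)
      then have "norm (cauchy_ker (Complex t (- (a + y))) s - cauchy_ker (Complex t (- a)) s) = norm (?w - ?z) / (norm ?z * norm ?w)"
        by (simp only: norm_divide norm_mult)
      also have "?w - ?z = - \<i> * y" by (simp add: complex_eq_iff)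
      also have "norm (- \<i> * complex_of_real y) / (norm ?z * norm ?w) \<le> y / a\<^sup>2"
      proof -
        have "a * a \<le> norm ?z * norm ?w" by (rule mult_mono) (use nl assms in auto)
        moreover have "0 < a * a" using assms by simp
        ultimately have "y / (norm ?z * norm ?w) \<le> y / (a * a)"
          using y by (intro divide_left_mono) (auto intro: mult_pos_pos order.strict_trans2)
        moreover have "norm (- \<i> * complex_of_real y) = y" using y by (simp add: norm_mult)
        ultimately show ?thesis by (simp only: power2_eq_square)
      qed
      finally have "norm (cauchy_ker (Complex t (- (a + y))) s - cauchy_ker (Complex t (- a)) s) \<le> y / a\<^sup>2" .
      then have "\<bar>f t\<bar> * norm (cauchy_ker (Complex t (- (a + y))) s - cauchy_ker (Complex t (- a)) s) \<le> \<bar>f t\<bar> * (y / a\<^sup>2)"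
        by (intro mult_left_mono) auto
      then show "norm (complex_of_real (f t) * cauchy_ker (Complex t (- (a + y))) s - complex_of_real (f t) * cauchy_ker (Complex t (- a)) s) \<le> \<bar>f t\<bar> * (y / a\<^sup>2)"
        by (simp only: right_diff_distrib[symmetric] norm_mult norm_of_real)
    qed
    also have "\<dots> = N / a\<^sup>2 * y" unfolding N_def by simp
    finally have "norm (F (a + y) s - F a s) \<le> N / a\<^sup>2 * y" .
    moreover have "\<bar>Re (F (a + y) s - F a s)\<bar> \<le> norm (F (a + y) s - F a s)" by (rule abs_Re_le_cmod)
    ultimately show ?thesis by simp
  qed
  have "((\<lambda>y. N / a\<^sup>2 * y) \<longlongrightarrow> N / a\<^sup>2 * 0) (at_right 0)" by (intro tendsto_intros)
  then have lim: "((\<lambda>y. N / a\<^sup>2 * y) \<longlongrightarrow> 0) (at_right 0)" unfolding mult_zero_right .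
  have "((\<lambda>y. Re (F (a + y) s) - Re (F a s)) \<longlongrightarrow> 0) (at_right 0)"
    by (rule Lim_null_comparison[OF eventually_mono[OF eventually_at_right_less[of 0] le] lim])
  then show ?thesis by (rule LIM_zero_cancel)
qed


text \<open>The identity \<open>poisson_conj_poisson\<close> at heights a and \<open>Y m\<close>
  passes to the limit, on the left by L^2 convergence, on the right by continuity in the height.
  Every Re F a is thereby the Poisson average of the boundary function g.\<close>

lemma poisson_of_limit:
  assumes g[measurable]: "g \<in> borel_measurable borel" and Y: "\<And>m. Y m > 0" "Y \<longlonglongrightarrow> 0"
    and lim: "(\<lambda>m. \<integral>\<^sup>+s. ennreal ((Re (F (Y m) s) - g s)\<^sup>2) \<partial>lborel) \<longlonglongrightarrow> 0"
    and g2: "(\<integral>\<^sup>+s. ennreal ((g s)\<^sup>2) \<partial>lborel) < \<infinity>" and a: "a > 0"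
  shows "integrable lborel (\<lambda>u. poisson_ker a (s - u) * g u)"
    and "(LINT u|lborel. poisson_ker a (s - u) * g u) = pi * Re (F a s)"
proof -
  have P2: "(\<integral>\<^sup>+u. ennreal ((poisson_ker a (s - u))\<^sup>2) \<partial>lborel) < \<infinity>"
    by (rule nn_integral_poisson_ker_square[OF a])
  have F2: "(\<integral>\<^sup>+u. ennreal ((Re (F (Y m) u))\<^sup>2) \<partial>lborel) < \<infinity>" for m
  proof (rule le_less_trans)
    show "(\<integral>\<^sup>+u. ennreal ((Re (F (Y m) u))\<^sup>2) \<partial>lborel) \<le> (\<integral>\<^sup>+u. ennreal ((norm (F (Y m) u))\<^sup>2) \<partial>lborel)"
      by (intro nn_integral_mono ennreal_leI) (simp add: cmod_power2)
    show "(\<integral>\<^sup>+u. ennreal ((norm (F (Y m) u))\<^sup>2) \<partial>lborel) < \<infinity>"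
      using Y(1)[of m] by (intro F_square_finite) simp
  qed
  show ig: "integrable lborel (\<lambda>u. poisson_ker a (s - u) * g u)"
    by (rule integrable_mult_L2[OF _ _ P2 g2]) measurable
  have iu: "integrable lborel (\<lambda>u. poisson_ker a (s - u) * Re (F (Y m) u))" for m
    by (rule integrable_mult_L2[OF _ _ P2 F2]) measurable
  have "(\<lambda>m. LINT u|lborel. poisson_ker a (s - u) * Re (F (Y m) u)) \<longlonglongrightarrow> (LINT u|lborel. poisson_ker a (s - u) * g u)"
    by (rule L2_tendsto_integral_mult[OF _ _ _ P2 lim iu ig]) measurable
  then have 1: "(\<lambda>m. pi * Re (F (a + Y m) s)) \<longlonglongrightarrow> (LINT u|lborel. poisson_ker a (s - u) * g u)"
    unfolding poisson_conj_poisson[OF a Y(1)] .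
  have "filterlim Y (at_right 0) sequentially"
  proof -
    have "Y m \<in> {0<..} \<and> Y m \<noteq> 0" for m using Y(1)[of m] by simp
    then show ?thesis unfolding filterlim_at using Y(2) by (simp add: always_eventually)
  qed
  from filterlim_compose[OF F_continuous_right[OF a] this]
  have "(\<lambda>m. pi * Re (F (a + Y m) s)) \<longlonglongrightarrow> pi * Re (F a s)"
    by (intro tendsto_mult tendsto_const)
  with 1 show "(LINT u|lborel. poisson_ker a (s - u) * g u) = pi * Re (F a s)"
    by (rule LIMSEQ_unique)
qed

text \<open>Although g was obtained along the sequence Y only, \<open>Re (F y s)\<close> is a
  Poisson average of g for every y, so it converges at each point supplied by
  \<open>AE_poisson_lebesgue_point\<close> as y tends to 0 continuously.\<close>

lemma conj_poisson_AE_tendsto: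
  assumes g[measurable]: "g \<in> borel_measurable borel" and Y: "\<And>m. Y m > 0" "Y \<longlonglongrightarrow> 0"
    and lim: "(\<lambda>m. \<integral>\<^sup>+s. ennreal ((Re (F (Y m) s) - g s)\<^sup>2) \<partial>lborel) \<longlonglongrightarrow> 0"
    and g2: "(\<integral>\<^sup>+s. ennreal ((g s)\<^sup>2) \<partial>lborel) < \<infinity>"
  shows "AE s in lborel. ((\<lambda>y. Re (F y s)) \<longlongrightarrow> g s) (at_right 0)"
proof -
  have "(\<integral>\<^sup>+u. ennreal (\<bar>g u\<bar> / (1 + u\<^sup>2)) \<partial>lborel) = (\<integral>\<^sup>+u. ennreal (norm (g u * poisson_ker 1 (0 - u))) \<partial>lborel)"
    by (intro nn_integral_cong) (simp add: poisson_ker_def abs_mult add.commute)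
  also have "\<dots> < \<infinity>"
    by (rule le_less_trans[OF nn_integral_norm_mult_le])
      (use g2 nn_integral_poisson_ker_square[of 1 0] in simp_all)
  finally have "(\<integral>\<^sup>+u. ennreal (\<bar>g u\<bar> / (1 + u\<^sup>2)) \<partial>lborel) < \<infinity>" .
  from AE_poisson_lebesgue_point[OF g this] show ?thesis
  proof (rule eventually_mono)
    fix s
    assume L: "((\<lambda>y. \<integral>\<^sup>+u. ennreal (poisson_ker y (s - u) * \<bar>g u - g s\<bar>) \<partial>lborel) \<longlongrightarrow> 0) (at_right 0)"
    have le: "ennreal \<bar>pi * Re (F y s) - pi * g s\<bar> \<le> (\<integral>\<^sup>+u. ennreal (poisson_ker y (s - u) * \<bar>g u - g s\<bar>) \<partial>lborel)" if y: "0 < y" for y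
    proof -
      note P = poisson_of_limit[OF g Y lim g2 y, of s]
      have i: "integrable lborel (\<lambda>u. poisson_ker y (s - u) * (g u - g s))"
        using P(1) integrable_poisson_ker(1)[OF y, of s] by (simp add: right_diff_distrib)
      have "pi * Re (F y s) - pi * g s = (LINT u|lborel. poisson_ker y (s - u) * (g u - g s))"
        using P integrable_poisson_ker[OF y, of s] by (simp add: right_diff_distrib)
      then have "ennreal \<bar>pi * Re (F y s) - pi * g s\<bar> \<le> (\<integral>\<^sup>+u. ennreal (norm (poisson_ker y (s - u) * (g u - g s))) \<partial>lborel)"
        using integral_norm_bound_ennreal[OF i] by simp
      then show ?thesis using y by (simp add: abs_mult poisson_ker_nonneg)
    qed
    have "((\<lambda>y. ennreal \<bar>pi * Re (F y s) - pi * g s\<bar>) \<longlongrightarrow> 0) (at_right 0)"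
      by (rule tendsto_sandwich[OF always_eventually eventually_mono[OF eventually_at_right_less[of 0] le] tendsto_const L]) simp
    then have "((\<lambda>y. \<bar>pi * Re (F y s) - pi * g s\<bar>) \<longlongrightarrow> 0) (at_right 0)"
      by (simp add: tendsto_ennreal_iff[of _ _ 0, simplified])
    then have "((\<lambda>y. pi * Re (F y s) - pi * g s) \<longlongrightarrow> 0) (at_right 0)"
      by (simp only: tendsto_rabs_zero_iff)
    then have "((\<lambda>y. pi * Re (F y s)) \<longlongrightarrow> pi * g s) (at_right 0)" by (rule LIM_zero_cancel)
    then have "((\<lambda>y. pi * Re (F y s) / pi) \<longlongrightarrow> pi * g s / pi) (at_right 0)"
      by (rule tendsto_divide[OF _ tendsto_const pi_neq_zero])
    then show "((\<lambda>y. Re (F y s)) \<longlongrightarrow> g s) (at_right 0)" by simp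
  qed
qed

section \<open>Principal values and pairing with monotone functions\<close>

definition truncated_hilbert :: "real \<Rightarrow> real \<Rightarrow> real" where
  "truncated_hilbert \<epsilon> s = (LINT t:{t. \<epsilon> < \<bar>s - t\<bar>}|lborel. f t / (s - t))"

lemma truncated_hilbert_integrable:
  assumes "0 < \<epsilon>"
  shows "set_integrable lborel {t. \<epsilon> < \<bar>s - t\<bar>} (\<lambda>t. f t / (s - t))"
  unfolding set_integrable_def
proof (rule Bochner_Integration.integrable_bound[of _ "\<lambda>t. f t / \<epsilon>"])
  show "AE t in lborel. norm (indicat_real {t. \<epsilon> < \<bar>s - t\<bar>} t *\<^sub>R (f t / (s - t))) \<le> norm (f t / \<epsilon>)"
  proof (rule AE_I2)
    fix t show "norm (indicat_real {t. \<epsilon> < \<bar>s - t\<bar>} t *\<^sub>R (f t / (s - t))) \<le> norm (f t / \<epsilon>)"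
    proof (cases "\<epsilon> < \<bar>s - t\<bar>")
      case True
      then have "\<bar>f t\<bar> / \<bar>s - t\<bar> \<le> \<bar>f t\<bar> / \<epsilon>" using assms by (intro divide_left_mono) auto
      then show ?thesis using True assms by simp
    qed simp
  qed
qed (use L1 in auto)

text \<open>The difference \<open>\<kappa>\<close> of the two kernels is odd and dominated by the
  Poisson kernel. Oddness gives it integral 0, so f t may be replaced by f t - f s before
  estimating.\<close>

lemma truncated_hilbert_conj_poisson:
  assumes e: "0 < \<epsilon>"
  shows "ennreal \<bar>truncated_hilbert \<epsilon> s - Re (F \<epsilon> s)\<bar> \<le> (\<integral>\<^sup>+t. ennreal (poisson_ker \<epsilon> (s - t) * \<bar>f t - f s\<bar>) \<partial>lborel)"
proof -
  define \<kappa> where "\<kappa> v = indicator {v. \<epsilon> < \<bar>v\<bar>} v / v - v / (v\<^sup>2 + \<epsilon>\<^sup>2)" for v :: real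
  have [measurable]: "\<kappa> \<in> borel_measurable borel" unfolding \<kappa>_def by measurable
  have odd: "\<kappa> (- v) = - \<kappa> v" for v by (auto simp: \<kappa>_def split: split_indicator)
  have bound: "\<bar>\<kappa> v\<bar> \<le> poisson_ker \<epsilon> v" for v
  proof -
    have p: "0 < v\<^sup>2 + \<epsilon>\<^sup>2" using e by (simp add: add_nonneg_pos)
    show ?thesis
    proof (cases "\<epsilon> < \<bar>v\<bar>")
      case True
      then have v: "v \<noteq> 0" using e by auto
      have "\<kappa> v = \<epsilon>\<^sup>2 / (v * (v\<^sup>2 + \<epsilon>\<^sup>2))"
        using True v p by (simp add: \<kappa>_def field_simps power2_eq_square)
      then have "\<bar>\<kappa> v\<bar> = \<epsilon> * (\<epsilon> / \<bar>v\<bar>) / (v\<^sup>2 + \<epsilon>\<^sup>2)"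
        using p e by (simp add: abs_mult power2_eq_square)
      also have "\<dots> \<le> \<epsilon> * 1 / (v\<^sup>2 + \<epsilon>\<^sup>2)"
        using True e p by (intro divide_right_mono mult_left_mono) auto
      finally show ?thesis by (simp add: poisson_ker_def)
    next
      case False
      then show ?thesis using p by (simp add: \<kappa>_def poisson_ker_def divide_right_mono)
    qed
  qed
  have ki: "integrable lborel (\<lambda>t. \<kappa> (s - t))"
    by (rule Bochner_Integration.integrable_bound[OF integrable_poisson_ker(1)[OF e, of s]])
      (use bound e in \<open>auto simp: poisson_ker_nonneg\<close>)
  have k0: "(LINT t|lborel. \<kappa> (s - t)) = 0"
  proof -
    have "(LINT t|lborel. \<kappa> (s - t)) = (LINT t|lborel. \<kappa> (s - (2 * s + (-1) * t)))"
      by (subst lborel_integral_real_affine[where c="-1" and t="2 * s"]) auto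
    also have "\<dots> = (LINT t|lborel. - \<kappa> (s - t))"
      by (intro Bochner_Integration.integral_cong refl) (simp flip: odd)
    finally show ?thesis by simp
  qed
  have i1: "integrable lborel (\<lambda>t. indicator {t. \<epsilon> < \<bar>s - t\<bar>} t * (f t / (s - t)))"
    using truncated_hilbert_integrable[OF e, of s] by (simp add: set_integrable_def)
  have i2: "integrable lborel (\<lambda>t. f t * ((s - t) / ((s - t)\<^sup>2 + \<epsilon>\<^sup>2)))"
  proof -
    have "integrable lborel (\<lambda>t. Re (complex_of_real (f t) * cauchy_ker (Complex t (- \<epsilon>)) s))"
      by (intro integrable_Re integrable_mult_cauchy_ker L1) (use e in simp)
    then show ?thesis by (simp add: Re_cauchy_ker)
  qed
  have "truncated_hilbert \<epsilon> s - Re (F \<epsilon> s)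
      = (LINT t|lborel. indicator {t. \<epsilon> < \<bar>s - t\<bar>} t * (f t / (s - t)) - f t * ((s - t) / ((s - t)\<^sup>2 + \<epsilon>\<^sup>2)))"
    unfolding truncated_hilbert_def set_lebesgue_integral_def Re_F[OF e] using i1 i2 by simp
  also have "\<dots> = (LINT t|lborel. f t * \<kappa> (s - t))"
    by (intro Bochner_Integration.integral_cong refl) (auto simp: \<kappa>_def right_diff_distrib split: split_indicator)
  finally have d: "truncated_hilbert \<epsilon> s - Re (F \<epsilon> s) = (LINT t|lborel. f t * \<kappa> (s - t))" .
  have i3: "integrable lborel (\<lambda>t. f t * \<kappa> (s - t))"
  proof -
    have "integrable lborel (\<lambda>t. indicator {t. \<epsilon> < \<bar>s - t\<bar>} t * (f t / (s - t)) - f t * ((s - t) / ((s - t)\<^sup>2 + \<epsilon>\<^sup>2)))"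
      using i1 i2 by (rule Bochner_Integration.integrable_diff)
    then show ?thesis
      by (rule Bochner_Integration.integrable_cong[THEN iffD1, rotated -1])
        (auto simp: \<kappa>_def right_diff_distrib split: split_indicator)
  qed
  have i4: "integrable lborel (\<lambda>t. (f t - f s) * \<kappa> (s - t))"
    using i3 ki by (simp add: left_diff_distrib)
  have "truncated_hilbert \<epsilon> s - Re (F \<epsilon> s) = (LINT t|lborel. (f t - f s) * \<kappa> (s - t))"
    unfolding d using i3 ki k0 by (simp add: left_diff_distrib)
  then have "ennreal \<bar>truncated_hilbert \<epsilon> s - Re (F \<epsilon> s)\<bar> \<le> (\<integral>\<^sup>+t. ennreal (norm ((f t - f s) * \<kappa> (s - t))) \<partial>lborel)"
    using integral_norm_bound_ennreal[OF i4] by simp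
  also have "\<dots> \<le> (\<integral>\<^sup>+t. ennreal (poisson_ker \<epsilon> (s - t) * \<bar>f t - f s\<bar>) \<partial>lborel)"
    using bound by (intro nn_integral_mono ennreal_leI) (simp add: abs_mult mult.commute mult_right_mono)
  finally show ?thesis .
qed

lemma AE_poisson_lebesgue_point_f:
  "AE s in lborel. ((\<lambda>y. \<integral>\<^sup>+t. ennreal (poisson_ker y (s - t) * \<bar>f t - f s\<bar>) \<partial>lborel) \<longlongrightarrow> 0) (at_right 0)"
proof (rule AE_poisson_lebesgue_point[OF f_measurable])
  have "(\<integral>\<^sup>+t. ennreal (\<bar>f t\<bar> / (1 + t\<^sup>2)) \<partial>lborel) \<le> (\<integral>\<^sup>+t. ennreal (norm (f t)) \<partial>lborel)"
    by (intro nn_integral_mono ennreal_leI) (simp add: divide_le_eq add_pos_nonneg distrib_left)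
  also have "\<dots> < \<infinity>" using L1 by (simp add: integrable_iff_bounded)
  finally show "(\<integral>\<^sup>+t. ennreal (\<bar>f t\<bar> / (1 + t\<^sup>2)) \<partial>lborel) < \<infinity>" .
qed

lemma truncated_hilbert_tendsto:
  assumes "((\<lambda>y. \<integral>\<^sup>+t. ennreal (poisson_ker y (s - t) * \<bar>f t - f s\<bar>) \<partial>lborel) \<longlongrightarrow> 0) (at_right 0)"
    and g: "((\<lambda>y. Re (F y s)) \<longlongrightarrow> l) (at_right 0)"
  shows "((\<lambda>\<epsilon>. truncated_hilbert \<epsilon> s) \<longlongrightarrow> l) (at_right 0)"
proof -
  have "((\<lambda>y. ennreal \<bar>truncated_hilbert y s - Re (F y s)\<bar>) \<longlongrightarrow> 0) (at_right 0)"
    by (rule tendsto_sandwich[OF always_eventually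
          eventually_mono[OF eventually_at_right_less[of 0] truncated_hilbert_conj_poisson] tendsto_const assms(1)]) simp
  then have "((\<lambda>y. \<bar>truncated_hilbert y s - Re (F y s)\<bar>) \<longlongrightarrow> 0) (at_right 0)"
    by (simp add: tendsto_ennreal_iff[of _ _ 0, simplified])
  then have "((\<lambda>y. truncated_hilbert y s - Re (F y s)) \<longlongrightarrow> 0) (at_right 0)"
    by (simp only: tendsto_rabs_zero_iff)
  from tendsto_add[OF this g] show ?thesis by simp
qed


text \<open>The kernel \<open>(s - t) / ((s - t)\<^sup>2 + y\<^sup>2)\<close> is antisymmetric, so pairing its transform with
  \<open>\<phi> f\<close> symmetrizes to a difference quotient of \<open>\<phi>\<close>, which is nonnegative for monotone \<open>\<phi>\<close>.\<close>

lemma conj_poisson_pairing: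
  fixes \<phi> :: "real \<Rightarrow> real"
  assumes nn: "\<And>t. 0 \<le> f t" and [measurable]: "\<phi> \<in> borel_measurable borel" and mono: "mono \<phi>"
    and bdd: "\<And>s. \<bar>\<phi> s\<bar> \<le> B" and y: "y > 0"
  shows "ennreal (2 * (LINT s|lborel. \<phi> s * f s * Re (F y s)))
    = (\<integral>\<^sup>+p. ennreal ((\<phi> (fst p) - \<phi> (snd p)) * (fst p - snd p) / ((fst p - snd p)\<^sup>2 + y\<^sup>2) * (f (fst p) * f (snd p))) \<partial>(lborel \<Otimes>\<^sub>M lborel))"
    and "0 \<le> (LINT s|lborel. \<phi> s * f s * Re (F y s))"
proof -
  define W where "W s t = f s * f t * ((s - t) / ((s - t)\<^sup>2 + y\<^sup>2))" for s t
  have [measurable]: "(\<lambda>p. W (fst p) (snd p)) \<in> borel_measurable (lborel \<Otimes>\<^sub>M lborel)"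
    unfolding W_def by measurable
  have Wanti: "W t s = - W s t" for s t
  proof -
    have 1: "(t - s)\<^sup>2 = (s - t)\<^sup>2" by (rule power2_commute)
    have 2: "(t - s) / D = - ((s - t) / D)" for D by (simp add: minus_divide_left)
    show ?thesis unfolding W_def 1 2 by (simp add: mult.commute)
  qed
  have kb: "\<bar>v / (v\<^sup>2 + y\<^sup>2)\<bar> \<le> 1 / y" for v :: real
  proof -
    have p: "0 < v\<^sup>2 + y\<^sup>2" using y by (simp add: add_nonneg_pos)
    have "0 \<le> (\<bar>v\<bar> - y)\<^sup>2" by simp
    then have "2 * (\<bar>v\<bar> * y) \<le> v\<^sup>2 + y\<^sup>2" by (simp add: power2_diff)
    moreover have "0 \<le> \<bar>v\<bar> * y" using y by simp
    ultimately have "\<bar>v\<bar> * y \<le> v\<^sup>2 + y\<^sup>2" by linarith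
    then show ?thesis using p y by (simp add: abs_div divide_le_eq pos_le_divide_eq)
  qed
  have ff: "integrable (lborel \<Otimes>\<^sub>M lborel) (\<lambda>p. f (fst p) * f (snd p))"
  proof (rule integrableI_bounded)
    have "(\<integral>\<^sup>+p. ennreal (norm (f (fst p) * f (snd p))) \<partial>(lborel \<Otimes>\<^sub>M lborel)) = (\<integral>\<^sup>+s. \<integral>\<^sup>+t. ennreal (norm (f s)) * ennreal (norm (f t)) \<partial>lborel \<partial>lborel)"
      by (subst lborel.nn_integral_fst[symmetric]) (auto simp: abs_mult ennreal_mult')
    also have "\<dots> < \<infinity>"
      using L1 by (simp add: nn_integral_cmult nn_integral_multc ennreal_mult_less_top integrable_iff_bounded)
    finally show "(\<integral>\<^sup>+p. ennreal (norm (f (fst p) * f (snd p))) \<partial>(lborel \<Otimes>\<^sub>M lborel)) < \<infinity>" .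
  qed measurable
  have B: "0 \<le> B" using bdd[of 0] by linarith
  have intW: "integrable (lborel \<Otimes>\<^sub>M lborel) (\<lambda>p. h p * W (fst p) (snd p))"
    if [measurable]: "h \<in> borel_measurable (lborel \<Otimes>\<^sub>M lborel)" and hb: "\<And>p. \<bar>h p\<bar> \<le> B" for h
  proof (rule Bochner_Integration.integrable_bound[of _ "\<lambda>p. (B * (1 / y)) * (f (fst p) * f (snd p))"])
    show "integrable (lborel \<Otimes>\<^sub>M lborel) (\<lambda>p. (B * (1 / y)) * (f (fst p) * f (snd p)))"
      using ff by (rule integrable_mult_right)
    show "AE p in lborel \<Otimes>\<^sub>M lborel. norm (h p * W (fst p) (snd p)) \<le> norm ((B * (1 / y)) * (f (fst p) * f (snd p)))"
    proof (rule AE_I2)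
      fix p
      have "\<bar>h p\<bar> * (f (fst p) * f (snd p) * \<bar>(fst p - snd p) / ((fst p - snd p)\<^sup>2 + y\<^sup>2)\<bar>) \<le> B * (f (fst p) * f (snd p) * (1 / y))"
        using kb nn B by (intro mult_mono hb order_refl mult_nonneg_nonneg) auto
      moreover have "norm (h p * W (fst p) (snd p)) = \<bar>h p\<bar> * (f (fst p) * f (snd p) * \<bar>(fst p - snd p) / ((fst p - snd p)\<^sup>2 + y\<^sup>2)\<bar>)"
        using nn by (simp add: W_def abs_mult)
      moreover have "norm ((B * (1 / y)) * (f (fst p) * f (snd p))) = B * (f (fst p) * f (snd p) * (1 / y))"
        using nn B y by (simp add: abs_mult)
      ultimately show "norm (h p * W (fst p) (snd p)) \<le> norm ((B * (1 / y)) * (f (fst p) * f (snd p)))" by simp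
    qed
  qed measurable
  have i1: "integrable (lborel \<Otimes>\<^sub>M lborel) (\<lambda>p. \<phi> (fst p) * W (fst p) (snd p))"
    by (rule intW) (use bdd in auto)
  have i2: "integrable (lborel \<Otimes>\<^sub>M lborel) (\<lambda>p. \<phi> (snd p) * W (fst p) (snd p))"
    by (rule intW) (use bdd in auto)
  have A1: "(LINT s|lborel. \<phi> s * f s * Re (F y s)) = (LINT p|(lborel \<Otimes>\<^sub>M lborel). \<phi> (fst p) * W (fst p) (snd p))"
  proof -
    have "(LINT p|(lborel \<Otimes>\<^sub>M lborel). \<phi> (fst p) * W (fst p) (snd p)) = (LINT s|lborel. LINT t|lborel. \<phi> s * W s t)"
      using lborel_pair.integral_fst'[OF i1] by simp
    also have "\<dots> = (LINT s|lborel. \<phi> s * f s * Re (F y s))"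
      by (intro Bochner_Integration.integral_cong refl)
        (simp add: Re_F[OF y] W_def mult.assoc flip: integral_mult_right_zero)
    finally show ?thesis by simp
  qed
  have A2: "(LINT p|(lborel \<Otimes>\<^sub>M lborel). \<phi> (snd p) * W (fst p) (snd p)) = - (LINT p|(lborel \<Otimes>\<^sub>M lborel). \<phi> (fst p) * W (fst p) (snd p))"
  proof -
    have "(LINT p|(lborel \<Otimes>\<^sub>M lborel). \<phi> (snd p) * W (fst p) (snd p)) = (LINT p|(lborel \<Otimes>\<^sub>M lborel). (case p of (s, t) \<Rightarrow> \<phi> (snd (t, s)) * W (fst (t, s)) (snd (t, s))))"
      using lborel_pair.integral_product_swap[of "\<lambda>p. \<phi> (snd p) * W (fst p) (snd p)"] i2 by (simp add: borel_measurable_integrable)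
    also have "\<dots> = (LINT p|(lborel \<Otimes>\<^sub>M lborel). - (\<phi> (fst p) * W (fst p) (snd p)))"
    proof (intro Bochner_Integration.integral_cong refl)
      fix p :: "real \<times> real"
      show "(case p of (s, t) \<Rightarrow> \<phi> (snd (t, s)) * W (fst (t, s)) (snd (t, s))) = - (\<phi> (fst p) * W (fst p) (snd p))"
        by (simp only: case_prod_beta fst_conv snd_conv Wanti[of "snd p" "fst p"] mult_minus_right)
    qed
    finally show ?thesis by simp
  qed
  have nn2: "0 \<le> (\<phi> s - \<phi> t) * W s t" for s t
  proof -
    have "0 \<le> (\<phi> s - \<phi> t) * (s - t)"
      using monoD[OF mono, of s t] monoD[OF mono, of t s] by (cases "s \<le> t") (auto intro: mult_nonpos_nonpos)
    then have "0 \<le> ((\<phi> s - \<phi> t) * (s - t)) / ((s - t)\<^sup>2 + y\<^sup>2) * (f s * f t)"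
      by (rule mult_nonneg_nonneg[OF divide_nonneg_nonneg]) (use nn in auto)
    then show ?thesis by (simp add: W_def mult_ac)
  qed
  have i3: "integrable (lborel \<Otimes>\<^sub>M lborel) (\<lambda>p. (\<phi> (fst p) - \<phi> (snd p)) * W (fst p) (snd p))"
    using i1 i2 by (simp add: left_diff_distrib)
  have val: "2 * (LINT s|lborel. \<phi> s * f s * Re (F y s)) = (LINT p|(lborel \<Otimes>\<^sub>M lborel). (\<phi> (fst p) - \<phi> (snd p)) * W (fst p) (snd p))"
    using i1 i2 A2 by (simp add: A1 left_diff_distrib)
  have "0 \<le> (LINT p|(lborel \<Otimes>\<^sub>M lborel). (\<phi> (fst p) - \<phi> (snd p)) * W (fst p) (snd p))"
    by (intro integral_nonneg_AE AE_I2 nn2)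
  then show "0 \<le> (LINT s|lborel. \<phi> s * f s * Re (F y s))" unfolding val[symmetric] by simp
  have "ennreal (2 * (LINT s|lborel. \<phi> s * f s * Re (F y s))) = ennreal (LINT p|(lborel \<Otimes>\<^sub>M lborel). (\<phi> (fst p) - \<phi> (snd p)) * W (fst p) (snd p))"
    by (simp only: val)
  also have "\<dots> = (\<integral>\<^sup>+p. ennreal ((\<phi> (fst p) - \<phi> (snd p)) * W (fst p) (snd p)) \<partial>(lborel \<Otimes>\<^sub>M lborel))"
    by (rule nn_integral_eq_integral[OF i3, symmetric]) (simp add: nn2)
  finally show "ennreal (2 * (LINT s|lborel. \<phi> s * f s * Re (F y s)))
    = (\<integral>\<^sup>+p. ennreal ((\<phi> (fst p) - \<phi> (snd p)) * (fst p - snd p) / ((fst p - snd p)\<^sup>2 + y\<^sup>2) * (f (fst p) * f (snd p))) \<partial>(lborel \<Otimes>\<^sub>M lborel))"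
    by (simp add: W_def mult_ac)
qed

text \<open>The pairing at height \<open>Y m\<close> passes to the limit: the single integral by L^2
  convergence, while the nonnegative double integrals have the asserted limit by Fatou in one
  direction and by the pointwise bound \<open>Rle\<close> in the other. Finiteness of the limiting
  double integral is part of the result.\<close>

lemma hilbert_pairing:
  fixes \<phi> g :: "real \<Rightarrow> real"
  assumes g[measurable]: "g \<in> borel_measurable borel" and Y: "\<And>m. Y m > 0" "Y \<longlonglongrightarrow> 0"
    and lim: "(\<lambda>m. \<integral>\<^sup>+s. ennreal ((Re (F (Y m) s) - g s)\<^sup>2) \<partial>lborel) \<longlonglongrightarrow> 0"
    and g2: "(\<integral>\<^sup>+s. ennreal ((g s)\<^sup>2) \<partial>lborel) < \<infinity>"
    and nn: "\<And>t. 0 \<le> f t" and phi[measurable]: "\<phi> \<in> borel_measurable borel" and mono: "mono \<phi>"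
    and bdd: "\<And>s. \<bar>\<phi> s\<bar> \<le> B"
  shows "integrable lborel (\<lambda>s. \<phi> s * f s * g s)"
    and "ennreal (2 * (LINT s|lborel. \<phi> s * f s * g s))
      = (\<integral>\<^sup>+p. ennreal ((\<phi> (fst p) - \<phi> (snd p)) / (fst p - snd p) * (f (fst p) * f (snd p))) \<partial>(lborel \<Otimes>\<^sub>M lborel))"
    and "0 \<le> (LINT s|lborel. \<phi> s * f s * g s)"
proof -
  define I where "I = (\<integral>\<^sup>+p. ennreal ((\<phi> (fst p) - \<phi> (snd p)) / (fst p - snd p) * (f (fst p) * f (snd p))) \<partial>(lborel \<Otimes>\<^sub>M lborel))"
  define R where "R y p = (\<phi> (fst p) - \<phi> (snd p)) * (fst p - snd p) / ((fst p - snd p)\<^sup>2 + y\<^sup>2) * (f (fst p) * f (snd p))" for y :: real and p :: "real \<times> real"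
  have B: "0 \<le> B" using bdd[of 0] by linarith
  have h2: "(\<integral>\<^sup>+s. ennreal ((\<phi> s * f s)\<^sup>2) \<partial>lborel) < \<infinity>"
  proof -
    have "(\<integral>\<^sup>+s. ennreal ((\<phi> s * f s)\<^sup>2) \<partial>lborel) \<le> (\<integral>\<^sup>+s. ennreal (B\<^sup>2) * ennreal ((f s)\<^sup>2) \<partial>lborel)"
    proof (rule nn_integral_mono)
      fix s
      have "\<bar>\<phi> s\<bar>\<^sup>2 \<le> B\<^sup>2" by (intro power_mono bdd) simp
      then show "ennreal ((\<phi> s * f s)\<^sup>2) \<le> ennreal (B\<^sup>2) * ennreal ((f s)\<^sup>2)"
        by (simp add: ennreal_mult'[symmetric] power_mult_distrib ennreal_leI mult_right_mono)
    qed
    also have "\<dots> = ennreal (B\<^sup>2) * ennreal (LINT t|lborel. (f t)\<^sup>2)"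
      using L2 by (simp add: nn_integral_cmult nn_integral_eq_integral)
    also have "\<dots> < \<infinity>" by (simp add: ennreal_mult_less_top)
    finally show ?thesis .
  qed
  have F2: "(\<integral>\<^sup>+u. ennreal ((Re (F (Y m) u))\<^sup>2) \<partial>lborel) < \<infinity>" for m
  proof (rule le_less_trans)
    show "(\<integral>\<^sup>+u. ennreal ((Re (F (Y m) u))\<^sup>2) \<partial>lborel) \<le> (\<integral>\<^sup>+u. ennreal ((norm (F (Y m) u))\<^sup>2) \<partial>lborel)"
      by (intro nn_integral_mono ennreal_leI) (simp add: cmod_power2)
    show "(\<integral>\<^sup>+u. ennreal ((norm (F (Y m) u))\<^sup>2) \<partial>lborel) < \<infinity>"
      using Y(1)[of m] by (intro F_square_finite) simp
  qed
  show ig: "integrable lborel (\<lambda>s. \<phi> s * f s * g s)"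
    by (rule integrable_mult_L2[OF _ _ h2 g2]) measurable
  have iu: "integrable lborel (\<lambda>s. \<phi> s * f s * Re (F (Y m) s))" for m
    by (rule integrable_mult_L2[OF _ _ h2 F2]) measurable
  have limA: "(\<lambda>m. LINT s|lborel. \<phi> s * f s * Re (F (Y m) s)) \<longlonglongrightarrow> (LINT s|lborel. \<phi> s * f s * g s)"
    by (rule L2_tendsto_integral_mult[OF _ _ _ h2 lim iu ig]) measurable
  then show "0 \<le> (LINT s|lborel. \<phi> s * f s * g s)"
    by (rule LIMSEQ_le_const) (intro exI allI impI conj_poisson_pairing(2)[OF nn phi mono bdd Y(1)])
  from limA have "(\<lambda>m. ennreal (2 * (LINT s|lborel. \<phi> s * f s * Re (F (Y m) s)))) \<longlonglongrightarrow> ennreal (2 * (LINT s|lborel. \<phi> s * f s * g s))"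
    by (intro tendsto_ennrealI tendsto_mult tendsto_const)
  then have limR: "(\<lambda>m. \<integral>\<^sup>+p. ennreal (R (Y m) p) \<partial>(lborel \<Otimes>\<^sub>M lborel)) \<longlonglongrightarrow> ennreal (2 * (LINT s|lborel. \<phi> s * f s * g s))"
    unfolding R_def conj_poisson_pairing(1)[OF nn phi mono bdd Y(1)] .
  have quot: "0 \<le> (\<phi> s - \<phi> t) / (s - t)" for s t
    using monoD[OF mono, of s t] monoD[OF mono, of t s] by (cases "s \<le> t") (auto intro: divide_nonpos_nonpos)
  have Rle: "R y p \<le> (\<phi> (fst p) - \<phi> (snd p)) / (fst p - snd p) * (f (fst p) * f (snd p))" if y: "y > 0" for y p
  proof -
    define v where "v = fst p - snd p"
    define d where "d = \<phi> (fst p) - \<phi> (snd p)"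
    have q: "0 \<le> d / v" using quot by (simp add: d_def v_def)
    have "d * v / (v\<^sup>2 + y\<^sup>2) \<le> d / v"
    \<comment> \<open>On the diagonal both sides are 0, because division by zero returns 0.\<close>
    proof (cases "v = 0")
      case False
      have p: "0 < v\<^sup>2 + y\<^sup>2" using y by (simp add: add_nonneg_pos)
      have "d * v / (v\<^sup>2 + y\<^sup>2) = d / v * (v\<^sup>2 / (v\<^sup>2 + y\<^sup>2))" using False by (simp add: power2_eq_square)
      also have "\<dots> \<le> d / v * 1" using p q by (intro mult_left_mono) auto
      finally show ?thesis by simp
    qed simp
    then show ?thesis unfolding R_def d_def v_def using nn by (intro mult_right_mono) auto
  qed
  have "I \<le> ennreal (2 * (LINT s|lborel. \<phi> s * f s * g s))"
  proof -
    have "I = (\<integral>\<^sup>+p. liminf (\<lambda>m. ennreal (R (Y m) p)) \<partial>(lborel \<Otimes>\<^sub>M lborel))"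
      unfolding I_def
    proof (rule nn_integral_cong)
      fix p :: "real \<times> real"
      have "(\<lambda>m. R (Y m) p) \<longlonglongrightarrow> (\<phi> (fst p) - \<phi> (snd p)) / (fst p - snd p) * (f (fst p) * f (snd p))"
      proof (cases "fst p = snd p")
        case False
        then have "(\<lambda>m. R (Y m) p) \<longlonglongrightarrow> (\<phi> (fst p) - \<phi> (snd p)) * (fst p - snd p) / ((fst p - snd p)\<^sup>2 + 0\<^sup>2) * (f (fst p) * f (snd p))"
          unfolding R_def by (intro tendsto_intros Y(2)) auto
        then show ?thesis using False by (simp add: power2_eq_square)
      qed (simp add: R_def)
      then have "(\<lambda>m. ennreal (R (Y m) p)) \<longlonglongrightarrow> ennreal ((\<phi> (fst p) - \<phi> (snd p)) / (fst p - snd p) * (f (fst p) * f (snd p)))"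
        by (rule tendsto_ennrealI)
      then show "ennreal ((\<phi> (fst p) - \<phi> (snd p)) / (fst p - snd p) * (f (fst p) * f (snd p))) = liminf (\<lambda>m. ennreal (R (Y m) p))"
        by (rule lim_imp_Liminf[OF sequentially_bot, symmetric])
    qed
    also have "\<dots> \<le> liminf (\<lambda>m. \<integral>\<^sup>+p. ennreal (R (Y m) p) \<partial>(lborel \<Otimes>\<^sub>M lborel))"
      by (rule nn_integral_liminf) (unfold R_def, measurable)
    also have "\<dots> = ennreal (2 * (LINT s|lborel. \<phi> s * f s * g s))"
      by (rule lim_imp_Liminf[OF sequentially_bot limR])
    finally show ?thesis .
  qed
  moreover have "ennreal (2 * (LINT s|lborel. \<phi> s * f s * g s)) \<le> I"
  proof (rule LIMSEQ_le_const2[OF limR], intro exI allI impI)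
    fix m
    show "(\<integral>\<^sup>+p. ennreal (R (Y m) p) \<partial>(lborel \<Otimes>\<^sub>M lborel)) \<le> I"
      unfolding I_def by (intro nn_integral_mono ennreal_leI Rle Y)
  qed
  ultimately show "ennreal (2 * (LINT s|lborel. \<phi> s * f s * g s))
      = (\<integral>\<^sup>+p. ennreal ((\<phi> (fst p) - \<phi> (snd p)) / (fst p - snd p) * (f (fst p) * f (snd p))) \<partial>(lborel \<Otimes>\<^sub>M lborel))"
    unfolding I_def by (rule antisym[rotated])
qed

end

section \<open>The Hilbert transform on the half-line\<close>

lemma nn_integral_reflect:
  fixes h :: "real \<Rightarrow> ennreal"
  assumes [measurable]: "h \<in> borel_measurable borel"
  shows "(\<integral>\<^sup>+t. h (- t) \<partial>lborel) = (\<integral>\<^sup>+t. h t \<partial>lborel)"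
  by (subst (2) nn_integral_real_affine[where c="-1" and t=0]) auto

lemma nn_integral_even:
  fixes h :: "real \<Rightarrow> ennreal"
  assumes [measurable]: "h \<in> borel_measurable borel" and even: "\<And>t. h (- t) = h t"
  shows "(\<integral>\<^sup>+t. h t \<partial>lborel) = 2 * (\<integral>\<^sup>+t. h t * indicator {0..} t \<partial>lborel)"
proof -
  have "(\<integral>\<^sup>+t. h t \<partial>lborel) = (\<integral>\<^sup>+t. h t * indicator {0..} t + h t * indicator {..0} t \<partial>lborel)"
    by (rule nn_integral_cong_AE) (use AE_lborel_singleton[of 0] in \<open>auto elim!: eventually_mono split: split_indicator\<close>)
  also have "\<dots> = (\<integral>\<^sup>+t. h t * indicator {0..} t \<partial>lborel) + (\<integral>\<^sup>+t. h t * indicator {..0} t \<partial>lborel)"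
    by (rule nn_integral_add) measurable
  also have "(\<integral>\<^sup>+t. h t * indicator {..0} t \<partial>lborel) = (\<integral>\<^sup>+t. h (- t) * indicator {..0} (- t) \<partial>lborel)"
    by (rule nn_integral_reflect[symmetric]) measurable
  also have "\<dots> = (\<integral>\<^sup>+t. h t * indicator {0..} t \<partial>lborel)"
    by (intro nn_integral_cong) (auto simp: even split: split_indicator)
  finally show ?thesis by (simp add: mult_2)
qed

text \<open>The substitution rule is used on the compact intervals from 0 to n, followed by monotone
  convergence.\<close>

lemma nn_integral_square_substitution_indicator:
  assumes A[measurable]: "A \<in> sets borel"
  shows "(\<integral>\<^sup>+x. indicator A x * indicator {0..} x \<partial>lborel)
    = (\<integral>\<^sup>+s. ennreal (2 * s) * indicator {0..} s * indicator A (s\<^sup>2) \<partial>lborel)"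
proof -
  have eq: "(\<integral>\<^sup>+x. indicator A x * indicator {0..(real n)\<^sup>2} x \<partial>lborel)
     = (\<integral>\<^sup>+s. ennreal (2 * s) * indicator {0..real n} s * indicator A (s\<^sup>2) \<partial>lborel)" for n :: nat
  proof -
    have "(\<integral>\<^sup>+x. ennreal (indicator A x * indicator {0\<^sup>2..(real n)\<^sup>2} x) \<partial>lborel)
      = (\<integral>\<^sup>+s. ennreal (indicator A (s\<^sup>2) * (2 * s) * indicator {0..real n} s) \<partial>lborel)"
      by (rule nn_integral_substitution)
        (auto intro!: derivative_eq_intros continuous_intros simp: set_borel_measurable_def)
    moreover have "(\<integral>\<^sup>+x. ennreal (indicator A x * indicator {0\<^sup>2..(real n)\<^sup>2} x) \<partial>lborel) = (\<integral>\<^sup>+x. indicator A x * indicator {0..(real n)\<^sup>2} x \<partial>lborel)"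
      by (intro nn_integral_cong) (auto split: split_indicator)
    moreover have "(\<integral>\<^sup>+s. ennreal (indicator A (s\<^sup>2) * (2 * s) * indicator {0..real n} s) \<partial>lborel)
      = (\<integral>\<^sup>+s. ennreal (2 * s) * indicator {0..real n} s * indicator A (s\<^sup>2) \<partial>lborel)"
      by (intro nn_integral_cong) (auto split: split_indicator)
    ultimately show ?thesis by simp
  qed
  have L: "(\<lambda>n. \<integral>\<^sup>+x. indicator A x * indicator {0..(real n)\<^sup>2} x \<partial>lborel) \<longlonglongrightarrow> (\<integral>\<^sup>+x. indicator A x * indicator {0..} x \<partial>lborel)"
  proof (rule nn_integral_LIMSEQ)
    show "incseq (\<lambda>n x. indicator A x * (indicator {0..(real n)\<^sup>2} x :: ennreal))"
    proof (intro monoI le_funI mult_left_mono)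
      fix m n :: nat and x :: real assume "m \<le> n"
      then have le: "(real m)\<^sup>2 \<le> (real n)\<^sup>2" by (intro power_mono) auto
      show "indicator {0..(real m)\<^sup>2} x \<le> (indicator {0..(real n)\<^sup>2} x :: ennreal)"
        using order_trans[OF _ le, of x] by (auto split: split_indicator)
    qed simp
    fix x :: real
    obtain N :: nat where N: "x \<le> real N" "1 \<le> N" using real_arch_simple[of "max 1 x"] by auto
    have "x \<le> (real n)\<^sup>2" if "N \<le> n" for n
    proof -
      have "real N \<le> real n" "1 \<le> real n" using that N by auto
      then have "real N * 1 \<le> real n * real n" by (intro mult_mono) auto
      then show ?thesis using N by (simp add: power2_eq_square)
    qed
    then show "(\<lambda>n. indicator A x * indicator {0..(real n)\<^sup>2} x) \<longlonglongrightarrow> (indicator A x * indicator {0..} x :: ennreal)"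
      by (intro tendsto_eventually eventually_sequentiallyI[of N]) (auto split: split_indicator)
  qed measurable
  have R: "(\<lambda>n. \<integral>\<^sup>+s. ennreal (2 * s) * indicator {0..real n} s * indicator A (s\<^sup>2) \<partial>lborel)
     \<longlonglongrightarrow> (\<integral>\<^sup>+s. ennreal (2 * s) * indicator {0..} s * indicator A (s\<^sup>2) \<partial>lborel)"
  proof (rule nn_integral_LIMSEQ)
    show "incseq (\<lambda>n s. ennreal (2 * s) * indicator {0..real n} s * (indicator A (s\<^sup>2)))"
      by (intro monoI le_funI mult_left_mono mult_right_mono) (auto split: split_indicator)
    fix s :: real
    obtain N :: nat where N: "s \<le> real N" using real_arch_simple by blast
    then show "(\<lambda>n. ennreal (2 * s) * indicator {0..real n} s * indicator A (s\<^sup>2)) \<longlonglongrightarrow> ennreal (2 * s) * indicator {0..} s * indicator A (s\<^sup>2)"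
      by (intro tendsto_eventually eventually_sequentiallyI[of N]) (auto split: split_indicator)
  qed measurable
  show ?thesis using LIMSEQ_unique[OF L R[folded eq]] .
qed

lemma distr_square:
  "distr (density lborel (\<lambda>s. ennreal (2 * s) * indicator {0..} s)) borel (\<lambda>s. s\<^sup>2) = density lborel (indicator {0..})"
proof (rule measure_eqI)
  fix A assume "A \<in> sets (distr (density lborel (\<lambda>s. ennreal (2 * s) * indicator {0..} s)) borel (\<lambda>s. s\<^sup>2))"
  then have A[measurable]: "A \<in> sets borel" by simp
  have "emeasure (distr (density lborel (\<lambda>s. ennreal (2 * s) * indicator {0..} s)) borel (\<lambda>s. s\<^sup>2)) A
     = (\<integral>\<^sup>+s. ennreal (2 * s) * indicator {0..} s * indicator A (s\<^sup>2) \<partial>lborel)"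
    by (subst nn_integral_indicator[symmetric])
      (auto simp: nn_integral_distr nn_integral_density simp del: nn_integral_indicator)
  also have "\<dots> = (\<integral>\<^sup>+x. indicator A x * indicator {0..} x \<partial>lborel)"
    by (rule nn_integral_square_substitution_indicator[OF A, symmetric])
  also have "\<dots> = emeasure (density lborel (indicator {0..})) A"
    by (subst emeasure_density) (auto intro!: nn_integral_cong split: split_indicator)
  finally show "emeasure (distr (density lborel (\<lambda>s. ennreal (2 * s) * indicator {0..} s)) borel (\<lambda>s. s\<^sup>2)) A = emeasure (density lborel (indicator {0..})) A" .
qed simp

text \<open>Folding the half-line density 2 s evenly onto the whole line replaces the factor 2 s by
  \<open>\<bar>s\<bar>\<close>.\<close>

lemma nn_integral_square_substitution:
  fixes h :: "real \<Rightarrow> ennreal"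
  assumes [measurable]: "h \<in> borel_measurable borel"
  shows "(\<integral>\<^sup>+x. h x * indicator {0..} x \<partial>lborel) = (\<integral>\<^sup>+s. ennreal \<bar>s\<bar> * h (s\<^sup>2) \<partial>lborel)"
proof -
  have "(\<integral>\<^sup>+x. h x * indicator {0..} x \<partial>lborel) = (\<integral>\<^sup>+x. h x \<partial>density lborel (indicator {0..}))"
    by (subst nn_integral_density) (auto simp: mult.commute)
  also have "\<dots> = (\<integral>\<^sup>+s. ennreal (2 * s) * indicator {0..} s * h (s\<^sup>2) \<partial>lborel)"
    unfolding distr_square[symmetric] by (subst nn_integral_distr) (auto simp: nn_integral_density)
  also have "\<dots> = (\<integral>\<^sup>+s. 2 * (ennreal \<bar>s\<bar> * h (s\<^sup>2) * indicator {0..} s) \<partial>lborel)"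
    by (intro nn_integral_cong) (auto simp: ennreal_mult' mult_ac split: split_indicator)
  also have "\<dots> = (\<integral>\<^sup>+s. ennreal \<bar>s\<bar> * h (s\<^sup>2) \<partial>lborel)"
    by (subst nn_integral_cmult) (auto simp: nn_integral_even[of "\<lambda>s. ennreal \<bar>s\<bar> * h (s\<^sup>2)"])
  finally show ?thesis .
qed

text \<open>In the variable \<open>s = sqrt x\<close> the truncation \<open>\<bar>x - t\<^sup>2\<bar> \<le> 2 s d\<close> agrees with \<open>\<bar>s - t\<bar> \<le> d\<close>
  up to sets of size \<open>O(d\<^sup>2)\<close> near \<open>s\<close>, and removes a harmless neighbourhood of \<open>- s\<close>.\<close>

definition truncation_error :: "real \<Rightarrow> real \<Rightarrow> real \<Rightarrow> real" where
  "truncation_error s d t = (indicator {t. 2 * s * d < \<bar>s\<^sup>2 - t\<^sup>2\<bar>} t - indicator {t. d < \<bar>s - t\<bar>} t) / (s - t)"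

lemma measurable_truncation_error [measurable]: "truncation_error s d \<in> borel_measurable borel"
  unfolding truncation_error_def by measurable

text \<open>The two bounds serve different parts of q t = q s + (q t - q s): the Poisson bound
  controls the oscillation at Lebesgue points, the bound by three indicators the constant part. With
  r = d / s at most 1/4, the locations of t reduce to polynomial inequalities in r.\<close>

lemma truncation_error_bounds:
  assumes d: "0 < d" "d \<le> s / 4"
  shows "\<bar>truncation_error s d t\<bar> \<le> 5 * (poisson_ker d (s - t) + poisson_ker d (s + t))" (is ?P)
    and "\<bar>truncation_error s d t\<bar> \<le> 4 / (3 * d) * indicator {s + d - d\<^sup>2 / s..s + d} t
      + 4 / (3 * d) * indicator {s - d - 2 * d\<^sup>2 / s..s - d} t + 1 / s * indicator {- s - 2 * d..- s + 2 * d} t" (is ?M)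
proof -
  have s: "s > 0" using d by simp
  define r where "r = d / s"
  have r: "0 < r" "r \<le> 1 / 4" using d s by (auto simp: r_def field_simps)
  have dr: "d = r * s" using s by (simp add: r_def)
  have ds: "d\<^sup>2 / s = r * d" using s by (simp add: dr power2_eq_square)
  have pos: "0 \<le> poisson_ker d v" for v using d by (simp add: poisson_ker_nonneg)
  have low: "1 / (c * d) \<le> poisson_ker d v" if "v\<^sup>2 + d\<^sup>2 \<le> c * d\<^sup>2" "c > 0" for c v
  proof -
    have "1 / (c * d) = d / (c * d\<^sup>2)" using d by (simp add: power2_eq_square)
    also have "\<dots> \<le> d / (v\<^sup>2 + d\<^sup>2)" using that d by (intro divide_left_mono mult_pos_pos add_nonneg_pos) auto
    finally show ?thesis by (simp add: poisson_ker_def)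
  qed
  have nnI: "0 \<le> 4 / (3 * d) * indicator I t" "0 \<le> 1 / s * indicator I t" for I :: "real set" and t
    using d s by auto
  \<comment> \<open>The truncations differ in three places: just below s + d, where the interval
    windows remove t while the square windows keep it out of the cut-off (A); just below s - d (B);
    and around -s (C). The worst ratio to the Poisson kernels, 5, arises in (C).\<close>
  consider (A) "\<bar>s - t\<bar> \<le> d" "2 * s * d < \<bar>s\<^sup>2 - t\<^sup>2\<bar>" | (B) "d < \<bar>s - t\<bar>" "\<bar>s\<^sup>2 - t\<^sup>2\<bar> \<le> 2 * s * d" "0 \<le> t"
    | (C) "d < \<bar>s - t\<bar>" "\<bar>s\<^sup>2 - t\<^sup>2\<bar> \<le> 2 * s * d" "t < 0" | (D) "truncation_error s d t = 0"
    unfolding truncation_error_def by (cases "\<bar>s - t\<bar> \<le> d"; cases "2 * s * d < \<bar>s\<^sup>2 - t\<^sup>2\<bar>"; cases "0 \<le> t") auto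
  then have "?P \<and> ?M"
  proof cases
    case A
    have t0: "0 < t" using A d by linarith
    have fac: "s\<^sup>2 - t\<^sup>2 = (s - t) * (s + t)" by (simp add: power2_eq_square algebra_simps)
    have ts: "s < t"
    proof (rule ccontr)
      assume "\<not> s < t"
      then have "\<bar>s\<^sup>2 - t\<^sup>2\<bar> = (s - t) * (s + t)" unfolding fac using t0 s by (simp add: abs_mult)
      also have "\<dots> \<le> d * (2 * s)" using A \<open>\<not> s < t\<close> t0 s d by (intro mult_mono) auto
      finally show False using A(2) by (simp add: mult.commute mult.left_commute)
    qed
    then have t2: "s\<^sup>2 + 2 * s * d < t\<^sup>2"
    proof -
      have "s\<^sup>2 < t\<^sup>2" using ts s by (intro power_strict_mono) auto
      then show ?thesis using A(2) by linarith
    qed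
    have c: "s + d - d\<^sup>2 / s \<le> t"
    proof (rule ccontr)
      assume "\<not> s + d - d\<^sup>2 / s \<le> t"
      then have "t\<^sup>2 \<le> (s + d - d\<^sup>2 / s)\<^sup>2" using t0 by (intro power_mono) auto
      also have "s + d - d\<^sup>2 / s = s * (1 + r - r\<^sup>2)" unfolding ds by (simp add: dr power2_eq_square algebra_simps)
      also have "(s * (1 + r - r\<^sup>2))\<^sup>2 = s\<^sup>2 * (1 + 2 * r - r\<^sup>2 - 2 * r ^ 3 + r ^ 4)"
        by (simp add: power2_eq_square power3_eq_cube power4_eq_xxxx algebra_simps)
      also have "\<dots> \<le> s\<^sup>2 * (1 + 2 * r)"
      proof (rule mult_left_mono)
        have "r ^ 4 \<le> r ^ 2" using r by (intro power_decreasing) auto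
        moreover have "0 \<le> r ^ 3" using r by simp
        ultimately show "1 + 2 * r - r\<^sup>2 - 2 * r ^ 3 + r ^ 4 \<le> 1 + 2 * r" by linarith
      qed simp
      also have "\<dots> = s\<^sup>2 + 2 * s * d" by (simp add: dr power2_eq_square algebra_simps)
      finally show False using t2 by simp
    qed
    have gap: "3 / 4 * d \<le> t - s"
    proof -
      have "r * d \<le> 1 / 4 * d" using r d by (intro mult_right_mono) auto
      then show ?thesis using c unfolding ds by linarith
    qed
    have e: "\<bar>truncation_error s d t\<bar> = 1 / (t - s)"
      using A ts by (simp add: truncation_error_def)
    also have "1 / (t - s) \<le> 1 / (3 / 4 * d)" using gap d by (intro divide_left_mono mult_pos_pos) auto
    finally have le: "\<bar>truncation_error s d t\<bar> \<le> 4 / (3 * d)" by simp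
    have "(s - t)\<^sup>2 \<le> d\<^sup>2" using A(1) d by (metis abs_le_square_iff abs_of_pos)
    then have "1 / (2 * d) \<le> poisson_ker d (s - t)" by (intro low) auto
    moreover have "4 / (3 * d) \<le> 5 * (1 / (2 * d))" using d by (simp add: field_simps)
    ultimately have ?P using le pos[of "s + t"] by (smt (verit))
    moreover have "t \<in> {s + d - d\<^sup>2 / s..s + d}" using c A(1) by auto
    then have ?M using le nnI(1)[of "{s - d - 2 * d\<^sup>2 / s..s - d}" t] nnI(2)[of "{- s - 2 * d..- s + 2 * d}" t] by simp
    ultimately show ?thesis ..
  next
    case B
    have fac: "s\<^sup>2 - t\<^sup>2 = (s - t) * (s + t)" by (simp add: power2_eq_square algebra_simps)
    have ts: "t < s"
    proof (rule ccontr)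
      assume ts: "\<not> t < s"
      then have "d * (2 * s) < (t - s) * (t + s)" using B(1) s d by (intro mult_less_le_imp_less) auto
      also have "\<dots> = - (s\<^sup>2 - t\<^sup>2)" by (simp add: power2_eq_square algebra_simps)
      also have "\<dots> \<le> \<bar>s\<^sup>2 - t\<^sup>2\<bar>" by linarith
      finally show False using B(2) by (simp add: mult.commute mult.left_commute)
    qed
    have t2: "s\<^sup>2 - 2 * s * d \<le> t\<^sup>2" using B(2) by linarith
    have c: "s - d - 2 * d\<^sup>2 / s \<le> t"
    proof (rule ccontr)
      assume n: "\<not> s - d - 2 * d\<^sup>2 / s \<le> t"
      have d2: "2 * d\<^sup>2 / s = 2 * (r * d)" using ds by simp
      have "t\<^sup>2 < (s - d - 2 * d\<^sup>2 / s)\<^sup>2" using n B(3) by (intro power_strict_mono) auto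
      also have "s - d - 2 * d\<^sup>2 / s = s * (1 - r - 2 * r\<^sup>2)" unfolding d2 by (simp add: dr power2_eq_square algebra_simps)
      also have "(s * (1 - r - 2 * r\<^sup>2))\<^sup>2 = s\<^sup>2 * (1 - 2 * r - r\<^sup>2 * (3 - 4 * r - 4 * r\<^sup>2))"
        by (simp add: power2_eq_square algebra_simps)
      also have "\<dots> \<le> s\<^sup>2 * (1 - 2 * r)"
      proof (rule mult_left_mono)
        have "r\<^sup>2 \<le> (1 / 4)\<^sup>2" using r by (intro power_mono) auto
        then have "0 \<le> 3 - 4 * r - 4 * r\<^sup>2" using r by (simp add: power2_eq_square)
        then have "0 \<le> r\<^sup>2 * (3 - 4 * r - 4 * r\<^sup>2)" by simp
        then show "1 - 2 * r - r\<^sup>2 * (3 - 4 * r - 4 * r\<^sup>2) \<le> 1 - 2 * r" by linarith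
      qed simp
      also have "\<dots> = s\<^sup>2 - 2 * s * d" by (simp add: dr power2_eq_square algebra_simps)
      finally show False using t2 by simp
    qed
    have e: "\<bar>truncation_error s d t\<bar> = 1 / (s - t)"
      using B ts by (simp add: truncation_error_def)
    also have "1 / (s - t) \<le> 1 / d" using B(1) ts d by (intro divide_left_mono mult_pos_pos) auto
    finally have le: "\<bar>truncation_error s d t\<bar> \<le> 1 / d" .
    have "r * d \<le> 1 / 4 * d" using r d by (intro mult_right_mono) auto
    moreover have "2 * d\<^sup>2 / s = 2 * (r * d)" using ds by simp
    ultimately have "\<bar>s - t\<bar> \<le> 3 / 2 * d" using c ts by linarith
    then have "\<bar>s - t\<bar>\<^sup>2 \<le> (3 / 2 * d)\<^sup>2" by (intro power_mono) auto
    then have "4 * (s - t)\<^sup>2 \<le> 9 * d\<^sup>2" by (simp add: power_mult_distrib power_divide)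
    moreover have "0 \<le> d\<^sup>2" by simp
    ultimately have "(s - t)\<^sup>2 + d\<^sup>2 \<le> 4 * d\<^sup>2" by linarith
    then have "1 / (4 * d) \<le> poisson_ker d (s - t)" by (intro low) auto
    moreover have "1 / d \<le> 5 * (1 / (4 * d))" using d by (simp add: field_simps)
    ultimately have P: ?P using le pos[of "s + t"] by (smt (verit))
    have "t \<in> {s - d - 2 * d\<^sup>2 / s..s - d}" using c B(1) ts by auto
    moreover have "1 / d \<le> 4 / (3 * d)" using d by (simp add: field_simps)
    with le have "\<bar>truncation_error s d t\<bar> \<le> 4 / (3 * d)" by linarith
    ultimately have ?M using nnI(1)[of "{s + d - d\<^sup>2 / s..s + d}" t] nnI(2)[of "{- s - 2 * d..- s + 2 * d}" t]
      by simp
    with P show ?thesis ..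
  next
    case C
    have "\<bar>s\<^sup>2 - t\<^sup>2\<bar> = \<bar>s - t\<bar> * \<bar>s + t\<bar>" by (simp add: abs_mult[symmetric] power2_eq_square algebra_simps)
    moreover have "s * \<bar>s + t\<bar> \<le> \<bar>s - t\<bar> * \<bar>s + t\<bar>" using C s by (intro mult_right_mono) auto
    ultimately have "s * \<bar>s + t\<bar> \<le> s * (2 * d)" using C(2) by (simp add: mult_ac)
    then have st: "\<bar>s + t\<bar> \<le> 2 * d" using s by simp
    have e: "\<bar>truncation_error s d t\<bar> = 1 / (s - t)"
      using C s by (simp add: truncation_error_def)
    also have "1 / (s - t) \<le> 1 / s" using C s by (intro divide_left_mono mult_pos_pos) auto
    finally have le: "\<bar>truncation_error s d t\<bar> \<le> 1 / s" .
    have "\<bar>s + t\<bar>\<^sup>2 \<le> (2 * d)\<^sup>2" using st by (intro power_mono) auto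
    then have "(s + t)\<^sup>2 + d\<^sup>2 \<le> 5 * d\<^sup>2" by (simp add: power_mult_distrib)
    then have "1 / (5 * d) \<le> poisson_ker d (s + t)" by (intro low) auto
    moreover have "1 / s \<le> 5 * (1 / (5 * d))" using d s by (simp add: field_simps)
    ultimately have ?P using le pos[of "s - t"] by (smt (verit))
    moreover have I: "indicat_real {- s - 2 * d..- s + 2 * d} t = 1" using st by (auto simp: indicator_def)
    have ?M unfolding I using le nnI(1)[of "{s + d - d\<^sup>2 / s..s + d}" t] nnI(1)[of "{s - d - 2 * d\<^sup>2 / s..s - d}" t] by linarith
    ultimately show ?thesis ..
  next
    case D
    then show ?thesis using pos nnI by (simp only: abs_zero) (auto intro!: add_nonneg_nonneg simp del: indicator_simps)
  qed
  then show ?P ?M by auto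
qed

text \<open>The three windows contribute 4/3, 8/3 and 4 times d / s.\<close>

lemma nn_integral_truncation_error:
  assumes d: "0 < d" "d \<le> s / 4"
  shows "(\<integral>\<^sup>+t. ennreal \<bar>truncation_error s d t\<bar> \<partial>lborel) \<le> ennreal (8 * d / s)"
proof -
  have s: "s > 0" using d by simp
  have "(\<integral>\<^sup>+t. ennreal \<bar>truncation_error s d t\<bar> \<partial>lborel)
    \<le> (\<integral>\<^sup>+t. ennreal (4 / (3 * d)) * indicator {s + d - d\<^sup>2 / s..s + d} t
      + ennreal (4 / (3 * d)) * indicator {s - d - 2 * d\<^sup>2 / s..s - d} t + ennreal (1 / s) * indicator {- s - 2 * d..- s + 2 * d} t \<partial>lborel)"
  proof (rule nn_integral_mono)
    fix t
    have "ennreal \<bar>truncation_error s d t\<bar> \<le> ennreal (4 / (3 * d) * indicator {s + d - d\<^sup>2 / s..s + d} t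
      + 4 / (3 * d) * indicator {s - d - 2 * d\<^sup>2 / s..s - d} t + 1 / s * indicator {- s - 2 * d..- s + 2 * d} t)"
      by (rule ennreal_leI) (rule truncation_error_bounds(2)[OF d])
    also have "\<dots> = ennreal (4 / (3 * d)) * indicator {s + d - d\<^sup>2 / s..s + d} t
      + ennreal (4 / (3 * d)) * indicator {s - d - 2 * d\<^sup>2 / s..s - d} t + ennreal (1 / s) * indicator {- s - 2 * d..- s + 2 * d} t"
      using d s by (auto simp: ennreal_plus[symmetric] simp del: ennreal_plus split: split_indicator)
    finally show "ennreal \<bar>truncation_error s d t\<bar> \<le> ennreal (4 / (3 * d)) * indicator {s + d - d\<^sup>2 / s..s + d} t
      + ennreal (4 / (3 * d)) * indicator {s - d - 2 * d\<^sup>2 / s..s - d} t + ennreal (1 / s) * indicator {- s - 2 * d..- s + 2 * d} t" .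
  qed
  also have "\<dots> = ennreal (4 / (3 * d)) * ennreal (d\<^sup>2 / s) + ennreal (4 / (3 * d)) * ennreal (2 * d\<^sup>2 / s) + ennreal (1 / s) * ennreal (4 * d)"
    using d s by (simp add: nn_integral_add nn_integral_cmult_indicator)
  also have "\<dots> = ennreal (4 / (3 * d) * (d\<^sup>2 / s) + 4 / (3 * d) * (2 * d\<^sup>2 / s) + 1 / s * (4 * d))"
    using d s by (simp add: ennreal_mult'[symmetric] ennreal_plus[symmetric] del: ennreal_plus)
  also have "4 / (3 * d) * (d\<^sup>2 / s) + 4 / (3 * d) * (2 * d\<^sup>2 / s) + 1 / s * (4 * d) = 8 * d / s"
    using d s by (simp add: field_simps power2_eq_square)
  finally show ?thesis .
qed

section \<open>From a density on the half-line to an even density on the line\<close>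

locale half_line_density =
  fixes \<mu> :: "real measure" and p :: "real \<Rightarrow> real"
  assumes p_measurable [measurable]: "p \<in> borel_measurable borel"
    and p_nonneg: "0 \<le> p x" and p_neg: "x < 0 \<Longrightarrow> p x = 0"
    and mu: "\<mu> = density leb_pos (\<lambda>x. ennreal (p x))" and prob: "prob_space \<mu>"
    and cube: "(\<integral>\<^sup>+x. ennreal (x * p x ^ 3) * indicator {0..} x \<partial>lborel) < \<infinity>"
begin

sublocale prob_space \<mu> by (rule prob)

text \<open>The measure is the image of the even probability density \<open>q\<close> under
  squaring. The weight x in the L^3 condition is what makes \<open>q\<close> cube integrable
  (\<open>nn_integral_q_cube\<close>).\<close>

definition q :: "real \<Rightarrow> real" where "q s = \<bar>s\<bar> * p (s\<^sup>2)"

lemma q_measurable [measurable]: "q \<in> borel_measurable borel"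
  unfolding q_def by measurable

lemma q_nonneg: "0 \<le> q s"
  by (simp add: q_def p_nonneg)

lemma q_even: "q (- s) = q s"
  by (simp add: q_def)

lemma space_mu: "space \<mu> = {0..}"
  by (simp add: mu)

lemma sets_mu: "sets \<mu> = sets (restrict_space borel {0..})"
  by (simp add: mu sets_leb_pos)

lemma measurable_mu: "h \<in> borel_measurable borel \<Longrightarrow> h \<in> borel_measurable \<mu>"
  by (subst measurable_cong_sets[OF sets_mu refl]) (rule measurable_restrict_space1)

lemma p_measurable_leb_pos: "p \<in> borel_measurable leb_pos"
  unfolding leb_pos_def by (rule measurable_restrict_space1) simp

lemma nn_integral_mu:
  fixes h :: "real \<Rightarrow> ennreal"
  assumes [measurable]: "h \<in> borel_measurable borel"
  shows "(\<integral>\<^sup>+x. h x \<partial>\<mu>) = (\<integral>\<^sup>+s. ennreal (q s) * h (s\<^sup>2) \<partial>lborel)"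
proof -
  have h: "h \<in> borel_measurable leb_pos"
    unfolding leb_pos_def by (rule measurable_restrict_space1) simp
  have "(\<integral>\<^sup>+x. h x \<partial>\<mu>) = (\<integral>\<^sup>+x. ennreal (p x) * h x \<partial>leb_pos)"
    unfolding mu using h p_measurable_leb_pos by (intro nn_integral_density) auto
  also have "\<dots> = (\<integral>\<^sup>+x. ennreal (p x) * h x * indicator {0..} x \<partial>lborel)"
    by (rule nn_integral_leb_pos)
  also have "\<dots> = (\<integral>\<^sup>+s. ennreal \<bar>s\<bar> * (ennreal (p (s\<^sup>2)) * h (s\<^sup>2)) \<partial>lborel)"
    by (rule nn_integral_square_substitution) measurable
  finally show ?thesis by (simp add: q_def ennreal_mult' mult.assoc)
qed

lemma mu_eq_distr: "\<mu> = distr (density lborel (\<lambda>s. ennreal (q s))) leb_pos (\<lambda>s. s\<^sup>2)"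
proof (rule measure_eqI)
  have m: "(\<lambda>s. s\<^sup>2) \<in> density lborel (\<lambda>s. ennreal (q s)) \<rightarrow>\<^sub>M leb_pos"
    unfolding leb_pos_def by (rule measurable_restrict_space2) (auto simp: measurable_lborel2)
  show "sets \<mu> = sets (distr (density lborel (\<lambda>s. ennreal (q s))) leb_pos (\<lambda>s. s\<^sup>2))"
    by (simp add: mu)
  fix A assume A: "A \<in> sets \<mu>"
  then have Ab[measurable]: "A \<in> sets borel" by (auto simp: sets_mu sets_restrict_space_iff)
  have "emeasure \<mu> A = (\<integral>\<^sup>+x. indicator A x \<partial>\<mu>)" using A by simp
  also have "\<dots> = (\<integral>\<^sup>+s. ennreal (q s) * indicator A (s\<^sup>2) \<partial>lborel)" by (rule nn_integral_mu) measurable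
  also have "\<dots> = (\<integral>\<^sup>+s. indicator A (s\<^sup>2) \<partial>density lborel (\<lambda>s. ennreal (q s)))"
    by (rule nn_integral_density[symmetric]) auto
  also have "\<dots> = (\<integral>\<^sup>+x. indicator A x \<partial>distr (density lborel (\<lambda>s. ennreal (q s))) leb_pos (\<lambda>s. s\<^sup>2))"
    using A by (intro nn_integral_distr[symmetric] m) (simp add: mu)
  also have "\<dots> = emeasure (distr (density lborel (\<lambda>s. ennreal (q s))) leb_pos (\<lambda>s. s\<^sup>2)) A"
    using A by (intro nn_integral_indicator) (simp add: mu)
  finally show "emeasure \<mu> A = emeasure (distr (density lborel (\<lambda>s. ennreal (q s))) leb_pos (\<lambda>s. s\<^sup>2)) A" .
qed

lemma integral_mu:
  fixes h :: "real \<Rightarrow> real"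
  assumes [measurable]: "h \<in> borel_measurable borel"
  shows "integrable \<mu> h \<longleftrightarrow> integrable lborel (\<lambda>s. q s * h (s\<^sup>2))"
    and "(LINT x|\<mu>. h x) = (LINT s|lborel. q s * h (s\<^sup>2))"
proof -
  have m: "(\<lambda>s. s\<^sup>2) \<in> density lborel (\<lambda>s. ennreal (q s)) \<rightarrow>\<^sub>M leb_pos"
    unfolding leb_pos_def by (rule measurable_restrict_space2) (auto simp: measurable_lborel2)
  have h: "h \<in> borel_measurable leb_pos"
    unfolding leb_pos_def by (rule measurable_restrict_space1) simp
  show "integrable \<mu> h \<longleftrightarrow> integrable lborel (\<lambda>s. q s * h (s\<^sup>2))"
    by (subst mu_eq_distr, subst integrable_distr_eq[OF m h], subst integrable_density) (auto simp: q_nonneg)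
  show "(LINT x|\<mu>. h x) = (LINT s|lborel. q s * h (s\<^sup>2))"
    by (subst mu_eq_distr, subst integral_distr[OF m h], subst integral_density) (auto simp: q_nonneg)
qed

lemma integral_density_mu:
  fixes h :: "real \<Rightarrow> real"
  assumes [measurable]: "h \<in> borel_measurable borel"
  shows "(LINT x|lborel. p x * h x) = (LINT x|\<mu>. h x)"
proof -
  have h: "h \<in> borel_measurable leb_pos"
    unfolding leb_pos_def by (rule measurable_restrict_space1) simp
  have "(LINT x|\<mu>. h x) = (LINT x|leb_pos. p x * h x)"
    unfolding mu using integral_density[OF h p_measurable_leb_pos] by (simp add: p_nonneg)
  also have "\<dots> = (LINT x|lborel. indicator {0..} x * (p x * h x))"
    unfolding leb_pos_def by (subst integral_restrict_space) (auto simp: set_lebesgue_integral_def)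
  also have "\<dots> = (LINT x|lborel. p x * h x)"
    by (intro Bochner_Integration.integral_cong) (auto simp: p_neg split: split_indicator)
  finally show ?thesis by simp
qed

lemma nn_integral_q: "(\<integral>\<^sup>+s. ennreal (q s) \<partial>lborel) = 1"
  using nn_integral_mu[of "\<lambda>_. 1"] emeasure_space_1 by simp

lemma nn_integral_q_cube: "(\<integral>\<^sup>+s. ennreal (q s ^ 3) \<partial>lborel) < \<infinity>"
proof -
  have "(\<integral>\<^sup>+x. ennreal (x * p x ^ 3) * indicator {0..} x \<partial>lborel) = (\<integral>\<^sup>+s. ennreal \<bar>s\<bar> * ennreal (s\<^sup>2 * p (s\<^sup>2) ^ 3) \<partial>lborel)"
    by (rule nn_integral_square_substitution) measurable
  also have "\<dots> = (\<integral>\<^sup>+s. ennreal (q s ^ 3) \<partial>lborel)"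
  proof (intro nn_integral_cong)
    fix s :: real
    have "\<bar>s\<bar> * (s\<^sup>2 * p (s\<^sup>2) ^ 3) = q s ^ 3"
    proof -
      have "\<bar>s\<bar> ^ 3 = \<bar>s\<bar> * s\<^sup>2" by (simp only: power3_eq_cube power2_eq_square mult.assoc abs_mult_self_eq)
      then show ?thesis unfolding q_def power_mult_distrib by (simp only: mult.assoc)
    qed
    then show "ennreal \<bar>s\<bar> * ennreal (s\<^sup>2 * p (s\<^sup>2) ^ 3) = ennreal (q s ^ 3)"
      by (simp add: ennreal_mult'[symmetric])
  qed
  finally show ?thesis using cube by simp
qed

text \<open>Interpolation between L^1 and L^3: q^2 is at most q or at most q^3, according to whether
  q <= 1.\<close>

lemma nn_integral_q_square: "(\<integral>\<^sup>+s. ennreal ((q s)\<^sup>2) \<partial>lborel) < \<infinity>"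
proof -
  have "(\<integral>\<^sup>+s. ennreal ((q s)\<^sup>2) \<partial>lborel) \<le> (\<integral>\<^sup>+s. ennreal (q s) + ennreal (q s ^ 3) \<partial>lborel)"
  proof (rule nn_integral_mono)
    fix s
    have "(q s)\<^sup>2 \<le> q s + q s ^ 3"
    proof (cases "q s \<le> 1")
      case True
      then have "(q s)\<^sup>2 \<le> q s ^ 1" by (intro power_decreasing) (auto simp: q_nonneg)
      then show ?thesis using q_nonneg[of s] by (simp add: add_increasing2)
    next
      case False
      then have "(q s)\<^sup>2 \<le> q s ^ 3" by (intro power_increasing) auto
      then show ?thesis using q_nonneg[of s] by (simp add: add_increasing)
    qed
    then show "ennreal ((q s)\<^sup>2) \<le> ennreal (q s) + ennreal (q s ^ 3)"
      by (simp add: ennreal_plus[symmetric] q_nonneg ennreal_leI del: ennreal_plus)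
  qed
  also have "\<dots> < \<infinity>" using nn_integral_q nn_integral_q_cube by (simp add: nn_integral_add)
  finally show ?thesis .
qed

sublocale L1_L2_function q
proof
  show "integrable lborel q"
    by (rule integrableI_nonneg) (auto simp: q_nonneg nn_integral_q)
  show "integrable lborel (\<lambda>t. (q t)\<^sup>2)"
    by (rule integrableI_nonneg) (use nn_integral_q_square in auto)
qed

text \<open>The measure is the image under squaring of an absolutely continuous one, so Lebesgue
  null sets of s, together with their reflections and the point 0, map to null sets.\<close>

lemma AE_muI:
  assumes "AE s in lborel. 0 < s \<longrightarrow> P (s\<^sup>2)"
  shows "AE x in \<mu>. P x"
proof -
  obtain N where N: "{s \<in> space lborel. \<not> (0 < s \<longrightarrow> P (s\<^sup>2))} \<subseteq> N" "emeasure lborel N = 0" "N \<in> sets lborel"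
    using AE_E[OF assms] by blast
  have [measurable]: "N \<in> sets borel" using N by simp
  have AE1: "AE s in lborel. s \<notin> N" using N by (intro AE_not_in) (auto simp: null_sets_def)
  have "(\<integral>\<^sup>+s. indicator N (- s) \<partial>lborel) = (\<integral>\<^sup>+s. indicator N s \<partial>lborel)"
    by (rule nn_integral_reflect) measurable
  also have "\<dots> = 0" using N by simp
  finally have AE2: "AE s in lborel. - s \<notin> N"
    by (subst (asm) nn_integral_0_iff_AE) (auto simp: indicator_eq_0_iff)
  have "AE x in \<mu>. \<not> (sqrt x \<in> N \<or> x = 0)"
  proof -
    have "(\<integral>\<^sup>+x. indicator {x. sqrt x \<in> N \<or> x = 0} x \<partial>\<mu>) = (\<integral>\<^sup>+s. ennreal (q s) * indicator {x. sqrt x \<in> N \<or> x = 0} (s\<^sup>2) \<partial>lborel)"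
      by (rule nn_integral_mu) measurable
    also have "\<dots> = (\<integral>\<^sup>+s. 0 \<partial>(lborel :: real measure))"
    proof (rule nn_integral_cong_AE)
      show "AE s in lborel. ennreal (q s) * indicator {x. sqrt x \<in> N \<or> x = 0} (s\<^sup>2) = 0"
        using AE1 AE2 AE_lborel_singleton[of 0]
      proof eventually_elim
        case (elim s)
        then have "sqrt (s\<^sup>2) \<notin> N" "s\<^sup>2 \<noteq> 0" by (auto simp: abs_if)
        then show ?case by simp
      qed
    qed
    finally have "(\<integral>\<^sup>+x. indicator {x. sqrt x \<in> N \<or> x = 0} x \<partial>\<mu>) = 0" by simp
    then show ?thesis
      by (subst (asm) nn_integral_0_iff_AE) (auto intro!: measurable_mu simp: indicator_eq_0_iff)
  qed
  moreover have "AE x in \<mu>. 0 \<le> x" by (rule AE_I2) (simp add: space_mu)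
  ultimately show ?thesis
  proof eventually_elim
    case (elim x)
    then have "0 < sqrt x" "sqrt x \<notin> N" by auto
    then have "sqrt x \<notin> {s \<in> space lborel. \<not> (0 < s \<longrightarrow> P (s\<^sup>2))}" using N(1) by blast
    then have "0 < sqrt x \<longrightarrow> P ((sqrt x)\<^sup>2)" unfolding mem_Collect_eq space_lborel space_borel by blast
    then show ?case using elim by simp
  qed
qed

lemma conj_poisson_odd:
  assumes "y > 0"
  shows "Re (F y (- s)) = - Re (F y s)"
proof -
  have "Re (F y (- s)) = (LINT t|lborel. q (- t) * ((- s - - t) / ((- s - - t)\<^sup>2 + y\<^sup>2)))"
    unfolding Re_F[OF assms] by (subst lborel_integral_real_affine[where c="-1" and t=0]) auto
  also have "\<dots> = (LINT t|lborel. - (q t * ((s - t) / ((s - t)\<^sup>2 + y\<^sup>2))))"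
  proof (intro Bochner_Integration.integral_cong refl)
    fix t
    have "- s - - t = - (s - t)" by simp
    then show "q (- t) * ((- s - - t) / ((- s - - t)\<^sup>2 + y\<^sup>2)) = - (q t * ((s - t) / ((s - t)\<^sup>2 + y\<^sup>2)))"
      unfolding q_even by (simp only: power2_minus minus_divide_left[symmetric] mult_minus_right)
  qed
  finally show ?thesis by (simp add: Re_F[OF assms])
qed

text \<open>Since s / (s^2 - t^2) is the mean of 1 / (s - t) and 1 / (s + t) and \<open>q\<close> is
  even, the left integral is that of q t / (s - t) over
  \<open>2 * s * d < \<bar>s\<^sup>2 - t\<^sup>2\<bar>\<close>, where 2 * s * d is the first-order
  image of d under squaring. Only \<open>truncation_error\<close> remains. The constant 10 is 5 from
  each Poisson kernel, the one at s + t being reflected to s - t.\<close>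

lemma truncated_hilbert_half_line:
  assumes s: "s > 0" and d: "0 < d" "d \<le> s / 4"
  shows "ennreal \<bar>s * (LINT t:{t. 2 * s * d < \<bar>s\<^sup>2 - t\<bar>}|lborel. p t / (s\<^sup>2 - t)) - truncated_hilbert d s\<bar>
    \<le> 10 * (\<integral>\<^sup>+t. ennreal (poisson_ker d (s - t) * \<bar>q t - q s\<bar>) \<partial>lborel) + ennreal (q s * (8 * d / s))"
proof -
  define E :: "real \<Rightarrow> real" where "E t = indicator {t. 2 * s * d < \<bar>s\<^sup>2 - t\<^sup>2\<bar>} t" for t
  have [measurable]: "E \<in> borel_measurable borel" unfolding E_def[abs_def] by measurable
  have sd: "0 < 2 * s * d" using s d by simp
  have E1: "E t = 1 \<and> 2 * s * d < \<bar>s\<^sup>2 - t\<^sup>2\<bar>" if "E t \<noteq> 0" for t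
    using that by (auto simp: E_def indicator_def split: if_splits)
  have Eint: "integrable lborel (\<lambda>t. q t * (E t / (s\<^sup>2 - t\<^sup>2) * c t))"
    if [measurable]: "c \<in> borel_measurable borel" and c: "\<And>t. \<bar>E t / (s\<^sup>2 - t\<^sup>2) * c t\<bar> \<le> C" for c :: "real \<Rightarrow> real" and C
  proof (rule Bochner_Integration.integrable_bound[of _ "\<lambda>t. q t * C"])
    show "integrable lborel (\<lambda>t. q t * C)" using L1 by (rule integrable_mult_left)
    show "AE t in lborel. norm (q t * (E t / (s\<^sup>2 - t\<^sup>2) * c t)) \<le> norm (q t * C)"
    proof (rule AE_I2)
      fix t
      have "\<bar>q t\<bar> * \<bar>E t / (s\<^sup>2 - t\<^sup>2) * c t\<bar> \<le> \<bar>q t\<bar> * \<bar>C\<bar>"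
        using c[of t] by (intro mult_left_mono) auto
      then show "norm (q t * (E t / (s\<^sup>2 - t\<^sup>2) * c t)) \<le> norm (q t * C)" by (simp only: real_norm_def abs_mult)
    qed
  qed measurable
  have Eb: "\<bar>E t / (s\<^sup>2 - t\<^sup>2)\<bar> \<le> 1 / (2 * s * d)" for t
  proof (cases "2 * s * d < \<bar>s\<^sup>2 - t\<^sup>2\<bar>")
    case True
    then have "1 / \<bar>s\<^sup>2 - t\<^sup>2\<bar> \<le> 1 / (2 * s * d)"
      using sd by (intro divide_left_mono) (simp_all only: mult_pos_pos less_trans less_imp_le zero_le_one)
    then show ?thesis using True by (simp add: E_def)
  qed (use sd in \<open>simp add: E_def\<close>)
  have is': "integrable lborel (\<lambda>t. q t * (E t / (s\<^sup>2 - t\<^sup>2) * s))"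
  proof (rule Eint)
    fix t show "\<bar>E t / (s\<^sup>2 - t\<^sup>2) * s\<bar> \<le> 1 / (2 * s * d) * s"
      using Eb[of t] s by (simp only: abs_mult[of _ s] abs_of_pos[OF s]) (rule mult_right_mono, auto)
  qed measurable
  have fac: "s\<^sup>2 - t\<^sup>2 = (s - t) * (s + t)" for t by (simp add: power2_eq_square algebra_simps)
  have Es: "E t / (s - t) = E t / (s\<^sup>2 - t\<^sup>2) * (s + t)" for t
  proof (cases "E t = 0")
    case False
    then have "s\<^sup>2 - t\<^sup>2 \<noteq> 0" using sd E1[of t] by auto
    then show ?thesis unfolding fac by simp
  qed simp
  have iE: "integrable lborel (\<lambda>t. q t * (E t / (s - t)))"
    unfolding Es
  proof (rule Eint)
    fix t
    show "\<bar>E t / (s\<^sup>2 - t\<^sup>2) * (s + t)\<bar> \<le> 1 / (2 * s * d) * (4 * s) + 2 / s"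
    proof (cases "E t = 0")
      case False
      then have E1t: "E t = 1" using E1[of t] by auto
      show ?thesis
      proof (cases "\<bar>t\<bar> \<le> 3 * s")
        case True
        have "\<bar>E t / (s\<^sup>2 - t\<^sup>2)\<bar> * \<bar>s + t\<bar> \<le> 1 / (2 * s * d) * (4 * s)"
          using True s d by (intro mult_mono Eb) auto
        then show ?thesis using s by (simp add: abs_mult add_increasing2)
      next
        case False
        then have "s / 2 \<le> \<bar>s - t\<bar>" using s by linarith
        then have "1 / \<bar>s - t\<bar> \<le> 1 / (s / 2)" using s by (intro divide_left_mono mult_pos_pos) auto
        moreover have "E t / (s\<^sup>2 - t\<^sup>2) * (s + t) = 1 / (s - t)" using Es[of t] E1t by simp
        moreover have "0 \<le> 1 / (2 * s * d) * (4 * s)" using s d by simp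
        ultimately show ?thesis by (simp add: add_increasing)
      qed
    qed (use s d in \<open>simp add: add_nonneg_nonneg\<close>)
  qed measurable
  have "s * (LINT t:{t. 2 * s * d < \<bar>s\<^sup>2 - t\<bar>}|lborel. p t / (s\<^sup>2 - t))
     = s * (LINT t|lborel. p t * (indicator {t. 2 * s * d < \<bar>s\<^sup>2 - t\<bar>} t / (s\<^sup>2 - t)))"
    unfolding set_lebesgue_integral_def by (simp add: mult_ac)
  also have "\<dots> = s * (LINT t|lborel. q t * (E t / (s\<^sup>2 - t\<^sup>2)))"
  proof -
    have "(LINT t|lborel. p t * (indicator {t. 2 * s * d < \<bar>s\<^sup>2 - t\<bar>} t / (s\<^sup>2 - t)))
       = (LINT x|\<mu>. indicator {t. 2 * s * d < \<bar>s\<^sup>2 - t\<bar>} x / (s\<^sup>2 - x))"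
      by (rule integral_density_mu) measurable
    also have "\<dots> = (LINT t|lborel. q t * (indicator {t. 2 * s * d < \<bar>s\<^sup>2 - t\<bar>} (t\<^sup>2) / (s\<^sup>2 - t\<^sup>2)))"
      by (rule integral_mu(2)) measurable
    finally show ?thesis by (simp add: E_def indicator_def)
  qed
  also have "\<dots> = (LINT t|lborel. q t * (E t / (s\<^sup>2 - t\<^sup>2) * s))"
    by (simp add: mult_ac flip: integral_mult_right_zero)
  also have "\<dots> = (LINT t|lborel. q t * (E t / (s - t)))"
  proof -
    have Eeven: "E (- t) = E t" for t by (simp add: E_def indicator_def)
    have "(LINT t|lborel. q t * (E t / (s - t))) = (LINT t|lborel. q (- t) * (E (- t) / (s - - t)))"
      by (subst lborel_integral_real_affine[where c="-1" and t=0]) auto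
    then have r: "(LINT t|lborel. q t * (E t / (s - t))) = (LINT t|lborel. q t * (E t / (s + t)))"
      by (simp add: q_even Eeven)
    have iE': "integrable lborel (\<lambda>t. q t * (E t / (s + t)))"
    proof -
      have "integrable lborel (\<lambda>t. q (0 + (-1) * t) * (E (0 + (-1) * t) / (s - (0 + (-1) * t))))"
        by (rule lborel_integrable_real_affine[OF iE]) simp
      then show ?thesis by (simp add: q_even Eeven)
    qed
    have "q t * (E t / (s\<^sup>2 - t\<^sup>2) * s) = 1 / 2 * (q t * (E t / (s - t)) + q t * (E t / (s + t)))" for t
    proof (cases "E t = 0")
      case False
      then have nz: "(s - t) * (s + t) \<noteq> 0" unfolding fac[symmetric] using sd E1[of t] by auto
      then have "s - t \<noteq> 0" "s + t \<noteq> 0" by auto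
      then have "1 / (s - t) + 1 / (s + t) = 2 * s / ((s - t) * (s + t))" by (simp add: add_frac_eq)
      then have e: "E t / (s - t) + E t / (s + t) = E t * (2 * s / ((s - t) * (s + t)))"
        by (metis (no_types, opaque_lifting) distrib_left mult.right_neutral times_divide_eq_right)
      have "q t * (E t / (s\<^sup>2 - t\<^sup>2) * s) = 1 / 2 * (q t * (E t * (2 * s / ((s - t) * (s + t)))))"
        unfolding fac by simp
      then show ?thesis by (simp only: e distrib_left[symmetric])
    qed simp
    then have "(LINT t|lborel. q t * (E t / (s\<^sup>2 - t\<^sup>2) * s)) = (LINT t|lborel. 1 / 2 * (q t * (E t / (s - t)) + q t * (E t / (s + t))))"
      by (simp only:)
    also have "\<dots> = 1 / 2 * ((LINT t|lborel. q t * (E t / (s - t))) + (LINT t|lborel. q t * (E t / (s + t))))"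
      using iE iE' by (subst integral_mult_right_zero, subst Bochner_Integration.integral_add) auto
    finally show ?thesis unfolding r by simp
  qed
  finally have lhs: "s * (LINT t:{t. 2 * s * d < \<bar>s\<^sup>2 - t\<bar>}|lborel. p t / (s\<^sup>2 - t)) = (LINT t|lborel. q t * (E t / (s - t)))" .
  have iT: "integrable lborel (\<lambda>t. q t * (indicator {t. d < \<bar>s - t\<bar>} t / (s - t)))"
    using truncated_hilbert_integrable[OF d(1), of s] by (simp add: set_integrable_def mult_ac)
  have "s * (LINT t:{t. 2 * s * d < \<bar>s\<^sup>2 - t\<bar>}|lborel. p t / (s\<^sup>2 - t)) - truncated_hilbert d s
     = (LINT t|lborel. q t * (E t / (s - t))) - (LINT t|lborel. q t * (indicator {t. d < \<bar>s - t\<bar>} t / (s - t)))"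
    unfolding lhs by (simp add: truncated_hilbert_def set_lebesgue_integral_def mult_ac)
  also have "\<dots> = (LINT t|lborel. q t * truncation_error s d t)"
    by (subst Bochner_Integration.integral_diff[OF iE iT, symmetric])
      (intro Bochner_Integration.integral_cong refl, simp add: truncation_error_def E_def diff_divide_distrib right_diff_distrib)
  finally have diff: "s * (LINT t:{t. 2 * s * d < \<bar>s\<^sup>2 - t\<bar>}|lborel. p t / (s\<^sup>2 - t)) - truncated_hilbert d s
     = (LINT t|lborel. q t * truncation_error s d t)" .
  have iq: "integrable lborel (\<lambda>t. q t * truncation_error s d t)"
    using Bochner_Integration.integrable_diff[OF iE iT]
    by (simp add: truncation_error_def E_def diff_divide_distrib right_diff_distrib)
  have pos: "0 \<le> poisson_ker d v" for v using d by (simp add: poisson_ker_nonneg)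
  have "ennreal \<bar>LINT t|lborel. q t * truncation_error s d t\<bar> \<le> (\<integral>\<^sup>+t. ennreal \<bar>q t * truncation_error s d t\<bar> \<partial>lborel)"
    using integral_norm_bound_ennreal[OF iq] by simp
  also have "\<dots> \<le> (\<integral>\<^sup>+t. (5 * ennreal (poisson_ker d (s - t) * \<bar>q t - q s\<bar>) + 5 * ennreal (poisson_ker d (s + t) * \<bar>q t - q s\<bar>))
      + ennreal (q s) * ennreal \<bar>truncation_error s d t\<bar> \<partial>lborel)"
  proof (rule nn_integral_mono)
    fix t
    have "\<bar>q t * truncation_error s d t\<bar> \<le> (\<bar>q t - q s\<bar> + q s) * \<bar>truncation_error s d t\<bar>"
      unfolding abs_mult using q_nonneg[of s] q_nonneg[of t] by (intro mult_right_mono) auto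
    also have "\<dots> = \<bar>truncation_error s d t\<bar> * \<bar>q t - q s\<bar> + q s * \<bar>truncation_error s d t\<bar>"
      by (simp add: algebra_simps)
    also have "\<dots> \<le> 5 * (poisson_ker d (s - t) + poisson_ker d (s + t)) * \<bar>q t - q s\<bar> + q s * \<bar>truncation_error s d t\<bar>"
      by (intro add_right_mono mult_right_mono truncation_error_bounds(1) d) simp
    finally have "ennreal \<bar>q t * truncation_error s d t\<bar>
      \<le> ennreal ((5 * (poisson_ker d (s - t) * \<bar>q t - q s\<bar>) + 5 * (poisson_ker d (s + t) * \<bar>q t - q s\<bar>)) + q s * \<bar>truncation_error s d t\<bar>)"
      by (intro ennreal_leI) (simp add: algebra_simps)
    also have "\<dots> = (5 * ennreal (poisson_ker d (s - t) * \<bar>q t - q s\<bar>) + 5 * ennreal (poisson_ker d (s + t) * \<bar>q t - q s\<bar>))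
      + ennreal (q s) * ennreal \<bar>truncation_error s d t\<bar>"
      using pos[of "s - t"] pos[of "s + t"] q_nonneg[of s] by (simp add: ennreal_mult')
    finally show "ennreal \<bar>q t * truncation_error s d t\<bar> \<le> (5 * ennreal (poisson_ker d (s - t) * \<bar>q t - q s\<bar>) + 5 * ennreal (poisson_ker d (s + t) * \<bar>q t - q s\<bar>))
      + ennreal (q s) * ennreal \<bar>truncation_error s d t\<bar>" .
  qed
  also have "\<dots> = (5 * (\<integral>\<^sup>+t. ennreal (poisson_ker d (s - t) * \<bar>q t - q s\<bar>) \<partial>lborel) + 5 * (\<integral>\<^sup>+t. ennreal (poisson_ker d (s + t) * \<bar>q t - q s\<bar>) \<partial>lborel))
      + ennreal (q s) * (\<integral>\<^sup>+t. ennreal \<bar>truncation_error s d t\<bar> \<partial>lborel)"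
    by (simp add: nn_integral_add nn_integral_cmult)
  also have "(\<integral>\<^sup>+t. ennreal (poisson_ker d (s + t) * \<bar>q t - q s\<bar>) \<partial>lborel) = (\<integral>\<^sup>+t. ennreal (poisson_ker d (s - t) * \<bar>q t - q s\<bar>) \<partial>lborel)"
    using nn_integral_reflect[of "\<lambda>t. ennreal (poisson_ker d (s + t) * \<bar>q t - q s\<bar>)"] by (simp add: q_even)
  also have "5 * X + 5 * X = 10 * X" for X :: ennreal
    by (simp flip: distrib_right)
  also have "ennreal (q s) * (\<integral>\<^sup>+t. ennreal \<bar>truncation_error s d t\<bar> \<partial>lborel) \<le> ennreal (q s * (8 * d / s))"
    unfolding ennreal_mult'[OF q_nonneg] by (intro mult_left_mono nn_integral_truncation_error d) simp
  finally show ?thesis unfolding diff by (meson add_left_mono order_trans)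
qed


text \<open>At common points of convergence and of vanishing Poisson oscillation of
  \<open>q\<close>, both truncations have the limit g s. The change of scale from d to 2 * s * d is
  invertible near 0, so the principal value of p at s^2 exists and equals g s / s.\<close>

lemma hilbert_transform_AE:
  assumes conv: "AE s in lborel. ((\<lambda>y. Re (F y s)) \<longlongrightarrow> g s) (at_right 0)"
  shows "AE s in lborel. 0 < s \<longrightarrow> s * hilbert_transform p (s\<^sup>2) = g s"
  using conv AE_poisson_lebesgue_point_f
proof eventually_elim
  case (elim s)
  show ?case
  proof
    assume s: "0 < s"
    define T where "T \<epsilon> = (LINT t:{t. \<epsilon> < \<bar>s\<^sup>2 - t\<bar>}|lborel. p t / (s\<^sup>2 - t))" for \<epsilon>
    define D where "D d = s * T (2 * s * d) - truncated_hilbert d s" for d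
    have "((\<lambda>d. 10 * (\<integral>\<^sup>+t. ennreal (poisson_ker d (s - t) * \<bar>q t - q s\<bar>) \<partial>lborel) + ennreal (q s * (8 * d / s))) \<longlongrightarrow> 10 * 0 + ennreal (q s * (8 * 0 / s))) (at_right 0)"
      using s by (intro tendsto_add ennreal_tendsto_cmult elim(2) tendsto_ennrealI tendsto_intros) auto
    then have up: "((\<lambda>d. 10 * (\<integral>\<^sup>+t. ennreal (poisson_ker d (s - t) * \<bar>q t - q s\<bar>) \<partial>lborel) + ennreal (q s * (8 * d / s))) \<longlongrightarrow> 0) (at_right 0)"
      by simp
    have small: "eventually (\<lambda>d. 0 < d \<and> d \<le> s / 4) (at_right 0)"
      unfolding eventually_at_right_field using s by (intro exI[of _ "s / 4"]) auto
    have le: "eventually (\<lambda>d. ennreal \<bar>D d\<bar> \<le> 10 * (\<integral>\<^sup>+t. ennreal (poisson_ker d (s - t) * \<bar>q t - q s\<bar>) \<partial>lborel) + ennreal (q s * (8 * d / s))) (at_right 0)"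
      using small by (rule eventually_mono) (simp only: D_def T_def truncated_hilbert_half_line[OF s])
    have "((\<lambda>d. ennreal \<bar>D d\<bar>) \<longlongrightarrow> 0) (at_right 0)"
      by (rule tendsto_sandwich[OF always_eventually le tendsto_const up]) simp
    then have "((\<lambda>d. \<bar>D d\<bar>) \<longlongrightarrow> 0) (at_right 0)"
      by (simp add: tendsto_ennreal_iff[of _ _ 0, simplified])
    then have "(D \<longlongrightarrow> 0) (at_right 0)" by (simp only: tendsto_rabs_zero_iff)
    from tendsto_add[OF this truncated_hilbert_tendsto[OF elim(2,1)]]
    have "((\<lambda>d. s * T (2 * s * d)) \<longlongrightarrow> g s) (at_right 0)" by (simp add: D_def)
    then have "((\<lambda>d. 1 / s * (s * T (2 * s * d))) \<longlongrightarrow> 1 / s * g s) (at_right 0)"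
      by (rule tendsto_mult[OF tendsto_const])
    then have lim: "((\<lambda>d. T (2 * s * d)) \<longlongrightarrow> g s / s) (at_right 0)" using s by simp
    have fl: "filterlim (\<lambda>\<epsilon>. \<epsilon> / (2 * s)) (at_right 0) (at_right 0)"
      unfolding filterlim_at
    proof
      show "eventually (\<lambda>\<epsilon>. \<epsilon> / (2 * s) \<in> {0<..} \<and> \<epsilon> / (2 * s) \<noteq> 0) (at_right 0)"
        using eventually_at_right_less[of 0] by (rule eventually_mono) (use s in simp)
      have "((\<lambda>\<epsilon>. \<epsilon> / (2 * s)) \<longlongrightarrow> 0 / (2 * s)) (at_right 0)"
        using s by (intro tendsto_intros) auto
      then show "((\<lambda>\<epsilon>. \<epsilon> / (2 * s)) \<longlongrightarrow> 0) (at_right 0)" by simp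
    qed
    have "((\<lambda>\<epsilon>. T \<epsilon>) \<longlongrightarrow> g s / s) (at_right 0)"
      using filterlim_compose[OF lim fl] s by simp
    then have "hilbert_transform p (s\<^sup>2) = g s / s"
      unfolding hilbert_transform_def T_def by (intro tendsto_Lim) auto
    then show "s * hilbert_transform p (s\<^sup>2) = g s" using s by simp
  qed
qed

lemma AE_lborel_reflect:
  assumes "AE s in lborel. P (s::real)"
  shows "AE s in lborel. P (- s)"
proof -
  obtain N where N: "{s \<in> space lborel. \<not> P s} \<subseteq> N" "emeasure lborel N = 0" "N \<in> sets lborel"
    using AE_E[OF assms] by blast
  have [measurable]: "N \<in> sets borel" using N by simp
  have "(\<integral>\<^sup>+s. indicator N (- s) \<partial>lborel) = (\<integral>\<^sup>+s. indicator N s \<partial>lborel)"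
    by (rule nn_integral_reflect) measurable
  also have "\<dots> = 0" using N by simp
  finally have "AE s in lborel. - s \<notin> N"
    by (subst (asm) nn_integral_0_iff_AE) (auto simp: indicator_eq_0_iff)
  then show ?thesis by (rule eventually_mono) (use N(1) in auto)
qed

text \<open>For the odd extension of \<open>\<tau>(s\<^sup>2)\<close> the difference quotients at \<open>(s, t)\<close> and \<open>(s, - t)\<close>
  average to the quotient of \<open>\<tau>(x) sqrt x\<close> at \<open>(s\<^sup>2, t\<^sup>2)\<close>.\<close>

lemma nn_integral_symmetrized_quotient:
  fixes \<tau> :: "real \<Rightarrow> real"
  assumes [measurable]: "\<tau> \<in> borel_measurable borel" and nn: "\<And>x. 0 \<le> \<tau> x"
    and mono: "\<And>x y. 0 \<le> x \<Longrightarrow> x \<le> y \<Longrightarrow> \<tau> x \<le> \<tau> y"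
  defines "\<phi> \<equiv> \<lambda>s. if 0 \<le> s then \<tau> (s\<^sup>2) else - \<tau> (s\<^sup>2)"
  shows "(\<integral>\<^sup>+p. ennreal ((\<phi> (fst p) - \<phi> (snd p)) / (fst p - snd p) * (q (fst p) * q (snd p))) \<partial>(lborel \<Otimes>\<^sub>M lborel))
    = (\<integral>\<^sup>+x. \<integral>\<^sup>+y. ennreal ((\<tau> x * sqrt x - \<tau> y * sqrt y) / (x - y)) \<partial>\<mu> \<partial>\<mu>)"
proof -
  have [measurable]: "\<phi> \<in> borel_measurable borel" unfolding \<phi>_def by measurable
  have phi_mono: "mono \<phi>"
  proof (rule monoI)
    fix s t :: real assume st: "s \<le> t"
    consider "0 \<le> s" | "s < 0" "0 \<le> t" | "t < 0" using st by linarith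
    then show "\<phi> s \<le> \<phi> t"
    proof cases
      case 1
      then show ?thesis using st mono[of "s\<^sup>2" "t\<^sup>2"] by (auto simp: \<phi>_def power_mono)
    next
      case 2
      then show ?thesis using nn[of "s\<^sup>2"] nn[of "t\<^sup>2"] by (simp add: \<phi>_def)
    next
      case 3
      have "(- t)\<^sup>2 \<le> (- s)\<^sup>2" using 3 st by (intro power_mono) auto
      then show ?thesis using 3 st mono[of "t\<^sup>2" "s\<^sup>2"] by (auto simp: \<phi>_def)
    qed
  qed
  define k where "k s t = (\<phi> s - \<phi> t) / (s - t)" for s t
  have [measurable]: "(\<lambda>p. k (fst p) (snd p)) \<in> borel_measurable (borel \<Otimes>\<^sub>M borel)" unfolding k_def by measurable
  have k_nn: "0 \<le> k s t" for s t
    unfolding k_def using monoD[OF phi_mono, of s t] monoD[OF phi_mono, of t s] by (cases "s \<le> t") (auto intro: divide_nonpos_nonpos)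
  define K where "K x y = (\<tau> x * sqrt x - \<tau> y * sqrt y) / (x - y)" for x y
  have [measurable]: "(\<lambda>p. K (fst p) (snd p)) \<in> borel_measurable (borel \<Otimes>\<^sub>M borel)" unfolding K_def by measurable
  have avg: "k s t + k s (- t) = 2 * K (s\<^sup>2) (t\<^sup>2)" if "t \<noteq> s" "t \<noteq> - s" "s \<noteq> 0" "t \<noteq> 0" for s t
  proof -
    have abs: "\<phi> u = sgn u * \<tau> (u\<^sup>2)" if "u \<noteq> 0" for u using that by (auto simp: \<phi>_def sgn_if)
    have abs': "sqrt (u\<^sup>2) = sgn u * u" for u :: real by (simp add: sgn_if)
    have nz: "s - t \<noteq> 0" "s + t \<noteq> 0" using that by auto
    define a b where "a = sgn s * \<tau> (s\<^sup>2)" and "b = sgn t * \<tau> (t\<^sup>2)"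
    have "k s t + k s (- t) = (a - b) / (s - t) + (a + b) / (s + t)"
      using that unfolding k_def by (simp add: abs a_def b_def sgn_minus)
    also have "\<dots> = 2 * (a * s - b * t) / ((s - t) * (s + t))"
      using nz by (simp add: add_frac_eq) (simp add: algebra_simps)
    also have "(s - t) * (s + t) = s\<^sup>2 - t\<^sup>2" by (simp add: power2_eq_square algebra_simps)
    also have "2 * (a * s - b * t) / (s\<^sup>2 - t\<^sup>2) = 2 * K (s\<^sup>2) (t\<^sup>2)"
      unfolding K_def abs' a_def b_def by (simp add: mult_ac)
    finally show ?thesis .
  qed
  have "(\<integral>\<^sup>+p. ennreal (k (fst p) (snd p) * (q (fst p) * q (snd p))) \<partial>(lborel \<Otimes>\<^sub>M lborel))
      = (\<integral>\<^sup>+s. \<integral>\<^sup>+t. ennreal (q s) * (ennreal (q t) * ennreal (k s t)) \<partial>lborel \<partial>lborel)"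
    by (subst lborel.nn_integral_fst[symmetric]) (auto simp: ennreal_mult'' k_nn q_nonneg mult_ac intro!: nn_integral_cong)
  also have "\<dots> = (\<integral>\<^sup>+s. ennreal (q s) * (\<integral>\<^sup>+y. ennreal (K (s\<^sup>2) y) \<partial>\<mu>) \<partial>lborel)"
  proof (rule nn_integral_cong_AE, use AE_lborel_singleton[of 0] in \<open>rule eventually_mono\<close>)
    fix s :: real assume s: "s \<noteq> 0"
    have [measurable]: "(\<lambda>t. k s t) \<in> borel_measurable borel" "(\<lambda>y. K (s\<^sup>2) y) \<in> borel_measurable borel"
      unfolding k_def K_def by measurable
    have "2 * (\<integral>\<^sup>+t. ennreal (q t) * ennreal (k s t) \<partial>lborel)
      = (\<integral>\<^sup>+t. ennreal (q t) * ennreal (k s t) \<partial>lborel) + (\<integral>\<^sup>+t. ennreal (q (- t)) * ennreal (k s (- t)) \<partial>lborel)"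
      using nn_integral_reflect[of "\<lambda>t. ennreal (q t) * ennreal (k s t)"] by (simp add: mult_2)
    also have "\<dots> = (\<integral>\<^sup>+t. ennreal (q t) * ennreal (k s t) + ennreal (q t) * ennreal (k s (- t)) \<partial>lborel)"
      by (subst nn_integral_add) (auto simp: q_even)
    also have "\<dots> = (\<integral>\<^sup>+t. 2 * (ennreal (q t) * ennreal (K (s\<^sup>2) (t\<^sup>2))) \<partial>lborel)"
    proof (rule nn_integral_cong_AE)
      show "AE t in lborel. ennreal (q t) * ennreal (k s t) + ennreal (q t) * ennreal (k s (- t)) = 2 * (ennreal (q t) * ennreal (K (s\<^sup>2) (t\<^sup>2)))"
        using AE_lborel_singleton[of s] AE_lborel_singleton[of "- s"] AE_lborel_singleton[of 0]
      proof eventually_elim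
        case (elim t)
        have "ennreal (k s t) + ennreal (k s (- t)) = ennreal (2 * K (s\<^sup>2) (t\<^sup>2))"
          using avg[OF elim(1,2) s elim(3)] by (simp add: k_nn flip: ennreal_plus)
        then show ?case by (simp add: ennreal_mult' distrib_left[symmetric] mult.left_commute)
      qed
    qed
    also have "\<dots> = 2 * (\<integral>\<^sup>+t. ennreal (q t) * ennreal (K (s\<^sup>2) (t\<^sup>2)) \<partial>lborel)"
      by (rule nn_integral_cmult) measurable
    also have "(\<integral>\<^sup>+t. ennreal (q t) * ennreal (K (s\<^sup>2) (t\<^sup>2)) \<partial>lborel) = (\<integral>\<^sup>+y. ennreal (K (s\<^sup>2) y) \<partial>\<mu>)"
      by (rule nn_integral_mu[symmetric]) measurable
    finally have "(\<integral>\<^sup>+t. ennreal (q t) * ennreal (k s t) \<partial>lborel) = (\<integral>\<^sup>+y. ennreal (K (s\<^sup>2) y) \<partial>\<mu>)"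
      by (simp add: ennreal_mult_cancel_left)
    then show "(\<integral>\<^sup>+t. ennreal (q s) * (ennreal (q t) * ennreal (k s t)) \<partial>lborel) = ennreal (q s) * (\<integral>\<^sup>+y. ennreal (K (s\<^sup>2) y) \<partial>\<mu>)"
      by (simp add: nn_integral_cmult)
  qed
  also have "\<dots> = (\<integral>\<^sup>+x. \<integral>\<^sup>+y. ennreal (K x y) \<partial>\<mu> \<partial>\<mu>)"
  proof (rule nn_integral_mu[symmetric])
    have "(\<lambda>x. \<integral>\<^sup>+t. ennreal (q t) * ennreal (K x (t\<^sup>2)) \<partial>lborel) \<in> borel_measurable borel"
      unfolding K_def by measurable
    moreover have "(\<integral>\<^sup>+t. ennreal (q t) * ennreal (K x (t\<^sup>2)) \<partial>lborel) = (\<integral>\<^sup>+y. ennreal (K x y) \<partial>\<mu>)" for x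
    proof (rule nn_integral_mu[symmetric])
      show "(\<lambda>y. ennreal (K x y)) \<in> borel_measurable borel" unfolding K_def by measurable
    qed
    ultimately show "(\<lambda>x. \<integral>\<^sup>+y. ennreal (K x y) \<partial>\<mu>) \<in> borel_measurable borel" by simp
  qed
  finally show ?thesis unfolding k_def K_def .
qed

text \<open>H x is g (sqrt x) for the L^2 boundary function g. Unlike
  \<open>hilbert_transform p\<close>, whose \<open>Lim\<close> is controlled only where the limit
  exists, this H is Borel on the whole line. Almost everywhere oddness of g matches the odd
  extension of \<open>\<tau>\<close>, so \<open>hilbert_pairing\<close> on the line becomes the
  pairing on the half-line.\<close>

lemma hilbert_transform_exists:
  obtains H :: "real \<Rightarrow> real" where "H \<in> borel_measurable borel"
    "AE x in \<mu>. H x = sqrt x * hilbert_transform p x"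
    "\<And>\<tau> B. \<tau> \<in> borel_measurable borel \<Longrightarrow> (\<And>x. 0 \<le> \<tau> x) \<Longrightarrow> (\<And>x. \<tau> x \<le> B) \<Longrightarrow>
      (\<And>x y. 0 \<le> x \<Longrightarrow> x \<le> y \<Longrightarrow> \<tau> x \<le> \<tau> y) \<Longrightarrow>
      integrable \<mu> (\<lambda>x. \<tau> x * H x) \<and> 0 \<le> (LINT x|\<mu>. \<tau> x * H x) \<and>
      ennreal (2 * (LINT x|\<mu>. \<tau> x * H x)) = (\<integral>\<^sup>+x. \<integral>\<^sup>+y. ennreal ((\<tau> x * sqrt x - \<tau> y * sqrt y) / (x - y)) \<partial>\<mu> \<partial>\<mu>)"
proof -
  obtain g Y where g[measurable]: "g \<in> borel_measurable borel" and Y: "\<And>m. Y m > 0" "Y \<longlonglongrightarrow> 0"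
    and lim: "(\<lambda>m. \<integral>\<^sup>+s. ennreal ((Re (F (Y m) s) - g s)\<^sup>2) \<partial>lborel) \<longlonglongrightarrow> 0"
    and g2: "(\<integral>\<^sup>+s. ennreal ((g s)\<^sup>2) \<partial>lborel) < \<infinity>"
    by (rule conj_poisson_L2_limit) blast
  note conv = conj_poisson_AE_tendsto[OF g Y lim g2]
  have odd: "AE s in lborel. g (- s) = - g s"
    using conv AE_lborel_reflect[OF conv]
  proof eventually_elim
    case (elim s)
    have "((\<lambda>y. Re (F y (- s))) \<longlongrightarrow> - g s) (at_right 0)"
      by (rule Lim_transform_eventually[OF tendsto_minus[OF elim(1)]])
        (rule eventually_mono[OF eventually_at_right_less[of 0]], rule conj_poisson_odd[symmetric])
    with tendsto_unique[OF _ elim(2)] show ?case by simp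
  qed
  define H where "H x = g (sqrt x)" for x
  have H[measurable]: "H \<in> borel_measurable borel" unfolding H_def by measurable
  have eq: "AE x in \<mu>. H x = sqrt x * hilbert_transform p x"
  proof (rule AE_muI)
    show "AE s in lborel. 0 < s \<longrightarrow> H (s\<^sup>2) = sqrt (s\<^sup>2) * hilbert_transform p (s\<^sup>2)"
      using hilbert_transform_AE[OF conv] by (rule eventually_mono) (simp add: H_def)
  qed
  show thesis
  proof (rule that[OF H eq])
    fix \<tau> :: "real \<Rightarrow> real" and B :: real
    assume t[measurable]: "\<tau> \<in> borel_measurable borel" and nn: "\<And>x. 0 \<le> \<tau> x" and B: "\<And>x. \<tau> x \<le> B"
      and mono: "\<And>x y. 0 \<le> x \<Longrightarrow> x \<le> y \<Longrightarrow> \<tau> x \<le> \<tau> y"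
    define \<phi> where "\<phi> = (\<lambda>s. if 0 \<le> s then \<tau> (s\<^sup>2) else - \<tau> (s\<^sup>2))"
    have phi[measurable]: "\<phi> \<in> borel_measurable borel" unfolding \<phi>_def by measurable
    have phi_mono: "mono \<phi>"
    proof (rule monoI)
      fix s t :: real assume st: "s \<le> t"
      consider "0 \<le> s" | "s < 0" "0 \<le> t" | "t < 0" using st by linarith
      then show "\<phi> s \<le> \<phi> t"
      proof cases
        case 1
        then show ?thesis using st mono[of "s\<^sup>2" "t\<^sup>2"] by (auto simp: \<phi>_def power_mono)
      next
        case 2
        then show ?thesis using nn[of "s\<^sup>2"] nn[of "t\<^sup>2"] by (simp add: \<phi>_def)
      next
        case 3
        have "(- t)\<^sup>2 \<le> (- s)\<^sup>2" using 3 st by (intro power_mono) auto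
        then show ?thesis using 3 st mono[of "t\<^sup>2" "s\<^sup>2"] by (auto simp: \<phi>_def)
      qed
    qed
    have bdd: "\<bar>\<phi> s\<bar> \<le> B" for s using B[of "s\<^sup>2"] nn[of "s\<^sup>2"] by (simp add: \<phi>_def)
    note pair = hilbert_pairing[OF g Y lim g2 q_nonneg phi phi_mono bdd]
    have ae: "AE s in lborel. q s * (\<tau> (s\<^sup>2) * H (s\<^sup>2)) = \<phi> s * q s * g s"
      using odd
    proof eventually_elim
      case (elim s)
      show ?case
      proof (cases "0 \<le> s")
        case False
        then have "H (s\<^sup>2) = - g s" using elim by (simp add: H_def)
        then show ?thesis using False by (simp add: \<phi>_def)
      qed (simp add: \<phi>_def H_def)
    qed
    have int: "integrable lborel (\<lambda>s. q s * (\<tau> (s\<^sup>2) * H (s\<^sup>2)))"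
      by (rule integrable_cong_AE_imp[OF pair(1)]) (use ae in \<open>auto elim: eventually_mono\<close>)
    have val: "(LINT s|lborel. q s * (\<tau> (s\<^sup>2) * H (s\<^sup>2))) = (LINT s|lborel. \<phi> s * q s * g s)"
      by (rule integral_cong_AE) (use ae in auto)
    have m: "(\<lambda>x. \<tau> x * H x) \<in> borel_measurable borel" by measurable
    show "integrable \<mu> (\<lambda>x. \<tau> x * H x) \<and> 0 \<le> (LINT x|\<mu>. \<tau> x * H x) \<and>
      ennreal (2 * (LINT x|\<mu>. \<tau> x * H x)) = (\<integral>\<^sup>+x. \<integral>\<^sup>+y. ennreal ((\<tau> x * sqrt x - \<tau> y * sqrt y) / (x - y)) \<partial>\<mu> \<partial>\<mu>)"
      unfolding integral_mu[OF m] val pair(2)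
      using int pair(3) nn_integral_symmetrized_quotient[OF t nn mono] by (simp add: \<phi>_def)
  qed
qed

end

section \<open>Measures of finite free Fisher information\<close>

text \<open>\<open>H\<close> plays the role of \<open>sqrt x\<close> times the Hilbert transform of \<open>p\<close>; only its pairing with
  bounded monotone functions enters.\<close>

locale finite_fisher = confining_potential Q \<rho> + half_line_density \<mu> p
  for Q :: "real \<Rightarrow> real" and \<rho> :: real and \<mu> :: "real measure" and p :: "real \<Rightarrow> real" +
  fixes Q' H :: "real \<Rightarrow> real"
  assumes H_measurable [measurable]: "H \<in> borel_measurable borel"
    and Q'_measurable [measurable]: "Q' \<in> borel_measurable borel"
    and tangent: "\<And>x y. 0 < x \<Longrightarrow> 0 \<le> y \<Longrightarrow> Q' x * (y - x) \<le> Q y - Q x"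
    and slope: "\<And>x. 0 < x \<Longrightarrow> \<rho> \<le> Q' x"
    and pairing: "\<And>\<tau> B. \<tau> \<in> borel_measurable borel \<Longrightarrow> (\<And>x. 0 \<le> \<tau> x) \<Longrightarrow> (\<And>x. \<tau> x \<le> B) \<Longrightarrow>
      (\<And>x y. 0 \<le> x \<Longrightarrow> x \<le> y \<Longrightarrow> \<tau> x \<le> \<tau> y) \<Longrightarrow>
      integrable \<mu> (\<lambda>x. \<tau> x * H x) \<and> 0 \<le> (LINT x|\<mu>. \<tau> x * H x) \<and>
      ennreal (2 * (LINT x|\<mu>. \<tau> x * H x)) = (\<integral>\<^sup>+x. \<integral>\<^sup>+y. ennreal ((\<tau> x * sqrt x - \<tau> y * sqrt y) / (x - y)) \<partial>\<mu> \<partial>\<mu>)"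
    and fisher: "(\<integral>\<^sup>+x. ennreal ((H x - sqrt x * Q' x / 2)\<^sup>2) \<partial>\<mu>) < \<infinity>"
begin

text \<open>When H is sqrt x times the Hilbert transform, 4 times the integral of G^2 is the free
  Fisher information.\<close>

definition G :: "real \<Rightarrow> real" where "G x = H x - sqrt x * Q' x / 2"

lemma G_measurable [measurable]: "G \<in> borel_measurable borel"
  unfolding G_def by measurable

lemma AE_pos: "AE x in \<mu>. 0 < x"
  by (rule AE_muI) simp

lemma measurable_mu_leb_pos: "h \<in> borel_measurable leb_pos \<Longrightarrow> h \<in> borel_measurable \<mu>"
  by (simp add: mu)

lemma mu_measurable [measurable]:
  "H \<in> borel_measurable \<mu>" "Q' \<in> borel_measurable \<mu>" "G \<in> borel_measurable \<mu>" "Q \<in> borel_measurable \<mu>"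
  "sqrt \<in> borel_measurable \<mu>" "(\<lambda>x. x) \<in> borel_measurable \<mu>"
  by (simp_all add: measurable_mu measurable_mu_leb_pos)

lemma G_square: "integrable \<mu> (\<lambda>x. (G x)\<^sup>2)"
  by (rule integrableI_nonneg) (use fisher in \<open>auto simp: G_def\<close>)

lemma slope_pos: "0 < x \<Longrightarrow> 0 < Q' x"
  using slope[of x] rho_pos by linarith

text \<open>The pairing admits bounded monotone functions only; this is the square root cut off at
  R, and \<open>max 0\<close> makes it nonnegative on the whole line.\<close>

definition trunc :: "real \<Rightarrow> real \<Rightarrow> real" where "trunc R x = min (sqrt (max 0 x)) R"

lemma trunc_measurable [measurable]: "trunc R \<in> borel_measurable borel"
  unfolding trunc_def by measurable

lemma trunc_nonneg: "0 \<le> R \<Longrightarrow> 0 \<le> trunc R x"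
  by (simp add: trunc_def)

lemma trunc_le: "trunc R x \<le> R"
  by (simp add: trunc_def)

lemma trunc_le_sqrt: "0 \<le> x \<Longrightarrow> trunc R x \<le> sqrt x"
  by (simp add: trunc_def)

lemma trunc_mono: "x \<le> y \<Longrightarrow> trunc R x \<le> trunc R y"
  unfolding trunc_def by (intro min.mono real_sqrt_le_mono max.mono) auto

text \<open>The defect x - trunc R x * sqrt x equals sqrt x * (sqrt x - trunc R x), a product of two
  nonnegative increasing functions, hence is increasing.\<close>

lemma trunc_quotient_le:
  assumes "0 \<le> x" "0 \<le> y" "0 \<le> R"
  shows "(trunc R x * sqrt x - trunc R y * sqrt y) / (x - y) \<le> 1"
proof -
  have main: "trunc R x * sqrt x - trunc R y * sqrt y \<le> x - y" if "0 \<le> y" "y < x" for x y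
  proof -
    have s: "sqrt y \<le> sqrt x" using that by simp
    moreover have "sqrt y - trunc R y \<le> sqrt x - trunc R x"
      using s that unfolding trunc_def min_def by (simp add: max_def del: real_sqrt_le_iff)
    moreover have "0 \<le> sqrt y - trunc R y" using that by (simp add: trunc_def)
    ultimately have "sqrt y * (sqrt y - trunc R y) \<le> sqrt x * (sqrt x - trunc R x)"
      using that by (intro mult_mono) auto
    moreover have "sqrt y * sqrt y = y" "sqrt x * sqrt x = x" using that by auto
    ultimately show ?thesis by (simp add: right_diff_distrib mult.commute)
  qed
  consider "x = y" | "y < x" | "x < y" by linarith
  then show ?thesis
  proof cases
    case 3
    have "(trunc R x * sqrt x - trunc R y * sqrt y) / (x - y) = (trunc R y * sqrt y - trunc R x * sqrt x) / (y - x)"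
      by (metis minus_diff_eq minus_divide_divide)
    then show ?thesis using main[of x y] 3 assms by (simp add: divide_le_eq)
  qed (use main[of y x] assms in \<open>auto simp: divide_le_eq\<close>)
qed

text \<open>For the square root itself the symmetrized kernel is 1 off the diagonal; truncation
  keeps it at most 1, so twice the integral is at most the total mass.\<close>

lemma trunc_H:
  assumes R: "0 \<le> R"
  shows "integrable \<mu> (\<lambda>x. trunc R x * H x)" "(LINT x|\<mu>. trunc R x * H x) \<le> 1 / 2"
proof -
  note P = pairing[of "trunc R" R, OF trunc_measurable trunc_nonneg[OF R] trunc_le trunc_mono]
  show "integrable \<mu> (\<lambda>x. trunc R x * H x)" using P by blast
  have "ennreal (2 * (LINT x|\<mu>. trunc R x * H x)) = (\<integral>\<^sup>+x. \<integral>\<^sup>+y. ennreal ((trunc R x * sqrt x - trunc R y * sqrt y) / (x - y)) \<partial>\<mu> \<partial>\<mu>)"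
    using P by blast
  also have "\<dots> \<le> (\<integral>\<^sup>+x. \<integral>\<^sup>+y. 1 \<partial>\<mu> \<partial>\<mu>)"
    by (intro nn_integral_mono) (use trunc_quotient_le R in \<open>auto simp: space_mu\<close>)
  also have "\<dots> = 1" by (simp add: emeasure_space_1)
  finally show "(LINT x|\<mu>. trunc R x * H x) \<le> 1 / 2" by (simp add: ennreal_le_1)
qed

text \<open>With sqrt x * Q' x = 2 (H x - G x), the H part is at most 1 by \<open>trunc_H\<close>.
  The G part is at most half of the unknown integral plus 2 / \<open>\<rho>\<close> times the
  integral of G^2, by completing a square and using that \<open>\<rho>\<close> * trunc^2 <= trunc *
  sqrt x * Q'. Absorbing the half gives a bound independent of R.\<close>

lemma trunc_slope_bound:
  assumes R: "0 \<le> R"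
  shows "(\<integral>\<^sup>+x. ennreal (trunc R x * (sqrt x * Q' x)) \<partial>\<mu>) \<le> ennreal (2 + 4 / \<rho> * (LINT x|\<mu>. (G x)\<^sup>2))"
proof -
  have mb: "(\<integral>\<^sup>+x. ennreal ((trunc R x)\<^sup>2) \<partial>\<mu>) < \<infinity>"
  proof -
    have "(\<integral>\<^sup>+x. ennreal ((trunc R x)\<^sup>2) \<partial>\<mu>) \<le> (\<integral>\<^sup>+x. ennreal (R\<^sup>2) \<partial>\<mu>)"
      by (intro nn_integral_mono ennreal_leI power_mono trunc_le trunc_nonneg R)
    also have "\<dots> < \<infinity>" by (simp add: emeasure_space_1)
    finally show ?thesis .
  qed
  have tm: "trunc R \<in> borel_measurable \<mu>" by (rule measurable_mu) measurable
  have iG: "integrable \<mu> (\<lambda>x. trunc R x * G x)"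
    by (rule integrable_mult_L2[OF tm _ mb]) (use fisher in \<open>auto simp: G_def\<close>)
  have iH: "integrable \<mu> (\<lambda>x. trunc R x * H x)" by (rule trunc_H(1)[OF R])
  have iS: "integrable \<mu> (\<lambda>x. trunc R x * (sqrt x * Q' x))"
  proof -
    have "integrable \<mu> (\<lambda>x. 2 * (trunc R x * H x - trunc R x * G x))"
      using iH iG by (intro integrable_mult_right Bochner_Integration.integrable_diff)
    then show ?thesis by (simp add: G_def algebra_simps)
  qed
  define S where "S = (LINT x|\<mu>. trunc R x * (sqrt x * Q' x))"
  have "S = 2 * (LINT x|\<mu>. trunc R x * H x) - (LINT x|\<mu>. 2 * (trunc R x * G x))"
  proof -
    have "S = (LINT x|\<mu>. 2 * (trunc R x * H x) - 2 * (trunc R x * G x))"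
      unfolding S_def by (intro Bochner_Integration.integral_cong refl) (simp add: G_def algebra_simps)
    then show ?thesis using iH iG by simp
  qed
  also have "\<dots> \<le> 1 + (LINT x|\<mu>. 1 / 2 * (trunc R x * (sqrt x * Q' x)) + 2 / \<rho> * (G x)\<^sup>2)"
  proof -
    have "- (LINT x|\<mu>. 2 * (trunc R x * G x)) = (LINT x|\<mu>. - (2 * (trunc R x * G x)))" by simp
    also have "\<dots> \<le> (LINT x|\<mu>. 1 / 2 * (trunc R x * (sqrt x * Q' x)) + 2 / \<rho> * (G x)\<^sup>2)"
    proof (rule integral_mono_AE)
      show "integrable \<mu> (\<lambda>x. - (2 * (trunc R x * G x)))" using iG by simp
      show "integrable \<mu> (\<lambda>x. 1 / 2 * (trunc R x * (sqrt x * Q' x)) + 2 / \<rho> * (G x)\<^sup>2)"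
        using iS G_square by (intro Bochner_Integration.integrable_add integrable_mult_right)
      show "AE x in \<mu>. - (2 * (trunc R x * G x)) \<le> 1 / 2 * (trunc R x * (sqrt x * Q' x)) + 2 / \<rho> * (G x)\<^sup>2"
        using AE_pos
      proof eventually_elim
        case (elim x)
        define m where "m = trunc R x"
        have m: "0 \<le> m" "m \<le> sqrt x" using elim R by (auto simp: m_def trunc_nonneg trunc_le_sqrt)
        have "0 \<le> (\<rho> * m + 2 * G x)\<^sup>2 / (2 * \<rho>)" using rho_pos by simp
        also have "\<dots> = \<rho> / 2 * (m * m) + 2 * (m * G x) + 2 / \<rho> * (G x)\<^sup>2"
          using rho_pos by (simp add: field_simps power2_eq_square)
        finally have "- (2 * (m * G x)) \<le> \<rho> / 2 * (m * m) + 2 / \<rho> * (G x)\<^sup>2" by linarith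
        moreover have "m * (m * \<rho>) \<le> m * (sqrt x * Q' x)"
          using m slope[OF elim] rho_pos elim by (intro mult_left_mono mult_mono) auto
        ultimately show ?case unfolding m_def[symmetric] by (simp add: mult_ac)
      qed
    qed
    finally show ?thesis using trunc_H(2)[OF R] by simp
  qed
  also have "\<dots> = 1 + (1 / 2 * S + 2 / \<rho> * (LINT x|\<mu>. (G x)\<^sup>2))"
    unfolding S_def using iS G_square by simp
  finally have "S \<le> 2 + 4 / \<rho> * (LINT x|\<mu>. (G x)\<^sup>2)" by (simp add: field_simps)
  moreover have "(\<integral>\<^sup>+x. ennreal (trunc R x * (sqrt x * Q' x)) \<partial>\<mu>) = ennreal S"
    unfolding S_def
  proof (rule nn_integral_eq_integral[OF iS])
    show "AE x in \<mu>. 0 \<le> trunc R x * (sqrt x * Q' x)"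
      using AE_pos by eventually_elim (use slope_pos R in \<open>auto intro!: mult_nonneg_nonneg simp: trunc_nonneg less_imp_le\<close>)
  qed
  ultimately show ?thesis by (simp add: ennreal_leI)
qed

text \<open>Fatou in \<open>trunc_slope_bound\<close> as R grows. Integrability of x follows from Q'
  >= \<open>\<rho>\<close>, and that of Q from the tangent inequality at 0.\<close>

lemma integrable_x_slope: "integrable \<mu> (\<lambda>x. x * Q' x)"
proof (rule integrableI_nonneg)
  show "AE x in \<mu>. 0 \<le> x * Q' x"
    using AE_pos by eventually_elim (use slope_pos in \<open>auto simp: less_imp_le\<close>)
  have "(\<integral>\<^sup>+x. ennreal (x * Q' x) \<partial>\<mu>) = (\<integral>\<^sup>+x. liminf (\<lambda>n. ennreal (trunc (real n) x * (sqrt x * Q' x))) \<partial>\<mu>)"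
  proof (rule nn_integral_cong_AE, use AE_pos in eventually_elim)
    fix x :: real assume x: "0 < x"
    obtain N :: nat where N: "sqrt x \<le> real N" using real_arch_simple by blast
    have "trunc (real n) x * (sqrt x * Q' x) = x * Q' x" if "N \<le> n" for n
    proof -
      have "real N \<le> real n" using that by simp
      then have "trunc (real n) x = sqrt x" using N x by (simp add: trunc_def)
      then show ?thesis using x by (simp add: mult.assoc[symmetric])
    qed
    then have "eventually (\<lambda>n. ennreal (trunc (real n) x * (sqrt x * Q' x)) = ennreal (x * Q' x)) sequentially"
      by (intro eventually_sequentiallyI[of N]) (simp only:)
    from lim_imp_Liminf[OF sequentially_bot tendsto_eventually[OF this]]
    show "ennreal (x * Q' x) = liminf (\<lambda>n. ennreal (trunc (real n) x * (sqrt x * Q' x)))" by simp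
  qed
  also have "\<dots> \<le> liminf (\<lambda>n. \<integral>\<^sup>+x. ennreal (trunc (real n) x * (sqrt x * Q' x)) \<partial>\<mu>)"
    by (rule nn_integral_liminf) (rule measurable_mu, measurable)
  also have "\<dots> \<le> ennreal (2 + 4 / \<rho> * (LINT x|\<mu>. (G x)\<^sup>2))"
  proof (rule Liminf_le)
    show "eventually (\<lambda>n. (\<integral>\<^sup>+x. ennreal (trunc (real n) x * (sqrt x * Q' x)) \<partial>\<mu>) \<le> ennreal (2 + 4 / \<rho> * (LINT x|\<mu>. (G x)\<^sup>2))) sequentially"
      by (intro always_eventually allI trunc_slope_bound) simp
  qed simp_all
  finally show "(\<integral>\<^sup>+x. ennreal (x * Q' x) \<partial>\<mu>) < \<infinity>" by (rule le_less_trans) simp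
qed measurable

lemma integrable_x: "integrable \<mu> (\<lambda>x. x)"
proof (rule Bochner_Integration.integrable_bound[of _ "\<lambda>x. 1 / \<rho> * (x * Q' x)"])
  show "integrable \<mu> (\<lambda>x. 1 / \<rho> * (x * Q' x))" using integrable_x_slope by (rule integrable_mult_right)
  show "AE x in \<mu>. norm x \<le> norm (1 / \<rho> * (x * Q' x))"
    using AE_pos
  proof eventually_elim
    case (elim x)
    have "x * \<rho> \<le> x * Q' x" using elim slope by (intro mult_left_mono) auto
    then have "x \<le> 1 / \<rho> * (x * Q' x)" using rho_pos by (simp add: field_simps)
    also have "\<dots> \<le> norm (1 / \<rho> * (x * Q' x))" unfolding real_norm_def by (rule abs_ge_self)
    finally show ?case using elim by simp
  qed
qed measurable

lemma nn_integral_sqrt_square_finite: "(\<integral>\<^sup>+x. ennreal ((sqrt x)\<^sup>2) \<partial>\<mu>) < \<infinity>"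
proof -
  have "(\<integral>\<^sup>+x. ennreal ((sqrt x)\<^sup>2) \<partial>\<mu>) = (\<integral>\<^sup>+x. ennreal (norm x) \<partial>\<mu>)"
    by (rule nn_integral_cong) (auto simp: space_mu)
  then show ?thesis using integrable_x by (simp add: integrable_iff_bounded)
qed

lemma integrable_Q: "integrable \<mu> Q"
proof (rule Bochner_Integration.integrable_bound[of _ "\<lambda>x. \<bar>Q 0\<bar> + x * Q' x"])
  show "integrable \<mu> (\<lambda>x. \<bar>Q 0\<bar> + x * Q' x)"
    by (intro Bochner_Integration.integrable_add integrable_x_slope) (simp add: integrable_const)
  show "AE x in \<mu>. norm (Q x) \<le> norm (\<bar>Q 0\<bar> + x * Q' x)"
    using AE_pos
  proof eventually_elim
    case (elim x)
    have "Q 0 \<le> Q x" using Q0_nonneg[of x] elim by (simp add: Q0_def)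
    moreover have "Q x \<le> Q 0 + x * Q' x" using tangent[OF elim, of 0] by (simp add: mult.commute)
    moreover have "0 \<le> x * Q' x" using elim slope_pos[OF elim] by simp
    ultimately show ?case by simp
  qed
qed measurable

lemma integrable_sqrt_H: "integrable \<mu> (\<lambda>x. sqrt x * H x)"
proof -
  have "integrable \<mu> (\<lambda>x. sqrt x * G x)"
    by (rule integrable_mult_L2[OF _ _ nn_integral_sqrt_square_finite]) (use fisher in \<open>auto simp: G_def\<close>)
  then have "integrable \<mu> (\<lambda>x. sqrt x * G x + 1 / 2 * (x * Q' x))"
    by (intro Bochner_Integration.integrable_add integrable_mult_right integrable_x_slope)
  then show ?thesis
  proof (rule Bochner_Integration.integrable_cong[OF refl, THEN iffD1, rotated])
    fix x assume "x \<in> space \<mu>"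
    then have "sqrt x * sqrt x = x" by (simp add: space_mu)
    then have "sqrt x * (sqrt x * Q' x / 2) = 1 / 2 * (x * Q' x)" by (simp add: mult.assoc[symmetric])
    then show "sqrt x * G x + 1 / 2 * (x * Q' x) = sqrt x * H x"
      by (simp only: G_def right_diff_distrib)
  qed
qed

text \<open>Limit of the truncated virial bounds by dominated convergence. Multiplied by 4, it pays
  for the constant 2 in \<open>ln_square_dist_le\<close>.\<close>

lemma integral_sqrt_H_le: "(LINT x|\<mu>. sqrt x * H x) \<le> 1 / 2"
proof -
  have "(\<lambda>n. LINT x|\<mu>. trunc (real n) x * H x) \<longlonglongrightarrow> (LINT x|\<mu>. sqrt x * H x)"
  proof (rule integral_dominated_convergence)
    show "integrable \<mu> (\<lambda>x. norm (sqrt x * H x))" by (rule integrable_norm[OF integrable_sqrt_H])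
    show "(\<lambda>x. trunc (real n) x * H x) \<in> borel_measurable \<mu>" for n by (rule measurable_mu) measurable
    show "AE x in \<mu>. (\<lambda>n. trunc (real n) x * H x) \<longlonglongrightarrow> sqrt x * H x"
      using AE_pos
    proof eventually_elim
      case (elim x)
      obtain N :: nat where N: "sqrt x \<le> real N" using real_arch_simple by blast
      have "trunc (real n) x * H x = sqrt x * H x" if "N \<le> n" for n
      proof -
        have "real N \<le> real n" using that by simp
        then show ?thesis using N elim by (simp add: trunc_def)
      qed
      then show ?case by (intro tendsto_eventually eventually_sequentiallyI[of N]) simp
    qed
    show "AE x in \<mu>. norm (trunc (real n) x * H x) \<le> norm (sqrt x * H x)" for n
      using AE_pos
    proof eventually_elim
      case (elim x)
      have "\<bar>trunc (real n) x\<bar> \<le> \<bar>sqrt x\<bar>" using elim trunc_nonneg[of "real n" x] trunc_le_sqrt[of x "real n"] by simp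
      then show ?case by (simp add: abs_mult mult_right_mono)
    qed
  qed measurable
  then show ?thesis
    by (rule LIMSEQ_le_const2) (intro exI[of _ 0] allI impI trunc_H(2), simp)
qed

end

section \<open>Logarithmic energy\<close>

text \<open>An integrable inverse square root dominating the logarithmic singularity. Its value 0 at
  0, from division by zero, agrees with \<open>ln 0 = 0\<close>.\<close>

definition log_majorant :: "real \<Rightarrow> real" where
  "log_majorant v = indicator {- 1..1} v / sqrt \<bar>v\<bar>"

lemma log_majorant_measurable [measurable]: "log_majorant \<in> borel_measurable borel"
  unfolding log_majorant_def by measurable

lemma log_majorant_nonneg: "0 \<le> log_majorant v"
  by (simp add: log_majorant_def)

lemma log_majorant_minus: "log_majorant (- v) = log_majorant v"
  by (auto simp: log_majorant_def split: split_indicator)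

lemma nn_integral_log_majorant: "(\<integral>\<^sup>+v. ennreal (log_majorant v) \<partial>lborel) \<le> 4"
proof -
  have even: "(\<integral>\<^sup>+v. ennreal (log_majorant v) \<partial>lborel) = 2 * (\<integral>\<^sup>+v. ennreal (log_majorant v) * indicator {0..} v \<partial>lborel)"
    by (rule nn_integral_even) (simp_all add: log_majorant_minus)
  have "(\<integral>\<^sup>+v. ennreal (log_majorant v) * indicator {0..} v \<partial>lborel) = (\<integral>\<^sup>+s. ennreal \<bar>s\<bar> * ennreal (log_majorant (s\<^sup>2)) \<partial>lborel)"
    by (rule nn_integral_square_substitution) measurable
  also have "\<dots> \<le> (\<integral>\<^sup>+s. indicator {- 1..1} s \<partial>(lborel :: real measure))"
  proof (rule nn_integral_mono)
    fix s :: real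
    have "\<bar>s\<bar> * log_majorant (s\<^sup>2) \<le> indicator {- 1..1} s"
    proof (cases "\<bar>s\<bar> \<le> 1")
      case True
      then have "s \<in> {- 1..1}" by auto
      then show ?thesis by (auto simp: log_majorant_def indicator_def)
    next
      case False
      then have "1 < s\<^sup>2" using one_less_power[of "\<bar>s\<bar>" 2] by simp
      then show ?thesis by (simp add: log_majorant_def)
    qed
    then have "ennreal (\<bar>s\<bar> * log_majorant (s\<^sup>2)) \<le> ennreal (indicator {- 1..1} s)" by (rule ennreal_leI)
    then show "ennreal \<bar>s\<bar> * ennreal (log_majorant (s\<^sup>2)) \<le> indicator {- 1..1} s"
      by (simp add: ennreal_mult' ennreal_indicator)
  qed
  also have "\<dots> = 2" by simp
  finally have "2 * (\<integral>\<^sup>+v. ennreal (log_majorant v) * indicator {0..} v \<partial>lborel) \<le> 2 * 2" by (rule mult_left_mono) simp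
  then show ?thesis unfolding even by simp
qed

text \<open>With v the distance of the square roots, \<open>\<bar>x - y\<bar>\<close> = v (sqrt x +
  sqrt y) is at least v^2, so -ln \<open>\<bar>x - y\<bar>\<close> is at most -2 ln v = 4 ln (1 /
  sqrt v), below 4 / sqrt v. At distances of at least 1 the linear terms suffice.\<close>

lemma abs_ln_dist_le:
  assumes "0 \<le> x" "0 \<le> y"
  shows "\<bar>ln \<bar>x - y\<bar>\<bar> \<le> x + y + 4 * log_majorant (sqrt x - sqrt y)"
proof (cases "1 \<le> \<bar>x - y\<bar>")
  case True
  have "ln \<bar>x - y\<bar> \<le> \<bar>x - y\<bar> - 1" using True by (intro ln_le_minus_one) simp
  moreover have "0 \<le> ln \<bar>x - y\<bar>" using True by simp
  ultimately show ?thesis using assms log_majorant_nonneg[of "sqrt x - sqrt y"] by simp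
next
  case False
  show ?thesis
  proof (cases "x = y")
    case True
    then show ?thesis using assms log_majorant_nonneg[of 0] by simp
  next
    case ne: False
    define v where "v = \<bar>sqrt x - sqrt y\<bar>"
    have v: "0 < v" using ne by (simp add: v_def)
    have fac: "\<bar>x - y\<bar> = v * (sqrt x + sqrt y)"
    proof -
      have "x - y = (sqrt x - sqrt y) * (sqrt x + sqrt y)"
        using assms by (simp add: algebra_simps)
      then show ?thesis using assms by (simp add: v_def abs_mult)
    qed
    have "v \<le> sqrt x + sqrt y"
      using real_sqrt_ge_zero[OF assms(1)] real_sqrt_ge_zero[OF assms(2)] unfolding v_def by linarith
    then have vv: "v * v \<le> \<bar>x - y\<bar>" unfolding fac using v by (intro mult_left_mono) auto
    have v1: "v < 1"
    proof (rule ccontr)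
      assume "\<not> v < 1"
      then have "1 * 1 \<le> v * v" by (intro mult_mono) auto
      then show False using vv False by simp
    qed
    have "ln (v * v) \<le> ln \<bar>x - y\<bar>" using vv v by (intro ln_mono) auto
    then have "- ln \<bar>x - y\<bar> \<le> - 2 * ln v" using v by (simp add: ln_mult)
    also have "- 2 * ln v = 4 * ln (1 / sqrt v)" using v by (simp add: ln_div ln_sqrt)
    also have "\<dots> \<le> 4 * (1 / sqrt v)"
      using ln_le_minus_one[of "1 / sqrt v"] v by simp
    also have "1 / sqrt v = log_majorant (sqrt x - sqrt y)"
    proof -
      have "sqrt x - sqrt y \<in> {- 1..1}" using v1 by (auto simp: v_def)
      then show ?thesis by (simp add: log_majorant_def v_def)
    qed
    finally have "- ln \<bar>x - y\<bar> \<le> 4 * log_majorant (sqrt x - sqrt y)" .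
    moreover have "ln \<bar>x - y\<bar> \<le> 0" using False ne by simp
    ultimately show ?thesis using assms by simp
  qed
qed

section \<open>Finiteness of the logarithmic energy\<close>

context half_line_density
begin

lemma measurable_mu_pair:
  assumes "h \<in> borel_measurable (borel \<Otimes>\<^sub>M borel)"
  shows "h \<in> borel_measurable (\<mu> \<Otimes>\<^sub>M \<mu>)"
proof -
  have id: "(\<lambda>x. x) \<in> \<mu> \<rightarrow>\<^sub>M borel" by (rule measurable_mu) simp
  have "(\<lambda>p. (fst p, snd p)) \<in> \<mu> \<Otimes>\<^sub>M \<mu> \<rightarrow>\<^sub>M borel \<Otimes>\<^sub>M borel"
    by (intro measurable_Pair measurable_compose[OF measurable_fst id] measurable_compose[OF measurable_snd id])
  from measurable_compose[OF this assms] show ?thesis by simp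
qed

text \<open>In square-root coordinates \<open>q s * q t\<close> is at most the sum of the squares.
  The distance of the absolute values is, up to sign, s - t or s + t, and integrating the majorant
  in the free variable costs at most 4 each time.\<close>

lemma nn_integral_log_majorant_mu:
  "(\<integral>\<^sup>+x. \<integral>\<^sup>+y. ennreal (log_majorant (sqrt x - sqrt y)) \<partial>\<mu> \<partial>\<mu>) < \<infinity>"
proof -
  define S where "S = (\<integral>\<^sup>+s. ennreal ((q s)\<^sup>2) \<partial>lborel)"
  have inner: "(\<integral>\<^sup>+y. ennreal (log_majorant (sqrt x - sqrt y)) \<partial>\<mu>) = (\<integral>\<^sup>+t. ennreal (q t) * ennreal (log_majorant (sqrt x - \<bar>t\<bar>)) \<partial>lborel)" for x
    using nn_integral_mu[of "\<lambda>y. ennreal (log_majorant (sqrt x - sqrt y))"] by simp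
  have "(\<integral>\<^sup>+x. \<integral>\<^sup>+y. ennreal (log_majorant (sqrt x - sqrt y)) \<partial>\<mu> \<partial>\<mu>)
    = (\<integral>\<^sup>+s. ennreal (q s) * (\<integral>\<^sup>+t. ennreal (q t) * ennreal (log_majorant (\<bar>s\<bar> - \<bar>t\<bar>)) \<partial>lborel) \<partial>lborel)"
    unfolding inner using nn_integral_mu[of "\<lambda>x. \<integral>\<^sup>+t. ennreal (q t) * ennreal (log_majorant (sqrt x - \<bar>t\<bar>)) \<partial>lborel"] by simp
  also have "\<dots> = (\<integral>\<^sup>+s. \<integral>\<^sup>+t. ennreal (q s * q t * log_majorant (\<bar>s\<bar> - \<bar>t\<bar>)) \<partial>lborel \<partial>lborel)"
    by (simp add: nn_integral_cmult[symmetric] ennreal_mult' ennreal_mult'' q_nonneg log_majorant_nonneg mult.assoc)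
  also have "\<dots> \<le> (\<integral>\<^sup>+s. \<integral>\<^sup>+t. (ennreal ((q s)\<^sup>2) * ennreal (log_majorant (s - t)) + ennreal ((q s)\<^sup>2) * ennreal (log_majorant (s + t)))
      + (ennreal ((q t)\<^sup>2) * ennreal (log_majorant (s - t)) + ennreal ((q t)\<^sup>2) * ennreal (log_majorant (s + t))) \<partial>lborel \<partial>lborel)"
  proof (intro nn_integral_mono)
    fix s t
    have "0 \<le> (q s - q t)\<^sup>2" by simp
    then have "2 * (q s * q t) \<le> (q s)\<^sup>2 + (q t)\<^sup>2" by (simp add: power2_diff)
    moreover have "0 \<le> q s * q t" using q_nonneg by simp
    ultimately have 1: "q s * q t \<le> (q s)\<^sup>2 + (q t)\<^sup>2" by linarith
    have "log_majorant (\<bar>s\<bar> - \<bar>t\<bar>) = log_majorant (s - t) \<or> log_majorant (\<bar>s\<bar> - \<bar>t\<bar>) = log_majorant (s + t)"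
      using log_majorant_minus[of "s - t"] log_majorant_minus[of "s + t"] by (auto simp: abs_if)
    then have 2: "log_majorant (\<bar>s\<bar> - \<bar>t\<bar>) \<le> log_majorant (s - t) + log_majorant (s + t)"
      using log_majorant_nonneg[of "s - t"] log_majorant_nonneg[of "s + t"] by auto
    have "q s * q t * log_majorant (\<bar>s\<bar> - \<bar>t\<bar>) \<le> ((q s)\<^sup>2 + (q t)\<^sup>2) * (log_majorant (s - t) + log_majorant (s + t))"
      by (intro mult_mono 1 2 log_majorant_nonneg) auto
    then have "ennreal (q s * q t * log_majorant (\<bar>s\<bar> - \<bar>t\<bar>)) \<le> ennreal (((q s)\<^sup>2 * log_majorant (s - t) + (q s)\<^sup>2 * log_majorant (s + t))
        + ((q t)\<^sup>2 * log_majorant (s - t) + (q t)\<^sup>2 * log_majorant (s + t)))"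
      by (intro ennreal_leI) (simp add: algebra_simps)
    then show "ennreal (q s * q t * log_majorant (\<bar>s\<bar> - \<bar>t\<bar>))
      \<le> (ennreal ((q s)\<^sup>2) * ennreal (log_majorant (s - t)) + ennreal ((q s)\<^sup>2) * ennreal (log_majorant (s + t)))
      + (ennreal ((q t)\<^sup>2) * ennreal (log_majorant (s - t)) + ennreal ((q t)\<^sup>2) * ennreal (log_majorant (s + t)))"
      by (simp add: ennreal_mult' log_majorant_nonneg)
  qed
  also have "\<dots> = ((\<integral>\<^sup>+s. \<integral>\<^sup>+t. ennreal ((q s)\<^sup>2) * ennreal (log_majorant (s - t)) \<partial>lborel \<partial>lborel)
       + (\<integral>\<^sup>+s. \<integral>\<^sup>+t. ennreal ((q s)\<^sup>2) * ennreal (log_majorant (s + t)) \<partial>lborel \<partial>lborel))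
      + ((\<integral>\<^sup>+s. \<integral>\<^sup>+t. ennreal ((q t)\<^sup>2) * ennreal (log_majorant (s - t)) \<partial>lborel \<partial>lborel)
       + (\<integral>\<^sup>+s. \<integral>\<^sup>+t. ennreal ((q t)\<^sup>2) * ennreal (log_majorant (s + t)) \<partial>lborel \<partial>lborel))"
    by (simp add: nn_integral_add)
  also have "\<dots> \<le> (S * 4 + S * 4) + (S * 4 + S * 4)"
  proof -
    have minus: "(\<integral>\<^sup>+t. ennreal (log_majorant (s - t)) \<partial>lborel) \<le> 4" for s
    proof -
      have "(\<integral>\<^sup>+t. ennreal (log_majorant (s - t)) \<partial>lborel) = (\<integral>\<^sup>+v. ennreal (log_majorant v) \<partial>lborel)"
        by (subst (2) nn_integral_real_affine[where c="-1" and t=s]) auto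
      then show ?thesis using nn_integral_log_majorant by simp
    qed
    have plus: "(\<integral>\<^sup>+t. ennreal (log_majorant (s + t)) \<partial>lborel) \<le> 4" for s
    proof -
      have "(\<integral>\<^sup>+t. ennreal (log_majorant (s + t)) \<partial>lborel) = (\<integral>\<^sup>+v. ennreal (log_majorant v) \<partial>lborel)"
        by (subst (2) nn_integral_real_affine[where c=1 and t=s]) auto
      then show ?thesis using nn_integral_log_majorant by simp
    qed
    have b: "(\<integral>\<^sup>+s. \<integral>\<^sup>+t. ennreal ((q s)\<^sup>2) * ennreal (l s t) \<partial>lborel \<partial>lborel) \<le> S * 4"
      if [measurable]: "(\<lambda>(s, t). l s t) \<in> borel_measurable (borel \<Otimes>\<^sub>M borel)" and l: "\<And>s. (\<integral>\<^sup>+t. ennreal (l s t) \<partial>lborel) \<le> 4" for l :: "real \<Rightarrow> real \<Rightarrow> real"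
    proof -
      have "(\<integral>\<^sup>+s. \<integral>\<^sup>+t. ennreal ((q s)\<^sup>2) * ennreal (l s t) \<partial>lborel \<partial>lborel) \<le> (\<integral>\<^sup>+s. ennreal ((q s)\<^sup>2) * 4 \<partial>lborel)"
        by (intro nn_integral_mono) (simp add: nn_integral_cmult mult_left_mono l)
      also have "\<dots> = S * 4" unfolding S_def by (rule nn_integral_multc) measurable
      finally show ?thesis .
    qed
    have c: "(\<integral>\<^sup>+s. \<integral>\<^sup>+t. ennreal ((q t)\<^sup>2) * ennreal (l s t) \<partial>lborel \<partial>lborel) = (\<integral>\<^sup>+t. \<integral>\<^sup>+s. ennreal ((q t)\<^sup>2) * ennreal (l s t) \<partial>lborel \<partial>lborel)"
      if [measurable]: "(\<lambda>(s, t). l s t) \<in> borel_measurable (borel \<Otimes>\<^sub>M borel)" for l :: "real \<Rightarrow> real \<Rightarrow> real"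
      by (rule lborel_pair.Fubini'[symmetric]) measurable
    have sym: "log_majorant (s - t) = log_majorant (t - s)" for s t using log_majorant_minus[of "s - t"] by simp
    show ?thesis
      by (intro add_mono b minus plus, measurable)
        (subst c, measurable, rule b, measurable, simp add: sym[of _ "_ :: real"] minus plus add.commute)+
  qed
  also have "\<dots> < \<infinity>" using nn_integral_q_square by (simp add: S_def ennreal_mult_less_top)
  finally show ?thesis .
qed

lemma AE_mu_offdiag: "AE p in \<mu> \<Otimes>\<^sub>M \<mu>. fst p \<noteq> snd p"
proof -
  interpret pair_prob_space \<mu> \<mu> ..
  have "AE x in \<mu>. AE y in \<mu>. fst (x, y) \<noteq> snd (x, y)"
  proof (rule AE_I2)
    fix x
    have "AE y in \<mu>. x \<noteq> y"
    proof (rule AE_muI)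
      show "AE s in lborel. 0 < s \<longrightarrow> x \<noteq> s\<^sup>2"
        using AE_lborel_singleton[of "sqrt x"] by eventually_elim auto
    qed
    then show "AE y in \<mu>. fst (x, y) \<noteq> snd (x, y)" by simp
  qed
  moreover have "{p \<in> space (\<mu> \<Otimes>\<^sub>M \<mu>). fst p \<noteq> snd p} \<in> sets (\<mu> \<Otimes>\<^sub>M \<mu>)"
  proof -
    have [measurable]: "fst \<in> borel_measurable (\<mu> \<Otimes>\<^sub>M \<mu>)" "snd \<in> borel_measurable (\<mu> \<Otimes>\<^sub>M \<mu>)"
      by (auto intro: measurable_mu_pair)
    show ?thesis by measurable
  qed
  ultimately show ?thesis by (intro AE_pair_measure) auto
qed

lemma integrable_mu_pair_fst:
  fixes h :: "real \<Rightarrow> real"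
  assumes "integrable \<mu> h"
  shows "integrable (\<mu> \<Otimes>\<^sub>M \<mu>) (\<lambda>p. h (fst p))" "(LINT p|(\<mu> \<Otimes>\<^sub>M \<mu>). h (fst p)) = (LINT x|\<mu>. h x)"
    "integrable (\<mu> \<Otimes>\<^sub>M \<mu>) (\<lambda>p. h (snd p))" "(LINT p|(\<mu> \<Otimes>\<^sub>M \<mu>). h (snd p)) = (LINT x|\<mu>. h x)"
proof -
  have [measurable]: "h \<in> borel_measurable \<mu>" using assms by auto
  interpret pair_prob_space \<mu> \<mu> ..
  have d1: "distr (\<mu> \<Otimes>\<^sub>M \<mu>) \<mu> fst = \<mu>" by (rule prob_space.distr_pair_fst[OF prob])
  show 1: "integrable (\<mu> \<Otimes>\<^sub>M \<mu>) (\<lambda>p. h (fst p))"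
    using integrable_distr_eq[of fst "\<mu> \<Otimes>\<^sub>M \<mu>" \<mu> h] assms by (simp add: d1)
  show 2: "(LINT p|(\<mu> \<Otimes>\<^sub>M \<mu>). h (fst p)) = (LINT x|\<mu>. h x)"
    using integral_distr[of fst "\<mu> \<Otimes>\<^sub>M \<mu>" \<mu> h] by (simp add: d1)
  show "integrable (\<mu> \<Otimes>\<^sub>M \<mu>) (\<lambda>p. h (snd p))"
    using integrable_product_swap[OF 1] by (simp add: case_prod_beta')
  show "(LINT p|(\<mu> \<Otimes>\<^sub>M \<mu>). h (snd p)) = (LINT x|\<mu>. h x)"
    using integral_product_swap[OF borel_measurable_integrable[OF 1]] 2 by (simp add: case_prod_beta')
qed

lemma integrable_log_energy:
  assumes x: "integrable \<mu> (\<lambda>x. x)"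
  shows "integrable (\<mu> \<Otimes>\<^sub>M \<mu>) (\<lambda>p. ln \<bar>fst p - snd p\<bar>)"
proof (rule integrableI_bounded)
  show "(\<lambda>p. ln \<bar>fst p - snd p\<bar>) \<in> borel_measurable (\<mu> \<Otimes>\<^sub>M \<mu>)"
    by (rule measurable_mu_pair) measurable
  have [measurable]: "(\<lambda>p. log_majorant (sqrt (fst p) - sqrt (snd p))) \<in> borel_measurable (\<mu> \<Otimes>\<^sub>M \<mu>)"
    by (rule measurable_mu_pair) measurable
  have [measurable]: "fst \<in> borel_measurable (\<mu> \<Otimes>\<^sub>M \<mu>)" "snd \<in> borel_measurable (\<mu> \<Otimes>\<^sub>M \<mu>)"
    by (auto intro: measurable_mu_pair)
  have "(\<integral>\<^sup>+p. ennreal (norm (ln \<bar>fst p - snd p\<bar>)) \<partial>(\<mu> \<Otimes>\<^sub>M \<mu>))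
      \<le> (\<integral>\<^sup>+p. (ennreal (norm (fst p)) + ennreal (norm (snd p))) + 4 * ennreal (log_majorant (sqrt (fst p) - sqrt (snd p))) \<partial>(\<mu> \<Otimes>\<^sub>M \<mu>))"
  proof (rule nn_integral_mono)
    fix p assume "p \<in> space (\<mu> \<Otimes>\<^sub>M \<mu>)"
    then have p: "0 \<le> fst p" "0 \<le> snd p" by (auto simp: space_pair_measure space_mu)
    have "ennreal (norm (ln \<bar>fst p - snd p\<bar>)) \<le> ennreal ((fst p + snd p) + 4 * log_majorant (sqrt (fst p) - sqrt (snd p)))"
      using abs_ln_dist_le[OF p] by (intro ennreal_leI) simp
    then show "ennreal (norm (ln \<bar>fst p - snd p\<bar>)) \<le> (ennreal (norm (fst p)) + ennreal (norm (snd p))) + 4 * ennreal (log_majorant (sqrt (fst p) - sqrt (snd p)))"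
      using p by (simp add: ennreal_mult' log_majorant_nonneg)
  qed
  also have "\<dots> = ((\<integral>\<^sup>+p. ennreal (norm (fst p)) \<partial>(\<mu> \<Otimes>\<^sub>M \<mu>)) + (\<integral>\<^sup>+p. ennreal (norm (snd p)) \<partial>(\<mu> \<Otimes>\<^sub>M \<mu>)))
      + 4 * (\<integral>\<^sup>+p. ennreal (log_majorant (sqrt (fst p) - sqrt (snd p))) \<partial>(\<mu> \<Otimes>\<^sub>M \<mu>))"
    by (simp add: nn_integral_add nn_integral_cmult)
  also have "\<dots> < \<infinity>"
  proof -
    have "(\<integral>\<^sup>+p. ennreal (norm (fst p)) \<partial>(\<mu> \<Otimes>\<^sub>M \<mu>)) < \<infinity>" "(\<integral>\<^sup>+p. ennreal (norm (snd p)) \<partial>(\<mu> \<Otimes>\<^sub>M \<mu>)) < \<infinity>"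
      using integrable_mu_pair_fst(1,3)[OF x] by (auto simp: integrable_iff_bounded)
    moreover have "(\<integral>\<^sup>+p. ennreal (log_majorant (sqrt (fst p) - sqrt (snd p))) \<partial>(\<mu> \<Otimes>\<^sub>M \<mu>)) < \<infinity>"
      using nn_integral_log_majorant_mu by (subst nn_integral_fst[symmetric]) auto
    ultimately show ?thesis by (simp add: ennreal_mult_less_top)
  qed
  finally show "(\<integral>\<^sup>+p. ennreal (norm (ln \<bar>fst p - snd p\<bar>)) \<partial>(\<mu> \<Otimes>\<^sub>M \<mu>)) < \<infinity>" .
qed

text \<open>The diagonal, where \<open>elog\<close> is -\<infinity>, is a null set, and both parts
  of the kernel have finite integral, so the difference in \<open>eintegral\<close> is an ordinary
  integral.\<close>

lemma weighted_energy_eq: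
  assumes x: "integrable \<mu> (\<lambda>x. x)" and Q: "integrable \<mu> Q"
  shows "weighted_energy Q \<mu> = ereal ((LINT x|\<mu>. Q x) - (LINT p|(\<mu> \<Otimes>\<^sub>M \<mu>). ln \<bar>fst p - snd p\<bar>))"
proof -
  define k where "k p = (Q (fst p) + Q (snd p)) / 2 - ln \<bar>fst p - snd p\<bar>" for p
  have ik: "integrable (\<mu> \<Otimes>\<^sub>M \<mu>) k"
    unfolding k_def using integrable_mu_pair_fst(1,3)[OF Q] integrable_log_energy[OF x] by auto
  have vk: "(LINT p|(\<mu> \<Otimes>\<^sub>M \<mu>). k p) = (LINT x|\<mu>. Q x) - (LINT p|(\<mu> \<Otimes>\<^sub>M \<mu>). ln \<bar>fst p - snd p\<bar>)"
    unfolding k_def using integrable_mu_pair_fst[OF Q] integrable_log_energy[OF x] by simp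
  have eq: "AE p in \<mu> \<Otimes>\<^sub>M \<mu>. (case p of (x, y) \<Rightarrow> - elog \<bar>x - y\<bar> + ereal ((Q x + Q y) / 2)) = ereal (k p)"
    using AE_mu_offdiag by eventually_elim (auto simp: elog_def k_def split: prod.split)
  have 1: "(\<integral>\<^sup>+p. e2ennreal (case p of (x, y) \<Rightarrow> - elog \<bar>x - y\<bar> + ereal ((Q x + Q y) / 2)) \<partial>(\<mu> \<Otimes>\<^sub>M \<mu>)) = (\<integral>\<^sup>+p. ennreal (k p) \<partial>(\<mu> \<Otimes>\<^sub>M \<mu>))"
    by (rule nn_integral_cong_AE) (use eq in eventually_elim, simp add: e2ennreal_ereal)
  have 2: "(\<integral>\<^sup>+p. e2ennreal (- (case p of (x, y) \<Rightarrow> - elog \<bar>x - y\<bar> + ereal ((Q x + Q y) / 2))) \<partial>(\<mu> \<Otimes>\<^sub>M \<mu>)) = (\<integral>\<^sup>+p. ennreal (- k p) \<partial>(\<mu> \<Otimes>\<^sub>M \<mu>))"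
    by (rule nn_integral_cong_AE) (use eq in eventually_elim, simp add: e2ennreal_ereal)
  have fin: "(\<integral>\<^sup>+p. ennreal (k p) \<partial>(\<mu> \<Otimes>\<^sub>M \<mu>)) \<noteq> \<infinity>" "(\<integral>\<^sup>+p. ennreal (- k p) \<partial>(\<mu> \<Otimes>\<^sub>M \<mu>)) \<noteq> \<infinity>"
    using ik by (auto simp: real_integrable_def)
  have "(LINT p|(\<mu> \<Otimes>\<^sub>M \<mu>). k p) = enn2real (\<integral>\<^sup>+p. ennreal (k p) \<partial>(\<mu> \<Otimes>\<^sub>M \<mu>)) - enn2real (\<integral>\<^sup>+p. ennreal (- k p) \<partial>(\<mu> \<Otimes>\<^sub>M \<mu>))"
    by (rule real_lebesgue_integral_def[OF ik])
  then show ?thesis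
    unfolding weighted_energy_def eintegral_def 1 2 vk[symmetric] using fin
    by (cases "\<integral>\<^sup>+p. ennreal (k p) \<partial>(\<mu> \<Otimes>\<^sub>M \<mu>)"; cases "\<integral>\<^sup>+p. ennreal (- k p) \<partial>(\<mu> \<Otimes>\<^sub>M \<mu>)") auto
qed

end

section \<open>Transport of quantile blocks\<close>

text \<open>The two difference quotients of square roots add up to twice (S * sqrt x - R * sqrt y) /
  (x - y), exactly the kernel of the pairing; each use of ln r <= r - 1 leaves a -1.\<close>

lemma ln_square_dist_le:
  fixes x y S R :: real
  assumes xy: "0 \<le> y" "y < x" and SR: "0 \<le> R" "R < S"
  shows "ln \<bar>S\<^sup>2 - R\<^sup>2\<bar> \<le> ln \<bar>x - y\<bar> + 2 * ((S * sqrt x - R * sqrt y) / (x - y)) - 2"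
proof -
  define s t where "s = sqrt x" and "t = sqrt y"
  have st: "0 \<le> t" "t < s" using xy by (auto simp: s_def t_def)
  have x: "x = s\<^sup>2" "y = t\<^sup>2" using xy by (auto simp: s_def t_def)
  have fac: "x - y = (s - t) * (s + t)" "S\<^sup>2 - R\<^sup>2 = (S - R) * (S + R)"
    unfolding x by (simp_all add: power2_eq_square algebra_simps)
  have p1: "0 < (S - R) / (s - t)" and p2: "0 < (S + R) / (s + t)" using st SR by auto
  have "ln \<bar>S\<^sup>2 - R\<^sup>2\<bar> = ln (S - R) + ln (S + R)"
    unfolding fac using SR by (simp add: abs_mult ln_mult)
  moreover have "ln \<bar>x - y\<bar> = ln (s - t) + ln (s + t)"
    unfolding fac using st by (simp add: abs_mult ln_mult)
  moreover have "ln (S - R) - ln (s - t) \<le> (S - R) / (s - t) - 1"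
    using ln_le_minus_one[OF p1] st SR by (simp add: ln_div)
  moreover have "ln (S + R) - ln (s + t) \<le> (S + R) / (s + t) - 1"
    using ln_le_minus_one[OF p2] st SR by (simp add: ln_div)
  moreover have "(S - R) / (s - t) + (S + R) / (s + t) = 2 * ((S * s - R * t) / (x - y))"
  proof -
    have "s - t \<noteq> 0" "s + t \<noteq> 0" using st by auto
    then show ?thesis unfolding fac(1) by (simp add: add_frac_eq) (simp add: algebra_simps)
  qed
  ultimately show ?thesis unfolding s_def[symmetric] t_def[symmetric] by linarith
qed

section \<open>Quantile blocks\<close>

context half_line_density
begin

definition cum :: "real \<Rightarrow> real" where "cum x = measure \<mu> {0..x}"

lemma atLeastAtMost_sets_mu [measurable]: "{0..x::real} \<in> sets \<mu>"
  by (auto simp: sets_mu sets_restrict_space_iff)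

lemma cum_mono: "x \<le> y \<Longrightarrow> cum x \<le> cum y"
  unfolding cum_def by (rule finite_measure_mono) auto

lemma cum_le_1: "cum x \<le> 1" and cum_nonneg: "0 \<le> cum x"
  by (simp_all add: cum_def)

lemma cum_neg: "x < 0 \<Longrightarrow> cum x = 0"
  by (simp add: cum_def)

lemma cum_continuous: "isCont cum x"
proof -
  define M where "M = distr \<mu> borel (\<lambda>x. x)"
  have id: "(\<lambda>x. x) \<in> \<mu> \<rightarrow>\<^sub>M borel" by (rule measurable_mu) simp
  interpret M: real_distribution M
    unfolding M_def by (rule real_distribution_distr[OF id])
  have eq: "cdf M y = cum y" for y
  proof -
    have "(\<lambda>x. x) -` {..y} \<inter> space \<mu> = {0..y}" by (auto simp: space_mu)
    then show ?thesis unfolding cdf_def M_def cum_def by (subst measure_distr[OF id]) auto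
  qed
  have "measure M {x} = 0"
  proof -
    have "AE y in \<mu>. y \<noteq> x"
    proof (rule AE_muI)
      show "AE s in lborel. 0 < s \<longrightarrow> s\<^sup>2 \<noteq> x"
        using AE_lborel_singleton[of "sqrt x"] by eventually_elim auto
    qed
    then have "AE y in M. y \<noteq> x" unfolding M_def by (subst AE_distr_iff[OF id]) auto
    then have "AE y in M. y \<notin> {x}" by simp
    then have "{x} \<in> null_sets M" by (subst AE_iff_null_sets) auto
    then show ?thesis by (simp add: measure_eq_0_null_sets)
  qed
  then have "isCont (cdf M) x" by (simp add: M.isCont_cdf)
  then show ?thesis by (simp add: eq[abs_def])
qed

lemma cum_lim: "(cum \<longlongrightarrow> 1) at_top"
proof -
  define M where "M = distr \<mu> borel (\<lambda>x. x)"
  have id: "(\<lambda>x. x) \<in> \<mu> \<rightarrow>\<^sub>M borel" by (rule measurable_mu) simp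
  interpret M: real_distribution M
    unfolding M_def by (rule real_distribution_distr[OF id])
  have "cdf M y = cum y" for y
  proof -
    have "(\<lambda>x. x) -` {..y} \<inter> space \<mu> = {0..y}" by (auto simp: space_mu)
    then show ?thesis unfolding cdf_def M_def cum_def by (subst measure_distr[OF id]) auto
  qed
  then have "cdf M = cum" by (intro ext)
  then show ?thesis using M.cdf_lim_at_top_prob by simp
qed

lemma cum_measurable [measurable]: "cum \<in> borel_measurable borel"
  by (intro borel_measurable_continuous_onI continuous_at_imp_continuous_on) (simp add: cum_continuous)

text \<open>Under \<open>mu\<close> the distribution function is uniformly distributed: the sublevel
  set is an initial interval whose right end c satisfies cum c = u by continuity. The bound u < 1
  makes c finite.\<close>

lemma measure_cum_le:
  assumes u: "0 \<le> u" "u < 1"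
  shows "measure \<mu> {x\<in>space \<mu>. cum x \<le> u} = u"
proof -
  define S where "S = {x. cum x \<le> u}"
  have "eventually (\<lambda>x. u < cum x) at_top" using cum_lim u(2) by (rule order_tendstoD(1))
  then obtain b where b: "u < cum b" by (auto simp: eventually_at_top_linorder)
  have bdd: "bdd_above S"
  proof (rule bdd_aboveI)
    fix x assume "x \<in> S"
    then show "x \<le> b" using b cum_mono[of b x] by (force simp: S_def)
  qed
  \<comment> \<open>\<open>cum\<close> vanishes on negative numbers, which guarantees a point of S
    even for u = 0.\<close>
  have ne: "- 1 \<in> S" using u by (simp add: S_def cum_neg)
  have cl: "closed S"
    unfolding S_def by (intro closed_Collect_le continuous_at_imp_continuous_on ballI cum_continuous continuous_on_const)
  define c where "c = Sup S"
  have cS: "c \<in> S" unfolding c_def by (rule closed_contains_Sup[OF _ bdd cl]) (use ne in auto)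
  have le: "cum c \<le> u" using cS by (simp add: S_def)
  have "u \<le> cum c"
  proof (rule ccontr)
    assume "\<not> u \<le> cum c"
    then have "cum c < u" by simp
    moreover have "(cum \<longlongrightarrow> cum c) (at_right c)"
      using cum_continuous[of c] unfolding isCont_def by (rule filterlim_mono[OF _ order_refl]) (simp add: at_within_le_at)
    ultimately have "eventually (\<lambda>x. cum x < u) (at_right c)" by (intro order_tendstoD(2)) 
    then obtain d where d: "d > c" "\<And>y. c < y \<Longrightarrow> y < d \<Longrightarrow> cum y < u"
      by (auto simp: eventually_at_right_field)
    have "(c + d) / 2 \<in> S" using d(2)[of "(c + d) / 2"] d(1) by (simp add: S_def)
    then have "(c + d) / 2 \<le> c" unfolding c_def by (rule cSup_upper[OF _ bdd])
    then show False using d(1) by simp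
  qed
  then have eq: "cum c = u" using le by simp
  have "{x\<in>space \<mu>. cum x \<le> u} = {0..c}"
  proof (intro equalityI subsetI)
    fix x assume "x \<in> {x\<in>space \<mu>. cum x \<le> u}"
    then have "x \<in> S" "0 \<le> x" by (auto simp: S_def space_mu)
    then show "x \<in> {0..c}" unfolding c_def using cSup_upper[OF _ bdd] by auto
  next
    fix x assume "x \<in> {0..c}"
    then show "x \<in> {x\<in>space \<mu>. cum x \<le> u}" using cum_mono[of x c] le by (auto simp: space_mu)
  qed
  then show ?thesis using eq by (simp add: cum_def)
qed

text \<open>The index of the quantile block of \<open>x\<close>; truncated subtraction puts \<open>cum x = 0\<close> into block 0.\<close>

definition block :: "nat \<Rightarrow> real \<Rightarrow> nat" where
  "block n x = nat \<lceil>real n * cum x\<rceil> - 1"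

lemma block_measurable [measurable]: "block n \<in> measurable borel (count_space UNIV)"
  unfolding block_def by measurable

lemma block_measurable_mu [measurable]: "block n \<in> measurable \<mu> (count_space UNIV)"
  by (subst measurable_cong_sets[OF sets_mu refl]) (rule measurable_restrict_space1, measurable)

lemma block_mono: "x \<le> y \<Longrightarrow> block n x \<le> block n y"
  unfolding block_def by (intro diff_le_mono nat_mono ceiling_mono mult_left_mono cum_mono) auto

lemma block_less: "0 < n \<Longrightarrow> block n x < n"
proof -
  assume n: "0 < n"
  have "real n * cum x \<le> real n * 1" by (intro mult_left_mono cum_le_1) auto
  then have "\<lceil>real n * cum x\<rceil> \<le> int n" by (simp add: ceiling_le_iff)
  then show ?thesis using n unfolding block_def by linarith
qed

lemma block_le_iff: "0 < n \<Longrightarrow> block n x \<le> i \<longleftrightarrow> cum x \<le> real (Suc i) / real n"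
proof -
  assume n: "0 < n"
  have "block n x \<le> i \<longleftrightarrow> \<lceil>real n * cum x\<rceil> \<le> int (Suc i)" unfolding block_def by linarith
  also have "\<dots> \<longleftrightarrow> real n * cum x \<le> real (Suc i)" by (simp add: ceiling_le_iff)
  also have "\<dots> \<longleftrightarrow> cum x \<le> real (Suc i) / real n" using n by (simp add: field_simps)
  finally show ?thesis .
qed

lemma measure_block_le:
  assumes "i < n"
  shows "measure \<mu> {x\<in>space \<mu>. block n x \<le> i} = real (Suc i) / real n"
proof (cases "Suc i = n")
  case True
  have "{x\<in>space \<mu>. block n x \<le> i} = space \<mu>"
    using block_less[of n] True by (auto simp: less_Suc_eq_le)
  then show ?thesis using True prob_space by simp
next
  case False
  then show ?thesis using assms measure_cum_le[of "real (Suc i) / real n"] by (simp add: block_le_iff)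
qed

lemma measure_block:
  assumes "i < n"
  shows "measure \<mu> {x\<in>space \<mu>. block n x = i} = 1 / real n"
proof (cases i)
  case 0
  then show ?thesis using measure_block_le[OF assms] by simp
next
  case (Suc j)
  have "{x\<in>space \<mu>. block n x = i} = {x\<in>space \<mu>. block n x \<le> i} - {x\<in>space \<mu>. block n x \<le> j}"
    using Suc by auto
  also have "measure \<mu> \<dots> = measure \<mu> {x\<in>space \<mu>. block n x \<le> i} - measure \<mu> {x\<in>space \<mu>. block n x \<le> j}"
    by (rule finite_measure_Diff) (auto simp: Suc)
  also have "\<dots> = real (Suc i) / real n - real i / real n"
    using measure_block_le[OF assms] measure_block_le[of j n] Suc assms by simp
  also have "\<dots> = 1 / real n" by (simp add: diff_divide_distrib[symmetric])
  finally show ?thesis .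
qed

lemma integral_block:
  fixes h :: "nat \<Rightarrow> real"
  assumes n: "0 < n"
  shows "integrable \<mu> (\<lambda>x. h (block n x))" "(LINT x|\<mu>. h (block n x)) = (\<Sum>i<n. h i) / real n"
proof -
  have eq: "h (block n x) = (\<Sum>i<n. h i * indicator {x\<in>space \<mu>. block n x = i} x)" if "x \<in> space \<mu>" for x
    using that block_less[OF n, of x] by (subst sum.remove[of _ "block n x"]) (auto simp: indicator_def intro!: sum.neutral)
  have i: "integrable \<mu> (\<lambda>x. h i * indicator {x\<in>space \<mu>. block n x = i} x)" for i
    by (intro integrable_mult_right) (simp add: integrable_indicator_iff emeasure_eq_measure)
  have "integrable \<mu> (\<lambda>x. \<Sum>i<n. h i * indicator {x\<in>space \<mu>. block n x = i} x)"
    by (intro Bochner_Integration.integrable_sum i)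
  then show "integrable \<mu> (\<lambda>x. h (block n x))"
    by (subst Bochner_Integration.integrable_cong[OF refl eq])
  have "(LINT x|\<mu>. h (block n x)) = (LINT x|\<mu>. (\<Sum>i<n. h i * indicator {x\<in>space \<mu>. block n x = i} x))"
    by (rule Bochner_Integration.integral_cong[OF refl eq])
  also have "\<dots> = (\<Sum>i<n. LINT x|\<mu>. h i * indicator {x\<in>space \<mu>. block n x = i} x)"
    by (rule Bochner_Integration.integral_sum) (rule i)
  also have "\<dots> = (\<Sum>i<n. h i * (1 / real n))"
    by (intro sum.cong refl) (simp add: measure_block Int_absorb2)
  finally show "(LINT x|\<mu>. h (block n x)) = (\<Sum>i<n. h i) / real n" by (simp add: sum_divide_distrib)
qed

lemma integral_block_pair:
  fixes h :: "nat \<Rightarrow> nat \<Rightarrow> real"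
  assumes n: "0 < n"
  shows "integrable (\<mu> \<Otimes>\<^sub>M \<mu>) (\<lambda>p. h (block n (fst p)) (block n (snd p)))"
    "(LINT p|(\<mu> \<Otimes>\<^sub>M \<mu>). h (block n (fst p)) (block n (snd p))) = (\<Sum>i<n. \<Sum>j<n. h i j) / (real n)\<^sup>2"
proof -
  interpret P: pair_prob_space \<mu> \<mu> ..
  have [measurable]: "(\<lambda>p. h (block n (fst p)) (block n (snd p))) \<in> borel_measurable (\<mu> \<Otimes>\<^sub>M \<mu>)"
    by measurable
  define C where "C = Max ((\<lambda>(i, j). \<bar>h i j\<bar>) ` ({..<n} \<times> {..<n}))"
  have C: "\<bar>h i j\<bar> \<le> C" if "i < n" "j < n" for i j
    unfolding C_def using that by (intro Max_ge) auto
  show int: "integrable (\<mu> \<Otimes>\<^sub>M \<mu>) (\<lambda>p. h (block n (fst p)) (block n (snd p)))"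
    by (rule P.integrable_const_bound[where B=C]) (use C block_less[OF n] in auto)
  have "(LINT p|(\<mu> \<Otimes>\<^sub>M \<mu>). h (block n (fst p)) (block n (snd p))) = (LINT x|\<mu>. LINT y|\<mu>. h (block n x) (block n y))"
    using P.integral_fst'[OF int] by simp
  also have "\<dots> = (LINT x|\<mu>. (\<Sum>j<n. h (block n x) j) / real n)"
    by (simp add: integral_block(2)[OF n])
  also have "\<dots> = (\<Sum>i<n. (\<Sum>j<n. h i j) / real n) / real n"
    by (rule integral_block(2)[OF n])
  finally show "(LINT p|(\<mu> \<Otimes>\<^sub>M \<mu>). h (block n (fst p)) (block n (snd p))) = (\<Sum>i<n. \<Sum>j<n. h i j) / (real n)\<^sup>2"
    by (simp add: sum_divide_distrib power2_eq_square)
qed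

text \<open>Block j is where n * cum x lies in the half-open interval from j to j + 1, closed on the
  right; block 0 also contains the value 0.\<close>

lemma block_eq_imp_close:
  assumes n: "0 < n" and eq: "block n x = block n y"
  shows "\<bar>cum x - cum y\<bar> \<le> 1 / real n"
proof -
  have main: "cum x - cum y \<le> 1 / real n" if "block n x = block n y" for x y
  proof (cases "block n y")
    case 0
    then have "cum x \<le> 1 / real n" using block_le_iff[OF n, of x 0] that by simp
    then show ?thesis using cum_nonneg[of y] by linarith
  next
    case (Suc j)
    then have "\<not> cum y \<le> real (Suc j) / real n" using block_le_iff[OF n, of y j] by simp
    moreover have "cum x \<le> real (Suc (Suc j)) / real n" using block_le_iff[OF n, of x "Suc j"] that Suc by simp
    moreover have "real (Suc (Suc j)) / real n = real (Suc j) / real n + 1 / real n" by (simp add: add_divide_distrib)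
    ultimately show ?thesis by linarith
  qed
  show ?thesis using main[OF eq] main[OF eq[symmetric]] by linarith
qed

text \<open>A level set of \<open>cum\<close> lies in a single block for every n, so its mass is at
  most 1 / n.\<close>

lemma AE_cum_neq: "AE p in \<mu> \<Otimes>\<^sub>M \<mu>. cum (fst p) \<noteq> cum (snd p)"
proof -
  interpret P: pair_prob_space \<mu> \<mu> ..
  have [measurable]: "cum \<in> borel_measurable \<mu>" by (rule measurable_mu) measurable
  have "AE x in \<mu>. AE y in \<mu>. cum (fst (x, y)) \<noteq> cum (snd (x, y))"
  proof (rule AE_I2)
    fix x
    define N where "N = {y\<in>space \<mu>. cum y = cum x}"
    have [measurable]: "N \<in> sets \<mu>" unfolding N_def by measurable
    have le: "measure \<mu> N \<le> 1 / real n" if n: "0 < n" for n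
    proof -
      have "N \<subseteq> {y\<in>space \<mu>. block n y = block n x}" by (auto simp: N_def block_def)
      then have "measure \<mu> N \<le> measure \<mu> {y\<in>space \<mu>. block n y = block n x}" by (rule finite_measure_mono) measurable
      then show ?thesis using measure_block[OF block_less[OF n]] by simp
    qed
    have "measure \<mu> N \<le> 0"
    proof (rule LIMSEQ_le_const[OF lim_const_over_n[of 1]])
      show "\<exists>N'. \<forall>n\<ge>N'. measure \<mu> N \<le> 1 / real n" by (rule exI[of _ 1]) (use le in auto)
    qed
    then have "emeasure \<mu> N = 0" by (simp add: emeasure_eq_measure measure_le_0_iff)
    then have "AE y in \<mu>. y \<notin> N" by (intro AE_not_in) auto
    then show "AE y in \<mu>. cum (fst (x, y)) \<noteq> cum (snd (x, y))"
      using AE_space by eventually_elim (auto simp: N_def)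
  qed
  then show ?thesis by (intro P.AE_pair_measure) auto
qed

text \<open>Almost every pair has distinct values of \<open>cum\<close> and is separated once 1 / n
  falls below their distance; dominated convergence does the rest. This disposes of pairs within one
  block, which the transport collapses to one point.\<close>

lemma integral_same_block_tendsto:
  fixes f :: "real \<times> real \<Rightarrow> real"
  assumes f: "integrable (\<mu> \<Otimes>\<^sub>M \<mu>) f"
  shows "(\<lambda>n. LINT p|(\<mu> \<Otimes>\<^sub>M \<mu>). (if block n (fst p) = block n (snd p) then f p else 0)) \<longlonglongrightarrow> 0"
proof -
  have [measurable]: "f \<in> borel_measurable (\<mu> \<Otimes>\<^sub>M \<mu>)" using f by auto
  define h :: "nat \<Rightarrow> nat \<Rightarrow> real" where "h i j = (if i = j then 1 else 0)" for i j
  have "(\<lambda>p. h (block n (fst p)) (block n (snd p)) * f p) \<in> borel_measurable (\<mu> \<Otimes>\<^sub>M \<mu>)" for n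
    by measurable
  moreover have "(\<lambda>p. h (block n (fst p)) (block n (snd p)) * f p) = (\<lambda>p. if block n (fst p) = block n (snd p) then f p else 0)" for n
    by (auto simp: h_def)
  ultimately have [measurable]: "(\<lambda>p. if block n (fst p) = block n (snd p) then f p else 0) \<in> borel_measurable (\<mu> \<Otimes>\<^sub>M \<mu>)" for n
    by simp
  have "(\<lambda>n. LINT p|(\<mu> \<Otimes>\<^sub>M \<mu>). (if block n (fst p) = block n (snd p) then f p else 0)) \<longlonglongrightarrow> (LINT p|(\<mu> \<Otimes>\<^sub>M \<mu>). 0)"
  proof (rule integral_dominated_convergence)
    show "integrable (\<mu> \<Otimes>\<^sub>M \<mu>) (\<lambda>p. norm (f p))" using f by (rule integrable_norm)
    show "AE p in \<mu> \<Otimes>\<^sub>M \<mu>. (\<lambda>n. if block n (fst p) = block n (snd p) then f p else 0) \<longlonglongrightarrow> 0"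
      using AE_cum_neq
    proof eventually_elim
      case (elim p)
      define e where "e = \<bar>cum (fst p) - cum (snd p)\<bar>"
      have "0 < e" using elim by (simp add: e_def)
      then obtain N where N: "1 / real (Suc N) < e" using reals_Archimedean by (auto simp: inverse_eq_divide)
      have "block n (fst p) \<noteq> block n (snd p)" if n: "Suc N \<le> n" for n
      proof
        assume "block n (fst p) = block n (snd p)"
        then have "e \<le> 1 / real n" unfolding e_def using n by (intro block_eq_imp_close) auto
        also have "\<dots> \<le> 1 / real (Suc N)" using n by (intro divide_left_mono) auto
        finally show False using N by simp
      qed
      then show ?case by (intro tendsto_eventually eventually_sequentiallyI[of "Suc N"]) simp
    qed
  qed (auto intro!: AE_I2)
  then show ?thesis by simp
qed

end

section \<open>Comparison of the measure with a finite configuration\<close>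

context finite_fisher
begin

text \<open>A pointwise bound for pairs in different blocks is integrated over the product measure
  and combined with the one-point transport inequality for the potential. The last bracket is the
  price of pairs in the same block, whose total mass is 1 / n.\<close>

lemma config_energy_le:
  assumes n: "n \<ge> 2" and P: "P \<in> configs n"
  shows "log_energy_sum P / (real n)\<^sup>2 - (\<Sum>a\<in>P. Q a) / real n
    \<le> ((LINT p|(\<mu> \<Otimes>\<^sub>M \<mu>). ln \<bar>fst p - snd p\<bar>) - (LINT x|\<mu>. Q x) + 4 / \<rho> * (LINT x|\<mu>. (G x)\<^sup>2))
      + (2 / real n + (LINT p|(\<mu> \<Otimes>\<^sub>M \<mu>). (if block n (fst p) = block n (snd p) then \<bar>ln \<bar>fst p - snd p\<bar>\<bar> else 0)))"
proof -
  have n0: "0 < n" using n by simp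
  have fin: "finite P" "card P = n" "P \<subseteq> {0..}" using P by (auto simp: configs_def)
  define xs where "xs = sorted_list_of_set P"
  define c where "c i = xs ! i" for i
  have len: "length xs = n" and ss: "sorted_wrt (<) xs" and sx: "set xs = P"
    using fin by (auto simp: xs_def)
  have cmono: "c i < c j" if "i < j" "j < n" for i j
    using ss that len by (auto simp: c_def sorted_wrt_iff_nth_less)
  have inj: "inj_on c {..<n}"
    using cmono by (intro linorder_inj_onI') fastforce
  have im: "c ` {..<n} = P"
    using sx len by (auto simp: c_def set_conv_nth)
  have cpos: "0 \<le> c i" if "i < n" for i using im fin that by auto
  define \<tau> where "\<tau> x = sqrt (c (block n x))" for x
  have tau_meas[measurable]: "\<tau> \<in> borel_measurable borel"
    unfolding \<tau>_def by (rule measurable_compose[OF block_measurable, of "\<lambda>i. sqrt (c i)"]) simp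
  have tau_sq: "(\<tau> x)\<^sup>2 = c (block n x)" for x
    using cpos[OF block_less[OF n0]] by (simp add: \<tau>_def)
  have tau_nn: "0 \<le> \<tau> x" for x using cpos[OF block_less[OF n0]] by (simp add: \<tau>_def)
  have cle: "c i \<le> c j" if "i \<le> j" "j < n" for i j
    using cmono[of i j] that by (cases "i = j") auto
  have tau_mono: "\<tau> x \<le> \<tau> y" if "x \<le> y" for x y
    unfolding \<tau>_def using cle[OF block_mono[OF that] block_less[OF n0]] by simp
  have tau_le: "\<tau> x \<le> sqrt (c (n - 1))" for x
    unfolding \<tau>_def using block_less[OF n0, of x] n0 by (intro real_sqrt_le_mono cle) auto
  have tau_less: "\<tau> y < \<tau> x" if "y \<le> x" "block n x \<noteq> block n y" for x y
  proof -
    have "block n y < block n x" using block_mono[OF that(1), of n] that(2) by simp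
    then show ?thesis unfolding \<tau>_def using cmono[OF _ block_less[OF n0]] by simp
  qed
  note pair = pairing[OF tau_meas tau_nn tau_le tau_mono]
  have itH: "integrable \<mu> (\<lambda>x. \<tau> x * H x)" using pair by blast
  define K where "K p = (\<tau> (fst p) * sqrt (fst p) - \<tau> (snd p) * sqrt (snd p)) / (fst p - snd p)" for p
  have K_meas: "K \<in> borel_measurable (\<mu> \<Otimes>\<^sub>M \<mu>)"
    by (rule measurable_mu_pair) (unfold K_def, measurable)
  have K_nn: "0 \<le> K p" if "p \<in> space (\<mu> \<Otimes>\<^sub>M \<mu>)" for p
  proof -
    have p: "0 \<le> fst p" "0 \<le> snd p" using that by (auto simp: space_pair_measure space_mu)
    have m: "\<tau> x * sqrt x \<le> \<tau> y * sqrt y" if "0 \<le> x" "x \<le> y" for x y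
      using that tau_mono[OF that(2)] tau_nn by (intro mult_mono) auto
    show ?thesis unfolding K_def
      using m[of "fst p" "snd p"] m[of "snd p" "fst p"] p
      by (cases "fst p \<le> snd p") (auto intro: divide_nonpos_nonpos)
  qed
  have nnK: "(\<integral>\<^sup>+p. ennreal (K p) \<partial>(\<mu> \<Otimes>\<^sub>M \<mu>)) = ennreal (2 * (LINT x|\<mu>. \<tau> x * H x))"
  proof -
    have "(\<integral>\<^sup>+x. \<integral>\<^sup>+y. ennreal (K (x, y)) \<partial>\<mu> \<partial>\<mu>) = (\<integral>\<^sup>+p. ennreal (K p) \<partial>(\<mu> \<Otimes>\<^sub>M \<mu>))"
      using K_meas by (intro nn_integral_fst) auto
    then show ?thesis using pair by (simp add: K_def)
  qed
  \<comment> \<open>Finiteness of the double integral is supplied by \<open>pairing\<close>, which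
    equates it with the \<open>ennreal\<close> of a real number.\<close>
  have iK: "integrable (\<mu> \<Otimes>\<^sub>M \<mu>) K"
    by (rule integrableI_nonneg) (use K_meas K_nn nnK in \<open>auto intro: AE_I2\<close>)
  have vK: "(LINT p|(\<mu> \<Otimes>\<^sub>M \<mu>). K p) = 2 * (LINT x|\<mu>. \<tau> x * H x)"
  proof -
    have "0 \<le> (LINT x|\<mu>. \<tau> x * H x)" using pair by blast
    moreover have "0 \<le> (LINT p|(\<mu> \<Otimes>\<^sub>M \<mu>). K p)" by (intro integral_nonneg_AE AE_I2 K_nn)
    moreover have "(\<integral>\<^sup>+p. ennreal (K p) \<partial>(\<mu> \<Otimes>\<^sub>M \<mu>)) = ennreal (LINT p|(\<mu> \<Otimes>\<^sub>M \<mu>). K p)"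
      by (intro nn_integral_eq_integral iK AE_I2 K_nn)
    ultimately show ?thesis using nnK by simp
  qed
  define A where "A = (LINT p|(\<mu> \<Otimes>\<^sub>M \<mu>). ln \<bar>fst p - snd p\<bar>)"
  \<comment> \<open>The value 0 on the diagonal matches the omission of equal points in
    \<open>log_energy_sum\<close>.\<close>
  define h :: "nat \<Rightarrow> nat \<Rightarrow> real" where "h i j = (if i = j then 0 else ln \<bar>c i - c j\<bar>)" for i j
  define d :: "nat \<Rightarrow> nat \<Rightarrow> real" where "d i j = (if i = j then 1 else 0)" for i j
  define D where "D p = d (block n (fst p)) (block n (snd p)) * \<bar>ln \<bar>fst p - snd p\<bar>\<bar>" for p
  have L_int: "integrable (\<mu> \<Otimes>\<^sub>M \<mu>) (\<lambda>p. ln \<bar>fst p - snd p\<bar>)" by (rule integrable_log_energy[OF integrable_x])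
  note h_int = integral_block_pair[OF n0, of h] and d_int = integral_block_pair[OF n0, of d]
  have D_int: "integrable (\<mu> \<Otimes>\<^sub>M \<mu>) D"
  proof (rule Bochner_Integration.integrable_bound[OF L_int])
    have [measurable]: "(\<lambda>p. ln \<bar>fst p - snd p\<bar>) \<in> borel_measurable (\<mu> \<Otimes>\<^sub>M \<mu>)"
      "(\<lambda>p. d (block n (fst p)) (block n (snd p))) \<in> borel_measurable (\<mu> \<Otimes>\<^sub>M \<mu>)"
      using L_int d_int(1) by auto
    show "D \<in> borel_measurable (\<mu> \<Otimes>\<^sub>M \<mu>)" unfolding D_def by measurable
    show "AE p in \<mu> \<Otimes>\<^sub>M \<mu>. norm (D p) \<le> norm (ln \<bar>fst p - snd p\<bar>)"
      by (rule AE_I2) (simp add: D_def d_def)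
  qed
  \<comment> \<open>For pairs in one block the left side is 0: \<open>D\<close> offsets a negative
    logarithm and 2 * d restores the -2, which is where 2 / n comes from.\<close>
  have point: "h (block n (fst p)) (block n (snd p))
      \<le> (ln \<bar>fst p - snd p\<bar> + D p) + (2 * K p + (2 * d (block n (fst p)) (block n (snd p)) - 2))"
    if p: "p \<in> space (\<mu> \<Otimes>\<^sub>M \<mu>)" for p
  proof (cases "block n (fst p) = block n (snd p)")
    case True
    then have "h (block n (fst p)) (block n (snd p)) = 0" "d (block n (fst p)) (block n (snd p)) = 1"
      "D p = \<bar>ln \<bar>fst p - snd p\<bar>\<bar>"
      by (simp_all add: h_def d_def D_def)
    then show ?thesis using K_nn[OF p] by linarith
  next
    case False
    have p0: "0 \<le> fst p" "0 \<le> snd p" using p by (auto simp: space_pair_measure space_mu)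
    have main: "ln \<bar>c (block n x) - c (block n y)\<bar> \<le> ln \<bar>x - y\<bar> + 2 * ((\<tau> x * sqrt x - \<tau> y * sqrt y) / (x - y)) - 2"
      if "0 \<le> y" "y < x" "block n x \<noteq> block n y" for x y
      using ln_square_dist_le[OF that(1,2) tau_nn[of y] tau_less[of y x]] that unfolding tau_sq by simp
    have "ln \<bar>c (block n (fst p)) - c (block n (snd p))\<bar> \<le> ln \<bar>fst p - snd p\<bar> + 2 * K p - 2"
    proof (cases "snd p < fst p")
      case True
      then show ?thesis using main[OF p0(2) True False] by (simp add: K_def)
    next
      case 2: False
      then have lt: "fst p < snd p" using False by (cases "fst p = snd p") auto
      have "K p = (\<tau> (snd p) * sqrt (snd p) - \<tau> (fst p) * sqrt (fst p)) / (snd p - fst p)"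
        unfolding K_def by (metis minus_diff_eq minus_divide_divide)
      then show ?thesis using main[OF p0(1) lt False[symmetric]] by (simp add: abs_minus_commute)
    qed
    moreover have "h (block n (fst p)) (block n (snd p)) = ln \<bar>c (block n (fst p)) - c (block n (snd p))\<bar>"
      "d (block n (fst p)) (block n (snd p)) = 0" "D p = 0"
      using False by (simp_all add: h_def d_def D_def)
    ultimately show ?thesis by linarith
  qed
  interpret P: pair_prob_space \<mu> \<mu> ..
  have "(LINT p|(\<mu> \<Otimes>\<^sub>M \<mu>). h (block n (fst p)) (block n (snd p)))
      \<le> (LINT p|(\<mu> \<Otimes>\<^sub>M \<mu>). (ln \<bar>fst p - snd p\<bar> + D p) + (2 * K p + (2 * d (block n (fst p)) (block n (snd p)) - 2)))"
    by (rule integral_mono[OF h_int(1) _ point])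
      (intro Bochner_Integration.integrable_add Bochner_Integration.integrable_diff integrable_mult_right L_int D_int iK d_int(1) P.integrable_const)
  also have "\<dots> = (A + (LINT p|(\<mu> \<Otimes>\<^sub>M \<mu>). D p)) + (2 * (LINT p|(\<mu> \<Otimes>\<^sub>M \<mu>). K p)
      + (2 * (LINT p|(\<mu> \<Otimes>\<^sub>M \<mu>). d (block n (fst p)) (block n (snd p))) - 2))"
    using L_int D_int iK d_int(1) by (simp add: A_def P.prob_space)
  also have "(LINT p|(\<mu> \<Otimes>\<^sub>M \<mu>). d (block n (fst p)) (block n (snd p))) = 1 / real n"
    unfolding d_int(2) using n0 by (simp add: d_def power2_eq_square)
  finally have E1: "(\<Sum>i<n. \<Sum>j<n. h i j) / (real n)\<^sup>2 \<le> A + (LINT p|(\<mu> \<Otimes>\<^sub>M \<mu>). D p) + 4 * (LINT x|\<mu>. \<tau> x * H x) + 2 / real n - 2"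
    unfolding h_int(2) vK by simp
  have hs: "(\<Sum>i<n. \<Sum>j<n. h i j) = log_energy_sum P"
  proof -
    have "(\<Sum>j<n. h i j) = (\<Sum>j\<in>{..<n}-{i}. ln \<bar>c i - c j\<bar>)" if "i < n" for i
      using that by (subst sum.remove[of _ i]) (auto simp: h_def intro!: sum.cong)
    then show ?thesis unfolding im[symmetric] log_energy_sum_image[OF inj] by (intro sum.cong[OF refl, of _ _ "\<lambda>i. \<Sum>j\<in>{..<n}-{i}. ln \<bar>c i - c j\<bar>"]) simp
  qed
  have itc: "integrable \<mu> (\<lambda>x. Q (c (block n x)))" and vtc: "(LINT x|\<mu>. Q (c (block n x))) = (\<Sum>a\<in>P. Q a) / real n"
    using integral_block[OF n0, of "\<lambda>i. Q (c i)"] inj unfolding im[symmetric] by (simp_all add: sum.reindex)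
  have "(LINT x|\<mu>. 4 * (\<tau> x * H x - sqrt x * H x) - Q (c (block n x))) \<le> (LINT x|\<mu>. 4 / \<rho> * (G x)\<^sup>2 - Q x)"
  proof (rule integral_mono_AE)
    show "integrable \<mu> (\<lambda>x. 4 * (\<tau> x * H x - sqrt x * H x) - Q (c (block n x)))"
      by (intro Bochner_Integration.integrable_diff integrable_mult_right itH integrable_sqrt_H itc)
    show "integrable \<mu> (\<lambda>x. 4 / \<rho> * (G x)\<^sup>2 - Q x)"
      by (intro Bochner_Integration.integrable_diff integrable_mult_right G_square integrable_Q)
    show "AE x in \<mu>. 4 * (\<tau> x * H x - sqrt x * H x) - Q (c (block n x)) \<le> 4 / \<rho> * (G x)\<^sup>2 - Q x"
      using AE_pos
    proof eventually_elim
      case (elim x)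
      define u where "u = \<tau> x - sqrt x"
      have T: "c (block n x) - x = 2 * (sqrt x * u) + u\<^sup>2"
        unfolding tau_sq[symmetric] u_def using elim by (simp add: power2_eq_square algebra_simps)
      have "Q' x * (c (block n x) - x) \<le> Q (c (block n x)) - Q x"
        by (rule tangent[OF elim cpos[OF block_less[OF n0]]])
      moreover have "Q' x * (c (block n x) - x) = 2 * (sqrt x * Q' x * u) + Q' x * u\<^sup>2"
        unfolding T by (simp add: algebra_simps)
      moreover have "\<rho> * u\<^sup>2 \<le> Q' x * u\<^sup>2" using slope[OF elim] by (intro mult_right_mono) auto
      moreover have "4 * (u * G x) - \<rho> * u\<^sup>2 \<le> 4 / \<rho> * (G x)\<^sup>2"
      proof -
        have "0 \<le> (\<rho> * u - 2 * G x)\<^sup>2 / \<rho>" using rho_pos by simp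
        also have "\<dots> = \<rho> * u\<^sup>2 - 4 * (u * G x) + 4 / \<rho> * (G x)\<^sup>2"
          using rho_pos by (simp add: field_simps power2_eq_square)
        finally show ?thesis by linarith
      qed
      moreover have "4 * (\<tau> x * H x - sqrt x * H x) = 4 * (u * G x) + 2 * (sqrt x * Q' x * u)"
        unfolding u_def G_def by (simp add: field_simps)
      ultimately show ?case by linarith
    qed
  qed
  moreover have "(LINT x|\<mu>. 4 * (\<tau> x * H x - sqrt x * H x) - Q (c (block n x)))
      = 4 * ((LINT x|\<mu>. \<tau> x * H x) - (LINT x|\<mu>. sqrt x * H x)) - (\<Sum>a\<in>P. Q a) / real n"
    using itH integrable_sqrt_H itc by (simp add: vtc)
  moreover have "(LINT x|\<mu>. 4 / \<rho> * (G x)\<^sup>2 - Q x) = 4 / \<rho> * (LINT x|\<mu>. (G x)\<^sup>2) - (LINT x|\<mu>. Q x)"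
    using G_square integrable_Q by simp
  moreover have "(LINT p|(\<mu> \<Otimes>\<^sub>M \<mu>). (if block n (fst p) = block n (snd p) then \<bar>ln \<bar>fst p - snd p\<bar>\<bar> else 0)) = (LINT p|(\<mu> \<Otimes>\<^sub>M \<mu>). D p)"
    by (intro Bochner_Integration.integral_cong refl) (simp add: D_def d_def)
  ultimately have "4 * ((LINT x|\<mu>. \<tau> x * H x) - (LINT x|\<mu>. sqrt x * H x)) - (\<Sum>a\<in>P. Q a) / real n
      \<le> 4 / \<rho> * (LINT x|\<mu>. (G x)\<^sup>2) - (LINT x|\<mu>. Q x)"
    and D_eq: "(LINT p|(\<mu> \<Otimes>\<^sub>M \<mu>). (if block n (fst p) = block n (snd p) then \<bar>ln \<bar>fst p - snd p\<bar>\<bar> else 0)) = (LINT p|(\<mu> \<Otimes>\<^sub>M \<mu>). D p)"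
    by simp_all
  \<comment> \<open>The sum of both estimates contains -2 + 4 times the integral of sqrt x * H x,
    which \<open>integral_sqrt_H_le\<close> bounds by 0.\<close>
  then show ?thesis
    using E1 integral_sqrt_H_le unfolding hs A_def[symmetric] D_eq
    by (simp only: right_diff_distrib[of 4])
qed

theorem rel_free_entropy_le_fisher:
  "rel_free_entropy_pos Q \<mu> \<le> ereal (4 / \<rho> * (LINT x|\<mu>. (G x)\<^sup>2))"
proof -
  define A where "A = (LINT p|(\<mu> \<Otimes>\<^sub>M \<mu>). ln \<bar>fst p - snd p\<bar>)"
  have "(\<lambda>n. 2 / real n + (LINT p|(\<mu> \<Otimes>\<^sub>M \<mu>). (if block n (fst p) = block n (snd p) then \<bar>ln \<bar>fst p - snd p\<bar>\<bar> else 0))) \<longlonglongrightarrow> 0 + 0"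
    by (intro tendsto_add lim_const_over_n integral_same_block_tendsto integrable_abs integrable_log_energy integrable_x)
  then have e: "(\<lambda>n. 2 / real n + (LINT p|(\<mu> \<Otimes>\<^sub>M \<mu>). (if block n (fst p) = block n (snd p) then \<bar>ln \<bar>fst p - snd p\<bar>\<bar> else 0))) \<longlonglongrightarrow> 0"
    by simp
  have "B_pos Q \<le> A - (LINT x|\<mu>. Q x) + 4 / \<rho> * (LINT x|\<mu>. (G x)\<^sup>2)"
    by (rule B_pos_leI[OF _ e]) (unfold A_def, rule config_energy_le)
  then show ?thesis
    unfolding rel_free_entropy_pos_def weighted_energy_eq[OF integrable_x integrable_Q] A_def[symmetric] by simp
qed

end

section \<open>The inequality between relative free entropy and Fisher information\<close>

theorem proposition6p4:
  fixes Q :: "real \<Rightarrow> real" and \<rho> :: real and \<mu> :: "real measure"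
  assumes "convex_on {0..} Q"
    and "continuous_on {0..} Q"
    and "Q C1_differentiable_on {0<..}"
    and "\<rho> > 0"
    and "\<And>x. x > 0 \<Longrightarrow> deriv Q x \<ge> \<rho>"
    and "\<mu> \<in> prob_measures_pos"
  shows "rel_free_entropy_pos Q \<mu> \<le> ereal (1 / \<rho>) * rel_free_fisher_pos Q \<mu>"
proof (cases "has_density_pos \<mu> \<and> integrable leb_pos (\<lambda>x. x * \<bar>density_pos \<mu> x\<bar> ^ 3)
    \<and> (\<integral>\<^sup>+ x. ennreal (x * (hilbert_transform (density_pos \<mu>) x - deriv Q x / 2)\<^sup>2) \<partial>\<mu>) < \<infinity>")
  \<comment> \<open>If any of the three conditions fails, the Fisher information is infinite and the
    inequality is trivial.\<close>
  case False
  then have "rel_free_fisher_pos Q \<mu> = \<infinity>"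
    by (auto simp: rel_free_fisher_pos_def less_top[symmetric] numeral_eq_ereal)
  then show ?thesis using assms(4) by simp
next
  case True
  define p where "p = density_pos \<mu>"
  \<comment> \<open>\<open>deriv Q\<close> is controlled on the open half-line only; cutting it off
    gives a Borel function on the whole line.\<close>
  define Q' where "Q' x = indicator {0<..} x * deriv Q x" for x
  have prob: "prob_space \<mu>" and sets: "sets \<mu> = sets borel_pos"
    using assms(6) by (auto simp: prob_measures_pos_def)
  have diff: "Q differentiable at x" if "0 < x" for x
    using assms(3) that unfolding C1_differentiable_on_def has_vector_derivative_def differentiable_def by auto
  have der: "(Q has_real_derivative deriv Q x) (at x)" if "0 < x" for x
    using diff[OF that] by (simp add: DERIV_deriv_iff_real_differentiable)
  have cont: "continuous_on {0<..} (deriv Q)"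
  proof -
    obtain D where D: "\<And>x. x \<in> {0<..} \<Longrightarrow> (Q has_vector_derivative D x) (at x)" "continuous_on {0<..} D"
      using assms(3) unfolding C1_differentiable_on_def by blast
    have "deriv Q x = D x" if "x \<in> {0<..}" for x
      using D(1)[OF that] by (intro DERIV_imp_deriv) (simp add: has_real_derivative_iff_has_vector_derivative)
    then show ?thesis by (intro continuous_on_eq[OF D(2)]) simp
  qed
  \<comment> \<open>The mean value theorem needs differentiability in the interior only, so x = 0 is
    covered by continuity at the end point.\<close>
  have growth: "\<rho> * (y - x) \<le> Q y - Q x" if xy: "0 \<le> x" "x \<le> y" for x y
  proof (cases "x = y")
    case False
    then have lt: "x < y" using xy by simp
    have "continuous_on {x..y} Q" using assms(2) by (rule continuous_on_subset) (use xy in auto)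
    moreover have "(Q has_derivative (\<lambda>h. h * deriv Q z)) (at z)" if "x < z" "z < y" for z
      using der[of z] xy that by (simp add: has_field_derivative_def mult.commute[of _ "deriv Q z"] mult_commute_abs)
    ultimately obtain z where z: "x < z" "z < y" "Q y - Q x = (y - x) * deriv Q z"
      using mvt[OF lt, of Q "\<lambda>z h. h * deriv Q z"] by auto
    have "\<rho> * (y - x) \<le> deriv Q z * (y - x)" using assms(5)[of z] z xy by (intro mult_right_mono) auto
    then show ?thesis using z(3) by (simp add: mult.commute)
  qed simp
  have pot: "confining_potential Q \<rho>"
    by unfold_locales (use assms growth in auto)
  obtain f where f: "f \<in> borel_measurable leb_pos" "density leb_pos f = \<mu>"
    using True by (auto simp: has_density_pos_def)
  have rn: "density leb_pos (RN_deriv leb_pos \<mu>) = \<mu>"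
    using density_RN_deriv_density[OF f(1)] unfolding f(2) .
  have rn_meas[measurable]: "RN_deriv leb_pos \<mu> \<in> borel_measurable leb_pos" by simp
  have p_eq: "p x = indicator {0..} x *\<^sub>R enn2real (RN_deriv leb_pos \<mu> x)" for x
    by (simp add: p_def density_pos_def)
  have p_meas: "p \<in> borel_measurable borel"
  proof -
    have "(\<lambda>x. enn2real (RN_deriv leb_pos \<mu> x)) \<in> borel_measurable leb_pos"
      by measurable
    moreover have "f \<in> borel_measurable leb_pos \<longleftrightarrow> (\<lambda>x. indicator {0..} x *\<^sub>R f x) \<in> borel_measurable lborel"
      for f :: "real \<Rightarrow> real"
      unfolding leb_pos_def by (rule borel_measurable_restrict_space_iff) simp
    ultimately show ?thesis by (simp add: p_eq[abs_def])
  qed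
  have mu: "\<mu> = density leb_pos (\<lambda>x. ennreal (p x))"
  proof -
    have "(\<integral>\<^sup>+x. RN_deriv leb_pos \<mu> x \<partial>leb_pos) = emeasure (density leb_pos (RN_deriv leb_pos \<mu>)) (space leb_pos)"
      using sets.top[of leb_pos] by (subst emeasure_density) (auto intro!: nn_integral_cong)
    also have "\<dots> = 1"
      unfolding rn using prob_space.emeasure_space_1[OF prob] sets_eq_imp_space_eq[OF sets]
      by (simp add: borel_pos_def space_restrict_space)
    finally have "(\<integral>\<^sup>+x. RN_deriv leb_pos \<mu> x \<partial>leb_pos) \<noteq> \<infinity>" by simp
    \<comment> \<open>\<open>enn2real\<close> sends infinity to 0, so p represents the measure only
      once infinite values of the derivative are known to be negligible.\<close>
    then have "AE x in leb_pos. RN_deriv leb_pos \<mu> x \<noteq> \<infinity>"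
      by (intro nn_integral_PInf_AE) auto
    then have "AE x in leb_pos. RN_deriv leb_pos \<mu> x = ennreal (p x)"
      using AE_space by eventually_elim (auto simp: p_eq less_top)
    then have "density leb_pos (RN_deriv leb_pos \<mu>) = density leb_pos (\<lambda>x. ennreal (p x))"
    proof (rule density_cong[rotated 2])
      have "p \<in> borel_measurable leb_pos"
        unfolding leb_pos_def by (rule measurable_restrict_space1) (use p_meas in simp)
      then show "(\<lambda>x. ennreal (p x)) \<in> borel_measurable leb_pos" by measurable
    qed simp
    then show ?thesis using rn by simp
  qed
  have cube: "(\<integral>\<^sup>+x. ennreal (x * p x ^ 3) * indicator {0..} x \<partial>lborel) < \<infinity>"
  proof -
    have p_nn: "0 \<le> p x" for x by (simp add: p_eq)
    have "(\<integral>\<^sup>+x. ennreal (norm (x * \<bar>p x\<bar> ^ 3)) \<partial>leb_pos) < \<infinity>"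
      using True by (auto simp: p_def integrable_iff_bounded)
    also have "(\<integral>\<^sup>+x. ennreal (norm (x * \<bar>p x\<bar> ^ 3)) \<partial>leb_pos) = (\<integral>\<^sup>+x. ennreal (x * p x ^ 3) * indicator {0..} x \<partial>lborel)"
      unfolding nn_integral_leb_pos using p_nn
      by (intro nn_integral_cong) (auto simp: abs_mult split: split_indicator)
    finally show ?thesis .
  qed
  interpret half_line_density \<mu> p
  proof (rule half_line_density.intro)
    show "p \<in> borel_measurable borel" by (rule p_meas)
    show "0 \<le> p x" for x by (simp add: p_eq)
    show "p x = 0" if "x < 0" for x using that by (simp add: p_eq)
    show "\<mu> = density leb_pos (\<lambda>x. ennreal (p x))" by (rule mu)
    show "prob_space \<mu>" by (rule prob)
    show "(\<integral>\<^sup>+x. ennreal (x * p x ^ 3) * indicator {0..} x \<partial>lborel) < \<infinity>" by (rule cube)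
  qed
  obtain H where H: "H \<in> borel_measurable borel" "AE x in \<mu>. H x = sqrt x * hilbert_transform p x"
    and pairing: "\<And>\<tau> B. \<tau> \<in> borel_measurable borel \<Longrightarrow> (\<And>x. 0 \<le> \<tau> x) \<Longrightarrow> (\<And>x. \<tau> x \<le> B) \<Longrightarrow>
      (\<And>x y. 0 \<le> x \<Longrightarrow> x \<le> y \<Longrightarrow> \<tau> x \<le> \<tau> y) \<Longrightarrow>
      integrable \<mu> (\<lambda>x. \<tau> x * H x) \<and> 0 \<le> (LINT x|\<mu>. \<tau> x * H x) \<and>
      ennreal (2 * (LINT x|\<mu>. \<tau> x * H x)) = (\<integral>\<^sup>+x. \<integral>\<^sup>+y. ennreal ((\<tau> x * sqrt x - \<tau> y * sqrt y) / (x - y)) \<partial>\<mu> \<partial>\<mu>)"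
    by (rule hilbert_transform_exists) blast
  have pos: "AE x in \<mu>. 0 < x" by (rule AE_muI) simp
  have fisher_eq: "(\<integral>\<^sup>+x. ennreal ((H x - sqrt x * Q' x / 2)\<^sup>2) \<partial>\<mu>)
      = (\<integral>\<^sup>+ x. ennreal (x * (hilbert_transform p x - deriv Q x / 2)\<^sup>2) \<partial>\<mu>)"
  proof (rule nn_integral_cong_AE)
    show "AE x in \<mu>. ennreal ((H x - sqrt x * Q' x / 2)\<^sup>2) = ennreal (x * (hilbert_transform p x - deriv Q x / 2)\<^sup>2)"
      using H(2) pos
    proof eventually_elim
      case (elim x)
      have "H x - sqrt x * Q' x / 2 = sqrt x * (hilbert_transform p x - deriv Q x / 2)"
        using elim by (simp add: Q'_def right_diff_distrib)
      then show ?case using elim by (simp add: power_mult_distrib)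
    qed
  qed
  have Q'_meas: "Q' \<in> borel_measurable borel"
    using borel_measurable_continuous_on_indicator[OF _ cont] by (simp add: Q'_def[abs_def])
  have tangent: "Q' x * (y - x) \<le> Q y - Q x" if "0 < x" "0 \<le> y" for x y
  proof -
    have "deriv Q x * (y - x) \<le> Q y - Q x"
      by (rule convex_on_imp_above_tangent[OF assms(1)])
        (use that der in \<open>auto intro: has_field_derivative_at_within\<close>)
    then show ?thesis using that by (simp add: Q'_def)
  qed
  interpret C: confining_potential Q \<rho> by (rule pot)
  interpret finite_fisher Q \<rho> \<mu> p Q' H
  proof unfold_locales
    show "(\<integral>\<^sup>+x. ennreal ((H x - sqrt x * Q' x / 2)\<^sup>2) \<partial>\<mu>) < \<infinity>"
      unfolding fisher_eq p_def using True by blast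
    show "\<rho> \<le> Q' x" if "0 < x" for x using that assms(5) by (simp add: Q'_def)
  qed (fact H(1) Q'_meas tangent | rule pairing; assumption)+
  have "(\<integral>\<^sup>+ x. ennreal (x * (hilbert_transform p x - deriv Q x / 2)\<^sup>2) \<partial>\<mu>) = ennreal (LINT x|\<mu>. (G x)\<^sup>2)"
    unfolding fisher_eq[symmetric] G_def[symmetric] using G_square by (intro nn_integral_eq_integral) auto
  then have "rel_free_fisher_pos Q \<mu> = ereal (4 * (LINT x|\<mu>. (G x)\<^sup>2))"
    using True by (simp add: rel_free_fisher_pos_def p_def enn2ereal_ennreal numeral_eq_ereal)
  then show ?thesis using rel_free_entropy_le_fisher by simp
qed

end
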